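(* Let $d\ge 1$, $\varrho\in\,]0,1]$ and let $p\in\mathscr{C}^{0,\varrho}_{\mathrm{pw}}S_d$ with set of potential singularities $\mathscr{U}_p$. Assume: (A1) there exists $\kappa_1\in\,]0,1]$ such that, for $0<r\ll 1$, $\mathrm{L}\big((\mathscr{U}_p+B(0,r))\cap[0,1]^d\big)=\mathcal{O}(r^{\kappa_1})$; (A2) there exists $\kappa_2\in\,]0,1]$ such that, uniformly for $z\in\mathbb{C}$, for $0\le t\ll 1$, $\mathrm{L}\big(\{\rho\in[0,1]^d\times\mathbb{T}^d:\ |p(\rho)-z|^2\le t\}\big)=\mathcal{O}(t^{\kappa_2})$. For each $N\ge1$ let $Q_N$ be a random $N^d\times N^d$ complex matrix such that: (A3-i) there exists $\kappa_3>0$ with $\mathbb{E}(\|Q_N\|)=\mathcal{O}(N^{\kappa_3})$; (A3-ii) for each $\theta>0$ there exists $\beta>0$ such that for every sequence $(A_N)$ of deterministic $N^d\times N^d$ matrices with $\|A_N\|=\mathcal{O}(N^\theta)$, one has $\mathbb{P}\big(s_{N^d}(A_N+Q_N)\le N^{-\beta}\big)\to 0$ as $N\to+\infty$. Then, for every $\delta_0>0$, setting $\delta:=N^{-(\kappa_3+\delta_0)}$, the empirical spectral measure $$\mu_N:=\frac{1}{N^d}\sum_{\lambda\in\sigma(M_N(p)+\delta Q_N)}\delta_\lambda$$ of $M_N(p)+\delta Q_N$ converges weakly in probability, as $N\to+\infty$, to the push-forward $p_*\mathrm{L}$ of the normalized Lebesgue measure on $[0,1]^d\times\mathbb{T}^d$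 by $p$.
   Context: $\mathbb{T}^d=(\mathbb{R}/\mathbb{Z})^d$; $\mathrm{L}$ denotes (normalized) Lebesgue measure on $[0,1]^d$ or on $[0,1]^d\times\mathbb{T}^d$; $B(0,r)$ is the ball of radius $r$ in $\mathbb{R}^d$. $\|A\|$ and $s_{N^d}(A)$ denote the greatest and the smallest singular value of an $N^d\times N^d$ matrix $A$. $\mathcal{O}(\cdot)$ means bounded by a constant multiple, the constant being independent of $N$ (resp. of $r$, $t$); "for $0<r\ll1$" means for all sufficiently small $r>0$. Eigenvalues in $\mu_N$ are counted with multiplicity. Symbol class. For $\varrho\in\,]0,1]$, $\mathscr{C}^{0,\varrho}_{\mathrm{pw}}S_d$ is the set of functions $f:[0,1]^d_x\times\mathbb{T}^d_\xi\to\mathbb{C}$ that are smooth with respect to $\xi$ and such that: (1) there is a finite family of open connected disjoint sets $U_1,\dots,U_s$ of $[0,1]^d$ with $\overline{\bigsqcup_{j=1}^sU_j}=[0,1]^d$; (2) for all $j\in\{1,\dots,s\}$ there exists $f_j:\overline{U_j}\times\mathbb{T}^d\to\mathbb{C}$ with $f_j=f$ on $U_j\times\mathbb{T}^d$ and such that for all $\beta\in\mathbb{N}^d$ there exists $C_{j,\beta}>0$ with $\|\partial_\xi^\beta f_j(\cdot,\xi)\|_{\mathscr{C}^{0,\varrho}(\overline{U_j})}\le C_{j,\beta}$ for all $\xi\in\mathbb{T}^d$ (Hölder norm of exponent $\varrho$). One sets $\mathscr{U}_f:=\bigcup_{j=1}^s\partial U_j$. Matrix. Write $p_\nu(x)=\int_{\mathbb{T}^d}p(x,\xi)e^{-2i\pi\langle\nu,\xi\rangle}d\xi$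 for $\nu\in\mathbb{Z}^d$. $M_N(p)$ is the $N^d\times N^d$ matrix indexed by $\{1,\dots,N\}^d$ with entries $M_N(p)_{n,j}=p_{n-j}(n/N)$, $n,j\in\{1,\dots,N\}^d$. Weak convergence in probability of $\mu_N$ to $\mu$ means: for every bounded continuous $f:\mathbb{C}\to\mathbb{R}$ and every $\varepsilon>0$, $\mathbb{P}(|\int f\,d\mu_N-\int f\,d\mu|\ge\varepsilon)\to0$ as $N\to+\infty$.
   Formalization: The symbol p is assumed bounded on [0,1]^d × T^d; this only restricts its values over the null set U_p, is automatic for d = 1, and without it the statement fails for d ≥ 2 (very large values of p at grid points on singular hyperplanes). *)

theory Defs
  imports
    "HOL-Probability.Probability"
    "HOL-Library.Landau_Symbols"
    "Jordan_Normal_Form.Schur_Decomposition"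
begin

text \<open>
  The dimension $d \geq 1$ is \<open>CARD('d)\<close>. A function on $[0,1]^d \times \mathbb{T}^d$ is a curried
  function of $x$ and $\xi$ in \<open>real ^ 'd\<close> that is $\mathbb{Z}^d$-periodic in $\xi$; only its values
  for $x$ in the unit cube matter. Integration over $\mathbb{T}^d$ is integration over the
  fundamental domain $[0,1]^d$.
\<close>

abbreviation unit_cube :: "(real ^ 'd) set" where
  "unit_cube \<equiv> cbox 0 1"

abbreviation cube_torus_measure :: "((real ^ 'd) \<times> (real ^ 'd)) measure" where
  "cube_torus_measure \<equiv> lebesgue_on (unit_cube \<times> unit_cube)"


section \<open>The symbol class\<close>

definition partial_deriv :: "'d \<Rightarrow> (real ^ 'd \<Rightarrow> complex) \<Rightarrow> real ^ 'd \<Rightarrow> complex" where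
  "partial_deriv i g = (\<lambda>\<xi>. frechet_derivative g (at \<xi>) (axis i 1))"

text \<open>
  A multi-index $\beta \in \mathbb{N}^d$ is given by a list of coordinates in which each $i$ occurs
  $\beta_i$ times. On smooth functions the order of the list is irrelevant.
\<close>

definition multi_deriv :: "'d list \<Rightarrow> (real ^ 'd \<Rightarrow> complex) \<Rightarrow> real ^ 'd \<Rightarrow> complex" where
  "multi_deriv \<beta> g = foldr partial_deriv \<beta> g"

text \<open>
  Differentiability of all iterated partial derivatives also makes them all continuous, so the
  second conjunct is $g \in C^\infty$.
\<close>

definition smooth_on_torus :: "(real ^ 'd \<Rightarrow> complex) \<Rightarrow> bool" where
  "smooth_on_torus g \<longleftrightarrow>
     (\<forall>i \<xi>. g (\<xi> + axis i 1) = g \<xi>) \<and>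
     (\<forall>\<beta> \<xi>. multi_deriv \<beta> g differentiable (at \<xi>))"

definition holder_norm :: "real \<Rightarrow> (real ^ 'd) set \<Rightarrow> (real ^ 'd \<Rightarrow> complex) \<Rightarrow> ennreal" where
  "holder_norm \<rho> K g =
     (SUP x\<in>K. ennreal (norm (g x))) +
     (SUP (x, y)\<in>{(x, y). x \<in> K \<and> y \<in> K \<and> x \<noteq> y}.
        ennreal (norm (g x - g y) / dist x y powr \<rho>))"

text \<open>
  \<open>pw_symbol \<rho> s U f\<close>: the function $f$ belongs to $\mathscr{C}^{0,\varrho}_{\mathrm{pw}}S_d$, and
  the sets $U_0,\dots,U_{s-1}$ are a family as required there. The singular set
  $\mathscr{U}_f$ depends on this family, which is why it is an argument.

  The symbol is taken to be bounded. Where $x$ lies in some $U_j$ this follows from the Hoelder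
  bound for $\beta = 0$, so it only concerns $x \in \mathscr{U}_f$. There it cannot be omitted: on
  singular hyperplanes, values of $f$ growing fast enough along the points $n/N$ swamp a matching
  adversarial perturbation $Q_N$, and the limit law of the spectrum fails for $d \geq 2$.
\<close>

definition pw_symbol ::
  "real \<Rightarrow> nat \<Rightarrow> (nat \<Rightarrow> (real ^ 'd) set) \<Rightarrow> (real ^ 'd \<Rightarrow> real ^ 'd \<Rightarrow> complex) \<Rightarrow> bool" where
  "pw_symbol \<rho> s U f \<longleftrightarrow>
     (\<forall>x\<in>unit_cube. smooth_on_torus (f x)) \<and>
     bounded {f x \<xi> | x \<xi>. x \<in> unit_cube} \<and>
     (\<forall>j<s. openin (top_of_set unit_cube) (U j) \<and> connected (U j)) \<and>
     disjoint_family_on U {..<s} \<and>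
     closure (\<Union>j<s. U j) = unit_cube \<and>
     (\<forall>j<s. \<exists>f\<^sub>j.
        (\<forall>x\<in>U j. \<forall>\<xi>. f\<^sub>j x \<xi> = f x \<xi>) \<and>
        (\<forall>x\<in>closure (U j). smooth_on_torus (f\<^sub>j x)) \<and>
        (\<forall>\<beta>. \<exists>C>0. \<forall>\<xi>.
           holder_norm \<rho> (closure (U j)) (\<lambda>x. multi_deriv \<beta> (f\<^sub>j x) \<xi>) \<le> ennreal C))"

definition singular_set :: "nat \<Rightarrow> (nat \<Rightarrow> (real ^ 'd) set) \<Rightarrow> (real ^ 'd) set" where
  "singular_set s U = (\<Union>j<s. frontier (U j))"


section \<open>The matrix of a symbol\<close>

definition fourier_coeff ::
  "(real ^ 'd \<Rightarrow> real ^ 'd \<Rightarrow> complex) \<Rightarrow> int ^ 'd \<Rightarrow> real ^ 'd \<Rightarrow> complex" where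
  "fourier_coeff p \<nu> x =
     (LINT \<xi>:unit_cube|lborel.
        p x \<xi> * exp (- 2 * \<i> * of_real pi * of_real (\<Sum>i\<in>UNIV. of_int (vec_nth \<nu> i) * vec_nth \<xi> i)))"

definition grid :: "nat \<Rightarrow> (int ^ 'd) set" where
  "grid N = {n. \<forall>i. 1 \<le> vec_nth n i \<and> vec_nth n i \<le> int N}"

text \<open>
  Rows and columns of a \<open>mat\<close> are numbered from \<open>0\<close>; \<open>from_nat_into (grid N)\<close> restricts to a
  bijection from \<open>{..<N ^ CARD('d)}\<close> onto \<open>grid N\<close>. The choice of the bijection only conjugates
  the matrix by a permutation.
\<close>

definition symbol_matrix ::
  "nat \<Rightarrow> (real ^ 'd \<Rightarrow> real ^ 'd \<Rightarrow> complex) \<Rightarrow> complex mat" where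
  "symbol_matrix N p =
     Matrix.mat (N ^ CARD('d)) (N ^ CARD('d)) (\<lambda>(a, b).
       let n = from_nat_into (grid N) a; j = from_nat_into (grid N) b
       in fourier_coeff p (n - j) (\<chi> i. of_int (vec_nth n i) / real N))"


section \<open>Singular values, random matrices and spectral measures\<close>

definition singular_values :: "complex mat \<Rightarrow> real set" where
  "singular_values A = {\<sigma>. \<sigma> \<ge> 0 \<and> eigenvalue (mat_adjoint A * A) (of_real (\<sigma>\<^sup>2))}"

definition greatest_sv :: "complex mat \<Rightarrow> real" where
  "greatest_sv A = Max (singular_values A)"

definition smallest_sv :: "complex mat \<Rightarrow> real" where
  "smallest_sv A = Min (singular_values A)"

definition random_matrix :: "'w measure \<Rightarrow> nat \<Rightarrow> ('w \<Rightarrow> complex mat) \<Rightarrow> bool" where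
  "random_matrix P m Q \<longleftrightarrow>
     (\<forall>\<omega>\<in>space P. Q \<omega> \<in> carrier_mat m m) \<and>
     (\<forall>a<m. \<forall>b<m. (\<lambda>\<omega>. Q \<omega> $$ (a, b)) \<in> borel_measurable P)"

text \<open>\<open>return borel \<lambda>\<close> is the Dirac measure $\delta_\lambda$, and \<open>proots (char_poly A)\<close> is the
  multiset of eigenvalues with algebraic multiplicities.\<close>

definition empirical_spectral_measure :: "complex mat \<Rightarrow> complex measure" where
  "empirical_spectral_measure A =
     measure_of UNIV (sets borel) (\<lambda>B.
       ennreal (1 / real (dim_row A)) *
       (\<Sum>z\<in>#proots (char_poly A). emeasure (return borel z) B))"

definition weakly_converges_in_prob ::
  "(nat \<Rightarrow> 'w measure) \<Rightarrow> (nat \<Rightarrow> 'w \<Rightarrow> complex measure) \<Rightarrow> complex measure \<Rightarrow> bool" where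
  "weakly_converges_in_prob P \<mu> \<mu>' \<longleftrightarrow>
     (\<forall>f :: complex \<Rightarrow> real. continuous_on UNIV f \<and> bounded (range f) \<longrightarrow>
        (\<forall>\<epsilon>>0. (\<lambda>N. measure (P N) {\<omega> \<in> space (P N).
            \<bar>(LINT z|\<mu> N \<omega>. f z) - (LINT z|\<mu>'. f z)\<bar> \<ge> \<epsilon>}) \<longlonglongrightarrow> 0))"

end

theory Submission
  imports
    Defs
    "Jordan_Normal_Form.Spectral_Radius"
    "HOL-Real_Asymp.Real_Asymp"
begin

text \<open>
  Write $X = M_N(p) + \delta Q_N$, $\mu = p_*\mathrm{L}$ and $m = N^d$. Test a singular basis of
  $X - z$ against a tight frame of wave packets, each of which lives on a window of side
  $L \ll N$ and is an approximate eigenvector of $M_N(p)$ with eigenvalue $p$ at its centre in phase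
  space. The result is a quantitative Weyl law: for every Lipschitz $\varphi$ the mean of $\varphi$ over
  the singular values of $X - z$ is within $O(N^{-c})$ of $\int \varphi(|w - z|)\,d\mu(w)$, uniformly
  in $z$, as soon as $\|\delta Q_N\|$ is a negative power of $N$.

  With $\varphi$ a regularized logarithm this controls $\frac1m \ln |\det(X - z)|$ from above for all $z$
  at once, and from below at each fixed $z$ with high probability, because (A3-ii) keeps the
  singular values above a power of $N$ and (A2) makes the mass of $\mu$ near $z$ negligible against
  $\ln N$. Averaging $z$ over the $M$-th roots of unity on a circle of radius $r$ turns
  $\ln |\lambda - z|$ into $\ln \max(|\lambda - z_0|, r)$ up to $O(1/M)$, so the logarithmic potentials
  of $\mu_N$ truncated at any fixed radius converge in probability to those of $\mu$. Differences of
  truncated potentials integrate compactly supported bumps, and finitely many of these determine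
  the integral of a given bounded continuous function up to $\varepsilon$.
\<close>

section \<open>Singular values\<close>

text \<open>A rate of convergence is what makes the logarithm tractable. With a statistics error of
  order \<open>N powr - c\<close>, the logarithm may be cut off at \<open>N powr - (c / 2)\<close>:
  its Lipschitz constant is the inverse of the cutoff, so the error still tends to 0. Below the
  cutoff each singular value costs at most a multiple of ln N, while discs of that size have
  polynomially small mass.

  (A3-ii) concerns one deterministic sequence of matrices at a time and gives no uniformity in z.
  Lower bounds on determinants are therefore available only at finitely many z chosen before N,
  whereas upper bounds do not see small singular values and hold at every z. Averages over finitely
  many nodes respect this asymmetry: only finitely many exceptional events are united.

  The symbol is merely Hoelder in x on each piece, so there is no symbol calculus to rely on. The
  packets use a Lipschitz bound in \<xi> and the Hoelder modulus across one window; (A1) bounds the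
  number of rows near discontinuities or near the boundary of the cube, where the sup norm has to
  do.\<close>

definition mtrace :: "complex mat \<Rightarrow> complex" where
  "mtrace A = (\<Sum>i<dim_row A. A $$ (i, i))"

lemma index_mult_mat_sum:
  assumes "A \<in> carrier_mat n k" "B \<in> carrier_mat k l" "i < n" "j < l"
  shows "(A * B) $$ (i, j) = (\<Sum>a<k. A $$ (i, a) * B $$ (a, j))"
  using assms by (simp add: scalar_prod_def atLeast0LessThan)

lemma mtrace_comm:
  assumes "A \<in> carrier_mat n k" "B \<in> carrier_mat k n"
  shows "mtrace (A * B) = mtrace (B * A)"
proof -
  have "mtrace (A * B) = (\<Sum>i<n. \<Sum>a<k. A $$ (i, a) * B $$ (a, i))"
    using assms unfolding mtrace_def by (auto simp: index_mult_mat_sum[OF assms] simp del: index_mult_mat(1) intro!: sum.cong)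
  also have "\<dots> = (\<Sum>a<k. \<Sum>i<n. B $$ (a, i) * A $$ (i, a))"
    by (subst sum.swap) (simp add: mult.commute)
  also have "\<dots> = mtrace (B * A)"
    using assms unfolding mtrace_def by (auto simp: index_mult_mat_sum[OF assms(2,1)] simp del: index_mult_mat(1) intro!: sum.cong)
  finally show ?thesis .
qed

lemma mtrace_similar:
  assumes "similar_mat_wit A B P Q"
  shows "mtrace A = mtrace B"
proof -
  define n where "n = dim_row A"
  have c: "A \<in> carrier_mat n n" "B \<in> carrier_mat n n" "P \<in> carrier_mat n n" "Q \<in> carrier_mat n n"
    and e: "P * Q = 1\<^sub>m n" "Q * P = 1\<^sub>m n" "A = P * B * Q"
    using similar_mat_witD[OF n_def assms] by blast+
  have "mtrace A = mtrace (P * (B * Q))" using c e by simp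
  also have "\<dots> = mtrace (B * Q * P)" using c by (intro mtrace_comm) auto
  also have "B * Q * P = B" using c e by simp
  finally show ?thesis .
qed

text \<open>If 0 were the only eigenvalue, the Schur form would be strictly upper triangular, so its
  square, and hence \<open>A * A\<close>, would have trace 0. For a Hermitian matrix that trace is
  the sum of the squared moduli of all entries.\<close>

lemma hermitian_nonzero_eigenvalue:
  assumes A: "A \<in> carrier_mat n n"
    and herm: "\<And>a b. a < n \<Longrightarrow> b < n \<Longrightarrow> A $$ (a, b) = cnj (A $$ (b, a))"
    and nz: "i < n" "j < n" "A $$ (i, j) \<noteq> 0"
  shows "\<exists>l. l \<noteq> 0 \<and> eigenvalue A l"
proof (rule ccontr)
  assume no: "\<nexists>l. l \<noteq> 0 \<and> eigenvalue A l"
  obtain es where es: "char_poly A = (\<Prod>a\<leftarrow>es. [:- a, 1:])" using char_poly_factorized[OF A] by auto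
  obtain B P Q where "schur_decomposition A es = (B, P, Q)" by (metis surj_pair)
  from schur_decomposition[OF A es this]
  have sim: "similar_mat_wit A B P Q" and ut: "upper_triangular B" and d: "diag_mat B = es" by auto
  have c: "B \<in> carrier_mat n n" using similar_mat_witD2[OF A sim] by auto
  have ev: "eigenvalue A e" if "e \<in> set es" for e
    unfolding eigenvalue_root_char_poly[OF A] es poly_prod_list using that by (force simp: prod_list_zero_iff)
  have Bd: "B $$ (k, k) = 0" if "k < n" for k
  proof -
    have "B $$ (k, k) \<in> set es" using that c d by (force simp: diag_mat_def)
    then show ?thesis using ev no by blast
  qed
  have "similar_mat_wit (A ^\<^sub>m 2) (B ^\<^sub>m 2) P Q" by (rule similar_mat_wit_pow[OF sim])
  then have "mtrace (A * A) = mtrace (B * B)" using mtrace_similar A c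
    by (metis carrier_matD(1) left_mult_one_mat numeral_2_eq_2 pow_mat.simps)
  also have "\<dots> = (\<Sum>k<n. \<Sum>a<n. B $$ (k, a) * B $$ (a, k))"
    using c unfolding mtrace_def by (auto simp: index_mult_mat_sum[OF c c] simp del: index_mult_mat(1) intro!: sum.cong)
  also have "\<dots> = 0"
  proof (intro sum.neutral ballI)
    fix k a assume "k \<in> {..<n}" "a \<in> {..<n}"
    then show "B $$ (k, a) * B $$ (a, k) = 0"
      using Bd[of k] ut c unfolding upper_triangular_def
      by (cases a k rule: linorder_cases) auto
  qed
  finally have "mtrace (A * A) = 0" .
  moreover have "mtrace (A * A) = (\<Sum>k<n. \<Sum>a<n. A $$ (k, a) * A $$ (a, k))"
    using A unfolding mtrace_def by (auto simp: index_mult_mat_sum[OF A A] simp del: index_mult_mat(1) intro!: sum.cong)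
  moreover have "\<dots> = of_real (\<Sum>k<n. \<Sum>a<n. (cmod (A $$ (k, a)))\<^sup>2)"
    unfolding of_real_sum
  proof (intro sum.cong refl)
    fix k a assume "k \<in> {..<n}" "a \<in> {..<n}"
    then have "A $$ (a, k) = cnj (A $$ (k, a))" by (intro herm) auto
    moreover have "A $$ (k, a) * cnj (A $$ (k, a)) = complex_of_real ((cmod (A $$ (k, a)))\<^sup>2)"
      by (simp only: complex_norm_square)
    ultimately show "A $$ (k, a) * A $$ (a, k) = complex_of_real ((cmod (A $$ (k, a)))\<^sup>2)"
      by metis
  qed
  ultimately have "complex_of_real (\<Sum>k<n. \<Sum>a<n. (cmod (A $$ (k, a)))\<^sup>2) = 0" by argo
  then have "(\<Sum>k<n. \<Sum>a<n. (cmod (A $$ (k, a)))\<^sup>2) = 0" by (simp only: of_real_eq_0_iff)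
  then have "(\<Sum>a<n. (cmod (A $$ (i, a)))\<^sup>2) = 0"
    using nz(1) by (subst (asm) sum_nonneg_eq_0_iff) (auto intro: sum_nonneg)
  then have "(cmod (A $$ (i, j)))\<^sup>2 = 0"
    using nz(2) by (subst (asm) sum_nonneg_eq_0_iff) auto
  then show False using nz by auto
qed

lemma hermitian_fun_nonzero_eigenvector:
  fixes h :: "nat \<Rightarrow> nat \<Rightarrow> complex"
  assumes herm: "\<And>a b. a < n \<Longrightarrow> b < n \<Longrightarrow> h a b = cnj (h b a)"
    and nz: "i < n" "j < n" "h i j \<noteq> 0"
  obtains l x where "l \<noteq> 0" "\<And>a. a < n \<Longrightarrow> (\<Sum>b<n. h a b * x b) = l * x a" "\<exists>a<n. x a \<noteq> 0"
proof -
  define A where "A = Matrix.mat n n (\<lambda>(a, b). h a b)"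
  have A: "A \<in> carrier_mat n n" by (simp add: A_def)
  obtain l where l: "l \<noteq> 0" "eigenvalue A l"
  proof -
    have "\<exists>l. l \<noteq> 0 \<and> eigenvalue A l"
    proof (rule hermitian_nonzero_eigenvalue[OF A _ nz(1,2)])
      fix a b assume "a < n" "b < n"
      then show "A $$ (a, b) = cnj (A $$ (b, a))" using herm[of a b] by (simp add: A_def)
    qed (use nz in \<open>simp add: A_def\<close>)
    then show thesis using that by blast
  qed
  then obtain v where v: "v \<in> carrier_vec n" "v \<noteq> 0\<^sub>v n" "A *\<^sub>v v = l \<cdot>\<^sub>v v"
    using A by (auto simp: eigenvalue_def eigenvector_def)
  show thesis
  proof (rule that[OF l(1), of "vec_index v"])
    fix a assume a: "a < n"
    have "vec_index (A *\<^sub>v v) a = (\<Sum>b<n. h a b * vec_index v b)"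
      using a v(1) by (simp add: A_def scalar_prod_def atLeast0LessThan)
    then show "(\<Sum>b<n. h a b * vec_index v b) = l * vec_index v a" using v a by simp
  next
    show "\<exists>a<n. vec_index v a \<noteq> 0" using v(1,2) by (metis eq_vecI index_zero_vec carrier_vecD)
  qed
qed

text \<open>Vectors are functions of which only the values below \<open>n\<close> count;
  \<open>v i\<close> is the i-th vector. Frames, singular vectors and matrix rows then share plain
  finite sums, free of carrier conditions.\<close>

definition orthonormal_sys :: "nat \<Rightarrow> nat \<Rightarrow> (nat \<Rightarrow> nat \<Rightarrow> complex) \<Rightarrow> bool" where
  "orthonormal_sys n k v \<longleftrightarrow> (\<forall>i<k. \<forall>j<k. (\<Sum>a<n. v i a * cnj (v j a)) = (if i = j then 1 else 0))"

lemma orthonormal_sysD: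
  "orthonormal_sys n k v \<Longrightarrow> i < k \<Longrightarrow> j < k \<Longrightarrow> (\<Sum>a<n. v i a * cnj (v j a)) = (if i = j then 1 else 0)"
  by (simp add: orthonormal_sys_def)

lemma hermitian_eigenvalue_real:
  fixes h :: "nat \<Rightarrow> nat \<Rightarrow> complex"
  assumes herm: "\<And>a b. a < n \<Longrightarrow> b < n \<Longrightarrow> h a b = cnj (h b a)"
    and ev: "\<And>a. a < n \<Longrightarrow> (\<Sum>b<n. h a b * x b) = l * x a"
    and nz: "a < n" "x a \<noteq> 0"
  shows "l \<in> \<real>"
proof -
  define q where "q = (\<Sum>a<n. (\<Sum>b<n. h a b * x b) * cnj (x a))"
  define t where "t = (\<Sum>a<n. (cmod (x a))\<^sup>2)"
  have "q = (\<Sum>a<n. l * x a * cnj (x a))"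
    unfolding q_def by (intro sum.cong refl) (simp add: ev)
  also have "\<dots> = l * of_real t"
    unfolding t_def of_real_sum complex_norm_square sum_distrib_left by (simp add: mult.assoc)
  finally have q1: "q = l * of_real t" .
  have "cnj q = (\<Sum>a<n. \<Sum>b<n. cnj (h a b) * cnj (x b) * x a)"
    unfolding q_def by (simp add: sum_distrib_right)
  also have "\<dots> = (\<Sum>b<n. \<Sum>a<n. cnj (h a b) * cnj (x b) * x a)"
    by (rule sum.swap)
  also have "\<dots> = (\<Sum>b<n. \<Sum>a<n. h b a * x a * cnj (x b))"
  proof (intro sum.cong refl)
    fix a b assume "b \<in> {..<n}" "a \<in> {..<n}"
    then have "h b a = cnj (h a b)" by (intro herm) auto
    then show "cnj (h a b) * cnj (x b) * x a = h b a * x a * cnj (x b)" by (simp add: mult_ac)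
  qed
  also have "\<dots> = q" unfolding q_def by (simp add: sum_distrib_right)
  finally have "q \<in> \<real>" by (simp add: Reals_cnj_iff)
  moreover have "t \<noteq> 0"
  proof
    assume "t = 0"
    then have "(cmod (x a))\<^sup>2 = 0" using nz(1) unfolding t_def by (subst (asm) sum_nonneg_eq_0_iff) auto
    then show False using nz by simp
  qed
  ultimately show ?thesis using q1
    by (metis Reals_divide Reals_of_real nonzero_mult_div_cancel_right of_real_eq_0_iff)
qed

text \<open>Deflation. \<open>K c\<close> subtracts the known eigenprojections from \<open>h\<close>
  and adds \<open>c\<close> times the projection onto the orthogonal complement of the system. It is
  Hermitian and annihilates every \<open>v j\<close>, so an eigenvector for a nonzero eigenvalue is
  orthogonal to the system; on the complement \<open>K c\<close> is \<open>h\<close> plus the scalar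
  \<open>c\<close>.\<close>

lemma orthonormal_sys_extend:
  fixes h :: "nat \<Rightarrow> nat \<Rightarrow> complex" and mu :: "nat \<Rightarrow> real"
  assumes herm: "\<And>a b. a < n \<Longrightarrow> b < n \<Longrightarrow> h a b = cnj (h b a)"
    and on: "orthonormal_sys n k v" and kn: "k < n"
    and ev: "\<And>i a. i < k \<Longrightarrow> a < n \<Longrightarrow> (\<Sum>b<n. h a b * v i b) = of_real (mu i) * v i a"
  obtains l x where "\<And>a. a < n \<Longrightarrow> (\<Sum>b<n. h a b * x b) = l * x a" "\<exists>a<n. x a \<noteq> 0"
    "\<And>i. i < k \<Longrightarrow> (\<Sum>a<n. x a * cnj (v i a)) = 0"
proof -
  define P where "P = (\<lambda>a b. \<Sum>i<k. v i a * cnj (v i b))"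
  define K where "K = (\<lambda>c a b. h a b - (\<Sum>i<k. of_real (mu i) * v i a * cnj (v i b))
      + of_real c * ((if a = b then 1 else 0) - P a b))" for c :: real
  have Kherm: "K c a b = cnj (K c b a)" if "a < n" "b < n" for c a b
  proof -
    have "h a b = cnj (h b a)" using that by (rule herm)
    then show ?thesis by (simp add: K_def P_def mult_ac)
  qed
  \<comment> \<open>The shift \<open>c\<close> covers the case where the deflated matrix vanishes.
    If \<open>K 0\<close> and \<open>K 1\<close> both vanished, the projection \<open>P\<close>
    would have ones on its diagonal, but its trace is \<open>k < n\<close>.\<close>
  have "\<exists>c. \<exists>i<n. \<exists>j<n. K c i j \<noteq> 0"
  proof (rule ccontr)
    assume "\<not> ?thesis"
    then have z: "K 0 i j = 0" "K 1 i j = 0" if "i < n" "j < n" for i j using that by auto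
    have "P i i = 1" if "i < n" for i using z[OF that that] by (simp add: K_def)
    then have "(\<Sum>i<n. P i i) = of_nat n" by simp
    moreover have "(\<Sum>i<n. P i i) = (\<Sum>j<k. \<Sum>i<n. v j i * cnj (v j i))"
      unfolding P_def by (rule sum.swap)
    moreover have "\<dots> = of_nat k" using on by (simp add: orthonormal_sysD)
    ultimately show False using kn by simp
  qed
  then obtain c i j where c: "i < n" "j < n" "K c i j \<noteq> 0" by blast
  obtain l x where lx: "l \<noteq> 0" "\<And>a. a < n \<Longrightarrow> (\<Sum>b<n. K c a b * x b) = l * x a" "\<exists>a<n. x a \<noteq> 0"
    by (rule hermitian_fun_nonzero_eigenvector[where h = "K c", OF Kherm c]) blast+
  have Px: "(\<Sum>b<n. (\<Sum>i<k. f i * v i a * cnj (v i b)) * x b) = (\<Sum>i<k. f i * v i a * (\<Sum>b<n. x b * cnj (v i b)))"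
    for f a x
  proof -
    have "(\<Sum>b<n. (\<Sum>i<k. f i * v i a * cnj (v i b)) * x b) = (\<Sum>b<n. \<Sum>i<k. f i * v i a * (x b * cnj (v i b)))"
      unfolding sum_distrib_right by (simp add: mult_ac)
    also have "\<dots> = (\<Sum>i<k. \<Sum>b<n. f i * v i a * (x b * cnj (v i b)))" by (rule sum.swap)
    finally show ?thesis by (simp add: sum_distrib_left)
  qed
  have Kx: "(\<Sum>b<n. K c a b * x b) = (\<Sum>b<n. h a b * x b) - (\<Sum>i<k. of_real (mu i) * v i a * (\<Sum>b<n. x b * cnj (v i b)))
     + of_real c * (x a - (\<Sum>i<k. v i a * (\<Sum>b<n. x b * cnj (v i b))))" if a: "a < n" for a x
  proof -
    have "(\<Sum>b<n. K c a b * x b) = (\<Sum>b<n. h a b * x b) - (\<Sum>b<n. (\<Sum>i<k. of_real (mu i) * v i a * cnj (v i b)) * x b)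
      + of_real c * ((\<Sum>b<n. (if a = b then x b else 0)) - (\<Sum>b<n. (\<Sum>i<k. 1 * v i a * cnj (v i b)) * x b))"
      unfolding K_def P_def sum_distrib_left sum_subtractf[symmetric] sum.distrib[symmetric]
      by (intro sum.cong refl) (simp add: algebra_simps)
    then show ?thesis unfolding Px using a by simp
  qed
  have Kv: "(\<Sum>b<n. K c a b * v j b) = 0" if "a < n" "j < k" for a j
  proof -
    have "(\<Sum>i<k. f i * v i a * (\<Sum>b<n. v j b * cnj (v i b))) = f j * v j a" for f
    proof -
      have "(\<Sum>i<k. f i * v i a * (\<Sum>b<n. v j b * cnj (v i b))) = (\<Sum>i<k. if j = i then f i * v i a else 0)"
        using that on by (intro sum.cong refl) (auto simp: orthonormal_sysD)
      then show ?thesis using that by simp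
    qed
    from this[of "\<lambda>i. of_real (mu i)"] this[of "\<lambda>i. 1"] show ?thesis
      unfolding Kx[OF that(1)] using ev that by simp
  qed
  have orth: "(\<Sum>a<n. x a * cnj (v j a)) = 0" if j: "j < k" for j
  proof -
    have "l * (\<Sum>a<n. x a * cnj (v j a)) = (\<Sum>a<n. (\<Sum>b<n. K c a b * x b) * cnj (v j a))"
      unfolding sum_distrib_left by (intro sum.cong refl) (simp add: lx(2))
    also have "\<dots> = (\<Sum>a<n. \<Sum>b<n. x b * cnj (K c b a * v j a))"
      unfolding sum_distrib_right
    proof (intro sum.cong refl)
      fix a b assume "a \<in> {..<n}" "b \<in> {..<n}"
      then have "K c a b = cnj (K c b a)" by (intro Kherm) auto
      then show "K c a b * x b * cnj (v j a) = x b * cnj (K c b a * v j a)" by simp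
    qed
    also have "\<dots> = (\<Sum>b<n. \<Sum>a<n. x b * cnj (K c b a * v j a))" by (rule sum.swap)
    also have "\<dots> = (\<Sum>b<n. x b * cnj (\<Sum>a<n. K c b a * v j a))" by (simp add: sum_distrib_left)
    also have "\<dots> = 0" using j by (simp add: Kv)
    finally show ?thesis using lx(1) by simp
  qed
  show thesis
  proof (rule that[OF _ lx(3) orth])
    fix a assume a: "a < n"
    have "(\<Sum>b<n. K c a b * x b) = (\<Sum>b<n. h a b * x b) + of_real c * x a"
      unfolding Kx[OF a] using orth by simp
    then show "(\<Sum>b<n. h a b * x b) = (l - of_real c) * x a" using lx(2)[OF a] by (simp add: algebra_simps)
  qed
qed

lemma hermitian_spectral:
  fixes h :: "nat \<Rightarrow> nat \<Rightarrow> complex"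
  assumes herm: "\<And>a b. a < n \<Longrightarrow> b < n \<Longrightarrow> h a b = cnj (h b a)"
  shows "\<exists>v mu. orthonormal_sys n n v \<and>
    (\<forall>i<n. \<forall>a<n. (\<Sum>b<n. h a b * v i b) = of_real (mu i :: real) * v i a)"
proof -
  have "\<exists>v mu. orthonormal_sys n k v \<and>
    (\<forall>i<k. \<forall>a<n. (\<Sum>b<n. h a b * v i b) = of_real (mu i :: real) * v i a)" if "k \<le> n" for k
    using that
  proof (induction k)
    case 0
    then show ?case by (simp add: orthonormal_sys_def)
  next
    case (Suc k)
    then obtain v mu where on: "orthonormal_sys n k v"
      and ev: "\<And>i a. i < k \<Longrightarrow> a < n \<Longrightarrow> (\<Sum>b<n. h a b * v i b) = of_real (mu i :: real) * v i a" by auto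
    have kn: "k < n" using Suc.prems by simp
    obtain l x where lx: "\<And>a. a < n \<Longrightarrow> (\<Sum>b<n. h a b * x b) = l * x a" "\<exists>a<n. x a \<noteq> 0"
      and orth: "\<And>i. i < k \<Longrightarrow> (\<Sum>a<n. x a * cnj (v i a)) = 0"
      by (rule orthonormal_sys_extend[OF herm on kn ev]) blast+
    obtain a0 where a0: "a0 < n" "x a0 \<noteq> 0" using lx(2) by auto
    have "l \<in> \<real>" by (rule hermitian_eigenvalue_real[OF herm lx(1) a0])
    then obtain r where r: "l = of_real r" by (auto elim: Reals_cases)
    define t where "t = (\<Sum>a<n. (cmod (x a))\<^sup>2)"
    have t: "t > 0"
      unfolding t_def using a0 by (intro sum_pos2[of _ a0]) auto
    have xt: "(\<Sum>a<n. x a * cnj (x a)) = of_real t" by (simp only: t_def of_real_sum complex_norm_square)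
    define w where "w = v(k := (\<lambda>a. x a / of_real (sqrt t)))"
    have orth': "(\<Sum>a<n. v i a * cnj (x a)) = 0" if "i < k" for i
    proof -
      have "(\<Sum>a<n. v i a * cnj (x a)) = cnj (\<Sum>a<n. x a * cnj (v i a))" by (simp add: mult.commute)
      then show ?thesis using orth[OF that] by simp
    qed
    have tt: "complex_of_real (sqrt t) * of_real (sqrt t) = of_real t"
      using t by (metis abs_of_pos of_real_mult real_sqrt_mult_self)
    have "orthonormal_sys n (Suc k) w"
      unfolding orthonormal_sys_def
    proof (intro allI impI)
      fix i j assume ij: "i < Suc k" "j < Suc k"
      consider "i < k" "j < k" | "i = k" "j < k" | "i < k" "j = k" | "i = k" "j = k" using ij by linarith
      then show "(\<Sum>a<n. w i a * cnj (w j a)) = (if i = j then 1 else 0)"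
      proof cases
        case 1 then show ?thesis using on by (simp add: w_def orthonormal_sysD)
      next
        case 2 then show ?thesis using orth[of j] by (simp add: w_def flip: sum_divide_distrib)
      next
        case 3 then show ?thesis using orth'[of i] by (simp add: w_def flip: sum_divide_distrib)
      next
        case 4 then show ?thesis using xt t by (simp add: w_def tt flip: sum_divide_distrib)
      qed
    qed
    moreover have "\<forall>i<Suc k. \<forall>a<n. (\<Sum>b<n. h a b * w i b) = of_real ((mu(k := r)) i) * w i a"
      using ev lx(1) r by (auto simp: w_def less_Suc_eq simp flip: sum_divide_distrib)
    ultimately show ?case by blast
  qed
  then show ?thesis by blast
qed

text \<open>For square matrices a one-sided inverse is two-sided.\<close>

lemma orthonormal_sys_complete:
  assumes "orthonormal_sys n n v" "a < n" "b < n"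
  shows "(\<Sum>i<n. v i a * cnj (v i b)) = (if a = b then 1 else 0)"
proof -
  define V where "V = Matrix.mat n n (\<lambda>(i, a). v i a)"
  define W where "W = Matrix.mat n n (\<lambda>(a, i). cnj (v i a))"
  have c: "V \<in> carrier_mat n n" "W \<in> carrier_mat n n" by (auto simp: V_def W_def)
  have "V * W = 1\<^sub>m n"
  proof (rule eq_matI)
    fix i j assume "i < dim_row (1\<^sub>m n :: complex mat)" "j < dim_col (1\<^sub>m n :: complex mat)"
    then have ij: "i < n" "j < n" by auto
    then show "(V * W) $$ (i, j) = 1\<^sub>m n $$ (i, j)"
      unfolding index_mult_mat_sum[OF c ij] using orthonormal_sysD[OF assms(1) ij] by (simp add: V_def W_def)
  qed (use c in auto)
  then have "W * V = 1\<^sub>m n" using mat_mult_left_right_inverse[OF c] by simp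
  then have "(W * V) $$ (b, a) = (if a = b then 1 else 0)" using assms by simp
  then show ?thesis using assms index_mult_mat_sum[OF c(2,1), of b a] by (simp add: V_def W_def mult.commute)
qed

lemma orthonormal_sys_parseval_polar:
  assumes "orthonormal_sys n n v"
  shows "(\<Sum>i<n. (\<Sum>a<n. f a * cnj (v i a)) * cnj (\<Sum>a<n. g a * cnj (v i a))) = (\<Sum>a<n. f a * cnj (g a))"
proof -
  have "(\<Sum>i<n. (\<Sum>a<n. f a * cnj (v i a)) * cnj (\<Sum>a<n. g a * cnj (v i a)))
      = (\<Sum>i<n. \<Sum>a<n. \<Sum>b<n. f a * cnj (g b) * (v i b * cnj (v i a)))"
    by (simp only: cnj_sum sum_product) (simp add: mult_ac)
  also have "\<dots> = (\<Sum>a<n. \<Sum>b<n. \<Sum>i<n. f a * cnj (g b) * (v i b * cnj (v i a)))"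
    by (subst sum.swap, subst (2) sum.swap) rule
  also have "\<dots> = (\<Sum>a<n. \<Sum>b<n. if b = a then f a * cnj (g b) else 0)"
    by (intro sum.cong refl) (auto simp: orthonormal_sys_complete[OF assms] simp flip: sum_distrib_left)
  finally show ?thesis by simp
qed

lemma orthonormal_sys_parseval:
  assumes "orthonormal_sys n n v"
  shows "(\<Sum>i<n. (cmod (\<Sum>a<n. f a * cnj (v i a)))\<^sup>2) = (\<Sum>a<n. (cmod (f a))\<^sup>2)"
proof -
  have "complex_of_real (\<Sum>i<n. (cmod (\<Sum>a<n. f a * cnj (v i a)))\<^sup>2) = of_real (\<Sum>a<n. (cmod (f a))\<^sup>2)"
    using orthonormal_sys_parseval_polar[OF assms, of f f] by (simp only: of_real_sum complex_norm_square)
  then show ?thesis by (simp only: of_real_eq_iff)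
qed

section \<open>Adjoints, singular bases and extremal singular values\<close>

lemma mat_adjoint_index:
  fixes A :: "complex mat"
  assumes "A \<in> carrier_mat n k"
  shows "mat_adjoint A \<in> carrier_mat k n"
    and "\<And>i j. i < k \<Longrightarrow> j < n \<Longrightarrow> mat_adjoint A $$ (i, j) = cnj (A $$ (j, i))"
proof -
  show c: "mat_adjoint A \<in> carrier_mat k n"
    using assms by (auto simp: mat_adjoint_def)
  fix i j assume ij: "i < k" "j < n"
  have "Matrix.row (mat_adjoint A) i = conjugate (col A i)"
    unfolding mat_adjoint_def using assms ij by (subst mat_of_rows_row) auto
  then have "vec_index (Matrix.row (mat_adjoint A) i) j = vec_index (conjugate (col A i)) j" by simp
  then show "mat_adjoint A $$ (i, j) = cnj (A $$ (j, i))"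
    using c assms ij by (auto simp: conjugate_complex_def)
qed

definition mat_app :: "nat \<Rightarrow> complex mat \<Rightarrow> (nat \<Rightarrow> complex) \<Rightarrow> nat \<Rightarrow> complex" where
  "mat_app n A x a = (\<Sum>b<n. A $$ (a, b) * x b)"

definition mat_app_adj :: "nat \<Rightarrow> complex mat \<Rightarrow> (nat \<Rightarrow> complex) \<Rightarrow> nat \<Rightarrow> complex" where
  "mat_app_adj n A x b = (\<Sum>a<n. cnj (A $$ (a, b)) * x a)"

lemma mat_app_adjoint:
  "(\<Sum>a<n. mat_app n A x a * cnj (y a)) = (\<Sum>b<n. x b * cnj (mat_app_adj n A y b))"
proof -
  have "(\<Sum>a<n. mat_app n A x a * cnj (y a)) = (\<Sum>a<n. \<Sum>b<n. x b * cnj (cnj (A $$ (a, b)) * y a))"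
    unfolding mat_app_def sum_distrib_right by (simp add: mult_ac)
  also have "\<dots> = (\<Sum>b<n. \<Sum>a<n. x b * cnj (cnj (A $$ (a, b)) * y a))" by (rule sum.swap)
  finally show ?thesis unfolding mat_app_adj_def cnj_sum sum_distrib_left .
qed

lemma mat_app_adj_mat_app:
  "mat_app_adj n A (mat_app n A x) b = (\<Sum>c<n. (\<Sum>a<n. cnj (A $$ (a, b)) * A $$ (a, c)) * x c)"
proof -
  have "mat_app_adj n A (mat_app n A x) b = (\<Sum>a<n. \<Sum>c<n. cnj (A $$ (a, b)) * A $$ (a, c) * x c)"
    unfolding mat_app_adj_def mat_app_def sum_distrib_left by (simp add: mult_ac)
  also have "\<dots> = (\<Sum>c<n. \<Sum>a<n. cnj (A $$ (a, b)) * A $$ (a, c) * x c)" by (rule sum.swap)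
  finally show ?thesis unfolding sum_distrib_right .
qed

lemma index_mult_mat_vec_sum:
  assumes "B \<in> carrier_mat n k" "x \<in> carrier_vec k" "b < n"
  shows "vec_index (B *\<^sub>v x) b = (\<Sum>c<k. B $$ (b, c) * vec_index x c)"
  using assms by (simp add: scalar_prod_def atLeast0LessThan)

lemma singular_values_iff:
  assumes A: "A \<in> carrier_mat n n"
  shows "t \<in> singular_values A \<longleftrightarrow>
    t \<ge> 0 \<and> (\<exists>x. (\<exists>a<n. x a \<noteq> 0) \<and> (\<forall>b<n. mat_app_adj n A (mat_app n A x) b = of_real (t\<^sup>2) * x b))"
proof -
  let ?B = "mat_adjoint A * A"
  note adj = mat_adjoint_index[OF A]
  have B: "?B \<in> carrier_mat n n" using A adj(1) by simp
  have app: "vec_index (?B *\<^sub>v x) b = mat_app_adj n A (mat_app n A (vec_index x)) b"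
    if "x \<in> carrier_vec n" "b < n" for x b
  proof -
    have "vec_index (?B *\<^sub>v x) b = (\<Sum>c<n. ?B $$ (b, c) * vec_index x c)"
      by (rule index_mult_mat_vec_sum[OF B that])
    also have "\<dots> = (\<Sum>c<n. (\<Sum>a<n. cnj (A $$ (a, b)) * A $$ (a, c)) * vec_index x c)"
      using that adj(2) by (intro sum.cong refl) (simp add: index_mult_mat_sum[OF adj(1) A] del: index_mult_mat(1))
    finally show ?thesis unfolding mat_app_adj_mat_app .
  qed
  have "eigenvalue ?B l \<longleftrightarrow>
    (\<exists>x. (\<exists>a<n. x a \<noteq> 0) \<and> (\<forall>b<n. mat_app_adj n A (mat_app n A x) b = l * x b))" for l
  proof
    assume "eigenvalue ?B l"
    then obtain x where x: "x \<in> carrier_vec n" "x \<noteq> 0\<^sub>v n" "?B *\<^sub>v x = l \<cdot>\<^sub>v x"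
      using B by (auto simp: eigenvalue_def eigenvector_def)
    have "\<exists>a<n. vec_index x a \<noteq> 0" using x(1,2) by (metis eq_vecI index_zero_vec carrier_vecD)
    moreover have "mat_app_adj n A (mat_app n A (vec_index x)) b = l * vec_index x b" if "b < n" for b
      using app[OF x(1) that] x that by simp
    ultimately show "\<exists>x. (\<exists>a<n. x a \<noteq> 0) \<and> (\<forall>b<n. mat_app_adj n A (mat_app n A x) b = l * x b)" by blast
  next
    assume "\<exists>x. (\<exists>a<n. x a \<noteq> 0) \<and> (\<forall>b<n. mat_app_adj n A (mat_app n A x) b = l * x b)"
    then obtain x a0 where a0: "a0 < n" "x a0 \<noteq> 0"
      and x: "\<And>b. b < n \<Longrightarrow> mat_app_adj n A (mat_app n A x) b = l * x b" by blast
    have "mat_app_adj n A (mat_app n A (vec_index (Matrix.vec n x))) b = mat_app_adj n A (mat_app n A x) b" for b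
      unfolding mat_app_adj_mat_app by (intro sum.cong refl) simp
    then have "?B *\<^sub>v Matrix.vec n x = l \<cdot>\<^sub>v Matrix.vec n x"
      using app[of "Matrix.vec n x"] x B A by (intro eq_vecI) (auto simp: mat_adjoint_def)
    moreover have "Matrix.vec n x \<noteq> 0\<^sub>v n" using a0 by (metis index_vec index_zero_vec(1))
    ultimately have "eigenvector ?B (Matrix.vec n x) l" using adj(1) by (simp add: eigenvector_def)
    then show "eigenvalue ?B l" by (auto simp: eigenvalue_def)
  qed
  then show ?thesis by (simp add: singular_values_def)
qed

lemma sum_cmod_mat_app:
  "complex_of_real (\<Sum>a<n. (cmod (mat_app n A x a))\<^sup>2) = (\<Sum>b<n. mat_app_adj n A (mat_app n A x) b * cnj (x b))"
proof -
  have "complex_of_real (\<Sum>a<n. (cmod (mat_app n A x a))\<^sup>2) = (\<Sum>a<n. mat_app n A x a * cnj (mat_app n A x a))"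
    by (simp only: of_real_sum complex_norm_square)
  then have "complex_of_real (\<Sum>a<n. (cmod (mat_app n A x a))\<^sup>2) = cnj (\<Sum>a<n. mat_app n A x a * cnj (mat_app n A x a))"
    by (metis complex_cnj_complex_of_real)
  then show ?thesis unfolding mat_app_adjoint by (simp add: mult.commute)
qed

lemma singular_value_attained:
  assumes A: "A \<in> carrier_mat n n" and t: "t \<in> singular_values A"
  obtains x where "\<exists>a<n. x a \<noteq> 0" "(\<Sum>a<n. (cmod (mat_app n A x a))\<^sup>2) = t\<^sup>2 * (\<Sum>a<n. (cmod (x a))\<^sup>2)"
proof -
  obtain x where x: "\<exists>a<n. x a \<noteq> 0" "\<And>b. b < n \<Longrightarrow> mat_app_adj n A (mat_app n A x) b = of_real (t\<^sup>2) * x b"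
    using t unfolding singular_values_iff[OF A] by blast
  have "complex_of_real (\<Sum>a<n. (cmod (mat_app n A x a))\<^sup>2) = (\<Sum>b<n. of_real (t\<^sup>2) * (x b * cnj (x b)))"
    unfolding sum_cmod_mat_app by (intro sum.cong refl) (simp add: x(2))
  also have "\<dots> = of_real (t\<^sup>2 * (\<Sum>a<n. (cmod (x a))\<^sup>2))"
    by (simp only: of_real_mult of_real_sum complex_norm_square sum_distrib_left)
  finally show thesis using that[OF x(1)] by (simp only: of_real_eq_iff)
qed

text \<open>\<open>singular_values A\<close> is a set and forgets multiplicities. The family
  \<open>mu\<close> of eigenvalues of the Gram matrix keeps them, and its quadratic form turns the
  extremal singular values into bounds for the norm of an image.\<close>

lemma singular_basis:
  assumes A: "A \<in> carrier_mat n n"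
  obtains v mu where "orthonormal_sys n n v" "\<And>i. i < n \<Longrightarrow> mu i \<ge> 0 \<and> sqrt (mu i) \<in> singular_values A"
    "\<And>i b. i < n \<Longrightarrow> b < n \<Longrightarrow> mat_app_adj n A (mat_app n A (v i)) b = of_real (mu i) * v i b"
    "\<And>x. (\<Sum>a<n. (cmod (mat_app n A x a))\<^sup>2) = (\<Sum>i<n. mu i * (cmod (\<Sum>a<n. x a * cnj (v i a)))\<^sup>2)"
proof -
  define h where "h = (\<lambda>b c. \<Sum>a<n. cnj (A $$ (a, b)) * A $$ (a, c))"
  have "h a b = cnj (h b a)" for a b by (simp add: h_def mult.commute)
  from hermitian_spectral[of n h, OF this] obtain v mu where on: "orthonormal_sys n n v"
    and ev: "\<And>i a. i < n \<Longrightarrow> a < n \<Longrightarrow> (\<Sum>b<n. h a b * v i b) = of_real (mu i :: real) * v i a" by blast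
  have ev': "mat_app_adj n A (mat_app n A (v i)) b = of_real (mu i) * v i b" if "i < n" "b < n" for i b
    using ev[OF that] unfolding mat_app_adj_mat_app h_def .
  have mu: "mu i = (\<Sum>a<n. (cmod (mat_app n A (v i) a))\<^sup>2)" if "i < n" for i
  proof -
    have "complex_of_real (\<Sum>a<n. (cmod (mat_app n A (v i) a))\<^sup>2) = (\<Sum>b<n. of_real (mu i) * (v i b * cnj (v i b)))"
      unfolding sum_cmod_mat_app by (intro sum.cong refl) (simp add: ev'[OF that])
    also have "\<dots> = of_real (mu i)" using orthonormal_sysD[OF on that that] by (simp flip: sum_distrib_left)
    finally show ?thesis by (simp only: of_real_eq_iff)
  qed
  have mu0: "mu i \<ge> 0" if "i < n" for i unfolding mu[OF that] by (simp add: sum_nonneg)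
  have sv: "sqrt (mu i) \<in> singular_values A" if "i < n" for i
  proof -
    have "\<exists>a<n. v i a \<noteq> 0"
    proof (rule ccontr)
      assume "\<not> ?thesis"
      then have "(\<Sum>a<n. v i a * cnj (v i a)) = 0" by simp
      then show False using orthonormal_sysD[OF on that that] by simp
    qed
    moreover have "\<forall>b<n. mat_app_adj n A (mat_app n A (v i)) b = of_real ((sqrt (mu i))\<^sup>2) * v i b"
      using ev'[OF that] mu0[OF that] by simp
    ultimately show ?thesis unfolding singular_values_iff[OF A] using mu0[OF that] by auto
  qed
  have quad: "(\<Sum>a<n. (cmod (mat_app n A x a))\<^sup>2) = (\<Sum>i<n. mu i * (cmod (\<Sum>a<n. x a * cnj (v i a)))\<^sup>2)" for x
  proof -
    let ?y = "mat_app_adj n A (mat_app n A x)"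
    have c: "(\<Sum>a<n. ?y a * cnj (v i a)) = of_real (mu i) * (\<Sum>a<n. x a * cnj (v i a))" if "i < n" for i
    proof -
      have "(\<Sum>a<n. ?y a * cnj (v i a)) = cnj (\<Sum>a<n. v i a * cnj (?y a))" by (simp add: mult.commute)
      also have "(\<Sum>a<n. v i a * cnj (?y a)) = (\<Sum>a<n. mat_app n A (v i) a * cnj (mat_app n A x a))"
        by (simp only: mat_app_adjoint)
      also have "cnj \<dots> = (\<Sum>a<n. mat_app n A x a * cnj (mat_app n A (v i) a))" by (simp add: mult.commute)
      also have "\<dots> = (\<Sum>b<n. x b * cnj (mat_app_adj n A (mat_app n A (v i)) b))" by (rule mat_app_adjoint)
      also have "\<dots> = (\<Sum>b<n. of_real (mu i) * (x b * cnj (v i b)))" using ev'[OF that] by (intro sum.cong refl) simp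
      finally show ?thesis by (simp only: sum_distrib_left)
    qed
    have "complex_of_real (\<Sum>a<n. (cmod (mat_app n A x a))\<^sup>2)
       = (\<Sum>i<n. (\<Sum>a<n. ?y a * cnj (v i a)) * cnj (\<Sum>a<n. x a * cnj (v i a)))"
      unfolding sum_cmod_mat_app orthonormal_sys_parseval_polar[OF on] ..
    also have "\<dots> = (\<Sum>i<n. of_real (mu i) * ((\<Sum>a<n. x a * cnj (v i a)) * cnj (\<Sum>a<n. x a * cnj (v i a))))"
      by (intro sum.cong refl) (simp only: c lessThan_iff mult.assoc)
    also have "\<dots> = of_real (\<Sum>i<n. mu i * (cmod (\<Sum>a<n. x a * cnj (v i a)))\<^sup>2)"
      by (simp only: of_real_sum of_real_mult complex_norm_square)
    finally show ?thesis by (simp only: of_real_eq_iff)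
  qed
  show thesis using that[OF on] mu0 sv ev' quad by blast
qed

lemma singular_values_finite_nonempty:
  assumes A: "A \<in> carrier_mat n n" and n: "n > 0"
  shows "finite (singular_values A)" "singular_values A \<noteq> {}"
proof -
  have B: "mat_adjoint A * A \<in> carrier_mat n n" using A mat_adjoint_index(1)[OF A] by simp
  have "(\<lambda>t. complex_of_real (t\<^sup>2)) ` singular_values A \<subseteq> spectrum (mat_adjoint A * A)"
    by (auto simp: singular_values_def spectrum_def)
  moreover have "inj_on (\<lambda>t. complex_of_real (t\<^sup>2)) (singular_values A)"
    by (rule inj_onI, simp only: of_real_eq_iff) (auto simp: singular_values_def)
  ultimately show "finite (singular_values A)"
    using card_finite_spectrum(1)[OF B] by (meson finite_imageD finite_subset)
  obtain v mu where "\<And>i. i < n \<Longrightarrow> mu i \<ge> 0 \<and> sqrt (mu i) \<in> singular_values A"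
    by (rule singular_basis[OF A]) blast
  then show "singular_values A \<noteq> {}" using n by blast
qed

lemma smallest_sv_le_mat_app:
  assumes A: "A \<in> carrier_mat n n" and n: "n > 0"
  shows "(smallest_sv A)\<^sup>2 * (\<Sum>a<n. (cmod (x a))\<^sup>2) \<le> (\<Sum>a<n. (cmod (mat_app n A x a))\<^sup>2)"
proof -
  note fin = singular_values_finite_nonempty[OF A n]
  obtain v mu where on: "orthonormal_sys n n v" and mu: "\<And>i. i < n \<Longrightarrow> mu i \<ge> 0 \<and> sqrt (mu i) \<in> singular_values A"
    and quad: "\<And>x. (\<Sum>a<n. (cmod (mat_app n A x a))\<^sup>2) = (\<Sum>i<n. mu i * (cmod (\<Sum>a<n. x a * cnj (v i a)))\<^sup>2)"
    by (rule singular_basis[OF A]) blast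
  have ge: "smallest_sv A \<ge> 0" using fin by (auto simp: smallest_sv_def singular_values_def)
  have "(smallest_sv A)\<^sup>2 * (\<Sum>a<n. (cmod (x a))\<^sup>2) = (\<Sum>i<n. (smallest_sv A)\<^sup>2 * (cmod (\<Sum>a<n. x a * cnj (v i a)))\<^sup>2)"
    unfolding orthonormal_sys_parseval[OF on, of x, symmetric] sum_distrib_left ..
  also have "\<dots> \<le> (\<Sum>i<n. mu i * (cmod (\<Sum>a<n. x a * cnj (v i a)))\<^sup>2)"
  proof (intro sum_mono mult_right_mono)
    fix i assume "i \<in> {..<n}"
    then have i: "i < n" by simp
    then have "smallest_sv A \<le> sqrt (mu i)" 
      unfolding smallest_sv_def using mu[OF i] fin(1) by (intro Min_le) auto
    then have "(smallest_sv A)\<^sup>2 \<le> (sqrt (mu i))\<^sup>2" using ge by (intro power_mono)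
    then show "(smallest_sv A)\<^sup>2 \<le> mu i" using mu[OF i] by simp
  qed auto
  finally show ?thesis unfolding quad .
qed

lemma mat_app_le_greatest_sv:
  assumes A: "A \<in> carrier_mat n n" and n: "n > 0"
  shows "(\<Sum>a<n. (cmod (mat_app n A x a))\<^sup>2) \<le> (greatest_sv A)\<^sup>2 * (\<Sum>a<n. (cmod (x a))\<^sup>2)"
proof -
  note fin = singular_values_finite_nonempty[OF A n]
  obtain v mu where on: "orthonormal_sys n n v" and mu: "\<And>i. i < n \<Longrightarrow> mu i \<ge> 0 \<and> sqrt (mu i) \<in> singular_values A"
    and quad: "\<And>x. (\<Sum>a<n. (cmod (mat_app n A x a))\<^sup>2) = (\<Sum>i<n. mu i * (cmod (\<Sum>a<n. x a * cnj (v i a)))\<^sup>2)"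
    by (rule singular_basis[OF A]) blast
  have "(\<Sum>i<n. mu i * (cmod (\<Sum>a<n. x a * cnj (v i a)))\<^sup>2) \<le> (\<Sum>i<n. (greatest_sv A)\<^sup>2 * (cmod (\<Sum>a<n. x a * cnj (v i a)))\<^sup>2)"
  proof (intro sum_mono mult_right_mono)
    fix i assume "i \<in> {..<n}"
    then have i: "i < n" by simp
    then have "sqrt (mu i) \<le> greatest_sv A" 
      unfolding greatest_sv_def using mu[OF i] fin(1) by (intro Max_ge) auto
    then have "(sqrt (mu i))\<^sup>2 \<le> (greatest_sv A)\<^sup>2" using mu[OF i] by (intro power_mono) auto
    then show "mu i \<le> (greatest_sv A)\<^sup>2" using mu[OF i] by simp
  qed auto
  also have "\<dots> = (greatest_sv A)\<^sup>2 * (\<Sum>a<n. (cmod (x a))\<^sup>2)"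
    unfolding orthonormal_sys_parseval[OF on, of x, symmetric] sum_distrib_left ..
  finally show ?thesis unfolding quad .
qed

text \<open>Column \<open>b\<close> is the image of a unit vector. This is how a bound on the
  operator norm of the perturbation becomes the mean square bound that the packet estimate
  takes.\<close>

lemma sum_entries_le_greatest_sv:
  assumes A: "A \<in> carrier_mat n n" and n: "n > 0"
  shows "(\<Sum>a<n. \<Sum>b<n. (cmod (A $$ (a, b)))\<^sup>2) \<le> real n * (greatest_sv A)\<^sup>2"
proof -
  have "(\<Sum>a<n. (cmod (A $$ (a, b)))\<^sup>2) \<le> (greatest_sv A)\<^sup>2" if "b < n" for b
  proof -
    have e: "mat_app n A (\<lambda>c. if c = b then 1 else 0) a = A $$ (a, b)" for a
      using that by (simp add: mat_app_def if_distrib cong: if_cong)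
    have o: "(\<Sum>a<n. (cmod (if a = b then 1 else 0))\<^sup>2) = (1::real)"
      using that by (simp add: if_distrib[of cmod] if_distrib[of "\<lambda>x. x\<^sup>2"] cong: if_cong)
    show ?thesis using mat_app_le_greatest_sv[OF A n, of "\<lambda>c. if c = b then 1 else 0"] unfolding e o by simp
  qed
  then have "(\<Sum>b<n. \<Sum>a<n. (cmod (A $$ (a, b)))\<^sup>2) \<le> (\<Sum>b<n. (greatest_sv A)\<^sup>2)"
    by (intro sum_mono) auto
  then show ?thesis by (subst sum.swap) simp
qed

lemma greatest_sv_le_sum_entries:
  assumes A: "A \<in> carrier_mat n n" and n: "n > 0"
  shows "greatest_sv A \<ge> 0" "(greatest_sv A)\<^sup>2 \<le> (\<Sum>a<n. \<Sum>b<n. (cmod (A $$ (a, b)))\<^sup>2)"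
proof -
  note fin = singular_values_finite_nonempty[OF A n]
  have mem: "greatest_sv A \<in> singular_values A" unfolding greatest_sv_def using fin by (rule Max_in)
  then show "greatest_sv A \<ge> 0" by (simp add: singular_values_def)
  obtain x where x: "\<exists>a<n. x a \<noteq> 0"
    "(\<Sum>a<n. (cmod (mat_app n A x a))\<^sup>2) = (greatest_sv A)\<^sup>2 * (\<Sum>a<n. (cmod (x a))\<^sup>2)"
    using singular_value_attained[OF A mem] by blast
  have pos: "(\<Sum>a<n. (cmod (x a))\<^sup>2) > 0" using x(1) by (auto intro!: sum_pos2)
  have "(cmod (mat_app n A x a))\<^sup>2 \<le> (\<Sum>b<n. (cmod (A $$ (a, b)))\<^sup>2) * (\<Sum>b<n. (cmod (x b))\<^sup>2)" for a
  proof -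
    have "cmod (mat_app n A x a) \<le> (\<Sum>b<n. cmod (A $$ (a, b)) * cmod (x b))"
      unfolding mat_app_def norm_mult[symmetric] by (rule norm_sum)
    then have "(cmod (mat_app n A x a))\<^sup>2 \<le> (\<Sum>b<n. cmod (A $$ (a, b)) * cmod (x b))\<^sup>2"
      by (intro power_mono) auto
    also have "\<dots> \<le> (\<Sum>b<n. (cmod (A $$ (a, b)))\<^sup>2) * (\<Sum>b<n. (cmod (x b))\<^sup>2)"
      by (rule Cauchy_Schwarz_ineq_sum)
    finally show ?thesis .
  qed
  then have "(\<Sum>a<n. (cmod (mat_app n A x a))\<^sup>2) \<le> (\<Sum>a<n. \<Sum>b<n. (cmod (A $$ (a, b)))\<^sup>2) * (\<Sum>a<n. (cmod (x a))\<^sup>2)"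
    unfolding sum_distrib_right[of "\<lambda>a. \<Sum>b<n. (cmod (A $$ (a, b)))\<^sup>2"] by (intro sum_mono)
  then show "(greatest_sv A)\<^sup>2 \<le> (\<Sum>a<n. \<Sum>b<n. (cmod (A $$ (a, b)))\<^sup>2)"
    using pos unfolding x(2) by (simp add: mult_le_cancel_right)
qed

section \<open>Singular value decomposition\<close>

lemma det_unitary:
  assumes "orthonormal_sys n n v"
  shows "cmod (det (Matrix.mat n n (\<lambda>(a, i). v i a))) = 1"
proof -
  let ?V = "Matrix.mat n n (\<lambda>(a, i). v i a)"
  let ?W = "Matrix.mat n n (\<lambda>(i, a). cnj (v i a))"
  interpret cnj: comm_ring_hom cnj by unfold_locales auto
  have c: "?V \<in> carrier_mat n n" "?W \<in> carrier_mat n n" by auto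
  have "?V * ?W = 1\<^sub>m n"
  proof (rule eq_matI)
    fix a b assume "a < dim_row (1\<^sub>m n :: complex mat)" "b < dim_col (1\<^sub>m n :: complex mat)"
    then have ab: "a < n" "b < n" by auto
    then show "(?V * ?W) $$ (a, b) = 1\<^sub>m n $$ (a, b)"
      unfolding index_mult_mat_sum[OF c ab] using orthonormal_sys_complete[OF assms ab] by simp
  qed auto
  then have "det ?V * det ?W = 1" using det_mult[OF c] by simp
  moreover have "?W = map_mat cnj (transpose_mat ?V)" by (intro eq_matI) auto
  then have "det ?W = cnj (det ?V)" using det_transpose[OF c(1)] by simp
  ultimately have "complex_of_real ((cmod (det ?V))\<^sup>2) = of_real 1" by (simp only: complex_norm_square of_real_1)
  then have "(cmod (det ?V))\<^sup>2 = 1" by (simp only: of_real_eq_iff)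
  then show ?thesis by (metis norm_ge_zero power2_eq_1_iff abs_of_nonneg abs_1 power2_eq_iff_nonneg zero_le_one one_power2)
qed

text \<open>Invertibility makes every \<open>s i\<close> positive, so the left singular vectors are
  simply the normalized images of the right ones. The matrices to which this is applied have a
  nonzero determinant, because its logarithm is what is being studied.\<close>

lemma svd_exists:
  assumes A: "A \<in> carrier_mat n n" and dA: "det A \<noteq> 0"
  obtains u v s where "orthonormal_sys n n u" "orthonormal_sys n n v"
    "\<And>i. i < n \<Longrightarrow> s i > 0 \<and> s i \<in> singular_values A"
    "\<And>i a. i < n \<Longrightarrow> a < n \<Longrightarrow> mat_app n A (v i) a = of_real (s i) * u i a"
    "\<And>i b. i < n \<Longrightarrow> b < n \<Longrightarrow> mat_app_adj n A (u i) b = of_real (s i) * v i b"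
    "cmod (det A) = (\<Prod>i<n. s i)"
proof -
  obtain v mu where on: "orthonormal_sys n n v" and mu: "\<And>i. i < n \<Longrightarrow> mu i \<ge> 0 \<and> sqrt (mu i) \<in> singular_values A"
    and ev: "\<And>i b. i < n \<Longrightarrow> b < n \<Longrightarrow> mat_app_adj n A (mat_app n A (v i)) b = of_real (mu i) * v i b"
    by (rule singular_basis[OF A]) blast
  have gram: "(\<Sum>a<n. mat_app n A (v i) a * cnj (mat_app n A (v j) a)) = (if i = j then of_real (mu i) else 0)"
    if ij: "i < n" "j < n" for i j
  proof -
    have "(\<Sum>a<n. mat_app n A (v i) a * cnj (mat_app n A (v j) a)) = (\<Sum>b<n. v i b * cnj (mat_app_adj n A (mat_app n A (v j)) b))"
      by (rule mat_app_adjoint)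
    also have "\<dots> = (\<Sum>b<n. of_real (mu j) * (v i b * cnj (v j b)))"
      using ev[OF ij(2)] by (intro sum.cong refl) simp
    also have "\<dots> = (if i = j then of_real (mu i) else 0)"
      using orthonormal_sysD[OF on ij] by (simp flip: sum_distrib_left)
    finally show ?thesis .
  qed
  have mupos: "mu i > 0" if i: "i < n" for i
  proof (rule ccontr)
    assume "\<not> mu i > 0"
    then have "mu i = 0" using mu[OF i] by simp
    then have "complex_of_real (\<Sum>a<n. (cmod (mat_app n A (v i) a))\<^sup>2) = of_real 0"
      using gram[OF i i] by (simp only: of_real_sum complex_norm_square) simp
    then have "(\<Sum>a<n. (cmod (mat_app n A (v i) a))\<^sup>2) = 0" by (simp only: of_real_eq_iff)
    then have z: "mat_app n A (v i) a = 0" if "a < n" for a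
      using that by (subst (asm) sum_nonneg_eq_0_iff) auto
    have "A *\<^sub>v Matrix.vec n (v i) = 0\<^sub>v n"
    proof (rule eq_vecI)
      fix a assume "a < dim_vec (0\<^sub>v n :: complex Matrix.vec)"
      then have a: "a < n" by simp
      show "vec_index (A *\<^sub>v Matrix.vec n (v i)) a = vec_index (0\<^sub>v n) a"
        using z[OF a] a by (subst index_mult_mat_vec_sum[OF A]) (auto simp: mat_app_def)
    qed (use A in auto)
    moreover have "Matrix.vec n (v i) \<noteq> 0\<^sub>v n"
    proof
      assume "Matrix.vec n (v i) = 0\<^sub>v n"
      then have "v i a = 0" if "a < n" for a using that by (metis index_vec index_zero_vec(1))
      then show False using orthonormal_sysD[OF on i i] by simp
    qed
    ultimately have "\<exists>x. x \<in> carrier_vec n \<and> x \<noteq> 0\<^sub>v n \<and> A *\<^sub>v x = 0\<^sub>v n"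
      by (intro exI[of _ "Matrix.vec n (v i)"]) simp
    then show False using det_0_iff_vec_prod_zero[OF A] dA by blast
  qed
  define s where "s i = sqrt (mu i)" for i
  define u where "u i a = mat_app n A (v i) a / of_real (s i)" for i a
  have spos: "s i > 0" if "i < n" for i using mupos[OF that] by (simp add: s_def)
  have s2: "complex_of_real (s i) * of_real (s i) = of_real (mu i)" if "i < n" for i
    using mupos[OF that] by (simp add: s_def flip: of_real_mult)
  have onu: "orthonormal_sys n n u"
    unfolding orthonormal_sys_def
  proof (intro allI impI)
    fix i j assume ij: "i < n" "j < n"
    have "(\<Sum>a<n. u i a * cnj (u j a)) = (\<Sum>a<n. mat_app n A (v i) a * cnj (mat_app n A (v j) a)) / (of_real (s i) * of_real (s j))"
      by (simp add: u_def flip: sum_divide_distrib)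
    then show "(\<Sum>a<n. u i a * cnj (u j a)) = (if i = j then 1 else 0)"
      unfolding gram[OF ij] using s2[OF ij(1)] mupos[OF ij(1)] by auto
  qed
  have Av: "mat_app n A (v i) a = of_real (s i) * u i a" if "i < n" for i a
    using spos[OF that] by (simp add: u_def)
  have Au: "mat_app_adj n A (u i) b = of_real (s i) * v i b" if ib: "i < n" "b < n" for i b
  proof -
    have "mat_app_adj n A (u i) b = mat_app_adj n A (mat_app n A (v i)) b / of_real (s i)"
      unfolding mat_app_adj_def u_def by (simp flip: sum_divide_distrib)
    also have "\<dots> = (of_real (s i) * of_real (s i)) * v i b / of_real (s i)"
      using ev[OF ib] s2[OF ib(1)] by simp
    finally show ?thesis using spos[OF ib(1)] by simp
  qed
  have "cmod (det A) = (\<Prod>i<n. s i)"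
  proof -
    let ?V = "Matrix.mat n n (\<lambda>(a, i). v i a)"
    let ?U = "Matrix.mat n n (\<lambda>(a, i). u i a)"
    let ?S = "mat_diag n (\<lambda>i. complex_of_real (s i))"
    have c: "?V \<in> carrier_mat n n" "?U \<in> carrier_mat n n" "?S \<in> carrier_mat n n" by auto
    have "A * ?V = ?U * ?S"
    proof (rule eq_matI)
      fix a i assume "a < dim_row (?U * ?S)" "i < dim_col (?U * ?S)"
      then have ai: "a < n" "i < n" by (auto simp: mat_diag_def)
      have "(A * ?V) $$ (a, i) = mat_app n A (v i) a"
        unfolding index_mult_mat_sum[OF A c(1) ai] mat_app_def using ai by simp
      also have "\<dots> = (?U * ?S) $$ (a, i)"
        using ai Av[OF ai(2)] by (simp add: mat_diag_mult_right[OF c(2)])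
      finally show "(A * ?V) $$ (a, i) = (?U * ?S) $$ (a, i)" .
    qed (use A in \<open>auto simp: mat_diag_def\<close>)
    then have "det A * det ?V = det ?U * det ?S" using det_mult[OF A c(1)] det_mult[OF c(2,3)] by simp
    then have "cmod (det A) * cmod (det ?V) = cmod (det ?U) * cmod (det ?S)" by (metis norm_mult)
    then have "cmod (det A) = cmod (det ?S)" unfolding det_unitary[OF on] det_unitary[OF onu] by simp
    also have "det ?S = (\<Prod>i<n. of_real (s i))"
      by (subst det_upper_triangular[OF _ c(3)]) (auto simp: mat_diag_def upper_triangular_def prod_list_diag_prod atLeast0LessThan)
    also have "cmod \<dots> = (\<Prod>i<n. s i)" using spos by (auto simp: prod_norm[symmetric] less_imp_le intro!: prod.cong)
    finally show ?thesis .
  qed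
  moreover have "s i > 0 \<and> s i \<in> singular_values A" if "i < n" for i
    using spos[OF that] mu[OF that] by (simp add: s_def)
  ultimately show thesis using that[OF onu on _ Av Au] by blast
qed

text \<open>The pairing is bilinear because it is applied to rows of matrices as well as to
  conjugated singular vectors.\<close>

lemma parseval_frame_norm:
  fixes g :: "'f \<Rightarrow> nat \<Rightarrow> complex"
  assumes frame: "\<And>a b. a < n \<Longrightarrow> b < n \<Longrightarrow> (\<Sum>f\<in>F. g f a * cnj (g f b)) = (if a = b then 1 else 0)"
  shows "(\<Sum>f\<in>F. (cmod (\<Sum>a<n. x a * g f a))\<^sup>2) = (\<Sum>a<n. (cmod (x a))\<^sup>2)"
proof -
  have "complex_of_real (\<Sum>f\<in>F. (cmod (\<Sum>a<n. x a * g f a))\<^sup>2)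
      = (\<Sum>f\<in>F. \<Sum>a<n. \<Sum>b<n. x a * cnj (x b) * (g f a * cnj (g f b)))"
    by (simp only: of_real_sum complex_norm_square cnj_sum sum_product) (simp add: mult_ac)
  also have "\<dots> = (\<Sum>a<n. \<Sum>b<n. \<Sum>f\<in>F. x a * cnj (x b) * (g f a * cnj (g f b)))"
    by (subst sum.swap, subst (2) sum.swap) rule
  also have "\<dots> = (\<Sum>a<n. \<Sum>b<n. if b = a then x a * cnj (x b) else 0)"
    by (intro sum.cong refl) (auto simp: frame simp flip: sum_distrib_left)
  also have "\<dots> = of_real (\<Sum>a<n. (cmod (x a))\<^sup>2)"
    by (simp only: of_real_sum complex_norm_square) simp
  finally show ?thesis by (simp only: of_real_eq_iff)
qed

text \<open>Here \<alpha> and \<beta> stand for the coefficients of one packet against a left and a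
  right singular vector. Both squares on the right contain the same cross term, so it cancels in
  their difference; in their sum it is bounded by
  \<open>cmod w * cmod \<alpha> * cmod \<beta>\<close> and the inequality of arithmetic and
  geometric means.\<close>

lemma svd_coupling_pointwise:
  fixes \<alpha> \<beta> w :: complex and s :: real
  assumes s: "s \<ge> 0"
  shows "(s - cmod w)\<^sup>2 * ((cmod \<alpha>)\<^sup>2 + (cmod \<beta>)\<^sup>2) \<le> (cmod (of_real s * \<beta> - w * \<alpha>))\<^sup>2 + (cmod (of_real s * \<alpha> - cnj w * \<beta>))\<^sup>2"
    and "(cmod (of_real s * \<beta> - w * \<alpha>))\<^sup>2 - (cmod (of_real s * \<alpha> - cnj w * \<beta>))\<^sup>2 = (s\<^sup>2 - (cmod w)\<^sup>2) * ((cmod \<beta>)\<^sup>2 - (cmod \<alpha>)\<^sup>2)"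
proof -
  define t where "t = Re (\<beta> * cnj w * cnj \<alpha>)"
  have e1: "(cmod (of_real s * \<beta> - w * \<alpha>))\<^sup>2 = s\<^sup>2 * (cmod \<beta>)\<^sup>2 + (cmod w)\<^sup>2 * (cmod \<alpha>)\<^sup>2 - 2 * s * t"
    unfolding t_def cmod_power2 by (simp add: power2_eq_square algebra_simps)
  have e2: "(cmod (of_real s * \<alpha> - cnj w * \<beta>))\<^sup>2 = s\<^sup>2 * (cmod \<alpha>)\<^sup>2 + (cmod w)\<^sup>2 * (cmod \<beta>)\<^sup>2 - 2 * s * t"
    unfolding t_def cmod_power2 by (simp add: power2_eq_square algebra_simps)
  have "t \<le> cmod w * (cmod \<alpha> * cmod \<beta>)"
    using complex_Re_le_cmod[of "\<beta> * cnj w * cnj \<alpha>"] by (simp add: t_def norm_mult mult_ac)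
  then have "2 * s * t \<le> 2 * s * (cmod w * (cmod \<alpha> * cmod \<beta>))" using s by (intro mult_left_mono) auto
  moreover have "2 * (cmod \<alpha> * cmod \<beta>) \<le> (cmod \<alpha>)\<^sup>2 + (cmod \<beta>)\<^sup>2"
    using sum_squares_bound[of "cmod \<alpha>" "cmod \<beta>"] by (simp add: mult_ac)
  then have "s * cmod w * (2 * (cmod \<alpha> * cmod \<beta>)) \<le> s * cmod w * ((cmod \<alpha>)\<^sup>2 + (cmod \<beta>)\<^sup>2)"
    using s by (intro mult_left_mono) auto
  ultimately show "(s - cmod w)\<^sup>2 * ((cmod \<alpha>)\<^sup>2 + (cmod \<beta>)\<^sup>2) \<le> (cmod (of_real s * \<beta> - w * \<alpha>))\<^sup>2 + (cmod (of_real s * \<alpha> - cnj w * \<beta>))\<^sup>2"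
    unfolding e1 e2 by (simp add: power2_eq_square algebra_simps)
  show "(cmod (of_real s * \<beta> - w * \<alpha>))\<^sup>2 - (cmod (of_real s * \<alpha> - cnj w * \<beta>))\<^sup>2 = (s\<^sup>2 - (cmod w)\<^sup>2) * ((cmod \<beta>)\<^sup>2 - (cmod \<alpha>)\<^sup>2)"
    unfolding e1 e2 by (simp add: algebra_simps)
qed

text \<open>
  The squared overlaps of the packets \<open>g f\<close> with the pairs \<open>(u i, v i)\<close> form a coupling between
  the singular values and the weighted values \<open>cmod (w f)\<close>; the hypothesis \<open>E\<close> bounds its
  transport cost. The same cost for the adjoint is not assumed: it is implied by summing the second
  part of \<open>svd_coupling_pointwise\<close>.
\<close>

lemma svd_coupling:
  fixes g :: "'f \<Rightarrow> nat \<Rightarrow> complex" and phi :: "real \<Rightarrow> real"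
  assumes F: "finite F"
    and on: "orthonormal_sys n n u" "orthonormal_sys n n v"
    and s: "\<And>i. i < n \<Longrightarrow> s i \<ge> 0"
    and Av: "\<And>i a. i < n \<Longrightarrow> a < n \<Longrightarrow> mat_app n A (v i) a = of_real (s i) * u i a"
    and Au: "\<And>i b. i < n \<Longrightarrow> b < n \<Longrightarrow> mat_app_adj n A (u i) b = of_real (s i) * v i b"
    and frame: "\<And>a b. a < n \<Longrightarrow> b < n \<Longrightarrow> (\<Sum>f\<in>F. g f a * cnj (g f b)) = (if a = b then 1 else 0)"
    and lip: "\<And>x y. x \<ge> 0 \<Longrightarrow> y \<ge> 0 \<Longrightarrow> \<bar>phi x - phi y\<bar> \<le> L * \<bar>x - y\<bar>"
    and E: "(\<Sum>f\<in>F. \<Sum>a<n. (cmod (mat_app n A (g f) a - w f * g f a))\<^sup>2) \<le> E"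
  shows "\<bar>(\<Sum>i<n. phi (s i)) - (\<Sum>f\<in>F. (\<Sum>a<n. (cmod (g f a))\<^sup>2) * phi (cmod (w f)))\<bar> \<le> L * sqrt (real n * E)"
proof -
  have L: "L \<ge> 0" using lip[of 0 1] by simp
  define \<alpha> where "\<alpha> i f = (\<Sum>a<n. g f a * cnj (u i a))" for i f
  define \<beta> where "\<beta> i f = (\<Sum>a<n. g f a * cnj (v i a))" for i f
  \<comment> \<open>Averaging the two overlaps treats left and right singular vectors alike. The
    marginals of \<open>p\<close> are 1 for each singular value and the squared norm for each
    packet.\<close>
  define p where "p i f = ((cmod (\<alpha> i f))\<^sup>2 + (cmod (\<beta> i f))\<^sup>2) / 2" for i f
  have un: "(\<Sum>a<n. (cmod (u' i a))\<^sup>2) = 1" if "orthonormal_sys n n u'" "i < n" for u' i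
  proof -
    have "complex_of_real (\<Sum>a<n. (cmod (u' i a))\<^sup>2) = of_real 1"
      using orthonormal_sysD[OF that(1) that(2) that(2)] by (simp only: of_real_sum complex_norm_square) simp
    then show ?thesis by (simp only: of_real_eq_iff)
  qed
  have \<alpha>F: "(\<Sum>f\<in>F. (cmod (\<alpha> i f))\<^sup>2) = 1" if "i < n" for i
    using parseval_frame_norm[OF frame, where x = "\<lambda>a. cnj (u i a)"] un[OF on(1) that]
    by (simp add: \<alpha>_def mult.commute)
  have \<beta>F: "(\<Sum>f\<in>F. (cmod (\<beta> i f))\<^sup>2) = 1" if "i < n" for i
    using parseval_frame_norm[OF frame, where x = "\<lambda>a. cnj (v i a)"] un[OF on(2) that]
    by (simp add: \<beta>_def mult.commute)
  have \<alpha>i: "(\<Sum>i<n. (cmod (\<alpha> i f))\<^sup>2) = (\<Sum>a<n. (cmod (g f a))\<^sup>2)" for f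
    unfolding \<alpha>_def by (rule orthonormal_sys_parseval[OF on(1)])
  have \<beta>i: "(\<Sum>i<n. (cmod (\<beta> i f))\<^sup>2) = (\<Sum>a<n. (cmod (g f a))\<^sup>2)" for f
    unfolding \<beta>_def by (rule orthonormal_sys_parseval[OF on(2)])
  have pF: "(\<Sum>f\<in>F. p i f) = 1" if "i < n" for i
    using \<alpha>F[OF that] \<beta>F[OF that] by (simp add: p_def sum.distrib flip: sum_divide_distrib)
  have pi: "(\<Sum>i<n. p i f) = (\<Sum>a<n. (cmod (g f a))\<^sup>2)" for f
    using \<alpha>i[of f] \<beta>i[of f] by (simp add: p_def sum.distrib flip: sum_divide_distrib)
  have p0: "p i f \<ge> 0" for i f by (simp add: p_def)
  define S1 where "S1 = (\<Sum>i<n. \<Sum>f\<in>F. (cmod (of_real (s i) * \<beta> i f - w f * \<alpha> i f))\<^sup>2)"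
  define S2 where "S2 = (\<Sum>i<n. \<Sum>f\<in>F. (cmod (of_real (s i) * \<alpha> i f - cnj (w f) * \<beta> i f))\<^sup>2)"
  have coef: "(\<Sum>a<n. (mat_app n A (g f) a - w f * g f a) * cnj (u i a)) = of_real (s i) * \<beta> i f - w f * \<alpha> i f"
    if i: "i < n" for i f
  proof -
    have "(\<Sum>a<n. (mat_app n A (g f) a - w f * g f a) * cnj (u i a))
        = (\<Sum>a<n. mat_app n A (g f) a * cnj (u i a)) - w f * \<alpha> i f"
      by (simp add: \<alpha>_def sum_distrib_left sum_subtractf[symmetric] algebra_simps)
    also have "(\<Sum>a<n. mat_app n A (g f) a * cnj (u i a)) = (\<Sum>b<n. g f b * cnj (mat_app_adj n A (u i) b))"
      by (rule mat_app_adjoint)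
    also have "\<dots> = of_real (s i) * \<beta> i f"
      unfolding \<beta>_def sum_distrib_left using Au[OF i] by (intro sum.cong refl) simp
    finally show ?thesis .
  qed
  have "S1 = (\<Sum>f\<in>F. \<Sum>i<n. (cmod (\<Sum>a<n. (mat_app n A (g f) a - w f * g f a) * cnj (u i a)))\<^sup>2)"
    unfolding S1_def by (subst sum.swap) (intro sum.cong refl, simp add: coef)
  then have S1: "S1 \<le> E" using E by (simp add: orthonormal_sys_parseval[OF on(1)])
  have "S1 - S2 = (\<Sum>i<n. \<Sum>f\<in>F. ((s i)\<^sup>2 - (cmod (w f))\<^sup>2) * ((cmod (\<beta> i f))\<^sup>2 - (cmod (\<alpha> i f))\<^sup>2))"
    unfolding S1_def S2_def sum_subtractf[symmetric]
    by (intro sum.cong refl svd_coupling_pointwise(2)) (use s in auto)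
  also have "\<dots> = (\<Sum>i<n. (s i)\<^sup>2 * ((\<Sum>f\<in>F. (cmod (\<beta> i f))\<^sup>2) - (\<Sum>f\<in>F. (cmod (\<alpha> i f))\<^sup>2)))
     - (\<Sum>f\<in>F. (cmod (w f))\<^sup>2 * ((\<Sum>i<n. (cmod (\<beta> i f))\<^sup>2) - (\<Sum>i<n. (cmod (\<alpha> i f))\<^sup>2)))"
    unfolding sum_subtractf[symmetric] sum_distrib_left left_diff_distrib
    by (subst (2) sum.swap) (simp add: sum_subtractf[symmetric])
  also have "\<dots> = 0" unfolding \<alpha>i \<beta>i using \<alpha>F \<beta>F by simp
  finally have S12: "S2 = S1" by simp
  have "2 * (\<Sum>i<n. \<Sum>f\<in>F. p i f * (s i - cmod (w f))\<^sup>2) = (\<Sum>i<n. \<Sum>f\<in>F. (s i - cmod (w f))\<^sup>2 * ((cmod (\<alpha> i f))\<^sup>2 + (cmod (\<beta> i f))\<^sup>2))"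
    unfolding sum_distrib_left p_def by (simp add: mult_ac)
  also have "\<dots> \<le> S1 + S2"
    unfolding S1_def S2_def sum.distrib[symmetric]
    by (intro sum_mono svd_coupling_pointwise(1)) (use s in auto)
  finally have key: "(\<Sum>i<n. \<Sum>f\<in>F. p i f * (s i - cmod (w f))\<^sup>2) \<le> E" using S1 S12 by simp
  \<comment> \<open>The Cauchy-Schwarz inequality turns the quadratic cost into a linear one; the
    total mass of the coupling is \<open>n\<close>.\<close>
  let ?I = "{..<n} \<times> F"
  have "(\<Sum>(i, f)\<in>?I. sqrt (p i f) * (sqrt (p i f) * \<bar>s i - cmod (w f)\<bar>))\<^sup>2
      \<le> (\<Sum>(i, f)\<in>?I. (sqrt (p i f))\<^sup>2) * (\<Sum>(i, f)\<in>?I. (sqrt (p i f) * \<bar>s i - cmod (w f)\<bar>)\<^sup>2)"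
    using Cauchy_Schwarz_ineq_sum[of "\<lambda>(i, f). sqrt (p i f)" "\<lambda>(i, f). sqrt (p i f) * \<bar>s i - cmod (w f)\<bar>" ?I]
    by (simp add: case_prod_unfold)
  moreover have "(\<Sum>(i, f)\<in>?I. sqrt (p i f) * (sqrt (p i f) * \<bar>s i - cmod (w f)\<bar>)) = (\<Sum>i<n. \<Sum>f\<in>F. p i f * \<bar>s i - cmod (w f)\<bar>)"
    using p0 by (simp add: sum.cartesian_product flip: mult.assoc)
  moreover have "(\<Sum>(i, f)\<in>?I. (sqrt (p i f))\<^sup>2) = real n"
    using p0 pF by (simp add: sum.cartesian_product[symmetric])
  moreover have "(\<Sum>(i, f)\<in>?I. (sqrt (p i f) * \<bar>s i - cmod (w f)\<bar>)\<^sup>2) = (\<Sum>i<n. \<Sum>f\<in>F. p i f * (s i - cmod (w f))\<^sup>2)"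
    using p0 by (simp add: sum.cartesian_product power_mult_distrib)
  ultimately have "(\<Sum>i<n. \<Sum>f\<in>F. p i f * \<bar>s i - cmod (w f)\<bar>)\<^sup>2 \<le> real n * (\<Sum>i<n. \<Sum>f\<in>F. p i f * (s i - cmod (w f))\<^sup>2)"
    by metis
  also have "\<dots> \<le> real n * E" using key by (intro mult_left_mono) auto
  finally have cs: "(\<Sum>i<n. \<Sum>f\<in>F. p i f * \<bar>s i - cmod (w f)\<bar>) \<le> sqrt (real n * E)" by (rule real_le_rsqrt)
  have "(\<Sum>i<n. phi (s i)) = (\<Sum>i<n. \<Sum>f\<in>F. p i f * phi (s i))"
    using pF by (simp flip: sum_distrib_right)
  moreover have "(\<Sum>f\<in>F. (\<Sum>a<n. (cmod (g f a))\<^sup>2) * phi (cmod (w f))) = (\<Sum>i<n. \<Sum>f\<in>F. p i f * phi (cmod (w f)))"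
    by (subst sum.swap) (simp add: pi flip: sum_distrib_right)
  ultimately have "\<bar>(\<Sum>i<n. phi (s i)) - (\<Sum>f\<in>F. (\<Sum>a<n. (cmod (g f a))\<^sup>2) * phi (cmod (w f)))\<bar>
      = \<bar>\<Sum>i<n. \<Sum>f\<in>F. p i f * (phi (s i) - phi (cmod (w f)))\<bar>"
    by (simp add: right_diff_distrib sum_subtractf)
  also have "\<dots> \<le> (\<Sum>i<n. \<Sum>f\<in>F. \<bar>p i f * (phi (s i) - phi (cmod (w f)))\<bar>)"
    by (intro order_trans[OF sum_abs] sum_mono sum_abs)
  also have "\<dots> \<le> (\<Sum>i<n. \<Sum>f\<in>F. L * (p i f * \<bar>s i - cmod (w f)\<bar>))"
  proof (intro sum_mono)
    fix i f assume "i \<in> {..<n}"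
    then have "\<bar>phi (s i) - phi (cmod (w f))\<bar> \<le> L * \<bar>s i - cmod (w f)\<bar>" using s by (intro lip) auto
    then have "p i f * \<bar>phi (s i) - phi (cmod (w f))\<bar> \<le> p i f * (L * \<bar>s i - cmod (w f)\<bar>)" using p0 by (rule mult_left_mono)
    then show "\<bar>p i f * (phi (s i) - phi (cmod (w f)))\<bar> \<le> L * (p i f * \<bar>s i - cmod (w f)\<bar>)"
      using p0[of i f] by (simp add: abs_mult mult_ac)
  qed
  also have "\<dots> = L * (\<Sum>i<n. \<Sum>f\<in>F. p i f * \<bar>s i - cmod (w f)\<bar>)" by (simp only: sum_distrib_left)
  also have "\<dots> \<le> L * sqrt (real n * E)" using cs L by (rule mult_left_mono)
  finally show ?thesis .
qed

text \<open>
  Rational vectors make the variational formula for \<open>smallest_sv\<close> countable, which gives its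
  measurability as a function of the entries.
\<close>

definition rat_vector :: "(rat \<times> rat) list \<Rightarrow> nat \<Rightarrow> complex" where
  "rat_vector l a = (if a < length l then Complex (of_rat (fst (l ! a))) (of_rat (snd (l ! a))) else 0)"

lemma rat_vector_approx:
  assumes "e > 0"
  shows "\<exists>l. \<forall>a<n. cmod (rat_vector l a - x a) < e"
proof -
  have "\<exists>q. cmod (Complex (of_rat (fst q)) (of_rat (snd q)) - z) < e" for z
  proof -
    obtain q where q: "Re z < of_rat q" "of_rat q < Re z + e / 2" using of_rat_dense[of "Re z" "Re z + e / 2"] assms by auto
    obtain r where r: "Im z < of_rat r" "of_rat r < Im z + e / 2" using of_rat_dense[of "Im z" "Im z + e / 2"] assms by auto
    have "cmod (Complex (of_rat q) (of_rat r) - z) \<le> \<bar>of_rat q - Re z\<bar> + \<bar>of_rat r - Im z\<bar>"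
      using cmod_le[of "Complex (of_rat q) (of_rat r) - z"] by simp
    then show ?thesis using q r by (intro exI[of _ "(q, r)"]) auto
  qed
  then obtain q where q: "\<And>z. cmod (Complex (of_rat (fst (q z))) (of_rat (snd (q z))) - z) < e" by metis
  have "\<forall>a<n. cmod (rat_vector (map (\<lambda>a. q (x a)) [0..<n]) a - x a) < e" using q by (simp add: rat_vector_def)
  then show ?thesis by blast
qed

text \<open>The slack \<open>1 / real (Suc k)\<close> lets a nearby rational vector replace a
  minimizing one. Strictness excludes the zero vector, for which both sides vanish, so no
  normalization appears.\<close>

lemma smallest_sv_le_iff:
  assumes B: "B \<in> carrier_mat n n" and n: "n > 0" and t: "t \<ge> 0"
  shows "smallest_sv B \<le> t \<longleftrightarrow> (\<forall>k::nat. \<exists>l.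
     (\<Sum>a<n. (cmod (mat_app n B (rat_vector l) a))\<^sup>2) < (t\<^sup>2 + 1 / real (Suc k)) * (\<Sum>a<n. (cmod (rat_vector l a))\<^sup>2))"
proof
  note fin = singular_values_finite_nonempty[OF B n]
  have mem: "smallest_sv B \<in> singular_values B" unfolding smallest_sv_def using fin by (rule Min_in)
  then have ge: "smallest_sv B \<ge> 0" by (simp add: singular_values_def)
  {
    assume le: "smallest_sv B \<le> t"
    obtain x where x: "\<exists>a<n. x a \<noteq> 0"
      "(\<Sum>a<n. (cmod (mat_app n B x a))\<^sup>2) = (smallest_sv B)\<^sup>2 * (\<Sum>a<n. (cmod (x a))\<^sup>2)"
      by (rule singular_value_attained[OF B mem])
    have pos: "(\<Sum>a<n. (cmod (x a))\<^sup>2) > 0" using x(1) by (auto intro!: sum_pos2)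
    have sq: "(smallest_sv B)\<^sup>2 \<le> t\<^sup>2" using le ge by (rule power_mono)
    obtain l where l: "\<And>j a. a < n \<Longrightarrow> cmod (rat_vector (l j) a - x a) < 1 / real (Suc j)"
      using rat_vector_approx[of "1 / real (Suc j)" n x for j] by (metis of_nat_0_less_iff zero_less_Suc zero_less_divide_1_iff)
    have lim: "(\<lambda>j. rat_vector (l j) a) \<longlonglongrightarrow> x a" if "a < n" for a
    proof -
      have "(\<lambda>j. cmod (rat_vector (l j) a - x a)) \<longlonglongrightarrow> 0"
        by (rule tendsto_sandwich[OF _ _ tendsto_const LIMSEQ_inverse_real_of_nat])
          (use l[OF that] in \<open>auto intro!: eventuallyI less_imp_le simp: inverse_eq_divide\<close>)
      then show ?thesis by (simp add: tendsto_norm_zero_iff LIM_zero_iff)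
    qed
    show "\<forall>k::nat. \<exists>l. (\<Sum>a<n. (cmod (mat_app n B (rat_vector l) a))\<^sup>2) < (t\<^sup>2 + 1 / real (Suc k)) * (\<Sum>a<n. (cmod (rat_vector l a))\<^sup>2)"
    proof
      fix k :: nat
      have "(\<lambda>j. (t\<^sup>2 + 1 / real (Suc k)) * (\<Sum>a<n. (cmod (rat_vector (l j) a))\<^sup>2) - (\<Sum>a<n. (cmod (mat_app n B (rat_vector (l j)) a))\<^sup>2))
        \<longlonglongrightarrow> (t\<^sup>2 + 1 / real (Suc k)) * (\<Sum>a<n. (cmod (x a))\<^sup>2) - (\<Sum>a<n. (cmod (mat_app n B x a))\<^sup>2)"
        unfolding mat_app_def by (intro tendsto_intros lim) auto
      moreover have "(t\<^sup>2 + 1 / real (Suc k)) * (\<Sum>a<n. (cmod (x a))\<^sup>2) - (\<Sum>a<n. (cmod (mat_app n B x a))\<^sup>2) > 0"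
      proof -
        have "(smallest_sv B)\<^sup>2 < t\<^sup>2 + 1 / real (Suc k)" using sq by (smt (verit) of_nat_0_less_iff zero_less_Suc zero_less_divide_1_iff)
        then show ?thesis unfolding x(2) using pos by (simp add: mult_strict_right_mono)
      qed
      ultimately have "\<forall>\<^sub>F j in sequentially. (t\<^sup>2 + 1 / real (Suc k)) * (\<Sum>a<n. (cmod (rat_vector (l j) a))\<^sup>2)
          - (\<Sum>a<n. (cmod (mat_app n B (rat_vector (l j)) a))\<^sup>2) > 0"
        by (rule order_tendstoD(1))
      then obtain j where "(t\<^sup>2 + 1 / real (Suc k)) * (\<Sum>a<n. (cmod (rat_vector (l j) a))\<^sup>2)
          - (\<Sum>a<n. (cmod (mat_app n B (rat_vector (l j)) a))\<^sup>2) > 0"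
        using eventually_happens'[OF sequentially_bot] by blast
      then show "\<exists>l. (\<Sum>a<n. (cmod (mat_app n B (rat_vector l) a))\<^sup>2) < (t\<^sup>2 + 1 / real (Suc k)) * (\<Sum>a<n. (cmod (rat_vector l a))\<^sup>2)"
        by (intro exI[of _ "l j"]) simp
    qed
  }
  {
    assume r: "\<forall>k::nat. \<exists>l. (\<Sum>a<n. (cmod (mat_app n B (rat_vector l) a))\<^sup>2) < (t\<^sup>2 + 1 / real (Suc k)) * (\<Sum>a<n. (cmod (rat_vector l a))\<^sup>2)"
    have "(smallest_sv B)\<^sup>2 \<le> t\<^sup>2 + 1 / real (Suc k)" for k
    proof -
      obtain l where "(\<Sum>a<n. (cmod (mat_app n B (rat_vector l) a))\<^sup>2) < (t\<^sup>2 + 1 / real (Suc k)) * (\<Sum>a<n. (cmod (rat_vector l a))\<^sup>2)"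
        using r by blast
      then have "(smallest_sv B)\<^sup>2 * (\<Sum>a<n. (cmod (rat_vector l a))\<^sup>2) < (t\<^sup>2 + 1 / real (Suc k)) * (\<Sum>a<n. (cmod (rat_vector l a))\<^sup>2)"
        using smallest_sv_le_mat_app[OF B n, of "rat_vector l"] by linarith
      then show ?thesis by (rule mult_right_less_imp_less[THEN less_imp_le]) (auto intro: sum_nonneg)
    qed
    moreover have "(\<lambda>k. t\<^sup>2 + 1 / real (Suc k)) \<longlonglongrightarrow> t\<^sup>2 + 0"
      using LIMSEQ_inverse_real_of_nat by (intro tendsto_intros) (simp add: inverse_eq_divide)
    ultimately have "(smallest_sv B)\<^sup>2 \<le> t\<^sup>2 + 0" by (intro LIMSEQ_le_const) auto
    then show "smallest_sv B \<le> t" using t by (simp add: power2_le_iff_abs_le)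
  }
qed

text \<open>(A3-ii) speaks of the measure of this event. Since \<open>measure\<close> is 0 on
  non-measurable sets, such a bound has content only because the event is measurable, and only then
  can it serve as an exceptional event.\<close>

lemma smallest_sv_sets:
  fixes Q :: "'w \<Rightarrow> complex mat"
  assumes Q: "random_matrix P n Q" and A: "A \<in> carrier_mat n n" and n: "n > 0" and t: "t \<ge> 0"
  shows "{\<omega> \<in> space P. smallest_sv (A + Q \<omega>) \<le> t} \<in> sets P"
proof -
  have Qc: "Q \<omega> \<in> carrier_mat n n" if "\<omega> \<in> space P" for \<omega> using Q that by (simp add: random_matrix_def)
  have [measurable]: "(\<lambda>\<omega>. Q \<omega> $$ (a, b)) \<in> borel_measurable P" if "a < n" "b < n" for a b
    using Q that by (simp add: random_matrix_def)
  have "{\<omega> \<in> space P. smallest_sv (A + Q \<omega>) \<le> t} = {\<omega> \<in> space P. \<forall>k::nat. \<exists>l.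
     (\<Sum>a<n. (cmod (\<Sum>b<n. (A $$ (a, b) + Q \<omega> $$ (a, b)) * rat_vector l b))\<^sup>2)
       < (t\<^sup>2 + 1 / real (Suc k)) * (\<Sum>a<n. (cmod (rat_vector l a))\<^sup>2)}"
    (is "_ = {\<omega> \<in> space P. ?R \<omega>}")
  proof (intro Collect_cong conj_cong refl)
    fix \<omega> assume w: "\<omega> \<in> space P"
    have "A + Q \<omega> \<in> carrier_mat n n" using A Qc[OF w] by simp
    from smallest_sv_le_iff[OF this n t] show "smallest_sv (A + Q \<omega>) \<le> t \<longleftrightarrow> ?R \<omega>"
      unfolding mat_app_def using A Qc[OF w] by (simp add: carrier_matD)
  qed
  moreover have "Measurable.pred P ?R"
  proof (intro pred_intros_countable)
    fix k :: nat and l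
    have "(\<lambda>\<omega>. \<Sum>a<n. (cmod (\<Sum>b<n. (A $$ (a, b) + Q \<omega> $$ (a, b)) * rat_vector l b))\<^sup>2) \<in> borel_measurable P"
      by (intro borel_measurable_sum borel_measurable_power borel_measurable_norm borel_measurable_times
          borel_measurable_add borel_measurable_const) (auto intro: \<open>\<And>b a. a < n \<Longrightarrow> b < n \<Longrightarrow> (\<lambda>\<omega>. Q \<omega> $$ (a, b)) \<in> borel_measurable P\<close>)
    then show "Measurable.pred P (\<lambda>\<omega>. (\<Sum>a<n. (cmod (\<Sum>b<n. (A $$ (a, b) + Q \<omega> $$ (a, b)) * rat_vector l b))\<^sup>2)
       < (t\<^sup>2 + 1 / real (Suc k)) * (\<Sum>a<n. (cmod (rat_vector l a))\<^sup>2))"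
      by (rule borel_measurable_pred_less) simp
  qed
  ultimately show ?thesis by (simp add: pred_def)
qed

section \<open>Discrete Fourier analysis on boxes\<close>

definition vec_box :: "('d \<Rightarrow> int set) \<Rightarrow> (int ^ 'd) set" where
  "vec_box S = {v. \<forall>i. vec_nth v i \<in> S i}"

lemma vec_box_eq_image: "vec_box S = vec_lambda ` (PiE UNIV S)"
proof (intro equalityI subsetI)
  fix v assume "v \<in> vec_box S"
  then have "vec_nth v \<in> PiE UNIV S" by (auto simp: vec_box_def)
  then show "v \<in> vec_lambda ` (PiE UNIV S)" by (metis image_eqI vec_nth_inverse)
qed (auto simp: vec_box_def)

lemma inj_on_vec_lambda: "inj_on vec_lambda A"
  by (rule inj_onI) (simp add: vec_lambda_inject)

lemma finite_vec_box: "(\<And>i. finite (S i)) \<Longrightarrow> finite (vec_box S)"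
  unfolding vec_box_eq_image by (intro finite_imageI finite_PiE) auto

lemma card_vec_box: "card (vec_box S) = (\<Prod>i\<in>UNIV. card (S i))"
  unfolding vec_box_eq_image by (subst card_image[OF inj_on_vec_lambda]) (simp add: card_PiE)

lemma sum_prod_vec_box:
  fixes f :: "'d::finite \<Rightarrow> int \<Rightarrow> 'b::comm_semiring_1"
  assumes "\<And>i. finite (S i)"
  shows "(\<Sum>v\<in>vec_box S. \<Prod>i\<in>UNIV. f i (vec_nth v i)) = (\<Prod>i\<in>UNIV. \<Sum>t\<in>S i. f i t)"
  unfolding vec_box_eq_image
  by (subst sum.reindex[OF inj_on_vec_lambda]) (simp add: prod_sum_PiE assms)

lemma grid_eq_vec_box: "grid N = vec_box (\<lambda>_. {1..int N})"
  by (auto simp: grid_def vec_box_def)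

lemma finite_grid: "finite (grid N)"
  unfolding grid_eq_vec_box by (rule finite_vec_box) simp

lemma card_grid: "card (grid N :: (int ^ 'd) set) = N ^ CARD('d)"
  unfolding grid_eq_vec_box card_vec_box by simp


text \<open>The character exp(2 pi i <k, \<nu>> / n). The product form makes sums over boxes factor
  into geometric sums.\<close>

definition wave :: "nat \<Rightarrow> int ^ 'd \<Rightarrow> int ^ 'd \<Rightarrow> complex" where
  "wave n k \<nu> = (\<Prod>i\<in>UNIV. cis (2 * pi * (of_int (vec_nth k i) * of_int (vec_nth \<nu> i)) / real n))"

lemma wave_add: "wave n k (\<mu> + \<nu>) = wave n k \<mu> * wave n k \<nu>"
  unfolding wave_def prod.distrib[symmetric]
  by (intro prod.cong refl) (simp add: cis_mult ring_distribs add_divide_distrib)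

lemma wave_add_left: "wave n (k + l) \<nu> = wave n k \<nu> * wave n l \<nu>"
  unfolding wave_def prod.distrib[symmetric]
  by (intro prod.cong refl) (simp add: cis_mult ring_distribs add_divide_distrib)

lemma wave_minus: "wave n k (- \<nu>) = cnj (wave n k \<nu>)"
  unfolding wave_def cnj_prod by (intro prod.cong refl) (simp add: cis_cnj)

lemma norm_wave: "cmod (wave n k \<nu>) = 1"
  unfolding wave_def by (simp add: prod_norm[symmetric])

lemma wave_cnj_self: "wave n k \<nu> * cnj (wave n k \<nu>) = 1"
  using complex_norm_square[of "wave n k \<nu>"] by (simp add: norm_wave)

lemma wave_axis: "wave n (axis i 1) \<nu> = cis (2 * pi * of_int (vec_nth \<nu> i) / real n)"
proof -
  have "wave n (axis i 1) \<nu> = (\<Prod>j\<in>UNIV. if j = i then cis (2 * pi * of_int (vec_nth \<nu> i) / real n) else 1)"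
    unfolding wave_def by (intro prod.cong refl) (auto simp: axis_def)
  then show ?thesis by simp
qed

lemma cis_int_period:
  assumes "n > 0" "int n dvd v"
  shows "cis (2 * pi * of_int v / real n) = 1"
proof -
  obtain q where q: "v = int n * q" using assms by auto
  have e: "2 * pi * of_int v / real n = 2 * pi * of_int q" using assms by (simp add: q)
  have "cis (2 * pi * of_int v / real n) = cis (2 * pi * of_int q)" by (simp only: e)
  also have "\<dots> = 1" by (rule cis_multiple_2pi) simp
  finally show ?thesis .
qed

lemma wave_mod:
  assumes n: "n > 0"
  shows "wave n (\<chi> i. vec_nth k i mod int n) \<nu> = wave n k \<nu>"
  unfolding wave_def
proof (intro prod.cong refl)
  fix i
  have "2 * pi * (of_int (vec_nth k i) * of_int (vec_nth \<nu> i)) / real n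
    = 2 * pi * (of_int (vec_nth k i mod int n) * of_int (vec_nth \<nu> i)) / real n
     + 2 * pi * of_int (int n * ((vec_nth k i div int n) * vec_nth \<nu> i)) / real n"
  proof -
    have "of_int (vec_nth k i) = real_of_int (vec_nth k i mod int n) + real n * of_int (vec_nth k i div int n)"
      by (metis mod_mult_div_eq of_int_add of_int_mult of_int_of_nat_eq)
    then show ?thesis by (simp add: algebra_simps add_divide_distrib)
  qed
  then have "cis (2 * pi * (of_int (vec_nth k i) * of_int (vec_nth \<nu> i)) / real n)
    = cis (2 * pi * (of_int (vec_nth k i mod int n) * of_int (vec_nth \<nu> i)) / real n)
     * cis (2 * pi * of_int (int n * ((vec_nth k i div int n) * vec_nth \<nu> i)) / real n)"
    by (simp only: cis_mult)
  then show "cis (2 * pi * (of_int (vec_nth (\<chi> i. vec_nth k i mod int n) i) * of_int (vec_nth \<nu> i)) / real n)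
    = cis (2 * pi * (of_int (vec_nth k i) * of_int (vec_nth \<nu> i)) / real n)"
    using cis_int_period[OF n, of "int n * ((vec_nth k i div int n) * vec_nth \<nu> i)"] by simp
qed

text \<open>The interval may start anywhere because frequencies are taken in
  \<open>{0..<int n}\<close> and positions in \<open>{1..<1 + int n}\<close>.\<close>

lemma sum_cis_roots:
  assumes n: "n > 0"
  shows "(\<Sum>t\<in>{a..<a + int n}. cis (2 * pi * (of_int t * of_int v) / real n)) = (if int n dvd v then of_nat n else 0)"
proof -
  define z where "z = cis (2 * pi * of_int v / real n)"
  have "{a..<a + int n} = (\<lambda>j. a + int j) ` {..<n}"
  proof (intro equalityI subsetI)
    fix x assume "x \<in> {a..<a + int n}"
    then have "x = a + int (nat (x - a))" "nat (x - a) \<in> {..<n}" by auto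
    then show "x \<in> (\<lambda>j. a + int j) ` {..<n}" by blast
  qed auto
  then have "(\<Sum>t\<in>{a..<a + int n}. cis (2 * pi * (of_int t * of_int v) / real n))
      = (\<Sum>j<n. cis (2 * pi * (of_int (a + int j) * of_int v) / real n))"
    by (simp add: sum.reindex inj_on_def)
  also have "\<dots> = (\<Sum>j<n. cis (2 * pi * (of_int a * of_int v) / real n) * z ^ j)"
  proof (intro sum.cong refl)
    fix j
    have "2 * pi * (of_int (a + int j) * of_int v) / real n = 2 * pi * (of_int a * of_int v) / real n + real j * (2 * pi * of_int v / real n)"
      by (simp add: ring_distribs add_divide_distrib)
    then show "cis (2 * pi * (of_int (a + int j) * of_int v) / real n) = cis (2 * pi * (of_int a * of_int v) / real n) * z ^ j"
      by (simp only: z_def Complex.DeMoivre cis_mult)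
  qed
  also have "\<dots> = cis (2 * pi * (of_int a * of_int v) / real n) * (\<Sum>j<n. z ^ j)" by (simp only: sum_distrib_left)
  also have "\<dots> = (if int n dvd v then of_nat n else 0)"
  proof (cases "int n dvd v")
    case True
    then have "z = 1" unfolding z_def by (rule cis_int_period[OF n])
    moreover have "cis (2 * pi * (of_int a * of_int v) / real n) = 1"
      using cis_int_period[OF n, of "a * v"] True by simp
    ultimately show ?thesis using True by simp
  next
    case False
    have "z \<noteq> 1"
    proof
      assume "z = 1"
      then have "cos (2 * pi * of_int v / real n) = 1" by (simp add: z_def complex_eq_iff)
      then obtain q :: int where "2 * pi * of_int v / real n = of_int q * 2 * pi"
        unfolding cos_one_2pi_int by blast
      then have "real_of_int v = real_of_int (q * int n)" using n by (simp add: field_simps)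
      then have "v = q * int n" by (simp only: of_int_eq_iff)
      then show False using False by simp
    qed
    moreover have "z ^ n = 1"
      unfolding z_def Complex.DeMoivre using n cis_multiple_2pi[of "of_int v"] by simp
    ultimately show ?thesis using False by (simp add: geometric_sum)
  qed
  finally show ?thesis .
qed

lemma sum_wave_left:
  fixes \<nu> :: "int ^ 'd"
  assumes n: "n > 0"
  shows "(\<Sum>k\<in>vec_box (\<lambda>_. {a..<a + int n}). wave n k \<nu>)
    = (if \<forall>i. int n dvd vec_nth \<nu> i then of_nat (n ^ CARD('d)) else 0)"
proof -
  have "(\<Sum>k\<in>vec_box (\<lambda>_. {a..<a + int n}). wave n k \<nu>)
    = (\<Prod>i\<in>UNIV. if int n dvd vec_nth \<nu> i then of_nat n else (0::complex))"
    unfolding wave_def by (subst sum_prod_vec_box) (auto simp: sum_cis_roots[OF n])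
  then show ?thesis by (auto simp: prod_constant)
qed

lemma wave_commute: "wave n k \<nu> = wave n \<nu> k"
  unfolding wave_def by (simp add: mult.commute)

lemma vec_box_cong_eq:
  assumes "k \<in> vec_box (\<lambda>_. {a..<a + int n})" "l \<in> vec_box (\<lambda>_. {a..<a + int n})"
  shows "(\<forall>i. int n dvd vec_nth (k - l) i) \<longleftrightarrow> k = l"
proof
  assume d: "\<forall>i. int n dvd vec_nth (k - l) i"
  show "k = l"
  proof (rule Finite_Cartesian_Product.vec_eq_iff[THEN iffD2], rule allI)
    fix i
    have "\<bar>vec_nth k i - vec_nth l i\<bar> < int n" using assms by (simp add: vec_box_def) (smt (verit))
    moreover have "int n dvd vec_nth k i - vec_nth l i" using d by simp
    ultimately show "vec_nth k i = vec_nth l i" using zdvd_not_zless[of "\<bar>vec_nth k i - vec_nth l i\<bar>" "int n"] by auto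
  qed
qed simp

text \<open>The normalization is that of a Riemann sum, so that for a sampled symbol the values
  converge to its Fourier coefficients as \<open>n\<close> grows.\<close>

definition dft :: "nat \<Rightarrow> (int ^ 'd \<Rightarrow> complex) \<Rightarrow> int ^ 'd \<Rightarrow> complex" where
  "dft n P \<nu> = (\<Sum>k\<in>vec_box (\<lambda>_. {0..<int n}). P k * cnj (wave n k \<nu>)) / of_nat (n ^ CARD('d))"

text \<open>The coefficient is indexed by the difference \<open>\<mu> - j\<close> to match row \<mu>
  of a matrix whose entries depend on that difference. As \<open>j\<close> runs over the box, the
  difference runs over all residues modulo \<open>n\<close>.\<close>

lemma dft_inversion:
  fixes P :: "int ^ 'd \<Rightarrow> complex"
  assumes n: "n > 0" and per: "\<And>k. P (\<chi> i. vec_nth k i mod int n) = P k"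
  shows "(\<Sum>j\<in>vec_box (\<lambda>_. {1..<1 + int n}). dft n P (\<mu> - j) * wave n k (\<mu> - j)) = P k"
proof -
  let ?T = "vec_box (\<lambda>_::'d. {0..<int n})" and ?J = "vec_box (\<lambda>_::'d. {1..<1 + int n})"
  define k' where "k' = (\<chi> i. vec_nth k i mod int n)"
  have k'T: "k' \<in> ?T" using n by (simp add: k'_def vec_box_def)
  have fin: "finite ?T" "finite ?J" by (auto intro: finite_vec_box)
  have orth: "(\<Sum>j\<in>?J. wave n (k' - l) (\<mu> - j)) = (if l = k' then of_nat (n ^ CARD('d)) else 0)" if l: "l \<in> ?T" for l
  proof -
    have "(\<Sum>j\<in>?J. wave n (k' - l) (\<mu> - j)) = wave n (k' - l) \<mu> * (\<Sum>j\<in>?J. wave n j (l - k'))"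
    proof -
      have "wave n (k' - l) (\<mu> - j) = wave n (k' - l) \<mu> * wave n j (l - k')" for j
      proof -
        have "wave n (k' - l) (- j) = wave n (- j) (k' - l)" by (rule wave_commute)
        also have "\<dots> = wave n j (- (k' - l))"
        proof -
          have "real_of_int (vec_nth (- j) i) * of_int (vec_nth (k' - l) i) = of_int (vec_nth j i) * of_int (vec_nth (- (k' - l)) i)" for i
            by (simp add: algebra_simps)
          then show ?thesis unfolding wave_def by (simp only:)
        qed
        finally show ?thesis using wave_add[of n "k' - l" \<mu> "- j"] by simp
      qed
      then show ?thesis by (simp add: sum_distrib_left)
    qed
    also have "\<dots> = wave n (k' - l) \<mu> * (if l = k' then of_nat (n ^ CARD('d)) else 0)"
    proof -
      have "(\<forall>i. int n dvd vec_nth (l - k') i) \<longleftrightarrow> l = k'"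
        using vec_box_cong_eq[of l 0 n k'] l k'T by simp
      then show ?thesis by (simp only: sum_wave_left[OF n, where a = 1])
    qed
    also have "\<dots> = (if l = k' then of_nat (n ^ CARD('d)) else 0)"
      by (auto simp: wave_def)
    finally show ?thesis .
  qed
  have "(\<Sum>j\<in>?J. dft n P (\<mu> - j) * wave n k (\<mu> - j)) = (\<Sum>j\<in>?J. \<Sum>l\<in>?T. P l * wave n (k' - l) (\<mu> - j) / of_nat (n ^ CARD('d)))"
  proof (intro sum.cong refl)
    fix j
    have "cnj (wave n l (\<mu> - j)) * wave n k (\<mu> - j) = wave n (k' - l) (\<mu> - j)" for l
    proof -
      have "wave n (- l) (\<mu> - j) = cnj (wave n l (\<mu> - j))"
        by (metis wave_commute wave_minus)
      moreover have "wave n k (\<mu> - j) = wave n k' (\<mu> - j)" unfolding k'_def by (rule wave_mod[OF n, symmetric])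
      ultimately show ?thesis using wave_add_left[of n k' "- l" "\<mu> - j"] by (simp add: mult.commute)
    qed
    then show "dft n P (\<mu> - j) * wave n k (\<mu> - j) = (\<Sum>l\<in>?T. P l * wave n (k' - l) (\<mu> - j) / of_nat (n ^ CARD('d)))"
      unfolding dft_def by (simp add: sum_distrib_right sum_divide_distrib mult.assoc)
  qed
  also have "\<dots> = (\<Sum>l\<in>?T. P l * (\<Sum>j\<in>?J. wave n (k' - l) (\<mu> - j)) / of_nat (n ^ CARD('d)))"
    by (subst sum.swap) (simp add: sum_distrib_left sum_divide_distrib)
  also have "\<dots> = (\<Sum>l\<in>?T. if l = k' then P l else 0)"
    using n by (intro sum.cong refl) (simp add: orth)
  also have "\<dots> = P k'" using k'T fin by simp
  also have "\<dots> = P k" unfolding k'_def by (rule per)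
  finally show ?thesis .
qed

lemma wave_parseval:
  fixes a :: "int ^ 'd \<Rightarrow> complex"
  assumes n: "n > 0"
  shows "(\<Sum>k\<in>vec_box (\<lambda>_. {0..<int n}). (cmod (\<Sum>j\<in>vec_box (\<lambda>_. {1..<1 + int n}). a j * wave n k (\<mu> - j)))\<^sup>2)
    = real (n ^ CARD('d)) * (\<Sum>j\<in>vec_box (\<lambda>_. {1..<1 + int n}). (cmod (a j))\<^sup>2)"
proof -
  let ?T = "vec_box (\<lambda>_::'d. {0..<int n})" and ?J = "vec_box (\<lambda>_::'d. {1..<1 + int n})"
  have fin: "finite ?T" "finite ?J" by (auto intro: finite_vec_box)
  have w: "wave n k (\<mu> - j) * cnj (wave n k (\<mu> - l)) = wave n k (l - j)" for k j l
    using wave_add[of n k "\<mu> - j" "- (\<mu> - l)"] wave_minus[of n k "\<mu> - l"] by simp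
  have "complex_of_real (\<Sum>k\<in>?T. (cmod (\<Sum>j\<in>?J. a j * wave n k (\<mu> - j)))\<^sup>2)
      = (\<Sum>k\<in>?T. \<Sum>j\<in>?J. \<Sum>l\<in>?J. a j * cnj (a l) * (wave n k (\<mu> - j) * cnj (wave n k (\<mu> - l))))"
    by (simp only: of_real_sum complex_norm_square cnj_sum sum_product) (simp add: mult_ac)
  also have "\<dots> = (\<Sum>j\<in>?J. \<Sum>l\<in>?J. \<Sum>k\<in>?T. a j * cnj (a l) * wave n k (l - j))"
    unfolding w by (subst sum.swap, subst (2) sum.swap) rule
  also have "\<dots> = (\<Sum>j\<in>?J. \<Sum>l\<in>?J. if l = j then of_nat (n ^ CARD('d)) * (a j * cnj (a l)) else 0)"
  proof (intro sum.cong refl)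
    fix j l assume jl: "j \<in> ?J" "l \<in> ?J"
    have "(\<Sum>k\<in>?T. wave n k (l - j)) = (if l = j then of_nat (n ^ CARD('d)) else 0)"
      using sum_wave_left[OF n, where a = 0 and \<nu> = "l - j"] vec_box_cong_eq[OF jl(2,1)] by simp
    then show "(\<Sum>k\<in>?T. a j * cnj (a l) * wave n k (l - j)) = (if l = j then of_nat (n ^ CARD('d)) * (a j * cnj (a l)) else 0)"
      by (simp add: mult_ac flip: sum_distrib_left)
  qed
  also have "\<dots> = (\<Sum>j\<in>?J. of_nat (n ^ CARD('d)) * (a j * cnj (a j)))"
    using fin by (intro sum.cong refl) simp
  also have "\<dots> = of_real (real (n ^ CARD('d)) * (\<Sum>j\<in>?J. (cmod (a j))\<^sup>2))"
    by (simp only: of_real_mult of_real_sum complex_norm_square sum_distrib_left of_real_of_nat_eq)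
  finally show ?thesis by (simp only: of_real_eq_iff)
qed

text \<open>With x = y / 2, the bound x cos x \<le> sin x gives sin y = 2 sin x cos x \<ge> 2 x (cos
  x)^2, and (cos x)^2 \<ge> 1/2 on [0, pi/4].\<close>

lemma sin_ge_half:
  assumes y: "0 \<le> y" "y \<le> pi / 2"
  shows "y / 2 \<le> sin y"
proof -
  define x where "x = y / 2"
  have x: "0 \<le> x" "x \<le> pi / 4" using y by (auto simp: x_def)
  have "sin 0 - 0 * cos 0 \<le> sin x - x * cos x"
  proof (rule DERIV_nonneg_imp_nondecreasing[OF x(1)])
    fix t assume t: "0 \<le> t" "t \<le> x"
    have "((\<lambda>t. sin t - t * cos t) has_real_derivative t * sin t) (at t)"
      by (auto intro!: derivative_eq_intros)
    moreover have "0 \<le> t * sin t" using t x by (intro mult_nonneg_nonneg sin_ge_zero) auto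
    ultimately show "\<exists>d. ((\<lambda>t. sin t - t * cos t) has_real_derivative d) (at t) \<and> 0 \<le> d" by blast
  qed
  then have s: "x * cos x \<le> sin x" by simp
  have c: "sqrt 2 / 2 \<le> cos x"
    using cos_monotone_0_pi_le[of x "pi / 4"] x by (simp add: cos_45)
  have c0: "0 \<le> cos x" by (rule order_trans[OF _ c]) simp
  have "1 / 2 \<le> (cos x)\<^sup>2"
    using power_mono[OF c, of 2] by (simp add: power_divide)
  then have "x * (1 / 2) \<le> x * (cos x)\<^sup>2" using x by (intro mult_left_mono) auto
  also have "\<dots> = (x * cos x) * cos x" by (simp add: power2_eq_square)
  also have "\<dots> \<le> sin x * cos x" using s c0 by (intro mult_right_mono)
  finally have "x \<le> 2 * sin x * cos x" by simp
  also have "\<dots> = sin y" using sin_double[of x] by (simp add: x_def)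
  finally show ?thesis by (simp add: x_def)
qed

text \<open>\<open>b\<close> is a lower bound for the distance of \<open>v\<close> to the multiples
  of \<open>n\<close>. The chord has length 2 |sin (pi v / n)|, and up to pi/2 the sine is at least
  half its argument; beyond, its symmetry about pi/2 applies.\<close>

lemma cis_minus_one_ge:
  assumes n: "n > 0" and b: "b \<le> real_of_int (v mod int n)" "real_of_int (v mod int n) \<le> real n - b"
  shows "b / real n \<le> cmod (cis (2 * pi * of_int v / real n) - 1)"
proof -
  define r where "r = real_of_int (v mod int n)"
  define y where "y = pi * r / real n"
  have r: "0 \<le> r" "r \<le> real n" 
  proof -
    have "0 \<le> v mod int n" "v mod int n \<le> int n" using n by (auto intro: less_imp_le)
    then have "real_of_int (v mod int n) \<le> real_of_int (int n)" by (simp only: of_int_le_iff)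
    then show "0 \<le> r" "r \<le> real n" using \<open>0 \<le> v mod int n\<close> by (auto simp: r_def)
  qed
  have v: "real_of_int v = r + real n * of_int (v div int n)"
    unfolding r_def by (metis mod_mult_div_eq of_int_add of_int_mult of_int_of_nat_eq)
  have "2 * pi * of_int v / real n = 2 * y + 2 * pi * of_int (int n * (v div int n)) / real n"
    unfolding v y_def by (simp add: algebra_simps add_divide_distrib)
  then have "cis (2 * pi * of_int v / real n) = cis (2 * y) * cis (2 * pi * of_int (int n * (v div int n)) / real n)"
    by (simp only: cis_mult)
  then have "cis (2 * pi * of_int v / real n) = cis (2 * y)"
    using cis_int_period[OF n, of "int n * (v div int n)"] by simp
  moreover have "(cmod (cis (2 * y) - 1))\<^sup>2 = (2 * sin y)\<^sup>2"
  proof -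
    have "(cmod (cis (2 * y) - 1))\<^sup>2 = (cos (2 * y))\<^sup>2 + (sin (2 * y))\<^sup>2 + 1 - 2 * cos (2 * y)"
      unfolding cmod_power2 by (simp add: power2_eq_square algebra_simps)
    also have "\<dots> = 2 - 2 * cos (2 * y)" using sin_cos_squared_add2[of "2 * y"] by simp
    also have "\<dots> = (2 * sin y)\<^sup>2" unfolding cos_double_sin by (simp add: power2_eq_square)
    finally show ?thesis .
  qed
  then have "cmod (cis (2 * y) - 1) = \<bar>2 * sin y\<bar>" using real_sqrt_abs by (metis abs_norm_cancel)
  moreover have "pi * b / real n / 2 \<le> sin y"
  proof (cases "y \<le> pi / 2")
    case True
    have "pi * b / real n / 2 \<le> y / 2"
      unfolding y_def using b(1) n by (intro divide_right_mono mult_left_mono) (auto simp: r_def)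
    also have "\<dots> \<le> sin y" using True r n by (intro sin_ge_half) (auto simp: y_def)
    finally show ?thesis .
  next
    case False
    have "pi - y = pi * (real n - r) / real n" using n by (simp add: y_def field_simps)
    then have "pi * b / real n / 2 \<le> (pi - y) / 2"
      using b(2) n by (simp add: r_def divide_right_mono mult_left_mono)
    also have "\<dots> \<le> sin (pi - y)"
    proof (rule sin_ge_half)
      show "0 \<le> pi - y" using r n by (simp add: y_def field_simps)
      show "pi - y \<le> pi / 2" using False by simp
    qed
    finally show ?thesis by simp
  qed
  moreover have "b / real n \<le> pi * b / real n" if "b \<ge> 0"
    using that n pi_ge_two by (intro divide_right_mono) (auto simp: mult_le_cancel_right1)
  moreover have "b / real n \<le> cmod (cis (2 * pi * of_int v / real n) - 1)" if "b < 0"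
    using that n by (intro order_trans[OF _ norm_ge_zero]) (simp add: divide_nonpos_pos)
  ultimately show ?thesis by (cases "b \<ge> 0") auto
qed

text \<open>A unit shift of the frequency multiplies the coefficient at \<open>\<mu> - j\<close> by
  a character value. The second identity is thus a discrete Sobolev norm: a Lipschitz bound in \<xi>
  becomes square summability of the coefficients against a weight that grows with the distance of
  \<open>j\<close> from \<mu> modulo \<open>n\<close>.\<close>

lemma dft_shift_parseval:
  fixes P :: "int ^ 'd \<Rightarrow> complex"
  assumes n: "n > 0" and per: "\<And>k. P (\<chi> i. vec_nth k i mod int n) = P k"
  shows "(\<Sum>k\<in>vec_box (\<lambda>_. {0..<int n}). (cmod (P k))\<^sup>2)
      = real (n ^ CARD('d)) * (\<Sum>j\<in>vec_box (\<lambda>_. {1..<1 + int n}). (cmod (dft n P (\<mu> - j)))\<^sup>2)"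
    and "(\<Sum>k\<in>vec_box (\<lambda>_. {0..<int n}). (cmod (P (k + axis i 1) - P k))\<^sup>2)
      = real (n ^ CARD('d)) * (\<Sum>j\<in>vec_box (\<lambda>_. {1..<1 + int n}). (cmod (dft n P (\<mu> - j)))\<^sup>2 * (cmod (wave n (axis i 1) (\<mu> - j) - 1))\<^sup>2)"
proof -
  note inv = dft_inversion[where P = P, OF n per]
  show "(\<Sum>k\<in>vec_box (\<lambda>_. {0..<int n}). (cmod (P k))\<^sup>2)
      = real (n ^ CARD('d)) * (\<Sum>j\<in>vec_box (\<lambda>_. {1..<1 + int n}). (cmod (dft n P (\<mu> - j)))\<^sup>2)"
    using wave_parseval[OF n, of "\<lambda>j. dft n P (\<mu> - j)" \<mu>] by (simp add: inv)
  have "P (k + axis i 1) - P k = (\<Sum>j\<in>vec_box (\<lambda>_. {1..<1 + int n}).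
      (dft n P (\<mu> - j) * (wave n (axis i 1) (\<mu> - j) - 1)) * wave n k (\<mu> - j))" for k
  proof -
    have "P (k + axis i 1) - P k = (\<Sum>j\<in>vec_box (\<lambda>_. {1..<1 + int n}). dft n P (\<mu> - j) * wave n (k + axis i 1) (\<mu> - j))
      - (\<Sum>j\<in>vec_box (\<lambda>_. {1..<1 + int n}). dft n P (\<mu> - j) * wave n k (\<mu> - j))"
      by (simp only: inv)
    then show ?thesis unfolding wave_add_left sum_subtractf[symmetric] by (simp add: algebra_simps)
  qed
  then show "(\<Sum>k\<in>vec_box (\<lambda>_. {0..<int n}). (cmod (P (k + axis i 1) - P k))\<^sup>2)
      = real (n ^ CARD('d)) * (\<Sum>j\<in>vec_box (\<lambda>_. {1..<1 + int n}). (cmod (dft n P (\<mu> - j)))\<^sup>2 * (cmod (wave n (axis i 1) (\<mu> - j) - 1))\<^sup>2)"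
    by (simp add: wave_parseval[OF n] norm_mult power_mult_distrib)
qed

text \<open>
  A window is a cube of side \<open>L\<close> with corner \<open>y\<close>, taken cyclically in $\{1,\dots,N\}^d$; by
  cyclicity every point lies in exactly \<open>L ^ CARD('d)\<close> windows, even near the boundary.
\<close>

definition window :: "nat \<Rightarrow> nat \<Rightarrow> int ^ 'd \<Rightarrow> int ^ 'd \<Rightarrow> bool" where
  "window N L y m \<longleftrightarrow> (\<forall>i. (vec_nth m i - vec_nth y i) mod int N < int L)"

lemma card_mod_less:
  assumes "N > 0" "L \<le> N"
  shows "card {t \<in> {1..int N}. (a - t) mod int N < int L} = L"
proof -
  have "bij_betw (\<lambda>t. (a - t) mod int N) {t \<in> {1..int N}. (a - t) mod int N < int L} {0..<int L}"
  \<comment> \<open>Subtracting 1 before reducing and adding it back puts the representative into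
    \<open>{1..int N}\<close> instead of \<open>{0..<int N}\<close>.\<close>
  proof (rule bij_betw_byWitness[where f' = "\<lambda>u. (a - u - 1) mod int N + 1"])
    show "\<forall>t\<in>{t \<in> {1..int N}. (a - t) mod int N < int L}. (a - (a - t) mod int N - 1) mod int N + 1 = t"
    proof
      fix t assume t: "t \<in> {t \<in> {1..int N}. (a - t) mod int N < int L}"
      have "(a - (a - t) mod int N - 1) mod int N = (a - 1 - (a - t) mod int N) mod int N" by (simp add: algebra_simps)
      also have "\<dots> = (a - 1 - (a - t)) mod int N" by (rule mod_diff_right_eq)
      also have "\<dots> = t - 1" using t by (simp add: mod_pos_pos_trivial)
      finally show "(a - (a - t) mod int N - 1) mod int N + 1 = t" by simp
    qed
    show "\<forall>u\<in>{0..<int L}. (a - ((a - u - 1) mod int N + 1)) mod int N = u"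
    proof
      fix u assume u: "u \<in> {0..<int L}"
      have "(a - ((a - u - 1) mod int N + 1)) mod int N = (a - 1 - (a - u - 1) mod int N) mod int N" by (simp add: algebra_simps)
      also have "\<dots> = (a - 1 - (a - u - 1)) mod int N" by (rule mod_diff_right_eq)
      also have "\<dots> = u" using u assms by (simp add: mod_pos_pos_trivial)
      finally show "(a - ((a - u - 1) mod int N + 1)) mod int N = u" .
    qed
    show "(\<lambda>t. (a - t) mod int N) ` {t \<in> {1..int N}. (a - t) mod int N < int L} \<subseteq> {0..<int L}"
      using assms by auto
    show "(\<lambda>u. (a - u - 1) mod int N + 1) ` {0..<int L} \<subseteq> {t \<in> {1..int N}. (a - t) mod int N < int L}"
    proof (rule image_subsetI)
      fix u assume u: "u \<in> {0..<int L}"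
      have "(a - u - 1) mod int N \<ge> 0" "(a - u - 1) mod int N < int N" using assms by auto
      moreover have "(a - ((a - u - 1) mod int N + 1)) mod int N = u"
      proof -
        have "(a - ((a - u - 1) mod int N + 1)) mod int N = (a - 1 - (a - u - 1) mod int N) mod int N" by (simp add: algebra_simps)
        also have "\<dots> = (a - 1 - (a - u - 1)) mod int N" by (rule mod_diff_right_eq)
        also have "\<dots> = u" using u assms by (simp add: mod_pos_pos_trivial)
        finally show ?thesis .
      qed
      ultimately show "(a - u - 1) mod int N + 1 \<in> {t \<in> {1..int N}. (a - t) mod int N < int L}" using u by auto
    qed
  qed
  then show ?thesis
    using bij_betw_same_card by fastforce
qed

text \<open>The reflection of \<open>{1..int N}\<close> reduces this count to
  \<open>card_mod_less\<close>.\<close>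

lemma card_mod_less':
  assumes "N > 0" "L \<le> N"
  shows "card {t \<in> {1..int N}. (t - a) mod int N < int L} = L"
proof -
  have "bij_betw (\<lambda>t. int N + 1 - t) {t \<in> {1..int N}. (t - a) mod int N < int L} {t \<in> {1..int N}. (1 - a - t) mod int N < int L}"
  proof (rule bij_betw_byWitness[where f' = "\<lambda>t. int N + 1 - t"])
    have e: "(1 - a - (int N + 1 - t)) mod int N = (t - a) mod int N" for t
      using mod_add_self2[of "1 - a - (int N + 1 - t)" "int N"] by simp
    have e': "(int N + 1 - t - a) mod int N = (1 - a - t) mod int N" for t
      using mod_add_self2[of "1 - a - t" "int N"] by (simp add: algebra_simps)
    show "(\<lambda>t. int N + 1 - t) ` {t \<in> {1..int N}. (t - a) mod int N < int L} \<subseteq> {t \<in> {1..int N}. (1 - a - t) mod int N < int L}"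
      using e by auto
    show "(\<lambda>t. int N + 1 - t) ` {t \<in> {1..int N}. (1 - a - t) mod int N < int L} \<subseteq> {t \<in> {1..int N}. (t - a) mod int N < int L}"
      using e' by auto
  qed auto
  then show "card {t \<in> {1..int N}. (t - a) mod int N < int L} = L"
    using bij_betw_same_card card_mod_less[OF assms, of "1 - a"] by fastforce
qed

text \<open>Moving \<open>a\<close> by one changes membership for at most two \<open>t\<close>: the
  one whose residue passes from \<open>L - 1\<close> to \<open>L\<close>, and the one whose residue
  wraps from \<open>N - 1\<close> to 0. Steps of length one then add up.\<close>

lemma card_mod_neq:
  assumes N: "N > 0"
  shows "card {t \<in> {1..int N}. ((a - t) mod int N < int L) \<noteq> ((b - t) mod int N < int L)} \<le> nat (2 * \<bar>a - b\<bar>)"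
proof -
  define D where "D = (\<lambda>a b. {t \<in> {1..int N}. ((a - t) mod int N < int L) \<noteq> ((b - t) mod int N < int L)})"
  have fin: "finite (D a b)" for a b unfolding D_def by (rule finite_subset[of _ "{1..int N}"]) auto
  have one: "card {t \<in> {1..int N}. (a - t) mod int N = u} \<le> 1" for a u
  proof -
    have eq: "t = t'" if "t \<in> {t \<in> {1..int N}. (a - t) mod int N = u}" "t' \<in> {t \<in> {1..int N}. (a - t) mod int N = u}" for t t'
    proof -
      have "(a - t) mod int N = (a - t') mod int N" using that by simp
      then have "int N dvd (a - t) - (a - t')" by (simp only: mod_eq_dvd_iff)
      then have "int N dvd t' - t" by simp
      moreover have "\<bar>t' - t\<bar> < int N" using that by auto
      ultimately show ?thesis using zdvd_not_zless[of "\<bar>t' - t\<bar>" "int N"] by auto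
    qed
    have fin: "finite {t \<in> {1..int N}. (a - t) mod int N = u}" by (rule finite_subset[of _ "{1..int N}"]) auto
    have "card {t \<in> {1..int N}. (a - t) mod int N = u} \<le> Suc 0"
      unfolding card_le_Suc0_iff_eq[OF fin] using eq by blast
    then show ?thesis by simp
  qed
  have step: "card (D a (a + 1)) \<le> 2" for a
  proof -
    have "D a (a + 1) \<subseteq> {t \<in> {1..int N}. (a - t) mod int N = int L - 1} \<union> {t \<in> {1..int N}. (a - t) mod int N = int N - 1}"
    proof
      fix t assume t: "t \<in> D a (a + 1)"
      define r where "r = (a - t) mod int N"
      have r: "0 \<le> r" "r < int N" using N by (auto simp: r_def)
      have "(a + 1 - t) mod int N = (r + 1) mod int N"
        unfolding r_def mod_add_left_eq by (simp add: algebra_simps)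
      then have "r = int L - 1 \<or> r = int N - 1"
        using t r N by (cases "r + 1 < int N") (auto simp: D_def r_def[symmetric] mod_pos_pos_trivial)
      then show "t \<in> {t \<in> {1..int N}. (a - t) mod int N = int L - 1} \<union> {t \<in> {1..int N}. (a - t) mod int N = int N - 1}"
        using t by (auto simp: D_def r_def)
    qed
    then have "card (D a (a + 1)) \<le> card ({t \<in> {1..int N}. (a - t) mod int N = int L - 1} \<union> {t \<in> {1..int N}. (a - t) mod int N = int N - 1})"
      by (intro card_mono finite_UnI finite_subset[of "{t \<in> {1..int N}. _ t}" "{1..int N}"]) auto
    also have "\<dots> \<le> 1 + 1" by (intro order_trans[OF card_Un_le] add_mono one)
    finally show ?thesis by simp
  qed
  have up: "card (D a (a + int j)) \<le> 2 * j" for a j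
  proof (induction j)
    case 0
    then show ?case by (simp add: D_def)
  next
    case (Suc j)
    have "D a (a + int (Suc j)) \<subseteq> D a (a + int j) \<union> D (a + int j) (a + int j + 1)"
      by (auto simp: D_def add_ac)
    then have "card (D a (a + int (Suc j))) \<le> card (D a (a + int j) \<union> D (a + int j) (a + int j + 1))"
      by (intro card_mono) (auto simp: fin)
    also have "\<dots> \<le> 2 * j + 2" by (intro order_trans[OF card_Un_le] add_mono Suc step)
    finally show ?case by simp
  qed
  have "card (D a b) \<le> nat (2 * \<bar>a - b\<bar>)"
  proof (cases "a \<le> b")
    case True
    then show ?thesis using up[of a "nat (b - a)"] by (simp add: nat_mult_distrib)
  next
    case False
    have "D a b = D b a" by (auto simp: D_def)
    then show ?thesis using False up[of b "nat (a - b)"] by (simp add: nat_mult_distrib)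
  qed
  then show ?thesis by (simp only: D_def)
qed

lemma card_window:
  fixes m y :: "int ^ 'd"
  assumes "N > 0" "L \<le> N"
  shows "card {y \<in> grid N. window N L y m} = L ^ CARD('d)" "card {m \<in> grid N. window N L y m} = L ^ CARD('d)"
proof -
  have "{y \<in> grid N. window N L y m} = vec_box (\<lambda>i. {t \<in> {1..int N}. (vec_nth m i - t) mod int N < int L})"
    by (auto simp: grid_def window_def vec_box_def)
  then show "card {y \<in> grid N. window N L y m} = L ^ CARD('d)"
    using card_mod_less[OF assms] by (simp add: card_vec_box)
  have "{m \<in> grid N. window N L y m} = vec_box (\<lambda>i. {t \<in> {1..int N}. (t - vec_nth y i) mod int N < int L})"
    by (auto simp: grid_def window_def vec_box_def)
  then show "card {m \<in> grid N. window N L y m} = L ^ CARD('d)"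
    using card_mod_less'[OF assms] by (simp add: card_vec_box)
qed

text \<open>Some coordinate must tell the two memberships apart. That coordinate of the corner takes
  few values and the others are left free, whence the crude factor
  \<open>N ^ (CARD('d) - 1)\<close>. Divided by \<open>L ^ CARD('d)\<close> it still decays at the
  scale of \<open>window_scale\<close>.\<close>

lemma card_window_neq:
  fixes m j :: "int ^ 'd"
  assumes N: "N > 0"
  shows "real (card {y \<in> grid N. window N L y m \<noteq> window N L y j})
    \<le> real (N ^ (CARD('d) - 1)) * (\<Sum>i\<in>UNIV. 2 * \<bar>real_of_int (vec_nth m i - vec_nth j i)\<bar>)"
proof -
  define B where "B = (\<lambda>i. {t \<in> {1..int N}. ((vec_nth m i - t) mod int N < int L) \<noteq> ((vec_nth j i - t) mod int N < int L)})"
  have finB: "finite (B i)" for i unfolding B_def by (rule finite_subset[of _ "{1..int N}"]) auto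
  define V where "V = (\<lambda>i. vec_box (\<lambda>i'. if i' = i then B i else {1..int N}))"
  have "{y \<in> grid N. window N L y m \<noteq> window N L y j} \<subseteq> (\<Union>i. V i)"
    by (auto simp: V_def B_def vec_box_def grid_def window_def split: if_splits)
  then have "card {y \<in> grid N. window N L y m \<noteq> window N L y j} \<le> card (\<Union>i. V i)"
    using finB by (intro card_mono finite_UN_I) (auto simp: V_def intro!: finite_vec_box)
  also have "\<dots> \<le> (\<Sum>i\<in>UNIV. card (V i))" by (rule card_UN_le) simp
  also have "\<dots> = (\<Sum>i\<in>UNIV. card (B i) * N ^ (CARD('d) - 1))"
  proof (intro sum.cong refl)
    fix i :: 'd
    have "card (V i) = (\<Prod>i'\<in>UNIV. if i' = i then card (B i) else N)"
      unfolding V_def card_vec_box by (intro prod.cong refl) auto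
    also have "\<dots> = card (B i) * (\<Prod>i'\<in>UNIV - {i}. if i' = i then card (B i) else N)"
      by (subst prod.remove[of _ i]) auto
    also have "(\<Prod>i'\<in>UNIV - {i}. if i' = i then card (B i) else N) = N ^ (CARD('d) - 1)"
      by (simp add: card_Diff_singleton)
    finally show "card (V i) = card (B i) * N ^ (CARD('d) - 1)" .
  qed
  finally have "real (card {y \<in> grid N. window N L y m \<noteq> window N L y j}) \<le> real (\<Sum>i\<in>UNIV. card (B i) * N ^ (CARD('d) - 1))"
    by (simp only: of_nat_le_iff)
  also have "\<dots> = (\<Sum>i\<in>UNIV. real (N ^ (CARD('d) - 1)) * real (card (B i)))" by (simp add: mult.commute)
  also have "\<dots> \<le> (\<Sum>i\<in>UNIV. real (N ^ (CARD('d) - 1)) * (2 * \<bar>real_of_int (vec_nth m i - vec_nth j i)\<bar>))"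
  proof (intro sum_mono mult_left_mono)
    fix i
    have "card (B i) \<le> nat (2 * \<bar>vec_nth m i - vec_nth j i\<bar>)" unfolding B_def by (rule card_mod_neq[OF N])
    then have "real (card (B i)) \<le> real (nat (2 * \<bar>vec_nth m i - vec_nth j i\<bar>))" by (simp only: of_nat_le_iff)
    then show "real (card (B i)) \<le> 2 * \<bar>real_of_int (vec_nth m i - vec_nth j i)\<bar>" by simp
  qed simp
  finally show ?thesis by (simp only: sum_distrib_left)
qed

section \<open>Wave packets\<close>

text \<open>
  The index is a pair of a window corner and a frequency \<open>k\<close>, standing for $\xi = k/n$. The
  frequency lattice is finer than the grid (\<open>2 * N \<le> n\<close>) and \<open>n\<close> tends to infinity for fixed
  \<open>N\<close>, so that discrete Fourier coefficients become those of the symbol.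
\<close>

definition packet :: "nat \<Rightarrow> nat \<Rightarrow> nat \<Rightarrow> (int ^ 'd) \<times> (int ^ 'd) \<Rightarrow> int ^ 'd \<Rightarrow> complex" where
  "packet N L n f m = (if window N L (fst f) m then cnj (wave n (snd f) m) / of_real (sqrt (real (L ^ CARD('d) * n ^ CARD('d)))) else 0)"

abbreviation packet_index :: "nat \<Rightarrow> nat \<Rightarrow> ((int ^ 'd) \<times> (int ^ 'd)) set" where
  "packet_index N n \<equiv> grid N \<times> vec_box (\<lambda>_. {0..<int n})"

lemma finite_packet_index: "finite (packet_index N n)"
  by (intro finite_cartesian_product finite_grid finite_vec_box) simp

lemma grid_subset_vec_box: "N \<le> n \<Longrightarrow> grid N \<subseteq> vec_box (\<lambda>_. {1..<1 + int n})"
  by (auto simp: grid_def vec_box_def) (smt (verit) of_nat_le_iff)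

lemma sum_packet_const:
  fixes m :: "int ^ 'd"
  assumes "N > 0" "L \<le> N"
  shows "(\<Sum>y\<in>grid N. if window N L y m then c else 0) = real (L ^ CARD('d)) * c"
proof -
  have "(\<Sum>y\<in>grid N. if window N L y m then c else 0) = (\<Sum>y\<in>{y \<in> grid N. window N L y m}. c)"
    by (rule sum.inter_filter[OF finite_grid, symmetric])
  then show ?thesis by (simp add: card_window[OF assms])
qed

text \<open>The sum over frequencies gives orthogonality of characters at distinct grid points,
  which are incongruent modulo \<open>n\<close> because \<open>N \<le> n\<close>. On the diagonal
  there remains the number of windows through a point, and cyclic windows make it exactly
  \<open>L ^ CARD('d)\<close>.\<close>

lemma packet_frame:
  fixes m m' :: "int ^ 'd"
  assumes N: "N > 0" and L: "L > 0" "L \<le> N" and n: "N \<le> n"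
    and m: "m \<in> grid N" "m' \<in> grid N"
  shows "(\<Sum>f\<in>packet_index N n. packet N L n f m * cnj (packet N L n f m')) = (if m = m' then 1 else 0)"
proof -
  let ?T = "vec_box (\<lambda>_::'d. {0..<int n})"
  define c where "c = real (L ^ CARD('d) * n ^ CARD('d))"
  have c: "c > 0" using assms by (simp add: c_def)
  have n0: "n > 0" using N n by simp
  have cc: "complex_of_real (sqrt c) * of_real (sqrt c) = of_real c"
    using c by (simp flip: of_real_mult)
  have w: "cnj (wave n k m) * wave n k m' = wave n k (m' - m)" for k
    using wave_add[of n k m' "- m"] wave_minus[of n k m] by (simp add: mult.commute)
  have orth: "(\<Sum>k\<in>?T. wave n k (m' - m)) = (if m = m' then of_nat (n ^ CARD('d)) else 0)"
  proof -
    have "m \<in> vec_box (\<lambda>_. {1..<1 + int n})" "m' \<in> vec_box (\<lambda>_. {1..<1 + int n})"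
      using m grid_subset_vec_box[OF n] by auto
    then show ?thesis
      using sum_wave_left[OF n0, where a = 0 and \<nu> = "m' - m"] vec_box_cong_eq[of m' 1 n m] by auto
  qed
  have "(\<Sum>f\<in>packet_index N n. packet N L n f m * cnj (packet N L n f m'))
    = (\<Sum>y\<in>grid N. \<Sum>k\<in>?T. packet N L n (y, k) m * cnj (packet N L n (y, k) m'))"
    by (simp add: sum.cartesian_product case_prod_unfold)
  also have "\<dots> = (\<Sum>y\<in>grid N. \<Sum>k\<in>?T. (if window N L y m \<and> window N L y m' then wave n k (m' - m) / of_real c else 0))"
    by (intro sum.cong refl) (simp add: packet_def c_def[symmetric] cc w del: of_nat_mult)
  also have "\<dots> = (\<Sum>y\<in>grid N. if window N L y m \<and> window N L y m' then (\<Sum>k\<in>?T. wave n k (m' - m)) / of_real c else 0)"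
  proof (intro sum.cong refl)
    fix y
    show "(\<Sum>k\<in>?T. (if window N L y m \<and> window N L y m' then wave n k (m' - m) / of_real c else 0))
      = (if window N L y m \<and> window N L y m' then (\<Sum>k\<in>?T. wave n k (m' - m)) / of_real c else 0)"
      by (cases "window N L y m"; cases "window N L y m'") (simp_all add: sum_divide_distrib)
  qed
  also have "\<dots> = (if m = m' then of_real (\<Sum>y\<in>grid N. if window N L y m then real (n ^ CARD('d)) / c else 0) else 0)"
    unfolding orth of_real_sum by (auto intro!: sum.cong)
  also have "\<dots> = (if m = m' then 1 else 0)"
    unfolding sum_packet_const[OF N L(2)] using L n0 by (simp add: c_def)
  finally show ?thesis .
qed

lemma norm_packet:
  "(cmod (packet N L n (y, k) m))\<^sup>2 = (if window N L y m then 1 / real (L ^ CARD('d) * n ^ CARD('d)) else 0)" for m :: "int ^ 'd"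
  by (simp add: packet_def norm_divide norm_wave power_divide del: of_nat_mult)

text \<open>All packets carry the same weight, so the coupling compares the singular values with an
  unweighted average of the symbol over sample points in phase space.\<close>

lemma sum_norm_packet:
  fixes y :: "int ^ 'd"
  assumes "N > 0" "L > 0" "L \<le> N"
  shows "(\<Sum>m\<in>grid N. (cmod (packet N L n (y, k) m))\<^sup>2) = 1 / real (n ^ CARD('d))"
proof -
  have "(\<Sum>m\<in>grid N. (cmod (packet N L n (y, k) m))\<^sup>2)
      = (\<Sum>m\<in>{m \<in> grid N. window N L y m}. 1 / real (L ^ CARD('d) * n ^ CARD('d)))"
    unfolding norm_packet by (rule sum.inter_filter[OF finite_grid, symmetric])
  then show ?thesis using card_window(2)[OF assms(1,3), of y] assms by simp
qed

text \<open>A squared distance, over all corners \<open>y\<close>, between the window indicators at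
  \<open>j\<close> and at \<open>m\<close>. The former is set to 0 off the grid, where the matrix
  has no column; the truncation of a row at the boundary is thereby counted in the same
  quantity.\<close>

definition window_gap :: "nat \<Rightarrow> nat \<Rightarrow> int ^ 'd \<Rightarrow> int ^ 'd \<Rightarrow> real" where
  "window_gap N L m j = (\<Sum>y\<in>grid N. (of_bool (j \<in> grid N \<and> window N L y j) - of_bool (window N L y m))\<^sup>2)"

text \<open>On the full box and with a constant window, a row would reproduce \<open>P k\<close>
  exactly, by \<open>dft_inversion\<close>. The defect comes only from the variation of the window
  indicator between \<open>j\<close> and \<open>m\<close>, and Parseval in \<open>k\<close>
  evaluates its square exactly.\<close>

lemma packet_dft_identity:
  fixes P :: "int ^ 'd \<Rightarrow> complex"
  assumes N: "N > 0" and L: "L > 0" "L \<le> N" and n: "N \<le> n" and m: "m \<in> grid N"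
    and per: "\<And>k. P (\<chi> i. vec_nth k i mod int n) = P k"
  shows "(\<Sum>(y, k)\<in>packet_index N n. (cmod ((\<Sum>j\<in>grid N. dft n P (m - j) * packet N L n (y, k) j) - P k * packet N L n (y, k) m))\<^sup>2)
    = (\<Sum>j\<in>vec_box (\<lambda>_. {1..<1 + int n}). (cmod (dft n P (m - j)))\<^sup>2 * (window_gap N L m j / real (L ^ CARD('d))))"
proof -
  let ?T = "vec_box (\<lambda>_::'d. {0..<int n})" and ?J = "vec_box (\<lambda>_::'d. {1..<1 + int n})"
  define c where "c = real (L ^ CARD('d) * n ^ CARD('d))"
  have n0: "n > 0" using N n by simp
  have c: "c > 0" using L n0 by (simp add: c_def)
  define \<chi>' where "\<chi>' y j = (of_bool (j \<in> grid N \<and> window N L y j) :: real)" for y j :: "int ^ 'd"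
  define \<chi>0 where "\<chi>0 y = (of_bool (window N L y m) :: real)" for y :: "int ^ 'd"
  have fin: "finite ?J" by (intro finite_vec_box) simp
  have pk: "packet N L n (y, k) j = cnj (wave n k m) * wave n k (m - j) * of_real (\<chi>' y j) / of_real (sqrt c)" if "j \<in> grid N" for y k j
  proof -
    have "cnj (wave n k j) = wave n k (- j)" by (rule wave_minus[symmetric])
    also have "\<dots> = (cnj (wave n k m) * wave n k m) * wave n k (- j)" using wave_cnj_self[of n k m] by (simp add: mult.commute)
    also have "\<dots> = cnj (wave n k m) * wave n k (m - j)" using wave_add[of n k m "- j"] by (simp add: mult.assoc)
    finally show ?thesis using that by (simp add: packet_def \<chi>'_def c_def)
  qed
  have pm: "packet N L n (y, k) m = cnj (wave n k m) * of_real (\<chi>0 y) / of_real (sqrt c)" for y k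
    by (simp add: packet_def \<chi>0_def c_def)
  have diff: "(\<Sum>j\<in>grid N. dft n P (m - j) * packet N L n (y, k) j) - P k * packet N L n (y, k) m
      = cnj (wave n k m) / of_real (sqrt c) * (\<Sum>j\<in>?J. (dft n P (m - j) * of_real (\<chi>' y j - \<chi>0 y)) * wave n k (m - j))" for y k
  proof -
    have "(\<Sum>j\<in>grid N. dft n P (m - j) * packet N L n (y, k) j)
        = (\<Sum>j\<in>?J. cnj (wave n k m) / of_real (sqrt c) * (dft n P (m - j) * of_real (\<chi>' y j) * wave n k (m - j)))"
      using grid_subset_vec_box[OF n]
      by (intro sum.mono_neutral_cong_left[OF fin]) (auto simp: pk \<chi>'_def)
    moreover have "P k * packet N L n (y, k) m
        = (\<Sum>j\<in>?J. cnj (wave n k m) / of_real (sqrt c) * (dft n P (m - j) * of_real (\<chi>0 y) * wave n k (m - j)))"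
      unfolding pm dft_inversion[where P = P, OF n0 per, of m k, symmetric] sum_distrib_right
      by (intro sum.cong refl) simp
    ultimately show ?thesis
      by (simp add: sum_subtractf[symmetric] sum_distrib_left algebra_simps)
  qed
  have "(\<Sum>(y, k)\<in>packet_index N n. (cmod ((\<Sum>j\<in>grid N. dft n P (m - j) * packet N L n (y, k) j) - P k * packet N L n (y, k) m))\<^sup>2)
    = (\<Sum>y\<in>grid N. \<Sum>k\<in>?T. (cmod (\<Sum>j\<in>?J. (dft n P (m - j) * of_real (\<chi>' y j - \<chi>0 y)) * wave n k (m - j)))\<^sup>2 / c)"
    unfolding diff sum.cartesian_product[symmetric]
    using c by (intro sum.cong refl) (simp add: norm_mult norm_divide norm_wave power_mult_distrib power_divide)
  also have "\<dots> = (\<Sum>y\<in>grid N. (real (n ^ CARD('d)) * (\<Sum>j\<in>?J. (cmod (dft n P (m - j) * of_real (\<chi>' y j - \<chi>0 y)))\<^sup>2)) / c)"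
    by (simp only: sum_divide_distrib[symmetric] wave_parseval[OF n0])
  also have "\<dots> = (\<Sum>y\<in>grid N. \<Sum>j\<in>?J. (cmod (dft n P (m - j)))\<^sup>2 * ((\<chi>' y j - \<chi>0 y)\<^sup>2 / real (L ^ CARD('d))))"
  proof (intro sum.cong refl)
    fix y
    have e: "(cmod (dft n P (m - j) * of_real (\<chi>' y j - \<chi>0 y)))\<^sup>2 = (cmod (dft n P (m - j)))\<^sup>2 * (\<chi>' y j - \<chi>0 y)\<^sup>2" for j
      by (simp only: norm_mult norm_of_real power_mult_distrib power2_abs)
    have "real (n ^ CARD('d)) / c = 1 / real (L ^ CARD('d))" using n0 L by (simp add: c_def)
    then show "(real (n ^ CARD('d)) * (\<Sum>j\<in>?J. (cmod (dft n P (m - j) * of_real (\<chi>' y j - \<chi>0 y)))\<^sup>2)) / c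
        = (\<Sum>j\<in>?J. (cmod (dft n P (m - j)))\<^sup>2 * ((\<chi>' y j - \<chi>0 y)\<^sup>2 / real (L ^ CARD('d))))"
      unfolding e times_divide_eq_left[symmetric] by (simp only: sum_distrib_left) (simp add: mult_ac)
  qed
  also have "\<dots> = (\<Sum>j\<in>?J. (cmod (dft n P (m - j)))\<^sup>2 * (window_gap N L m j / real (L ^ CARD('d))))"
    by (subst sum.swap) (simp add: window_gap_def \<chi>'_def \<chi>0_def sum_distrib_left sum_divide_distrib)
  finally show ?thesis .
qed

lemma window_gap_le:
  fixes m j :: "int ^ 'd"
  assumes "N > 0" "L \<le> N"
  shows "window_gap N L m j \<le> 2 * real (L ^ CARD('d))"
proof -
  have "window_gap N L m j \<le> (\<Sum>y\<in>grid N. (if window N L y j then 1 else 0) + (if window N L y m then 1 else 0))"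
    unfolding window_gap_def by (intro sum_mono) (auto simp: of_bool_def)
  also have "\<dots> = 2 * real (L ^ CARD('d))"
    unfolding sum.distrib sum_packet_const[OF assms] by simp
  finally show ?thesis .
qed

text \<open>Together with \<open>window_gap_le\<close> this controls the rows for which only the sup
  norm of the symbol is at hand.\<close>

lemma dft_bessel:
  fixes P :: "int ^ 'd \<Rightarrow> complex"
  assumes n: "n > 0" and per: "\<And>k. P (\<chi> i. vec_nth k i mod int n) = P k" and S: "\<And>k. cmod (P k) \<le> S"
  shows "(\<Sum>j\<in>vec_box (\<lambda>_. {1..<1 + int n}). (cmod (dft n P (m - j)))\<^sup>2) \<le> S\<^sup>2"
proof -
  have "real (n ^ CARD('d)) * (\<Sum>j\<in>vec_box (\<lambda>_. {1..<1 + int n}). (cmod (dft n P (m - j)))\<^sup>2)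
      = (\<Sum>k\<in>vec_box (\<lambda>_. {0..<int n}). (cmod (P k))\<^sup>2)"
    by (rule dft_shift_parseval(1)[where P = P, OF n per, symmetric])
  also have "\<dots> \<le> (\<Sum>k\<in>vec_box (\<lambda>_::'d. {0..<int n}). S\<^sup>2)"
    using S by (intro sum_mono power_mono) auto
  also have "\<dots> = real (n ^ CARD('d)) * S\<^sup>2" by (simp add: card_vec_box)
  finally show ?thesis using n by (simp add: mult_le_cancel_left)
qed

text \<open>The gap is dominated by a multiple of \<open>W j\<close>, the weight that the Lipschitz
  bound in \<xi> controls through \<open>dft_shift_parseval\<close>. Inside the grid the gap grows
  at most linearly with the distance of \<open>j\<close> from \<open>m\<close>. Outside it is
  constant, but there \<open>j\<close> keeps a distance of at least \<open>b\<close> from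
  \<open>m\<close> modulo \<open>n\<close> in some coordinate. The two cases produce
  \<open>K1\<close> and \<open>K2\<close>.\<close>

lemma dft_window_gap_good:
  fixes P :: "int ^ 'd \<Rightarrow> complex"
  assumes N: "N > 0" and L: "L > 0" "L \<le> N" and n: "2 * N \<le> n" and m: "m \<in> grid N"
    and per: "\<And>k. P (\<chi> i. vec_nth k i mod int n) = P k"
    and lip: "\<And>k i. cmod (P (k + axis i 1) - P k) \<le> \<Lambda> / real n"
    and b: "b > 0" "\<And>i. b \<le> real_of_int (vec_nth m i) \<and> real_of_int (vec_nth m i) \<le> real N - b"
  shows "(\<Sum>j\<in>vec_box (\<lambda>_. {1..<1 + int n}). (cmod (dft n P (m - j)))\<^sup>2 * (window_gap N L m j / real (L ^ CARD('d))))
    \<le> (2 * real (N ^ (CARD('d) - 1)) / real (L ^ CARD('d)) + 1 / b\<^sup>2) * (real CARD('d) * \<Lambda>\<^sup>2)"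
proof -
  let ?J = "vec_box (\<lambda>_::'d. {1..<1 + int n})" and ?T = "vec_box (\<lambda>_::'d. {0..<int n})"
  have n0: "n > 0" using N n by simp
  define K1 where "K1 = 2 * real (N ^ (CARD('d) - 1)) / real (L ^ CARD('d))"
  define K2 where "K2 = 1 / b\<^sup>2"
  have K: "K1 \<ge> 0" "K2 \<ge> 0" by (auto simp: K1_def K2_def)
  define W where "W j = (\<Sum>i\<in>UNIV. (real n * cmod (wave n (axis i 1) (m - j) - 1))\<^sup>2)" for j
  have W0: "W j \<ge> 0" for j by (simp add: W_def sum_nonneg)
  have gap: "window_gap N L m j / real (L ^ CARD('d)) \<le> (K1 + K2) * W j" if j: "j \<in> ?J" for j
  proof (cases "j \<in> grid N")
    case True
    have "window_gap N L m j = real (card {y \<in> grid N. window N L y m \<noteq> window N L y j})"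
    proof -
      have "window_gap N L m j = (\<Sum>y\<in>grid N. if window N L y m \<noteq> window N L y j then 1 else 0)"
        unfolding window_gap_def using True by (intro sum.cong refl) auto
      also have "\<dots> = real (card {y \<in> grid N. window N L y m \<noteq> window N L y j})"
        by (simp add: sum.inter_filter[OF finite_grid, symmetric] card_eq_sum del: sum_constant)
      finally show ?thesis .
    qed
    also have "\<dots> \<le> real (N ^ (CARD('d) - 1)) * (\<Sum>i\<in>UNIV. 2 * \<bar>real_of_int (vec_nth m i - vec_nth j i)\<bar>)"
      by (rule card_window_neq[OF N])
    also have "\<dots> \<le> real (N ^ (CARD('d) - 1)) * (\<Sum>i\<in>UNIV. 2 * (real n * cmod (wave n (axis i 1) (m - j) - 1))\<^sup>2)"
    proof (rule mult_left_mono, rule sum_mono)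
      fix i
      define v where "v = vec_nth m i - vec_nth j i"
      have v: "\<bar>v\<bar> < int N" using m True by (simp add: v_def grid_def) (smt (verit))
      have "of_int \<bar>v\<bar> / real n \<le> cmod (cis (2 * pi * of_int v / real n) - 1)"
      proof (rule cis_minus_one_ge[OF n0])
        \<comment> \<open>Since \<open>2 * N \<le> n\<close>, the multiple of \<open>n\<close>
          nearest to \<open>v\<close> is 0, so no wrap-around shortens the distance.\<close>
        have "\<bar>v\<bar> \<le> v mod int n \<and> v mod int n \<le> int n - \<bar>v\<bar>"
        proof (cases "v \<ge> 0")
          case True
          then show ?thesis using v n by (simp add: mod_pos_pos_trivial)
        next
          case False
          have "v mod int n = (v + int n) mod int n" by simp
          also have "\<dots> = v + int n" using False v n by (intro mod_pos_pos_trivial) auto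
          finally show ?thesis using False v n by simp
        qed
        then show "real_of_int \<bar>v\<bar> \<le> real_of_int (v mod int n)" "real_of_int (v mod int n) \<le> real n - real_of_int \<bar>v\<bar>"
          by linarith+
      qed
      then have "real_of_int \<bar>v\<bar> \<le> real n * cmod (wave n (axis i 1) (m - j) - 1)"
        using n0 by (simp add: wave_axis v_def field_simps)
      then have "(real_of_int \<bar>v\<bar>)\<^sup>2 \<le> (real n * cmod (wave n (axis i 1) (m - j) - 1))\<^sup>2" by (intro power_mono) auto
      \<comment> \<open>The linear count of windows is traded for the quadratic weight, which is
        possible because \<open>v\<close> is an integer.\<close>
      moreover have "real_of_int \<bar>v\<bar> \<le> (real_of_int \<bar>v\<bar>)\<^sup>2"
      proof -
        have "\<bar>v\<bar> \<le> \<bar>v\<bar>\<^sup>2" 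
        proof (cases "v = 0")
          case False
          then have "\<bar>v\<bar> * 1 \<le> \<bar>v\<bar> * \<bar>v\<bar>" by (intro mult_left_mono) auto
          then show ?thesis by (simp add: power2_eq_square)
        qed simp
        then show ?thesis using of_int_le_iff[of "\<bar>v\<bar>" "\<bar>v\<bar>\<^sup>2", where ?'a = real] by simp
      qed
      ultimately show "2 * \<bar>real_of_int (vec_nth m i - vec_nth j i)\<bar> \<le> 2 * (real n * cmod (wave n (axis i 1) (m - j) - 1))\<^sup>2"
        by (simp add: v_def)
    qed auto
    also have "\<dots> = real (L ^ CARD('d)) * (K1 * W j)"
      using L by (simp add: K1_def W_def sum_distrib_left mult_ac)
    finally have "window_gap N L m j / real (L ^ CARD('d)) \<le> K1 * W j"
      using L by (simp add: divide_le_eq mult.commute)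
    also have "\<dots> \<le> (K1 + K2) * W j" using K W0 by (intro mult_right_mono) auto
    finally show ?thesis .
  next
    case False
    have "window_gap N L m j = (\<Sum>y\<in>grid N. if window N L y m then 1 else 0)"
      unfolding window_gap_def using False by (intro sum.cong refl) auto
    also have "\<dots> = real (L ^ CARD('d))" using sum_packet_const[OF N L(2), of m 1] by simp
    finally have g: "window_gap N L m j / real (L ^ CARD('d)) = 1" using L by simp
    obtain i where i: "vec_nth j i > int N" 
    proof -
      obtain i where "\<not> (1 \<le> vec_nth j i \<and> vec_nth j i \<le> int N)" using False by (auto simp: grid_def)
      moreover have "1 \<le> vec_nth j i" using j by (simp add: vec_box_def)
      ultimately show thesis using that[of i] by linarith
    qed
    define v where "v = vec_nth m i - vec_nth j i"
    have mi: "1 \<le> vec_nth m i" "vec_nth m i \<le> int N" using m by (auto simp: grid_def)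
    have "vec_nth j i < 1 + int n" using j by (simp add: vec_box_def)
    then have ji: "vec_nth j i \<le> int n" by simp
    have vm: "v mod int n = v + int n"
    proof -
      have "v mod int n = (v + int n) mod int n" by simp
      also have "\<dots> = v + int n" using i ji mi by (intro mod_pos_pos_trivial) (auto simp: v_def)
      finally show ?thesis .
    qed
    \<comment> \<open>Here \<open>v mod int n\<close> is \<open>v + int n\<close>. It is at least
      the coordinate of \<open>m\<close>, hence at least \<open>b\<close>; it is at most
      \<open>n - b\<close> because the coordinate of \<open>j\<close> exceeds \<open>N\<close> while
      that of \<open>m\<close> stays \<open>b\<close> below \<open>N\<close>.\<close>
    have "b / real n \<le> cmod (cis (2 * pi * of_int v / real n) - 1)"
    proof (rule cis_minus_one_ge[OF n0])
      have "real_of_int (vec_nth j i) \<le> real n" "real N < real_of_int (vec_nth j i)" using ji i by linarith+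
      then show "b \<le> real_of_int (v mod int n)" "real_of_int (v mod int n) \<le> real n - b"
        unfolding vm using b(2)[of i] by (auto simp: v_def)
    qed
    then have "b \<le> real n * cmod (wave n (axis i 1) (m - j) - 1)"
      using n0 by (simp add: wave_axis v_def field_simps)
    then have "b\<^sup>2 \<le> (real n * cmod (wave n (axis i 1) (m - j) - 1))\<^sup>2" using b(1) by (intro power_mono) auto
    also have "\<dots> \<le> W j" unfolding W_def by (rule member_le_sum) auto
    finally have "1 \<le> K2 * W j" using b(1) by (simp add: K2_def field_simps)
    also have "\<dots> \<le> (K1 + K2) * W j" using K W0 by (intro mult_right_mono) auto
    finally show ?thesis unfolding g .
  qed
  have "(\<Sum>j\<in>?J. (cmod (dft n P (m - j)))\<^sup>2 * (window_gap N L m j / real (L ^ CARD('d))))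
     \<le> (\<Sum>j\<in>?J. (cmod (dft n P (m - j)))\<^sup>2 * ((K1 + K2) * W j))"
    by (intro sum_mono mult_left_mono gap) auto
  also have "\<dots> = (\<Sum>j\<in>?J. \<Sum>i\<in>UNIV. (K1 + K2) * (real n)\<^sup>2 * ((cmod (dft n P (m - j)))\<^sup>2 * (cmod (wave n (axis i 1) (m - j) - 1))\<^sup>2))"
    unfolding W_def sum_distrib_left by (intro sum.cong refl) (simp add: power_mult_distrib)
  also have "\<dots> = (\<Sum>i\<in>UNIV. (K1 + K2) * (real n)\<^sup>2 * (\<Sum>j\<in>?J. (cmod (dft n P (m - j)))\<^sup>2 * (cmod (wave n (axis i 1) (m - j) - 1))\<^sup>2))"
    by (subst sum.swap) (simp only: sum_distrib_left)
  also have "\<dots> \<le> (\<Sum>i\<in>(UNIV::'d set). (K1 + K2) * (real n)\<^sup>2 * (\<Lambda> / real n)\<^sup>2)"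
  proof (intro sum_mono mult_left_mono)
    fix i :: 'd
    have "real (n ^ CARD('d)) * (\<Sum>j\<in>?J. (cmod (dft n P (m - j)))\<^sup>2 * (cmod (wave n (axis i 1) (m - j) - 1))\<^sup>2)
        = (\<Sum>k\<in>?T. (cmod (P (k + axis i 1) - P k))\<^sup>2)"
      by (rule dft_shift_parseval(2)[where P = P, OF n0 per, symmetric])
    also have "\<dots> \<le> (\<Sum>k\<in>?T. (\<Lambda> / real n)\<^sup>2)" using lip by (intro sum_mono power_mono) auto
    also have "\<dots> = real (n ^ CARD('d)) * (\<Lambda> / real n)\<^sup>2" by (simp add: card_vec_box)
    finally show "(\<Sum>j\<in>?J. (cmod (dft n P (m - j)))\<^sup>2 * (cmod (wave n (axis i 1) (m - j) - 1))\<^sup>2) \<le> (\<Lambda> / real n)\<^sup>2"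
      using n0 by (simp add: mult_le_cancel_left)
  qed (use K in auto)
  also have "\<dots> = (K1 + K2) * (real CARD('d) * \<Lambda>\<^sup>2)"
    using n0 by (simp add: power_divide)
  finally show ?thesis unfolding K1_def K2_def .
qed

text \<open>The identity for packets compares row \<open>m\<close> with the symbol at the point of
  \<open>m\<close>, but an approximate eigenvalue must be one number for the whole packet. It is
  taken at the window corner \<open>y\<close>, and the change of base point costs the oscillation
  \<open>H\<close> over a window.\<close>

lemma packet_symbol_error:
  fixes P :: "int ^ 'd \<Rightarrow> int ^ 'd \<Rightarrow> complex"
  assumes N: "N > 0" and L: "L > 0" "L \<le> N" and n: "2 * N \<le> n" and m: "m \<in> grid N"
    and per: "\<And>k. P m (\<chi> i. vec_nth k i mod int n) = P m k"
    and E: "(\<Sum>j\<in>vec_box (\<lambda>_. {1..<1 + int n}). (cmod (dft n (P m) (m - j)))\<^sup>2 * (window_gap N L m j / real (L ^ CARD('d)))) \<le> E"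
    and H: "H \<ge> 0" "\<And>y k. y \<in> grid N \<Longrightarrow> window N L y m \<Longrightarrow> cmod (P m k - P y k) \<le> H"
  shows "(\<Sum>(y, k)\<in>packet_index N n. (cmod ((\<Sum>j\<in>grid N. dft n (P m) (m - j) * packet N L n (y, k) j) - P y k * packet N L n (y, k) m))\<^sup>2)
    \<le> 2 * E + 2 * H\<^sup>2"
proof -
  let ?T = "vec_box (\<lambda>_::'d. {0..<int n})"
  have Nn: "N \<le> n" using n by simp
  define a where "a y k = (\<Sum>j\<in>grid N. dft n (P m) (m - j) * packet N L n (y, k) j)" for y k :: "int ^ 'd"
  have "(\<Sum>(y, k)\<in>packet_index N n. (cmod (a y k - P y k * packet N L n (y, k) m))\<^sup>2)
     \<le> (\<Sum>(y, k)\<in>packet_index N n. 2 * (cmod (a y k - P m k * packet N L n (y, k) m))\<^sup>2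
         + 2 * (if window N L y m then H\<^sup>2 / real (L ^ CARD('d) * n ^ CARD('d)) else 0))"
  proof (intro sum_mono)
    fix f :: "(int ^ 'd) \<times> (int ^ 'd)" assume f: "f \<in> packet_index N n"
    obtain y k where yk: "f = (y, k)" by force
    let ?u = "a y k - P m k * packet N L n (y, k) m" and ?v = "(P m k - P y k) * packet N L n (y, k) m"
    have "a y k - P y k * packet N L n (y, k) m = ?u + ?v" by (simp add: algebra_simps)
    then have "cmod (a y k - P y k * packet N L n (y, k) m) \<le> cmod ?u + cmod ?v" by (metis norm_triangle_ineq)
    then have "(cmod (a y k - P y k * packet N L n (y, k) m))\<^sup>2 \<le> (cmod ?u + cmod ?v)\<^sup>2" by (intro power_mono) auto
    also have "\<dots> \<le> 2 * (cmod ?u)\<^sup>2 + 2 * (cmod ?v)\<^sup>2"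
      using sum_squares_bound[of "cmod ?u" "cmod ?v"] by (simp add: power2_sum)
    also have "(cmod ?v)\<^sup>2 \<le> (if window N L y m then H\<^sup>2 / real (L ^ CARD('d) * n ^ CARD('d)) else 0)"
    proof (cases "window N L y m")
      case True
      have "(cmod (P m k - P y k))\<^sup>2 \<le> H\<^sup>2" using H(2)[of y k] True f yk by (intro power_mono) auto
      then show ?thesis using True unfolding norm_mult power_mult_distrib norm_packet by (simp add: divide_right_mono)
    qed (simp add: packet_def)
    finally show "(case f of (y, k) \<Rightarrow> (cmod (a y k - P y k * packet N L n (y, k) m))\<^sup>2)
      \<le> (case f of (y, k) \<Rightarrow> 2 * (cmod (a y k - P m k * packet N L n (y, k) m))\<^sup>2
         + 2 * (if window N L y m then H\<^sup>2 / real (L ^ CARD('d) * n ^ CARD('d)) else 0))" by (simp add: yk)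
  qed
  also have "\<dots> = 2 * (\<Sum>(y, k)\<in>packet_index N n. (cmod (a y k - P m k * packet N L n (y, k) m))\<^sup>2)
      + 2 * (\<Sum>y\<in>grid N. \<Sum>k\<in>?T. (if window N L y m then H\<^sup>2 / real (L ^ CARD('d) * n ^ CARD('d)) else 0))"
    unfolding sum.cartesian_product by (simp add: case_prod_unfold sum.distrib sum_distrib_left)
  also have "(\<Sum>y\<in>grid N. \<Sum>k\<in>?T. (if window N L y m then H\<^sup>2 / real (L ^ CARD('d) * n ^ CARD('d)) else 0))
      = (\<Sum>y\<in>grid N. if window N L y m then H\<^sup>2 / real (L ^ CARD('d)) else 0)"
    using N n by (intro sum.cong refl) (simp add: card_vec_box)
  also have "\<dots> = H\<^sup>2" unfolding sum_packet_const[OF N L(2)] using L by simp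
  also have "(\<Sum>(y, k)\<in>packet_index N n. (cmod (a y k - P m k * packet N L n (y, k) m))\<^sup>2) \<le> E"
    using E packet_dft_identity[where P = "P m", OF N L Nn m per] by (simp add: a_def)
  finally show ?thesis unfolding a_def by simp
qed

section \<open>Riemann sums and the symbol class\<close>

text \<open>Covering is expressed by total mass: disjoint cells of full measure miss only a null
  set. Half-open cells do miss the upper faces of the cube.\<close>

lemma integral_approx_partition:
  fixes g :: "'a \<Rightarrow> 'b::{banach, second_countable_topology}"
  assumes F: "finite F" and M: "finite_measure M"
    and C: "\<And>f. f \<in> F \<Longrightarrow> C f \<in> sets M" "\<And>f. f \<in> F \<Longrightarrow> measure M (C f) = c"
    and disj: "disjoint_family_on C F"
    and total: "real (card F) * c = measure M (space M)"
    and g: "integrable M g"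
    and e: "\<And>f x. f \<in> F \<Longrightarrow> x \<in> C f \<Longrightarrow> norm (g x - v f) \<le> e f"
  shows "norm (integral\<^sup>L M g - (\<Sum>f\<in>F. c *\<^sub>R v f)) \<le> c * (\<Sum>f\<in>F. e f)"
proof -
  interpret finite_measure M by (rule M)
  have sub: "C f \<subseteq> space M" if "f \<in> F" for f using C(1)[OF that] sets.sets_into_space by blast
  have U: "(\<Union>f\<in>F. C f) \<in> sets M" using C(1) F by auto
  have "measure M (\<Union>f\<in>F. C f) = (\<Sum>f\<in>F. measure M (C f))"
    using C(1) by (intro finite_measure_finite_Union F disj) auto
  then have "measure M (\<Union>f\<in>F. C f) = measure M (space M)" using C(2) total by simp
  then have "measure M (space M - (\<Union>f\<in>F. C f)) = 0" using finite_measure_compl[OF U] by simp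
  then have "space M - (\<Union>f\<in>F. C f) \<in> null_sets M"
    using U by (intro null_setsI) (auto simp: emeasure_eq_measure)
  then have ae: "AE x in M. x \<in> (\<Union>f\<in>F. C f)"
    by (rule AE_I') auto
  have int: "integrable M (\<lambda>x. indicator (C f) x *\<^sub>R g x)" if "f \<in> F" for f
    using C(1)[OF that] g by (rule integrable_mult_indicator)
  have intc: "integrable M (\<lambda>x. indicator (C f) x *\<^sub>R v f)" if "f \<in> F" for f
    using C(1)[OF that] by (intro integrable_mult_indicator) auto
  have "integral\<^sup>L M g = integral\<^sup>L M (\<lambda>x. \<Sum>f\<in>F. indicator (C f) x *\<^sub>R g x)"
  proof (rule integral_cong_AE)
    show "AE x in M. g x = (\<Sum>f\<in>F. indicator (C f) x *\<^sub>R g x)"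
      using ae
    proof eventually_elim
      case (elim x)
      then obtain f where f: "f \<in> F" "x \<in> C f" by auto
      have "indicator (C h) x = (if h = f then 1 else (0::real))" if "h \<in> F" for h
        using disj f that by (auto simp: disjoint_family_on_def indicator_def)
      then have "(\<Sum>h\<in>F. indicator (C h) x *\<^sub>R g x) = (\<Sum>h\<in>F. if h = f then g x else 0)"
        by (intro sum.cong refl) auto
      then show ?case using F f by simp
    qed
  qed (use g int in auto)
  also have "\<dots> = (\<Sum>f\<in>F. integral\<^sup>L M (\<lambda>x. indicator (C f) x *\<^sub>R g x))"
    by (rule Bochner_Integration.integral_sum) (rule int)
  finally have ig: "integral\<^sup>L M g = (\<Sum>f\<in>F. integral\<^sup>L M (\<lambda>x. indicator (C f) x *\<^sub>R g x))" .
  have "integral\<^sup>L M g - (\<Sum>f\<in>F. c *\<^sub>R v f)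
      = (\<Sum>f\<in>F. integral\<^sup>L M (\<lambda>x. indicator (C f) x *\<^sub>R g x) - integral\<^sup>L M (\<lambda>x. indicator (C f) x *\<^sub>R v f))"
  proof -
    have "integral\<^sup>L M (\<lambda>x. indicator (C f) x *\<^sub>R v f) = c *\<^sub>R v f" if "f \<in> F" for f
      using has_bochner_integral_integral_eq[OF has_bochner_integral_indicator[OF C(1)[OF that], of "v f"]] C(2)[OF that]
      by (simp add: emeasure_eq_measure)
    then show ?thesis unfolding ig by (simp add: sum_subtractf)
  qed
  also have "\<dots> = (\<Sum>f\<in>F. integral\<^sup>L M (\<lambda>x. indicator (C f) x *\<^sub>R g x - indicator (C f) x *\<^sub>R v f))"
    by (intro sum.cong refl Bochner_Integration.integral_diff[symmetric] int intc)
  also have "norm \<dots> \<le> (\<Sum>f\<in>F. c * e f)"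
  proof (intro sum_norm_le)
    fix f assume f: "f \<in> F"
    have "norm (integral\<^sup>L M (\<lambda>x. indicator (C f) x *\<^sub>R g x - indicator (C f) x *\<^sub>R v f)) \<le> integral\<^sup>L M (\<lambda>x. indicator (C f) x * e f)"
    proof (rule order_trans[OF integral_norm_bound], rule integral_mono)
      show "integrable M (\<lambda>x. norm (indicator (C f) x *\<^sub>R g x - indicator (C f) x *\<^sub>R v f))"
        using int[OF f] intc[OF f] by (intro integrable_norm Bochner_Integration.integrable_diff)
      show "integrable M (\<lambda>x. indicator (C f) x * e f)"
        using C(1)[OF f] by (intro integrable_mult_left integrable_real_indicator) (auto simp: emeasure_eq_measure)
      show "norm (indicator (C f) x *\<^sub>R g x - indicator (C f) x *\<^sub>R v f) \<le> indicator (C f) x * e f" for x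
        using e[OF f, of x] by (auto simp: indicator_def)
    qed
    also have "\<dots> = c * e f" using C[OF f] sub[OF f] by (simp add: Int_absorb2)
    finally show "norm (integral\<^sup>L M (\<lambda>x. indicator (C f) x *\<^sub>R g x - indicator (C f) x *\<^sub>R v f)) \<le> c * e f" .
  qed
  finally show ?thesis by (simp only: sum_distrib_left)
qed

section \<open>Lattice cells and Riemann sums\<close>

definition lattice_cell :: "nat \<Rightarrow> int ^ 'd \<Rightarrow> (real ^ 'd) set" where
  "lattice_cell n k = {x. \<forall>i. of_int (vec_nth k i) / real n \<le> vec_nth x i \<and> vec_nth x i < (of_int (vec_nth k i) + 1) / real n}"

definition lattice_point :: "nat \<Rightarrow> int ^ 'd \<Rightarrow> real ^ 'd" where
  "lattice_point n k = (\<chi> i. of_int (vec_nth k i) / real n)"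

lemma lattice_cell_measure:
  fixes k :: "int ^ 'd"
  assumes n: "n > 0"
  shows "lattice_cell n k \<in> sets borel" "emeasure lborel (lattice_cell n k) = ennreal (1 / real (n ^ CARD('d)))"
proof -
  let ?a = "lattice_point n k" and ?b = "(\<chi> i. (of_int (vec_nth k i) + 1) / real n) :: real ^ 'd"
  have "lattice_cell n k = (\<Inter>i. {x. vec_nth ?a i \<le> vec_nth x i} \<inter> {x. vec_nth x i < vec_nth ?b i})"
    by (auto simp: lattice_cell_def lattice_point_def)
  also have "\<dots> \<in> sets borel"
    by (intro sets.countable_INT'' sets.Int borel_closed borel_open closed_Collect_le open_Collect_less continuous_intros) auto
  finally show meas: "lattice_cell n k \<in> sets borel" .
  have ab: "vec_nth ?a i < vec_nth ?b i" for i using n by (simp add: lattice_point_def divide_strict_right_mono)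
  have cb: "emeasure lborel (cbox ?a ?b) = ennreal (1 / real (n ^ CARD('d)))"
  proof -
    have "cbox ?a ?b \<noteq> {}" using ab by (auto simp: interval_ne_empty_cart intro: less_imp_le)
    then have "measure lborel (cbox ?a ?b) = (\<Prod>i\<in>UNIV. vec_nth ?b i - vec_nth ?a i)"
      using content_cbox_cart[of ?a ?b] by simp
    also have "\<dots> = (\<Prod>i\<in>(UNIV::'d set). 1 / real n)"
      by (intro prod.cong refl) (simp add: lattice_point_def diff_divide_distrib[symmetric])
    also have "\<dots> = 1 / real (n ^ CARD('d))" by (simp add: power_divide)
    finally show ?thesis using emeasure_eq_ennreal_measure[of lborel "cbox ?a ?b"] emeasure_lborel_cbox_finite[of ?a ?b] by simp
  qed
  have "emeasure lborel (box ?a ?b) \<le> emeasure lborel (lattice_cell n k)"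
    using meas by (intro emeasure_mono) (auto simp: mem_box_cart lattice_cell_def lattice_point_def less_imp_le)
  moreover have "emeasure lborel (lattice_cell n k) \<le> emeasure lborel (cbox ?a ?b)"
    using meas by (intro emeasure_mono) (auto simp: mem_box_cart lattice_cell_def lattice_point_def less_imp_le)
  moreover have "emeasure lborel (box ?a ?b) = emeasure lborel (cbox ?a ?b)"
    by (simp add: emeasure_lborel_box_eq emeasure_lborel_cbox_eq)
  ultimately show "emeasure lborel (lattice_cell n k) = ennreal (1 / real (n ^ CARD('d)))" using cb by simp
qed

lemma lattice_cell_disjoint: "disjoint_family_on (lattice_cell n) A" if n: "n > 0"
  unfolding disjoint_family_on_def
proof (intro ballI impI)
  fix k l :: "int ^ 'a" assume kl: "k \<noteq> l"
  show "lattice_cell n k \<inter> lattice_cell n l = {}"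
  proof (rule ccontr)
    assume "lattice_cell n k \<inter> lattice_cell n l \<noteq> {}"
    then obtain x where x: "x \<in> lattice_cell n k" "x \<in> lattice_cell n l" by blast
    have "vec_nth k i = vec_nth l i" for i
    proof -
      have "of_int (vec_nth k i) \<le> vec_nth x i * real n" "vec_nth x i * real n < of_int (vec_nth k i) + 1"
        "of_int (vec_nth l i) \<le> vec_nth x i * real n" "vec_nth x i * real n < of_int (vec_nth l i) + 1"
        using x n by (auto simp: lattice_cell_def field_simps)
      then show ?thesis by linarith
    qed
    then show False using kl by (simp add: Finite_Cartesian_Product.vec_eq_iff)
  qed
qed

lemma lattice_cell_subset:
  assumes n: "n > 0" and k: "k \<in> vec_box (\<lambda>_. {0..<int n})"
  shows "lattice_cell n k \<subseteq> unit_cube"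
proof
  fix x assume x: "x \<in> lattice_cell n k"
  have "0 \<le> vec_nth x i \<and> vec_nth x i \<le> 1" for i
  proof -
    have ki: "0 \<le> vec_nth k i" "vec_nth k i < int n" using k by (auto simp: vec_box_def)
    then have "real_of_int (vec_nth k i) + 1 \<le> real n" by linarith
    moreover have "of_int (vec_nth k i) \<le> vec_nth x i * real n" "vec_nth x i * real n < of_int (vec_nth k i) + 1"
      using x n by (auto simp: lattice_cell_def field_simps)
    moreover have "0 \<le> real_of_int (vec_nth k i)" using ki by simp
    ultimately have "0 \<le> vec_nth x i * real n" "vec_nth x i * real n \<le> 1 * real n" by linarith+
    then show ?thesis using n by (simp add: zero_le_mult_iff mult_le_cancel_right)
  qed
  then show "x \<in> unit_cube" by (simp add: mem_box_cart)
qed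

text \<open>Two corners are used. A frequency is the lower corner of its cell, \<open>u = 0\<close>.
  A spatial index \<open>m\<close> counted from 1 owns the cell of \<open>m - 1\<close> and is its
  upper corner, \<open>u = 1\<close>.\<close>

lemma lattice_cell_dist:
  fixes x :: "real ^ 'd"
  assumes x: "x \<in> lattice_cell n k" and u: "\<And>i. vec_nth u i \<in> {0, 1}"
  shows "norm (x - lattice_point n (k + u)) \<le> real CARD('d) / real n"
proof -
  have "norm (x - lattice_point n (k + u)) \<le> (\<Sum>i\<in>UNIV. \<bar>vec_nth (x - lattice_point n (k + u)) i\<bar>)" by (rule norm_le_l1_cart)
  also have "\<dots> \<le> (\<Sum>i\<in>(UNIV::'d set). 1 / real n)"
  proof (intro sum_mono)
    fix i
    have "(of_int (vec_nth k i) + 1) / real n = of_int (vec_nth k i) / real n + 1 / real n" by (simp add: add_divide_distrib)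
    moreover have "of_int (vec_nth k i) / real n \<le> vec_nth x i" "vec_nth x i < (of_int (vec_nth k i) + 1) / real n"
      using x by (auto simp: lattice_cell_def)
    ultimately show "\<bar>vec_nth (x - lattice_point n (k + u)) i\<bar> \<le> 1 / real n"
      using u[of i] by (auto simp: lattice_point_def abs_le_iff)
  qed
  finally show ?thesis by simp
qed

lemma lattice_point_in_cell: "n > 0 \<Longrightarrow> lattice_point n k \<in> lattice_cell n k"
  by (simp add: lattice_point_def lattice_cell_def divide_strict_right_mono)

lemma lattice_point_in_cube:
  assumes "n > 0" "k \<in> vec_box (\<lambda>_. {0..int n})"
  shows "lattice_point n k \<in> unit_cube"
proof -
  have "0 \<le> vec_nth (lattice_point n k) i \<and> vec_nth (lattice_point n k) i \<le> 1" for i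
  proof -
    have "0 \<le> vec_nth k i" "vec_nth k i \<le> int n" using assms by (auto simp: vec_box_def)
    then have "0 \<le> real_of_int (vec_nth k i)" "real_of_int (vec_nth k i) \<le> real n" by linarith+
    then show ?thesis using assms(1) by (simp add: lattice_point_def)
  qed
  then show ?thesis by (simp add: mem_box_cart)
qed

lemma measure_unit_cube: "measure lborel (unit_cube :: (real ^ 'd) set) = 1"
  using content_cbox_cart[of "0 :: real ^ 'd" 1] by (simp add: interval_ne_empty_cart)

lemma riemann_sum_unit_cube:
  fixes g :: "real ^ 'd \<Rightarrow> complex"
  assumes g: "continuous_on unit_cube g"
  shows "(\<lambda>n. (\<Sum>k\<in>vec_box (\<lambda>_. {0..<int n}). g (lattice_point n k)) / of_nat (n ^ CARD('d)))
     \<longlonglongrightarrow> (LINT \<xi>:unit_cube|lborel. g \<xi>)"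
proof (rule LIMSEQ_I)
  fix r :: real assume r: "r > 0"
  let ?Q = "unit_cube :: (real ^ 'd) set" and ?T = "\<lambda>n. vec_box (\<lambda>_::'d. {0..<int n})"
  let ?M = "restrict_space lborel ?Q"
  have Qs: "?Q \<inter> space lborel \<in> sets lborel" by simp
  have fm: "finite_measure ?M"
    by (intro finite_measureI) (use emeasure_lborel_cbox_finite[of "0::real^'d" 1] in \<open>simp add: emeasure_restrict_space less_top\<close>)
  have mQ: "measure ?M (space ?M) = 1"
    using measure_unit_cube[where 'd = 'd] by (simp add: measure_restrict_space)
  have intg: "integrable ?M g"
    using borel_integrable_compact[OF compact_cbox g] by (subst integrable_restrict_space) (auto simp: set_integrable_def)
  obtain d where d: "d > 0" "\<And>x y. x \<in> ?Q \<Longrightarrow> y \<in> ?Q \<Longrightarrow> dist y x < d \<Longrightarrow> dist (g y) (g x) < r / 2"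
    using compact_uniformly_continuous[OF g compact_cbox] r unfolding uniformly_continuous_on_def by (metis half_gt_zero)
  obtain n0 :: nat where n0: "real CARD('d) / d < real n0" using reals_Archimedean2 by blast
  show "\<exists>no. \<forall>n\<ge>no. norm ((\<Sum>k\<in>?T n. g (lattice_point n k)) / of_nat (n ^ CARD('d)) - (LINT \<xi>:unit_cube|lborel. g \<xi>)) < r"
  proof (intro exI[of _ "max 1 n0"] allI impI)
    fix n assume n: "n \<ge> max 1 n0"
    then have npos: "n > 0" and nd: "real CARD('d) / real n < d" using n0 d(1) by (auto simp: field_simps less_le_trans)
    have "norm (integral\<^sup>L ?M g - (\<Sum>k\<in>?T n. (1 / real (n ^ CARD('d))) *\<^sub>R g (lattice_point n k))) \<le> 1 / real (n ^ CARD('d)) * (\<Sum>k\<in>?T n. r / 2)"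
    proof (rule integral_approx_partition[OF _ fm])
      show "finite (?T n)" by (intro finite_vec_box) simp
      show "disjoint_family_on (lattice_cell n) (?T n)" by (rule lattice_cell_disjoint[OF npos])
      show "real (card (?T n)) * (1 / real (n ^ CARD('d))) = measure ?M (space ?M)"
        unfolding mQ using npos by (simp add: card_vec_box)
      show "integrable ?M g" by (rule intg)
      fix k assume k: "k \<in> ?T n"
      have sub: "lattice_cell n k \<subseteq> ?Q" by (rule lattice_cell_subset[OF npos k])
      show "lattice_cell n k \<in> sets ?M"
        using sub lattice_cell_measure(1)[OF npos, of k] by (subst sets_restrict_space_iff) auto
      show "measure ?M (lattice_cell n k) = 1 / real (n ^ CARD('d))"
        using sub lattice_cell_measure(2)[OF npos, of k] by (subst measure_restrict_space) (auto simp: measure_def)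
      fix x assume x: "x \<in> lattice_cell n k"
      have "norm (x - lattice_point n k) \<le> real CARD('d) / real n"
        using lattice_cell_dist[OF x, of 0] by simp
      then have "dist x (lattice_point n k) < d" using nd by (simp add: dist_norm)
      then have "dist (g x) (g (lattice_point n k)) < r / 2"
        using d(2)[of "lattice_point n k" x] sub x lattice_point_in_cell[OF npos, of k] by blast
      then show "norm (g x - g (lattice_point n k)) \<le> r / 2" by (simp add: dist_norm)
    qed
    also have "\<dots> = r / 2" using npos by (simp add: card_vec_box)
    also have "\<dots> < r" using r by simp
    also have "integral\<^sup>L ?M g = (LINT \<xi>:unit_cube|lborel. g \<xi>)"
      unfolding set_lebesgue_integral_def by (rule integral_restrict_space[OF Qs])
    also have "(\<Sum>k\<in>?T n. (1 / real (n ^ CARD('d))) *\<^sub>R g (lattice_point n k)) = (\<Sum>k\<in>?T n. g (lattice_point n k)) / of_nat (n ^ CARD('d))"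
      by (simp add: scaleR_conv_of_real sum_divide_distrib)
    finally show "norm ((\<Sum>k\<in>?T n. g (lattice_point n k)) / of_nat (n ^ CARD('d)) - (LINT \<xi>:unit_cube|lborel. g \<xi>)) < r"
      by (simp add: norm_minus_commute)
  qed
qed

section \<open>Quantitative content of the symbol class\<close>

lemma holder_norm_le:
  assumes h: "holder_norm \<rho> K g \<le> ennreal C" and C: "C \<ge> 0"
  shows "\<And>x. x \<in> K \<Longrightarrow> norm (g x) \<le> C"
    and "\<And>x y. x \<in> K \<Longrightarrow> y \<in> K \<Longrightarrow> norm (g x - g y) \<le> C * dist x y powr \<rho>"
proof -
  let ?A = "SUP x\<in>K. ennreal (norm (g x))"
  let ?B = "SUP (x, y)\<in>{(x, y). x \<in> K \<and> y \<in> K \<and> x \<noteq> y}. ennreal (norm (g x - g y) / dist x y powr \<rho>)"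
  have le: "?A \<le> ?A + ?B" "?B \<le> ?A + ?B" by auto
  note A = order_trans[OF le(1) h[unfolded holder_norm_def]] and B = order_trans[OF le(2) h[unfolded holder_norm_def]]
  show "norm (g x) \<le> C" if "x \<in> K" for x
  proof -
    have "ennreal (norm (g x)) \<le> ?A" using that by (rule SUP_upper)
    then show ?thesis using A C by (meson ennreal_le_iff order_trans)
  qed
  show "norm (g x - g y) \<le> C * dist x y powr \<rho>" if "x \<in> K" "y \<in> K" for x y
  proof (cases "x = y")
    case False
    have "ennreal (norm (g x - g y) / dist x y powr \<rho>) \<le> ?B"
      using False that by (intro SUP_upper2[of "(x, y)"]) auto
    then have "norm (g x - g y) / dist x y powr \<rho> \<le> C" using B C by (meson ennreal_le_iff order_trans)
    then show ?thesis using False by (simp add: divide_le_eq)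
  qed simp
qed

lemma partial_deriv_lipschitz:
  fixes g :: "real ^ 'd \<Rightarrow> complex"
  assumes diff: "\<And>\<xi>. g differentiable (at \<xi>)" and b: "\<And>i \<xi>. norm (partial_deriv i g \<xi>) \<le> \<Lambda>"
  shows "norm (g \<xi> - g \<xi>') \<le> real CARD('d) * \<Lambda> * norm (\<xi> - \<xi>')"
proof -
  have L: "\<Lambda> \<ge> 0" using b order_trans norm_ge_zero by blast
  have on: "onorm (frechet_derivative g (at \<eta>)) \<le> real CARD('d) * \<Lambda>" for \<eta>
  proof (rule onorm_bound)
    show "0 \<le> real CARD('d) * \<Lambda>" using L by simp
    fix h :: "real ^ 'd"
    interpret bounded_linear "frechet_derivative g (at \<eta>)"
      using diff frechet_derivative_works has_derivative_bounded_linear by blast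
    have "frechet_derivative g (at \<eta>) h = frechet_derivative g (at \<eta>) (\<Sum>i\<in>UNIV. vec_nth h i *\<^sub>R axis i 1)"
      using basis_expansion[of h] by (simp add: scalar_mult_eq_scaleR)
    also have "\<dots> = (\<Sum>i\<in>UNIV. vec_nth h i *\<^sub>R partial_deriv i g \<eta>)"
      by (simp add: sum scaleR partial_deriv_def)
    finally have "norm (frechet_derivative g (at \<eta>) h) \<le> (\<Sum>i\<in>(UNIV::'d set). norm h * \<Lambda>)"
      by (simp only:) (intro sum_norm_le, simp only: norm_scaleR real_norm_def, intro mult_mono component_le_norm_cart b, auto)
    then show "norm (frechet_derivative g (at \<eta>) h) \<le> real CARD('d) * \<Lambda> * norm h" by (simp add: mult_ac)
  qed
  show ?thesis
  proof (rule differentiable_bound[of UNIV g "\<lambda>\<eta>. frechet_derivative g (at \<eta>)"])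
    show "(g has_derivative frechet_derivative g (at \<eta>)) (at \<eta> within UNIV)" for \<eta>
      using diff frechet_derivative_works by blast
  qed (use on in auto)
qed

text \<open>The multi-indices \<open>[]\<close> and \<open>[i]\<close> yield the Hoelder modulus in
  x and the Lipschitz constant in \<xi>; finiteness of the family of pieces makes both uniform in
  \<open>j\<close>.\<close>

lemma pw_symbol_bounds:
  fixes p :: "real ^ 'd \<Rightarrow> real ^ 'd \<Rightarrow> complex"
  assumes p: "pw_symbol \<rho> s U p"
  obtains S H \<Lambda> where "S > 0" "H \<ge> 0" "\<Lambda> \<ge> 0" "\<And>x \<xi>. x \<in> unit_cube \<Longrightarrow> cmod (p x \<xi>) \<le> S"
    "\<And>j x x' \<xi>. j < s \<Longrightarrow> x \<in> U j \<Longrightarrow> x' \<in> U j \<Longrightarrow> cmod (p x \<xi> - p x' \<xi>) \<le> H * dist x x' powr \<rho>"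
    "\<And>j x \<xi> \<xi>'. j < s \<Longrightarrow> x \<in> U j \<Longrightarrow> cmod (p x \<xi> - p x \<xi>') \<le> \<Lambda> * norm (\<xi> - \<xi>')"
proof -
  have smooth: "\<And>x. x \<in> unit_cube \<Longrightarrow> smooth_on_torus (p x)" and op: "\<And>j. j < s \<Longrightarrow> openin (top_of_set unit_cube) (U j)"
    and bdd: "bounded {p x \<xi> | x \<xi>. x \<in> unit_cube}"
    using p by (auto simp: pw_symbol_def)
  have sub: "U j \<subseteq> unit_cube" if "j < s" for j using openin_imp_subset[OF op[OF that]] .
  obtain S where S: "\<And>x \<xi>. x \<in> unit_cube \<Longrightarrow> cmod (p x \<xi>) \<le> S" "S > 0"
    using bdd unfolding bounded_pos by blast
  have ex: "\<exists>f. (\<forall>x\<in>U j. \<forall>\<xi>. f x \<xi> = p x \<xi>) \<and>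
        (\<forall>\<beta>. \<exists>C>0. \<forall>\<xi>. holder_norm \<rho> (closure (U j)) (\<lambda>x. multi_deriv \<beta> (f x) \<xi>) \<le> ennreal C)" if "j < s" for j
    using p that unfolding pw_symbol_def by metis
  have "\<exists>C>0. (\<forall>x\<in>U j. \<forall>x'\<in>U j. \<forall>\<xi>. cmod (p x \<xi> - p x' \<xi>) \<le> C * dist x x' powr \<rho>)
      \<and> (\<forall>x\<in>U j. \<forall>i \<xi>. norm (partial_deriv i (p x) \<xi>) \<le> C)" if j: "j < s" for j
  proof -
    obtain f where f: "\<And>x \<xi>. x \<in> U j \<Longrightarrow> f x \<xi> = p x \<xi>"
      and fC: "\<And>\<beta>. \<exists>C>0. \<forall>\<xi>. holder_norm \<rho> (closure (U j)) (\<lambda>x. multi_deriv \<beta> (f x) \<xi>) \<le> ennreal C"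
      using ex[OF j] by blast
    have fp: "f x = p x" if "x \<in> U j" for x using f[OF that] by auto
    have cl: "x \<in> closure (U j)" if "x \<in> U j" for x using that closure_subset by blast
    obtain C0 where C0: "C0 > 0" "\<And>\<xi>. holder_norm \<rho> (closure (U j)) (\<lambda>x. multi_deriv [] (f x) \<xi>) \<le> ennreal C0"
      using fC by metis
    have "\<forall>i. \<exists>C. C > 0 \<and> (\<forall>\<xi>. holder_norm \<rho> (closure (U j)) (\<lambda>x. multi_deriv [i] (f x) \<xi>) \<le> ennreal C)"
      using fC by blast
    from choice[OF this] obtain C1 where C1: "\<And>i. C1 i > 0"
      "\<And>i \<xi>. holder_norm \<rho> (closure (U j)) (\<lambda>x. multi_deriv [i] (f x) \<xi>) \<le> ennreal (C1 i)"
      by blast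
    define C where "C = C0 + (\<Sum>i\<in>UNIV. C1 i)"
    have sC: "(\<Sum>i\<in>UNIV. C1 i) \<ge> 0" using C1(1) by (intro sum_nonneg) (auto intro: less_imp_le)
    have C: "C > 0" "C0 \<le> C" "C1 i \<le> C" for i
    proof -
      show "C > 0" "C0 \<le> C" using C0(1) sC by (auto simp: C_def)
      have "C1 i \<le> (\<Sum>i\<in>UNIV. C1 i)" using C1(1) by (intro member_le_sum) (auto intro: less_imp_le)
      then show "C1 i \<le> C" using C0(1) by (simp add: C_def)
    qed
    have "cmod (p x \<xi> - p x' \<xi>) \<le> C * dist x x' powr \<rho>" if x: "x \<in> U j" "x' \<in> U j" for x x' \<xi>
    proof -
      have "cmod (p x \<xi> - p x' \<xi>) \<le> C0 * dist x x' powr \<rho>"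
        using holder_norm_le(2)[OF C0(2)[of \<xi>] less_imp_le[OF C0(1)] cl[OF x(1)] cl[OF x(2)]] fp[OF x(1)] fp[OF x(2)]
        by (simp add: multi_deriv_def)
      also have "\<dots> \<le> C * dist x x' powr \<rho>" using C by (intro mult_right_mono) auto
      finally show ?thesis .
    qed
    moreover have "norm (partial_deriv i (p x) \<xi>) \<le> C" if x: "x \<in> U j" for x i \<xi>
      using holder_norm_le(1)[OF C1(2)[of i \<xi>] less_imp_le[OF C1(1)] cl[OF x]] fp[OF x] C(3)[of i]
      by (simp add: multi_deriv_def)
    ultimately show ?thesis using C(1) by blast
  qed
  then obtain C where C: "\<And>j. j < s \<Longrightarrow> C j > 0"
    "\<And>j x x' \<xi>. j < s \<Longrightarrow> x \<in> U j \<Longrightarrow> x' \<in> U j \<Longrightarrow> cmod (p x \<xi> - p x' \<xi>) \<le> C j * dist x x' powr \<rho>"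
    "\<And>j x i \<xi>. j < s \<Longrightarrow> x \<in> U j \<Longrightarrow> norm (partial_deriv i (p x) \<xi>) \<le> C j" by metis
  define H where "H = (\<Sum>j<s. C j)"
  have H0: "H \<ge> 0" unfolding H_def using C(1) by (intro sum_nonneg) (auto intro: less_imp_le)
  have CH: "C j \<le> H" if "j < s" for j
    unfolding H_def using C(1) that by (intro member_le_sum) (auto intro: less_imp_le)
  show thesis
  proof (rule that[of S H "real CARD('d) * H"])
    show "cmod (p x \<xi> - p x' \<xi>) \<le> H * dist x x' powr \<rho>" if "j < s" "x \<in> U j" "x' \<in> U j" for j x x' \<xi>
      by (rule order_trans[OF C(2)[OF that]]) (use CH[OF that(1)] in \<open>auto intro: mult_right_mono\<close>)
    show "cmod (p x \<xi> - p x \<xi>') \<le> real CARD('d) * H * norm (\<xi> - \<xi>')" if j: "j < s" "x \<in> U j" for j x \<xi> \<xi>'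
    proof (rule partial_deriv_lipschitz)
      have "smooth_on_torus (p x)" using smooth sub j by blast
      then show "p x differentiable at \<eta>" for \<eta> unfolding smooth_on_torus_def by (metis foldr_Nil id_apply multi_deriv_def)
      show "norm (partial_deriv i (p x) \<eta>) \<le> H" for i \<eta> using C(3)[OF j] CH[OF j(1)] order_trans by blast
    qed
  qed (use S H0 in auto)
qed

lemma smooth_on_torus_periodic:
  fixes g :: "real ^ 'd \<Rightarrow> complex"
  assumes g: "smooth_on_torus g"
  shows "g (\<xi> + (\<chi> i. of_int (vec_nth m i))) = g \<xi>" "continuous_on A g"
proof -
  have per: "g (\<xi> + axis i 1) = g \<xi>" for i \<xi> using g by (simp add: smooth_on_torus_def)
  have nat: "g (\<xi> + axis i (of_nat n)) = g \<xi>" for i n \<xi>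
  proof (induction n)
    case 0
    have "axis i (0::real) = 0" by (simp add: Finite_Cartesian_Product.vec_eq_iff axis_def)
    then show ?case by (metis add_0_right of_nat_0)
  next
    case (Suc n)
    have "\<xi> + axis i (of_nat (Suc n)) = (\<xi> + axis i (of_nat n)) + axis i 1"
      by (simp add: Finite_Cartesian_Product.vec_eq_iff axis_def)
    then show ?case using per Suc by metis
  qed
  have int: "g (\<xi> + axis i (of_int v)) = g \<xi>" for i v \<xi>
  proof (cases "v \<ge> 0")
    case True
    then show ?thesis using nat[of \<xi> i "nat v"] by simp
  next
    case False
    have "\<xi> = (\<xi> + axis i (of_int v)) + axis i (of_nat (nat (- v)))"
      using False by (simp add: Finite_Cartesian_Product.vec_eq_iff axis_def)
    then show ?thesis using nat by metis
  qed
  have "g (\<xi> + (\<Sum>i\<in>A. axis i (of_int (vec_nth m i)))) = g \<xi>" if "finite A" for A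
    using that
  proof (induction A)
    case (insert i A)
    then show ?case using int[of "\<xi> + (\<Sum>i\<in>A. axis i (of_int (vec_nth m i)))" i "vec_nth m i"] by (simp add: add_ac)
  qed simp
  moreover have "(\<chi> i. of_int (vec_nth m i)) = (\<Sum>i\<in>UNIV. axis i (real_of_int (vec_nth m i)))"
    by (simp add: Finite_Cartesian_Product.vec_eq_iff axis_def)
  ultimately show "g (\<xi> + (\<chi> i. of_int (vec_nth m i))) = g \<xi>" by simp
  have "g differentiable at \<xi>" for \<xi> using g unfolding smooth_on_torus_def by (metis foldr_Nil id_apply multi_deriv_def)
  then show "continuous_on A g" by (meson continuous_at_imp_continuous_on differentiable_imp_continuous_within)
qed

text \<open>The centre lies in the closure of some piece and not on its frontier, hence in the
  piece. A ball is connected, so if it meets a set but not its frontier it is contained in the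
  set.\<close>

lemma pw_symbol_ball_subset:
  fixes x :: "real ^ 'd"
  assumes p: "pw_symbol \<rho> s U p" and x: "x \<in> unit_cube" and r: "r > 0"
    and dis: "ball x r \<inter> singular_set s U = {}"
  shows "\<exists>j<s. ball x r \<subseteq> U j"
proof -
  have "closure (\<Union>j<s. U j) = unit_cube" using p by (simp add: pw_symbol_def)
  moreover have "closure (\<Union>j<s. U j) \<subseteq> (\<Union>j<s. closure (U j))"
  proof (rule closure_minimal)
    show "(\<Union>j<s. U j) \<subseteq> (\<Union>j<s. closure (U j))" using closure_subset by fast
  qed (intro closed_UN, auto)
  ultimately have "x \<in> (\<Union>j<s. closure (U j))" using x by blast
  then obtain j where j: "j < s" "x \<in> closure (U j)" by auto
  have dj: "ball x r \<inter> frontier (U j) = {}" using dis j(1) by (auto simp: singular_set_def)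
  have "x \<in> ball x r" using r by simp
  then have "x \<notin> frontier (U j)" using dj by blast
  then have "x \<in> interior (U j)" using j(2) by (simp add: frontier_def)
  then have "x \<in> U j" using interior_subset by blast
  then have "ball x r \<inter> U j \<noteq> {}" using \<open>x \<in> ball x r\<close> by blast
  then have "ball x r - U j = {}" using connected_Int_frontier[of "ball x r" "U j"] dj by auto
  then show ?thesis using j(1) by auto
qed

lemma closed_singular_set: "closed (singular_set s U)"
  unfolding singular_set_def by (intro closed_UN) auto

lemma sum_set_eq_UN_ball: "{x + y | x y. x \<in> A \<and> y \<in> ball 0 r} = (\<Union>x\<in>A. ball x r)" for A :: "'a::real_normed_vector set"
proof (intro equalityI subsetI)
  fix z assume "z \<in> (\<Union>x\<in>A. ball x r)"
  then obtain x where "x \<in> A" "dist x z < r" by auto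
  then show "z \<in> {x + y | x y. x \<in> A \<and> y \<in> ball 0 r}"
    by (intro CollectI exI[of _ x] exI[of _ "z - x"]) (auto simp: dist_norm norm_minus_commute)
next
  fix z assume "z \<in> {x + y | x y. x \<in> A \<and> y \<in> ball 0 r}"
  then obtain x y where "x \<in> A" "norm y < r" "z = x + y" by auto
  then show "z \<in> (\<Union>x\<in>A. ball x r)" by (intro UN_I[of x]) (auto simp: dist_norm)
qed

lemma singular_nbhd_bound:
  fixes U :: "nat \<Rightarrow> (real ^ 'd) set"
  assumes A1: "\<exists>\<kappa>\<^sub>1\<in>{0<..1}.
      (\<lambda>r. measure lebesgue ({x + y | x y. x \<in> singular_set s U \<and> y \<in> ball 0 r} \<inter> unit_cube))
        \<in> O[at_right 0](\<lambda>r. r powr \<kappa>\<^sub>1)"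
  obtains \<kappa> C r0 where "\<kappa> > 0" "C > 0" "r0 > 0" "\<And>r. 0 < r \<Longrightarrow> r < r0 \<Longrightarrow>
    measure lborel ((\<Union>x\<in>singular_set s U. ball x r) \<inter> unit_cube) \<le> C * r powr \<kappa>"
proof -
  obtain \<kappa> where k: "\<kappa> > 0" and O: "(\<lambda>r. measure lebesgue ((\<Union>x\<in>singular_set s U. ball x r) \<inter> unit_cube)) \<in> O[at_right 0](\<lambda>r. r powr \<kappa>)"
    using A1 unfolding sum_set_eq_UN_ball by auto
  obtain C where C: "C > 0" "\<forall>\<^sub>F r in at_right 0. norm (measure lebesgue ((\<Union>x\<in>singular_set s U. ball x r) \<inter> unit_cube)) \<le> C * norm (r powr \<kappa>)"
    using O by (elim landau_o.bigE)
  obtain r0 where r0: "r0 > 0" "\<And>r. 0 < r \<Longrightarrow> r < r0 \<Longrightarrow> norm (measure lebesgue ((\<Union>x\<in>singular_set s U. ball x r) \<inter> unit_cube)) \<le> C * norm (r powr \<kappa>)"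
    using C(2) unfolding eventually_at_right_field by auto
  show thesis
  proof (rule that[OF k C(1) r0(1)])
    fix r assume r: "0 < r" "r < r0"
    have "(\<Union>x\<in>singular_set s U. ball x r) \<inter> unit_cube \<in> sets borel" by (intro sets.Int borel_open borel_closed) auto
    then show "measure lborel ((\<Union>x\<in>singular_set s U. ball x r) \<inter> unit_cube) \<le> C * r powr \<kappa>"
      using r0(2)[OF r] by simp
  qed
qed

lemma singular_set_null:
  fixes U :: "nat \<Rightarrow> (real ^ 'd) set"
  assumes "\<kappa> > 0" "C > 0" "r0 > 0" and b: "\<And>r. 0 < r \<Longrightarrow> r < r0 \<Longrightarrow>
    measure lborel ((\<Union>x\<in>singular_set s U. ball x r) \<inter> unit_cube) \<le> C * r powr \<kappa>"
  shows "emeasure lborel (singular_set s U \<inter> unit_cube) = 0"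
proof -
  let ?Z = "singular_set s U \<inter> unit_cube"
  have Z: "?Z \<in> sets borel" using closed_singular_set by (intro sets.Int borel_closed) auto
  have fin: "emeasure lborel (A \<inter> unit_cube) < \<infinity>" for A :: "(real ^ 'd) set"
    using emeasure_mono[of "A \<inter> unit_cube" unit_cube lborel] emeasure_lborel_cbox_finite[of "0::real^'d" 1] by (simp add: less_top[symmetric]) (metis Int_lower2 top.not_eq_extremum top.extremum_uniqueI)
  have le: "measure lborel ?Z \<le> C * r powr \<kappa>" if r: "0 < r" "r < r0" for r
  proof -
    have "measure lborel ?Z \<le> measure lborel ((\<Union>x\<in>singular_set s U. ball x r) \<inter> unit_cube)"
    proof (rule measure_mono_fmeasurable)
      show "?Z \<subseteq> (\<Union>x\<in>singular_set s U. ball x r) \<inter> unit_cube" using r by auto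
      show "?Z \<in> sets lborel" using Z by simp
      have "(\<Union>x\<in>singular_set s U. ball x r) \<inter> unit_cube \<in> sets borel" by (intro sets.Int borel_open borel_closed) auto
      then show "(\<Union>x\<in>singular_set s U. ball x r) \<inter> unit_cube \<in> fmeasurable lborel" using fin by (intro fmeasurableI) auto
    qed
    then show ?thesis using b[OF r] by linarith
  qed
  have "((\<lambda>r. C * r powr \<kappa>) \<longlongrightarrow> C * 0) (at_right 0)"
  proof (intro tendsto_intros)
    show "((\<lambda>r. r powr \<kappa>) \<longlongrightarrow> 0) (at_right 0)"
      using assms(1) by (intro tendsto_zero_powrI tendsto_intros) (auto intro: tendsto_ident_at eventually_mono[OF eventually_at_right_less])
  qed
  moreover have "\<forall>\<^sub>F r in at_right 0. measure lborel ?Z \<le> C * r powr \<kappa>"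
    unfolding eventually_at_right_field using le assms(3) by auto
  ultimately have "measure lborel ?Z \<le> C * 0" by (intro tendsto_lowerbound) auto
  then have "measure lborel ?Z = 0" by (simp add: measure_le_0_iff)
  then show ?thesis using fin[of "singular_set s U"] by (simp add: emeasure_eq_ennreal_measure)
qed

text \<open>Joint measurability is derived, not assumed. Off the singular set \<open>p\<close> is
  jointly continuous, by the Hoelder bound in x within one piece and the Lipschitz bound in \<xi>.
  Over the singular set it may vary wildly with x, but that set is null and Lebesgue measure is
  complete.\<close>

lemma pw_symbol_measurable:
  fixes p :: "real ^ 'd \<Rightarrow> real ^ 'd \<Rightarrow> complex"
  assumes \<rho>: "0 < \<rho>" and p: "pw_symbol \<rho> s U p"
    and null: "emeasure lborel (singular_set s U \<inter> unit_cube) = 0"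
  shows "(\<lambda>(x, \<xi>). p x \<xi>) \<in> borel_measurable cube_torus_measure"
proof -
  obtain S H \<Lambda> where H: "H \<ge> 0" "\<Lambda> \<ge> 0"
    "\<And>j x x' \<xi>. j < s \<Longrightarrow> x \<in> U j \<Longrightarrow> x' \<in> U j \<Longrightarrow> cmod (p x \<xi> - p x' \<xi>) \<le> H * dist x x' powr \<rho>"
    "\<And>j x \<xi> \<xi>'. j < s \<Longrightarrow> x \<in> U j \<Longrightarrow> cmod (p x \<xi> - p x \<xi>') \<le> \<Lambda> * norm (\<xi> - \<xi>')"
    by (rule pw_symbol_bounds[OF p]) blast
  let ?Q = "unit_cube :: (real ^ 'd) set"
  let ?Z = "singular_set s U \<inter> unit_cube"
  let ?W = "?Q \<times> ?Q" and ?N = "?Z \<times> ?Q"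
  have Zc: "closed ?Z" using closed_singular_set by (intro closed_Int) auto
  have cont: "continuous_on (?W - ?N) (\<lambda>(x, \<xi>). p x \<xi>)"
    unfolding continuous_on_def
  proof
    fix a assume a: "a \<in> ?W - ?N"
    obtain x \<xi> where x: "a = (x, \<xi>)" by force
    have xQ: "x \<in> ?Q" "x \<notin> singular_set s U" using a x by auto
    obtain r where r: "r > 0" "ball x r \<subseteq> - singular_set s U"
      using xQ(2) closed_singular_set[of s U] by (metis ComplI openE open_Compl)
    then have "ball x r \<inter> singular_set s U = {}" by blast
    then obtain j where j: "j < s" "ball x r \<subseteq> U j" using pw_symbol_ball_subset[OF p xQ(1) r(1)] by blast
    have "((\<lambda>b. H * dist x (fst b) powr \<rho> + \<Lambda> * norm (\<xi> - snd b)) \<longlongrightarrow> H * 0 + \<Lambda> * norm (\<xi> - \<xi>)) (at a)"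
    proof (intro tendsto_intros)
      have "((\<lambda>b. dist x (fst b)) \<longlongrightarrow> dist x (fst a)) (at a)" by (intro tendsto_intros)
      then have "((\<lambda>b. dist x (fst b)) \<longlongrightarrow> 0) (at a)" by (simp add: x)
      then show "((\<lambda>b. dist x (fst b) powr \<rho>) \<longlongrightarrow> 0) (at a)"
        using \<rho> by (intro tendsto_zero_powrI[OF _ tendsto_const]) auto
      have "((\<lambda>b. snd b) \<longlongrightarrow> snd a) (at a)" by (intro tendsto_intros)
      then show "((\<lambda>b. snd b) \<longlongrightarrow> \<xi>) (at a)" by (simp add: x)
    qed
    then have "((\<lambda>b. H * dist x (fst b) powr \<rho> + \<Lambda> * norm (\<xi> - snd b)) \<longlongrightarrow> 0) (at a)" by simp
    then have lim: "((\<lambda>b. H * dist x (fst b) powr \<rho> + \<Lambda> * norm (\<xi> - snd b)) \<longlongrightarrow> 0) (at a within ?W - ?N)"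
      by (rule tendsto_mono[OF at_le[OF subset_UNIV]])
    have ev: "\<forall>\<^sub>F b in at a. dist x (fst b) < r"
    proof -
      have "((\<lambda>b. dist x (fst b)) \<longlongrightarrow> dist x (fst a)) (at a)" by (intro tendsto_intros)
      then show ?thesis using r(1) by (intro order_tendstoD(2)[of _ "dist x (fst a)"]) (auto simp: x)
    qed
    have ev': "\<forall>\<^sub>F b in at a within ?W - ?N. norm ((case b of (x, \<xi>) \<Rightarrow> p x \<xi>) - p x \<xi>) \<le> H * dist x (fst b) powr \<rho> + \<Lambda> * norm (\<xi> - snd b)"
      using filter_leD[OF at_le[OF subset_UNIV] ev]
    proof eventually_elim
      case (elim b)
      have xb: "fst b \<in> U j" "x \<in> U j" using elim j(2) r(1) by auto
      have "p (fst b) (snd b) - p x \<xi> = (p (fst b) (snd b) - p (fst b) \<xi>) + (p (fst b) \<xi> - p x \<xi>)" by simp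
      then have "norm (p (fst b) (snd b) - p x \<xi>) \<le> norm (p (fst b) (snd b) - p (fst b) \<xi>) + norm (p (fst b) \<xi> - p x \<xi>)"
        by (metis norm_triangle_ineq)
      also have "\<dots> \<le> \<Lambda> * norm (snd b - \<xi>) + H * dist (fst b) x powr \<rho>"
        by (intro add_mono H(3)[OF j(1) xb] H(4)[OF j(1) xb(1)])
      finally show ?case by (simp add: case_prod_unfold dist_commute norm_minus_commute add_ac)
    qed
    have "((\<lambda>b. (case b of (x, \<xi>) \<Rightarrow> p x \<xi>) - p x \<xi>) \<longlongrightarrow> 0) (at a within ?W - ?N)"
      by (rule Lim_null_comparison[OF ev' lim])
    then show "((\<lambda>(x, \<xi>). p x \<xi>) \<longlongrightarrow> (case a of (x, \<xi>) \<Rightarrow> p x \<xi>)) (at a within ?W - ?N)"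
      by (subst (asm) LIM_zero_iff) (simp add: x)
  qed
  have W: "?W \<in> sets lebesgue" and N: "?N \<in> sets borel"
    using Zc by (auto intro!: borel_closed lborelD closed_Times)
  have "?W - ?N \<in> sets lebesgue" using W N by (intro sets.Diff) auto
  then have m: "(\<lambda>(x, \<xi>). p x \<xi>) \<in> borel_measurable (lebesgue_on (?W - ?N))"
    by (rule continuous_imp_measurable_on_sets_lebesgue[OF cont])
  have "emeasure (lborel \<Otimes>\<^sub>M lborel) ?N = emeasure lborel ?Z * emeasure lborel ?Q"
    using Zc by (intro lborel.emeasure_pair_measure_Times) (auto intro: borel_closed)
  then have "emeasure lborel ?N = 0" using null by (simp add: lborel_prod)
  then have "?N \<in> null_sets lborel" using N by (intro null_setsI) auto
  then have "?N \<in> null_sets lebesgue" by (rule null_sets_completionI)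
  then have "?N \<in> null_sets (lebesgue_on ?W)"
    using W by (subst null_sets_restrict_space) auto
  then show ?thesis using borel_measurable_diff_null[OF _ W] m by blast
qed

section \<open>Statistics of the singular values\<close>

lemma cnj_wave_eq_exp:
  fixes k \<nu> :: "int ^ 'd"
  shows "cnj (wave n k \<nu>) = exp (- 2 * \<i> * of_real pi * of_real (\<Sum>i\<in>UNIV. of_int (vec_nth \<nu> i) * vec_nth (lattice_point n k) i))"
proof -
  have "cnj (wave n k \<nu>) = (\<Prod>i\<in>UNIV. exp (- 2 * \<i> * of_real pi * of_real (of_int (vec_nth \<nu> i) * vec_nth (lattice_point n k) i)))"
    unfolding wave_def cnj_prod
    by (intro prod.cong refl) (simp add: cis_cnj cis_conv_exp exp_cnj lattice_point_def mult_ac)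
  also have "\<dots> = exp (\<Sum>i\<in>UNIV. - 2 * \<i> * of_real pi * of_real (of_int (vec_nth \<nu> i) * vec_nth (lattice_point n k) i))"
    by (rule exp_sum[symmetric]) simp
  also have "(\<Sum>i\<in>UNIV. - 2 * \<i> * of_real pi * of_real (of_int (vec_nth \<nu> i) * vec_nth (lattice_point n k) i))
      = - 2 * \<i> * of_real pi * of_real (\<Sum>i\<in>UNIV. of_int (vec_nth \<nu> i) * vec_nth (lattice_point n k) i)"
    by (simp only: of_real_sum sum_distrib_left)
  finally show ?thesis .
qed

lemma dft_tendsto_fourier_coeff:
  fixes p :: "real ^ 'd \<Rightarrow> real ^ 'd \<Rightarrow> complex"
  assumes "smooth_on_torus (p x)"
  shows "(\<lambda>n. dft n (\<lambda>k. p x (lattice_point n k)) \<nu>) \<longlonglongrightarrow> fourier_coeff p \<nu> x"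
proof -
  let ?g = "\<lambda>\<xi>. p x \<xi> * exp (- 2 * \<i> * of_real pi * of_real (\<Sum>i\<in>UNIV. of_int (vec_nth \<nu> i) * vec_nth \<xi> i))"
  have "continuous_on unit_cube ?g"
    by (intro continuous_intros smooth_on_torus_periodic(2) assms)
  from riemann_sum_unit_cube[OF this] show ?thesis
    unfolding dft_def fourier_coeff_def cnj_wave_eq_exp .
qed

lemma lattice_point_mod:
  fixes g :: "real ^ 'd \<Rightarrow> complex"
  assumes "smooth_on_torus g" "n > 0"
  shows "g (lattice_point n (\<chi> i. vec_nth k i mod int n)) = g (lattice_point n k)"
proof -
  have "lattice_point n k = lattice_point n (\<chi> i. vec_nth k i mod int n) + (\<chi> i. of_int (vec_nth (\<chi> i. vec_nth k i div int n) i))"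
  proof (subst Finite_Cartesian_Product.vec_eq_iff, rule allI)
    fix i
    have "real_of_int (vec_nth k i) = of_int (vec_nth k i mod int n) + real n * of_int (vec_nth k i div int n)"
      by (metis mod_mult_div_eq of_int_add of_int_mult of_int_of_nat_eq)
    then show "vec_nth (lattice_point n k) i = vec_nth (lattice_point n (\<chi> i. vec_nth k i mod int n) + (\<chi> i. of_int (vec_nth (\<chi> i. vec_nth k i div int n) i))) i"
      using assms(2) by (simp add: lattice_point_def add_divide_distrib)
  qed
  then show ?thesis using smooth_on_torus_periodic(1)[OF assms(1)] by metis
qed

lemma grid_minus_one: "m \<in> grid N \<Longrightarrow> m - 1 \<in> vec_box (\<lambda>_. {0..<int N})"
  unfolding vec_box_def
proof (rule CollectI, rule allI)
  fix i assume "m \<in> grid N"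
  then have "1 \<le> vec_nth m i" "vec_nth m i \<le> int N" by (auto simp: grid_def)
  then show "vec_nth (m - 1) i \<in> {0..<int N}" by simp
qed

lemma grid_point_in_cube: "m \<in> grid N \<Longrightarrow> N > 0 \<Longrightarrow> lattice_point N m \<in> unit_cube"
  by (rule lattice_point_in_cube) (auto simp: grid_def vec_box_def intro: order_trans[of 0 1])

text \<open>Regularity also keeps away from the boundary of the cube: frontiers are taken in the
  whole space, so a ball centred in the cube that avoids them lies in a single piece and therefore
  in the cube.\<close>

definition regular_index :: "nat \<Rightarrow> (nat \<Rightarrow> (real ^ 'd) set) \<Rightarrow> nat \<Rightarrow> real \<Rightarrow> int ^ 'd \<Rightarrow> bool" where
  "regular_index s U N r m \<longleftrightarrow> ball (lattice_point N m) r \<inter> singular_set s U = {}"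

text \<open>Volume comparison. Each irregular index owns a cell of volume
  \<open>1 / real (N ^ CARD('d))\<close>, and these disjoint cells lie in a slightly larger
  neighbourhood of the singular set. The added margin exceeds the distance, at most
  \<open>real CARD('d) / real N\<close>, from a point of the cell to its lattice point.\<close>

lemma singular_index_count:
  fixes U :: "nat \<Rightarrow> (real ^ 'd) set"
  assumes N: "N > 0" and r: "r > 0"
    and b: "measure lborel ((\<Union>x\<in>singular_set s U. ball x (r + 2 * real CARD('d) / real N)) \<inter> unit_cube) \<le> B"
  shows "real (card {m \<in> grid N. \<not> regular_index s U N r m}) \<le> real (N ^ CARD('d)) * B"
proof -
  let ?bad = "{m \<in> grid N. \<not> regular_index s U N r m}"
  define C where "C m = lattice_cell N (m - 1)" for m :: "int ^ 'd"
  let ?R = "(\<Union>x\<in>singular_set s U. ball x (r + 2 * real CARD('d) / real N)) \<inter> unit_cube"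
  note m1 = grid_minus_one
  have fin: "finite ?bad" using finite_grid by (rule finite_subset[rotated]) auto
  have sub: "(\<Union>m\<in>?bad. C m) \<subseteq> ?R"
  proof
    fix x assume "x \<in> (\<Union>m\<in>?bad. C m)"
    then obtain m where m: "m \<in> grid N" "\<not> regular_index s U N r m" "x \<in> C m" by auto
    obtain y where y: "y \<in> singular_set s U" "dist (lattice_point N m) y < r"
      using m(2) by (auto simp: regular_index_def)
    have "norm (x - lattice_point N (m - 1 + 1)) \<le> real CARD('d) / real N"
      using m(3) unfolding C_def by (rule lattice_cell_dist) simp
    then have "dist x (lattice_point N m) \<le> real CARD('d) / real N" by (simp add: dist_norm)
    moreover have "dist y x \<le> dist (lattice_point N m) y + dist x (lattice_point N m)" by (metis add.commute dist_commute dist_triangle)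
    moreover have "0 \<le> real CARD('d) / real N" by simp
    moreover have "2 * real CARD('d) / real N = 2 * (real CARD('d) / real N)" by simp
    ultimately have "dist y x < r + 2 * real CARD('d) / real N" using y(2) by linarith
    moreover have "x \<in> unit_cube" using lattice_cell_subset[OF N m1[OF m(1)]] m(3) by (auto simp: C_def)
    ultimately show "x \<in> ?R" using y(1) by auto
  qed
  have disj: "disjoint_family_on C ?bad"
    unfolding disjoint_family_on_def
  proof (intro ballI impI)
    fix m n :: "int ^ 'd" assume "m \<noteq> n"
    then have "m - 1 \<noteq> n - 1" by simp
    then show "C m \<inter> C n = {}"
      using lattice_cell_disjoint[OF N, of UNIV] unfolding disjoint_family_on_def C_def by blast
  qed
  have mC: "measure lborel (C m) = 1 / real (N ^ CARD('d))" "C m \<in> sets lborel" "emeasure lborel (C m) < \<infinity>" for m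
    using lattice_cell_measure[OF N, of "m - 1"] by (auto simp: C_def measure_def)
  have pw: "pairwise (\<lambda>m n. disjnt (C m) (C n)) ?bad"
    using disj unfolding disjoint_family_on_def pairwise_def disjnt_def by blast
  have "real (card ?bad) * (1 / real (N ^ CARD('d))) = (\<Sum>m\<in>?bad. measure lborel (C m))" by (simp add: mC)
  also have "\<dots> = measure lborel (\<Union>m\<in>?bad. C m)"
    using mC by (intro measure_UNION'[symmetric] fin pw) (auto simp: fmeasurable_def)
  also have "\<dots> \<le> measure lborel ?R"
  proof (rule measure_mono_fmeasurable[OF sub])
    show "(\<Union>m\<in>?bad. C m) \<in> sets lborel" using fin mC(2) by (intro sets.finite_UN) auto
    have "?R \<in> sets borel" by (intro sets.Int borel_open borel_closed) auto
    moreover have "emeasure lborel ?R \<le> emeasure lborel (unit_cube :: (real ^ 'd) set)" by (rule emeasure_mono) auto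
    then have "emeasure lborel ?R < \<infinity>" using emeasure_lborel_cbox_finite[of "0 :: real ^ 'd" 1] by (rule le_less_trans)
    ultimately show "?R \<in> fmeasurable lborel" by (intro fmeasurableI) auto
  qed
  also have "\<dots> \<le> B" by (rule b)
  finally show ?thesis using N by (simp add: field_simps)
qed

lemma norm_axis_real: "norm (axis i t :: real ^ 'd) = \<bar>t\<bar>"
proof -
  have "axis i t = t *\<^sub>R (axis i 1 :: real ^ 'd)" by (simp add: Finite_Cartesian_Product.vec_eq_iff axis_def)
  then show ?thesis by simp
qed

text \<open>Steps of length \<open>real b / real N\<close> along each axis stay in the ball, hence
  in the cube. This supplies the distance to the boundary required in
  \<open>dft_window_gap_good\<close> and \<open>window_lattice_dist\<close>.\<close>

lemma regular_index_interior:
  fixes m :: "int ^ 'd"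
  assumes N: "N > 0" and m: "m \<in> grid N" and r: "real b < r * real N"
    and sub: "ball (lattice_point N m) r \<subseteq> unit_cube"
  shows "int b \<le> vec_nth m i \<and> vec_nth m i \<le> int N - int b"
proof -
  have *: "lattice_point N m + axis i t \<in> unit_cube" if "\<bar>t\<bar> = real b / real N" for t
  proof -
    have "\<bar>t\<bar> < r" using r N that by (simp add: divide_less_eq)
    then have "lattice_point N m + axis i t \<in> ball (lattice_point N m) r" by (simp add: dist_norm norm_axis_real)
    then show ?thesis using sub by blast
  qed
  have "lattice_point N m + axis i (real b / real N) \<in> unit_cube" by (rule *) simp
  then have "vec_nth (lattice_point N m + axis i (real b / real N)) i \<le> 1"
    unfolding mem_box_cart by (metis one_index)
  moreover have "lattice_point N m + axis i (- (real b / real N)) \<in> unit_cube" by (rule *) simp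
  then have "0 \<le> vec_nth (lattice_point N m + axis i (- (real b / real N))) i"
    unfolding mem_box_cart by (metis zero_index)
  ultimately have "vec_nth (lattice_point N m + axis i (real b / real N)) i \<le> 1"
    "0 \<le> vec_nth (lattice_point N m + axis i (- (real b / real N))) i" by auto
  then have "(of_int (vec_nth m i) + real b) / real N \<le> 1" "0 \<le> (of_int (vec_nth m i) - real b) / real N"
    by (simp_all add: lattice_point_def axis_def add_divide_distrib diff_divide_distrib)
  then have "of_int (vec_nth m i) + real b \<le> real N" "real b \<le> of_int (vec_nth m i)"
    using N by (simp_all add: field_simps zero_le_divide_iff)
  then show ?thesis by linarith
qed

text \<open>The lower bound \<open>L\<close> on the coordinates of \<open>m\<close> rules out
  wrap-around: a cyclic window that passes \<open>N\<close> reaches only coordinates below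
  \<open>L\<close>.\<close>

lemma window_lattice_dist:
  fixes m y :: "int ^ 'd"
  assumes N: "N > 0" and m: "m \<in> grid N" "y \<in> grid N" and w: "window N L y m" and int: "\<And>i. int L \<le> vec_nth m i"
  shows "dist (lattice_point N m) (lattice_point N y) \<le> real CARD('d) * real L / real N"
proof -
  have "\<bar>vec_nth m i - vec_nth y i\<bar> \<le> int L" for i
  proof (cases "vec_nth y i \<le> vec_nth m i")
    case True
    have "vec_nth m i - vec_nth y i < int N" using m by (auto simp: grid_def) (smt (verit))
    then have "(vec_nth m i - vec_nth y i) mod int N = vec_nth m i - vec_nth y i" using True by (simp add: mod_pos_pos_trivial)
    then show ?thesis using w True by (simp add: window_def) (smt (verit))
  next
    case False
    have b: "vec_nth y i \<le> int N" "1 \<le> vec_nth m i" using m by (auto simp: grid_def)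
    have "(vec_nth m i - vec_nth y i) mod int N = (vec_nth m i - vec_nth y i + int N) mod int N" by simp
    also have "\<dots> = vec_nth m i - vec_nth y i + int N" using False b by (intro mod_pos_pos_trivial) auto
    finally have "vec_nth m i - vec_nth y i + int N < int L" using w by (simp add: window_def) (metis)
    then show ?thesis using int[of i] b by linarith
  qed
  then have le: "\<bar>real_of_int (vec_nth m i) - real_of_int (vec_nth y i)\<bar> \<le> real L" for i
    by (metis of_int_abs of_int_diff of_int_le_iff of_int_of_nat_eq)
  have "dist (lattice_point N m) (lattice_point N y) \<le> (\<Sum>i\<in>UNIV. \<bar>vec_nth (lattice_point N m - lattice_point N y) i\<bar>)"
    unfolding dist_norm by (rule norm_le_l1_cart)
  also have "\<dots> \<le> (\<Sum>i\<in>(UNIV::'d set). real L / real N)"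
  proof (intro sum_mono)
    fix i
    have "vec_nth (lattice_point N m - lattice_point N y) i = (of_int (vec_nth m i) - of_int (vec_nth y i)) / real N"
      by (simp add: lattice_point_def diff_divide_distrib)
    then show "\<bar>vec_nth (lattice_point N m - lattice_point N y) i\<bar> \<le> real L / real N"
      using le[of i] by (simp add: abs_divide divide_right_mono)
  qed
  finally show ?thesis by simp
qed

lemma norm_add3_square_le: "(norm (x + y + z))\<^sup>2 \<le> 3 * (norm x)\<^sup>2 + 3 * (norm y)\<^sup>2 + 3 * (norm z)\<^sup>2"
  for x y z :: "'a::real_normed_vector"
proof -
  have "norm (x + y + z) \<le> norm x + norm y + norm z"
    using norm_triangle_ineq[of "x + y" z] norm_triangle_ineq[of x y] by linarith
  then have "(norm (x + y + z))\<^sup>2 \<le> (norm x + norm y + norm z)\<^sup>2" by (intro power_mono) auto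
  also have "\<dots> \<le> 3 * (norm x)\<^sup>2 + 3 * (norm y)\<^sup>2 + 3 * (norm z)\<^sup>2"
    using sum_squares_bound[of "norm x" "norm y"] sum_squares_bound[of "norm x" "norm z"] sum_squares_bound[of "norm y" "norm z"]
    by (simp add: power2_eq_square algebra_simps)
  finally show ?thesis .
qed

lemma sum_grid_enum: "(\<Sum>b<N ^ CARD('d). h (from_nat_into (grid N :: (int ^ 'd) set) b)) = (\<Sum>j\<in>grid N. h j)"
  using bij_betw_from_nat_into_finite[OF finite_grid] unfolding card_grid by (rule sum.reindex_bij_betw)

lemma from_nat_into_grid:
  fixes a :: nat
  assumes "a < N ^ CARD('d)"
  shows "from_nat_into (grid N :: (int ^ 'd) set) a \<in> grid N"
    and "b < N ^ CARD('d) \<Longrightarrow> from_nat_into (grid N :: (int ^ 'd) set) a = from_nat_into (grid N) b \<longleftrightarrow> a = b"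
  using assms bij_betw_from_nat_into_finite[OF finite_grid[of N, where 'a = 'd]] unfolding card_grid
  by (auto simp: bij_betw_def inj_on_def)

text \<open>All errors are collected before any scale is fixed. Under the root stand mean squares:
  the perturbation, the replacement of Fourier coefficients by discrete ones, the irregular rows,
  the variation of windows, and the change of base point inside a window. Outside stand the errors
  of comparing the sum over packets with the integral. The frequency resolution \<open>n\<close> is
  picked inside the proof and leaves no trace in the bound.\<close>

lemma singular_value_statistics_discretized:
  fixes p :: "real ^ 'd \<Rightarrow> real ^ 'd \<Rightarrow> complex" and phi :: "real \<Rightarrow> real"
  defines "d \<equiv> real CARD('d)"
  assumes N: "N > 0" and L: "L > 0" "L \<le> N" and p: "pw_symbol \<rho> s U p" and \<rho>: "\<rho> > 0"
    and S: "S > 0" "\<And>x \<xi>. x \<in> unit_cube \<Longrightarrow> cmod (p x \<xi>) \<le> S"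
    and H: "H \<ge> 0" "\<And>j x x' \<xi>. j < s \<Longrightarrow> x \<in> U j \<Longrightarrow> x' \<in> U j \<Longrightarrow> cmod (p x \<xi> - p x' \<xi>) \<le> H * dist x x' powr \<rho>"
    and \<Lambda>: "\<Lambda> \<ge> 0" "\<And>j x \<xi> \<xi>'. j < s \<Longrightarrow> x \<in> U j \<Longrightarrow> cmod (p x \<xi> - p x \<xi>') \<le> \<Lambda> * norm (\<xi> - \<xi>')"
    and meas: "(\<lambda>(x, \<xi>). p x \<xi>) \<in> borel_measurable cube_torus_measure"
    and r: "d * real L / real N < r"
    and B: "real (card {m \<in> grid N. \<not> regular_index s U N r m}) \<le> real (N ^ CARD('d)) * B"
    and X: "X \<in> carrier_mat (N ^ CARD('d)) (N ^ CARD('d))"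
    and T: "(\<Sum>a<N ^ CARD('d). \<Sum>b<N ^ CARD('d). (cmod (X $$ (a, b) - symbol_matrix N p $$ (a, b)))\<^sup>2) \<le> real (N ^ CARD('d)) * T"
    and on: "orthonormal_sys (N ^ CARD('d)) (N ^ CARD('d)) u" "orthonormal_sys (N ^ CARD('d)) (N ^ CARD('d)) v"
    and sv: "\<And>i. i < N ^ CARD('d) \<Longrightarrow> sv i \<ge> 0"
    and Av: "\<And>i a. i < N ^ CARD('d) \<Longrightarrow> a < N ^ CARD('d) \<Longrightarrow>
       mat_app (N ^ CARD('d)) (X - z \<cdot>\<^sub>m 1\<^sub>m (N ^ CARD('d))) (v i) a = of_real (sv i) * u i a"
    and Au: "\<And>i b. i < N ^ CARD('d) \<Longrightarrow> b < N ^ CARD('d) \<Longrightarrow>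
       mat_app_adj (N ^ CARD('d)) (X - z \<cdot>\<^sub>m 1\<^sub>m (N ^ CARD('d))) (u i) b = of_real (sv i) * v i b"
    and lip: "\<And>x y. \<bar>phi x - phi y\<bar> \<le> \<L> * \<bar>x - y\<bar>"
  shows "\<bar>(\<Sum>i<N ^ CARD('d). phi (sv i)) / real (N ^ CARD('d)) - (LINT w|distr cube_torus_measure borel (\<lambda>(x, \<xi>). p x \<xi>). phi (cmod (w - z)))\<bar>
    \<le> \<L> * (sqrt (3 * T + 3 / real (N ^ CARD('d)) + 3 * (12 * S\<^sup>2 * B + 2 * (2 * real (N ^ (CARD('d) - 1)) / real (L ^ CARD('d)) + 1 / (real L)\<^sup>2) * (d * \<Lambda>\<^sup>2)
        + 2 * (H * (d * real L / real N) powr \<rho>)\<^sup>2)) + H * (d * real L / real N) powr \<rho> + \<Lambda> * d / real N + 2 * S * B)"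
proof -
  define m where "m = N ^ CARD('d)"
  have m0: "m > 0" using N by (simp add: m_def)
  have d0: "d > 0" by (simp add: d_def)
  define \<nu> where "\<nu> = from_nat_into (grid N :: (int ^ 'd) set)"
  have \<nu>: "\<nu> a \<in> grid N" if "a < m" for a using from_nat_into_grid(1)[of a N, where 'd = 'd] that by (simp add: \<nu>_def m_def)
  have \<nu>inj: "\<nu> a = \<nu> b \<longleftrightarrow> a = b" if "a < m" "b < m" for a b
    using from_nat_into_grid(2)[of a N b, where 'd = 'd] that by (simp add: \<nu>_def m_def)
  have \<nu>sum: "(\<Sum>b<m. h (\<nu> b)) = (\<Sum>j\<in>grid N. h j)" for h :: "int ^ 'd \<Rightarrow> 'x::comm_monoid_add"
    unfolding \<nu>_def m_def by (rule sum_grid_enum)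
  have cube: "lattice_point N y \<in> unit_cube" if "y \<in> grid N" for y :: "int ^ 'd" using grid_point_in_cube[OF that N] .
  have smooth: "smooth_on_torus (p (lattice_point N y))" if "y \<in> grid N" for y using p cube[OF that] by (simp add: pw_symbol_def)
  define M where "M = symbol_matrix N p"
  have Mab: "M $$ (a, b) = fourier_coeff p (\<nu> a - \<nu> b) (lattice_point N (\<nu> a))" if "a < m" "b < m" for a b
    using that by (simp add: M_def symbol_matrix_def m_def \<nu>_def Let_def lattice_point_def)
  have "\<forall>\<^sub>F n in sequentially. \<forall>a\<in>{..<m}. \<forall>b\<in>{..<m}. dist (dft n (\<lambda>k. p (lattice_point N (\<nu> a)) (lattice_point n k)) (\<nu> a - \<nu> b)) (M $$ (a, b)) < 1 / real m"
    using m0 by (intro eventually_ball_finite ballI) (auto simp: Mab intro!: tendstoD dft_tendsto_fourier_coeff smooth \<nu>)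
  \<comment> \<open>\<open>N\<close> is fixed here, so one \<open>n\<close> serves the finitely many
    entries. Accuracy \<open>1 / real m\<close> makes the squared error over all
    \<open>m * m\<close> entries at most 1, whence the summand
    \<open>3 / real (N ^ CARD('d))\<close> in the bound.\<close>
  then obtain n where n: "2 * N \<le> n"
    "\<And>a b. a < m \<Longrightarrow> b < m \<Longrightarrow> dist (dft n (\<lambda>k. p (lattice_point N (\<nu> a)) (lattice_point n k)) (\<nu> a - \<nu> b)) (M $$ (a, b)) < 1 / real m"
    unfolding eventually_sequentially by (meson lessThan_iff nle_le)
  have n0: "n > 0" and Nn: "N \<le> n" using n(1) N by auto
  define P where "P y k = p (lattice_point N y) (lattice_point n k)" for y k
  have per: "P y (\<chi> i. vec_nth k i mod int n) = P y k" if "y \<in> grid N" for y k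
    unfolding P_def by (rule lattice_point_mod[OF smooth[OF that] n0])
  have PS: "cmod (P y k) \<le> S" if "y \<in> grid N" for y k unfolding P_def by (rule S(2)[OF cube[OF that]])
  define D where "D a b = dft n (P (\<nu> a)) (\<nu> a - \<nu> b)" for a b
  have DM: "cmod (M $$ (a, b) - D a b) \<le> 1 / real m" if "a < m" "b < m" for a b
    using n(2)[OF that] by (simp add: D_def P_def[abs_def] dist_norm norm_minus_commute less_imp_le)
  define g where "g f a = packet N L n f (\<nu> a)" for f a
  define F where "F = (packet_index N n :: ((int ^ 'd) \<times> (int ^ 'd)) set)"
  have finF: "finite F" unfolding F_def by (rule finite_packet_index)
  define w where "w f = P (fst f) (snd f)" for f
  have frame: "(\<Sum>f\<in>F. g f a * cnj (g f b)) = (if a = b then 1 else 0)" if "a < m" "b < m" for a b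
    unfolding g_def F_def using packet_frame[OF N L Nn \<nu>[OF that(1)] \<nu>[OF that(2)]] \<nu>inj[OF that] by simp
  define \<eta> where "\<eta> = H * (d * real L / real N) powr \<rho>"
  have \<eta>0: "\<eta> \<ge> 0" using H by (simp add: \<eta>_def)
  define K where "K = 2 * real (N ^ (CARD('d) - 1)) / real (L ^ CARD('d)) + 1 / (real L)\<^sup>2"
  have K0: "K \<ge> 0" by (simp add: K_def)
  let ?R = "regular_index s U N r"
  define e where "e j = (\<Sum>(y, k)\<in>F. (cmod ((\<Sum>l\<in>grid N. dft n (P j) (j - l) * packet N L n (y, k) l) - P y k * packet N L n (y, k) j))\<^sup>2)" for j
  have dr: "0 < r" using r L N d0 by (meson divide_pos_pos less_trans mult_pos_pos of_nat_0_less_iff)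
  have ball: "\<exists>i<s. ball (lattice_point N j) r \<subseteq> U i" if "j \<in> grid N" "?R j" for j
    using that pw_symbol_ball_subset[OF p cube dr] by (simp add: regular_index_def)
  have Usub: "U i \<subseteq> unit_cube" if "i < s" for i
  proof -
    have "openin (top_of_set unit_cube) (U i)" using p that by (simp add: pw_symbol_def)
    then show ?thesis by (rule openin_imp_subset)
  qed
  \<comment> \<open>Irregular rows: a gap ratio of at most 2 together with Bessel gives
    \<open>2 * S\<^sup>2\<close>, and two values of the symbol differ by at most
    \<open>2 * S\<close>. The constant 12 is 4 + 8.\<close>
  have e_bad: "e j \<le> 12 * S\<^sup>2" if j: "j \<in> grid N" for j
  proof -
    have "e j \<le> 2 * (2 * S\<^sup>2) + 2 * (2 * S)\<^sup>2"
      unfolding e_def F_def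
    proof (rule packet_symbol_error[where P = P, OF N L n(1) j per[OF j]])
      have "(\<Sum>l\<in>vec_box (\<lambda>_. {1..<1 + int n}). (cmod (dft n (P j) (j - l)))\<^sup>2 * (window_gap N L j l / real (L ^ CARD('d))))
         \<le> (\<Sum>l\<in>vec_box (\<lambda>_. {1..<1 + int n}). (cmod (dft n (P j) (j - l)))\<^sup>2 * 2)"
        using window_gap_le[OF N L(2), of j] L by (intro sum_mono mult_left_mono) (auto simp: divide_le_eq)
      also have "\<dots> \<le> 2 * S\<^sup>2"
        using dft_bessel[where P = "P j" and m = j, OF n0 per[OF j] PS[OF j]] by (simp flip: sum_distrib_right)
      finally show "(\<Sum>l\<in>vec_box (\<lambda>_. {1..<1 + int n}). (cmod (dft n (P j) (j - l)))\<^sup>2 * (window_gap N L j l / real (L ^ CARD('d)))) \<le> 2 * S\<^sup>2" .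
      show "cmod (P j k - P y k) \<le> 2 * S" if "y \<in> grid N" for y k
        using norm_triangle_ineq4[of "P j k" "P y k"] PS[OF j, of k] PS[OF that, of k] by linarith
    qed (use S in auto)
    then show ?thesis by (simp add: power_mult_distrib)
  qed
  \<comment> \<open>Regular rows: the ball around the point lies in one piece and contains the
    corners of all windows through the point, so the Hoelder bound may be applied between
    them.\<close>
  have e_good: "e j \<le> 2 * (K * (d * \<Lambda>\<^sup>2)) + 2 * \<eta>\<^sup>2" if j: "j \<in> grid N" "?R j" for j
  proof -
    obtain i where i: "i < s" "ball (lattice_point N j) r \<subseteq> U i" using ball[OF j] by blast
    have jU: "lattice_point N j \<in> U i" using i(2) dr by auto
    have Lr: "real L < r * real N"
    proof -
      have "1 \<le> d" by (simp add: d_def) 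
      then have "real L \<le> d * real L" by (simp add: mult_le_cancel_right1)
      then show ?thesis using r N by (simp add: divide_less_eq)
    qed
    have int: "int L \<le> vec_nth j a \<and> vec_nth j a \<le> int N - int L" for a
      using i(2) Usub[OF i(1)] by (intro regular_index_interior[OF N j(1) Lr]) auto
    show ?thesis
      unfolding e_def F_def
    proof (rule packet_symbol_error[where P = P, OF N L n(1) j(1) per[OF j(1)]])
      show "(\<Sum>l\<in>vec_box (\<lambda>_. {1..<1 + int n}). (cmod (dft n (P j) (j - l)))\<^sup>2 * (window_gap N L j l / real (L ^ CARD('d)))) \<le> K * (d * \<Lambda>\<^sup>2)"
        unfolding K_def d_def
      proof (rule dft_window_gap_good[where P = "P j", OF N L n(1) j(1) per[OF j(1)]])
        fix k :: "int ^ 'd" and a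
        have "norm (lattice_point n (k + axis a 1) - lattice_point n k) = 1 / real n"
        proof -
          have "lattice_point n (k + axis a 1) - lattice_point n k = axis a (1 / real n)"
            by (simp add: Finite_Cartesian_Product.vec_eq_iff lattice_point_def axis_def add_divide_distrib)
          then show ?thesis by (simp add: norm_axis_real)
        qed
        then show "cmod (P j (k + axis a 1) - P j k) \<le> \<Lambda> / real n"
          using \<Lambda>(2)[OF i(1) jU, of "lattice_point n (k + axis a 1)" "lattice_point n k"] by (simp add: P_def)
      next
        show "real L \<le> real_of_int (vec_nth j a) \<and> real_of_int (vec_nth j a) \<le> real N - real L" for a
          using int[of a] by linarith
      qed (use L in auto)
      fix y k assume y: "y \<in> grid N" "window N L y j"
      have dd: "dist (lattice_point N j) (lattice_point N y) \<le> d * real L / real N"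
        unfolding d_def using int by (intro window_lattice_dist[OF N j(1) y]) blast
      then have "lattice_point N y \<in> U i" using i(2) r by auto
      then have "cmod (P j k - P y k) \<le> H * dist (lattice_point N j) (lattice_point N y) powr \<rho>"
        unfolding P_def by (intro H(2)[OF i(1) jU])
      also have "\<dots> \<le> \<eta>" unfolding \<eta>_def using dd H(1) \<rho> by (intro mult_left_mono powr_mono2) auto
      finally show "cmod (P j k - P y k) \<le> \<eta>" .
    qed (rule \<eta>0)
  qed
  define E3 where "E3 = 12 * S\<^sup>2 * B + 2 * K * (d * \<Lambda>\<^sup>2) + 2 * \<eta>\<^sup>2"
  have sum_e: "(\<Sum>j\<in>grid N. e j) \<le> real m * E3"
  proof -
    have "(\<Sum>j\<in>grid N. e j) \<le> (\<Sum>j\<in>grid N. (if \<not> ?R j then 12 * S\<^sup>2 else 0) + (2 * (K * (d * \<Lambda>\<^sup>2)) + 2 * \<eta>\<^sup>2))"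
    proof (intro sum_mono)
      fix j :: "int ^ 'd" assume j: "j \<in> grid N"
      have "0 \<le> 2 * (K * (d * \<Lambda>\<^sup>2)) + 2 * \<eta>\<^sup>2" using K0 d0 by simp
      then show "e j \<le> (if \<not> ?R j then 12 * S\<^sup>2 else 0) + (2 * (K * (d * \<Lambda>\<^sup>2)) + 2 * \<eta>\<^sup>2)"
        using e_bad[OF j] e_good[OF j] by auto
    qed
    also have "\<dots> = real (card {j \<in> grid N. \<not> ?R j}) * (12 * S\<^sup>2) + real m * (2 * (K * (d * \<Lambda>\<^sup>2)) + 2 * \<eta>\<^sup>2)"
      by (simp add: sum.distrib sum.inter_filter[OF finite_grid, symmetric] card_grid m_def)
    also have "\<dots> \<le> (real m * B) * (12 * S\<^sup>2) + real m * (2 * (K * (d * \<Lambda>\<^sup>2)) + 2 * \<eta>\<^sup>2)"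
      using B by (intro add_right_mono mult_right_mono) (auto simp: m_def)
    finally show ?thesis by (simp add: E3_def algebra_simps)
  qed
  define A where "A = X - z \<cdot>\<^sub>m 1\<^sub>m m"
  have Xc: "X \<in> carrier_mat m m" using X by (simp add: m_def)
  \<comment> \<open>Perturbation, discretization of the Fourier coefficients, and packet defect. The
    shift by \<open>z\<close> cancels between the matrix and the approximate eigenvalue, which makes
    the estimate uniform in \<open>z\<close>.\<close>
  have split: "mat_app m A (g f) a - (w f - z) * g f a
     = (\<Sum>b<m. (X $$ (a, b) - M $$ (a, b)) * g f b) + (\<Sum>b<m. (M $$ (a, b) - D a b) * g f b) + ((\<Sum>b<m. D a b * g f b) - w f * g f a)" if a: "a < m" for f a
  proof -
    have "mat_app m A (g f) a = (\<Sum>b<m. X $$ (a, b) * g f b - (if b = a then z * g f b else 0))"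
      unfolding mat_app_def using a Xc by (intro sum.cong refl) (auto simp: A_def algebra_simps)
    also have "\<dots> = (\<Sum>b<m. X $$ (a, b) * g f b) - z * g f a"
      using a by (simp add: sum_subtractf)
    finally show ?thesis by (simp add: algebra_simps sum_subtractf)
  qed
  have E: "(\<Sum>f\<in>F. \<Sum>a<m. (cmod (mat_app m A (g f) a - (w f - z) * g f a))\<^sup>2) \<le> real m * (3 * T + 3 / real m + 3 * E3)"
  proof -
    have "(\<Sum>f\<in>F. \<Sum>a<m. (cmod (mat_app m A (g f) a - (w f - z) * g f a))\<^sup>2)
      \<le> (\<Sum>f\<in>F. \<Sum>a<m. 3 * (cmod (\<Sum>b<m. (X $$ (a, b) - M $$ (a, b)) * g f b))\<^sup>2
         + 3 * (cmod (\<Sum>b<m. (M $$ (a, b) - D a b) * g f b))\<^sup>2 + 3 * (cmod ((\<Sum>b<m. D a b * g f b) - w f * g f a))\<^sup>2)"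
      by (intro sum_mono) (simp only: split lessThan_iff norm_add3_square_le)
    also have "\<dots> = (\<Sum>a<m. \<Sum>f\<in>F. 3 * (cmod (\<Sum>b<m. (X $$ (a, b) - M $$ (a, b)) * g f b))\<^sup>2
         + 3 * (cmod (\<Sum>b<m. (M $$ (a, b) - D a b) * g f b))\<^sup>2 + 3 * (cmod ((\<Sum>b<m. D a b * g f b) - w f * g f a))\<^sup>2)"
      by (rule sum.swap)
    also have "\<dots> = 3 * (\<Sum>a<m. \<Sum>b<m. (cmod (X $$ (a, b) - M $$ (a, b)))\<^sup>2) + 3 * (\<Sum>a<m. \<Sum>b<m. (cmod (M $$ (a, b) - D a b))\<^sup>2)
        + 3 * (\<Sum>a<m. \<Sum>f\<in>F. (cmod ((\<Sum>b<m. D a b * g f b) - w f * g f a))\<^sup>2)"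
      by (simp add: sum.distrib parseval_frame_norm[OF frame] flip: sum_distrib_left)
    also have "(\<Sum>a<m. \<Sum>f\<in>F. (cmod ((\<Sum>b<m. D a b * g f b) - w f * g f a))\<^sup>2) = (\<Sum>a<m. e (\<nu> a))"
    proof (intro sum.cong refl)
      fix a
      have "(\<Sum>b<m. D a b * g f b) = (\<Sum>l\<in>grid N. dft n (P (\<nu> a)) (\<nu> a - l) * packet N L n f l)" for f
        unfolding D_def g_def by (rule \<nu>sum)
      then show "(\<Sum>f\<in>F. (cmod ((\<Sum>b<m. D a b * g f b) - w f * g f a))\<^sup>2) = e (\<nu> a)"
        by (simp add: e_def w_def g_def case_prod_unfold)
    qed
    also have "\<dots> = (\<Sum>j\<in>grid N. e j)" by (rule \<nu>sum)
    also have "(\<Sum>a<m. \<Sum>b<m. (cmod (M $$ (a, b) - D a b))\<^sup>2) \<le> (\<Sum>a<m. \<Sum>b<m. (1 / real m)\<^sup>2)"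
      using DM by (intro sum_mono power_mono) auto
    also have "(\<Sum>a<m. \<Sum>b<m. (1 / real m)\<^sup>2) = 1" using m0 by (simp add: power2_eq_square)
    also have "(\<Sum>a<m. \<Sum>b<m. (cmod (X $$ (a, b) - M $$ (a, b)))\<^sup>2) \<le> real m * T" using T by (simp add: m_def M_def)
    finally have "(\<Sum>f\<in>F. \<Sum>a<m. (cmod (mat_app m A (g f) a - (w f - z) * g f a))\<^sup>2) \<le> 3 * (real m * T) + 3 * 1 + 3 * (\<Sum>j\<in>grid N. e j)"
      by simp
    also have "\<dots> \<le> 3 * (real m * T) + 3 * 1 + 3 * (real m * E3)" using sum_e by simp
    also have "\<dots> = real m * (3 * T + 3 / real m + 3 * E3)" using m0 by (simp add: field_simps)
    finally show ?thesis .
  qed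
  have L0: "\<L> \<ge> 0" using lip[of 0 1] by simp
  define Q where "Q = 3 * T + 3 / real m + 3 * E3"
  have gn: "(\<Sum>a<m. (cmod (g f a))\<^sup>2) = 1 / real (n ^ CARD('d))" for f
  proof -
    have "(\<Sum>a<m. (cmod (g f a))\<^sup>2) = (\<Sum>j\<in>grid N. (cmod (packet N L n f j))\<^sup>2)" unfolding g_def by (rule \<nu>sum)
    then show ?thesis using sum_norm_packet[OF N L, of n "fst f" "snd f"] by simp
  qed
  have "\<bar>(\<Sum>i<m. phi (sv i)) - (\<Sum>f\<in>F. (\<Sum>a<m. (cmod (g f a))\<^sup>2) * phi (cmod (w f - z)))\<bar> \<le> \<L> * sqrt (real m * (real m * Q))"
  proof (rule svd_coupling[OF finF])
    show "orthonormal_sys m m u" "orthonormal_sys m m v" using on by (simp_all add: m_def)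
    show "mat_app m A (v i) a = of_real (sv i) * u i a" if "i < m" "a < m" for i a
      using Av that by (simp add: m_def A_def)
    show "mat_app_adj m A (u i) b = of_real (sv i) * v i b" if "i < m" "b < m" for i b
      using Au that by (simp add: m_def A_def)
    show "(\<Sum>f\<in>F. \<Sum>a<m. (cmod (mat_app m A (g f) a - (w f - z) * g f a))\<^sup>2) \<le> real m * Q" using E by (simp add: Q_def)
  qed (use sv lip frame in \<open>auto simp: m_def\<close>)
  also have "sqrt (real m * (real m * Q)) = real m * sqrt Q" using m0 by (simp add: real_sqrt_mult mult.assoc[symmetric])
  finally have c1: "\<bar>(\<Sum>i<m. phi (sv i)) - (\<Sum>f\<in>F. 1 / real (n ^ CARD('d)) * phi (cmod (w f - z)))\<bar> \<le> \<L> * (real m * sqrt Q)"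
    unfolding gn .
  \<comment> \<open>The volume of the phase space cell owned by one packet: dividing by
    \<open>m\<close> turns packet weights into volumes.\<close>
  define c where "c = 1 / (real m * real (n ^ CARD('d)))"
  have nd0: "real (n ^ CARD('d)) > 0" using n0 by simp
  have c2: "\<bar>(\<Sum>i<m. phi (sv i)) / real m - (\<Sum>f\<in>F. c * phi (cmod (w f - z)))\<bar> \<le> \<L> * sqrt Q"
  proof -
    have "(\<Sum>i<m. phi (sv i)) / real m - (\<Sum>f\<in>F. c * phi (cmod (w f - z)))
      = ((\<Sum>i<m. phi (sv i)) - (\<Sum>f\<in>F. 1 / real (n ^ CARD('d)) * phi (cmod (w f - z)))) / real m"
      by (simp add: c_def diff_divide_distrib sum_divide_distrib mult.commute)
    then have "\<bar>(\<Sum>i<m. phi (sv i)) / real m - (\<Sum>f\<in>F. c * phi (cmod (w f - z)))\<bar>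
      = \<bar>(\<Sum>i<m. phi (sv i)) - (\<Sum>f\<in>F. 1 / real (n ^ CARD('d)) * phi (cmod (w f - z)))\<bar> / real m"
      by (simp only: abs_divide abs_of_nat)
    also have "\<dots> \<le> \<L> * (real m * sqrt Q) / real m"
      using c1 by (rule divide_right_mono) simp
    also have "\<dots> = \<L> * sqrt Q" using m0 by simp
    finally show ?thesis .
  qed
  let ?Qc = "unit_cube :: (real ^ 'd) set"
  define \<psi> where "\<psi> = (\<lambda>w. phi (cmod (w - z)))"
  have phic: "continuous_on UNIV phi"
  proof (rule continuous_on_subset[OF lipschitz_on_continuous_on])
    show "\<L>-lipschitz_on UNIV phi" using lip L0 by (intro lipschitz_onI) (auto simp: dist_real_def)
  qed simp
  have \<psi>m[measurable]: "\<psi> \<in> borel_measurable borel"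
    unfolding \<psi>_def by (intro borel_measurable_continuous_onI continuous_intros continuous_on_compose2[OF phic]) auto
  have \<psi>lip: "\<bar>\<psi> w - \<psi> w'\<bar> \<le> \<L> * cmod (w - w')" for w w'
  proof -
    have "\<bar>\<psi> w - \<psi> w'\<bar> \<le> \<L> * \<bar>cmod (w - z) - cmod (w' - z)\<bar>" unfolding \<psi>_def by (rule lip)
    also have "\<dots> \<le> \<L> * cmod (w - w')" using norm_triangle_ineq3[of "w - z" "w' - z"] L0 by (intro mult_left_mono) auto
    finally show ?thesis .
  qed
  define \<Psi> where "\<Psi> = (\<lambda>a. \<psi> (case a of (x, \<xi>) \<Rightarrow> p x \<xi>))"
  have \<Psi>m: "\<Psi> \<in> borel_measurable cube_torus_measure" unfolding \<Psi>_def using measurable_compose[OF meas \<psi>m] by simp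
  have emc: "emeasure lborel (?Qc \<times> ?Qc) = 1"
  proof -
    have "emeasure (lborel \<Otimes>\<^sub>M lborel) (?Qc \<times> ?Qc) = emeasure lborel ?Qc * emeasure lborel ?Qc"
      by (intro lborel.emeasure_pair_measure_Times) auto
    moreover have "emeasure lborel ?Qc = 1"
      using measure_unit_cube[where 'd = 'd] emeasure_eq_ennreal_measure[of lborel ?Qc] emeasure_lborel_cbox_finite[of "0 :: real ^ 'd" 1] by simp
    ultimately show ?thesis by (simp add: lborel_prod)
  qed
  have QQ: "?Qc \<times> ?Qc \<in> sets lborel" by (simp, intro borel_closed closed_Times closed_cbox)
  have QL: "?Qc \<times> ?Qc \<in> sets lebesgue" using QQ by auto
  have emL: "emeasure lebesgue (?Qc \<times> ?Qc) = 1" using emc QQ by simp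
  have fm: "finite_measure (cube_torus_measure :: ((real ^ 'd) \<times> (real ^ 'd)) measure)"
    using emL QL by (intro finite_measureI) (simp add: emeasure_restrict_space)
  interpret ct: finite_measure "cube_torus_measure :: ((real ^ 'd) \<times> (real ^ 'd)) measure" by (rule fm)
  have mtot: "measure (cube_torus_measure :: ((real ^ 'd) \<times> (real ^ 'd)) measure) (space cube_torus_measure) = 1"
  proof -
    have "emeasure (cube_torus_measure :: ((real ^ 'd) \<times> (real ^ 'd)) measure) (?Qc \<times> ?Qc) = 1"
      using emL QL by (subst emeasure_restrict_space) auto
    then show ?thesis by (simp add: measure_def)
  qed
  have \<Psi>i: "integrable cube_torus_measure \<Psi>"
  proof (rule ct.integrable_const_bound[OF _ \<Psi>m])
    have "\<bar>\<psi> w\<bar> \<le> \<bar>\<psi> 0\<bar> + \<L> * S" if "cmod w \<le> S" for w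
    proof -
      have "\<L> * cmod w \<le> \<L> * S" using that L0 by (rule mult_left_mono)
      then show ?thesis using \<psi>lip[of w 0] by simp
    qed
    then show "AE a in cube_torus_measure. norm (\<Psi> a) \<le> \<bar>\<psi> 0\<bar> + \<L> * S"
      using S(2) by (intro AE_I2) (auto simp: \<Psi>_def)
  qed
  \<comment> \<open>The window corner is the upper corner of its spatial cell, the frequency the
    lower corner of its cell, since grid indices start at 1 and frequencies at 0.\<close>
  define Cl where "Cl f = lattice_cell N (fst f - 1) \<times> lattice_cell n (snd f)" for f :: "(int ^ 'd) \<times> (int ^ 'd)"
  define er where "er f = (if ?R (fst f) then \<L> * (\<eta> + \<Lambda> * d / real N) else \<L> * (2 * S))" for f :: "(int ^ 'd) \<times> (int ^ 'd)"
  have c3: "norm (integral\<^sup>L cube_torus_measure \<Psi> - (\<Sum>f\<in>F. c *\<^sub>R \<psi> (w f))) \<le> c * (\<Sum>f\<in>F. er f)"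
  proof (rule integral_approx_partition[OF finF fm])
    fix f :: "(int ^ 'd) \<times> (int ^ 'd)" assume f: "f \<in> F"
    have f2: "snd f \<in> vec_box (\<lambda>_. {0..<int n})" and fg: "fst f \<in> grid N"
      using f by (auto simp: F_def)
    note f1 = grid_minus_one[OF fg]
    have s1: "lattice_cell N (fst f - 1) \<subseteq> ?Qc" and s2: "lattice_cell n (snd f) \<subseteq> ?Qc"
      using lattice_cell_subset[OF N f1] lattice_cell_subset[OF n0 f2] by auto
    note b1 = lattice_cell_measure[OF N, of "fst f - 1"] and b2 = lattice_cell_measure[OF n0, of "snd f"]
    have Cb: "Cl f \<in> sets lborel"
    proof -
      have "Cl f \<in> sets (lborel \<Otimes>\<^sub>M lborel)" unfolding Cl_def using b1(1) b2(1) by (intro pair_measureI) auto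
      then show ?thesis unfolding lborel_prod .
    qed
    have Cs: "Cl f \<subseteq> ?Qc \<times> ?Qc" using s1 s2 by (auto simp: Cl_def)
    have CL: "Cl f \<in> sets lebesgue" using Cb by auto
    show "Cl f \<in> sets cube_torus_measure" using CL Cs QL by (subst sets_restrict_space_iff) auto
    have "emeasure (lborel \<Otimes>\<^sub>M lborel) (Cl f) = ennreal (1 / real m) * ennreal (1 / real (n ^ CARD('d)))"
      unfolding Cl_def using b1 b2 by (subst lborel.emeasure_pair_measure_Times) (auto simp: m_def)
    also have "\<dots> = ennreal c" by (simp add: c_def flip: ennreal_mult)
    finally have "emeasure lborel (Cl f) = ennreal c" by (simp add: lborel_prod)
    then show "measure cube_torus_measure (Cl f) = c"
      using Cb CL Cs QL by (subst measure_restrict_space) (auto simp: measure_def c_def)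
    fix a assume a: "a \<in> Cl f"
    obtain x \<xi> where x: "a = (x, \<xi>)" "x \<in> lattice_cell N (fst f - 1)" "\<xi> \<in> lattice_cell n (snd f)"
      using a by (auto simp: Cl_def)
    have xQ: "x \<in> ?Qc" using x(2) s1 by auto
    have dx: "dist x (lattice_point N (fst f)) \<le> d / real N"
      using lattice_cell_dist[OF x(2), of 1] by (simp add: dist_norm d_def)
    have d\<xi>: "norm (\<xi> - lattice_point n (snd f)) \<le> d / real N"
    proof -
      have "norm (\<xi> - lattice_point n (snd f)) \<le> d / real n"
        using lattice_cell_dist[OF x(3), of 0] by (simp add: d_def)
      also have "\<dots> \<le> d / real N" using Nn N d0 by (intro divide_left_mono) auto
      finally show ?thesis .
    qed
    have dL: "d / real N \<le> d * real L / real N"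
      using L(1) d0 by (intro divide_right_mono) (auto simp: mult_le_cancel_left1)
    have "cmod (p x \<xi> - w f) \<le> (if ?R (fst f) then \<eta> + \<Lambda> * d / real N else 2 * S)"
    proof (cases "?R (fst f)")
      case True
      obtain i where i: "i < s" "ball (lattice_point N (fst f)) r \<subseteq> U i" using ball[OF fg True] by blast
      have xU: "x \<in> U i" "lattice_point N (fst f) \<in> U i"
        using i(2) dx dL r dr by (auto simp: dist_commute)
      have "p x \<xi> - w f = (p x \<xi> - p x (lattice_point n (snd f))) + (p x (lattice_point n (snd f)) - p (lattice_point N (fst f)) (lattice_point n (snd f)))"
        by (simp add: w_def P_def)
      then have "cmod (p x \<xi> - w f) \<le> cmod (p x \<xi> - p x (lattice_point n (snd f))) + cmod (p x (lattice_point n (snd f)) - p (lattice_point N (fst f)) (lattice_point n (snd f)))"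
        by (metis norm_triangle_ineq)
      also have "\<dots> \<le> \<Lambda> * norm (\<xi> - lattice_point n (snd f)) + H * dist x (lattice_point N (fst f)) powr \<rho>"
        by (intro add_mono \<Lambda>(2)[OF i(1) xU(1)] H(2)[OF i(1) xU])
      also have "\<dots> \<le> \<Lambda> * (d / real N) + H * (d * real L / real N) powr \<rho>"
        using d\<xi> dx dL \<Lambda>(1) H(1) \<rho> by (intro add_mono mult_left_mono powr_mono2) auto
      finally show ?thesis using True by (simp add: \<eta>_def)
    next
      case False
      have "cmod (p x \<xi> - w f) \<le> cmod (p x \<xi>) + cmod (w f)" by (rule norm_triangle_ineq4)
      also have "\<dots> \<le> S + S" unfolding w_def using S(2)[OF xQ, of \<xi>] PS[OF fg, of "snd f"] by (intro add_mono)
      finally show ?thesis using False by simp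
    qed
    then have "\<L> * cmod (p x \<xi> - w f) \<le> er f" using L0 unfolding er_def by (auto intro: mult_left_mono)
    then show "norm (\<Psi> a - \<psi> (w f)) \<le> er f" using \<psi>lip[of "p x \<xi>" "w f"] by (simp add: \<Psi>_def x(1))
  next
    show "disjoint_family_on Cl F"
      unfolding disjoint_family_on_def
    proof (intro ballI impI)
      fix f h :: "(int ^ 'd) \<times> (int ^ 'd)" assume fh: "f \<noteq> h"
      then consider "fst f \<noteq> fst h" | "snd f \<noteq> snd h" by (metis prod_eqI)
      then show "Cl f \<inter> Cl h = {}"
      proof cases
        case 1
        then have "lattice_cell N (fst f - 1) \<inter> lattice_cell N (fst h - 1) = {}"
          using lattice_cell_disjoint[OF N, of UNIV] unfolding disjoint_family_on_def by (metis UNIV_I diff_add_cancel)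
        then show ?thesis by (auto simp: Cl_def)
      next
        case 2
        then have "lattice_cell n (snd f) \<inter> lattice_cell n (snd h) = {}"
          using lattice_cell_disjoint[OF n0, of UNIV] unfolding disjoint_family_on_def by blast
        then show ?thesis by (auto simp: Cl_def)
      qed
    qed
    show "real (card F) * c = measure cube_torus_measure (space (cube_torus_measure :: ((real ^ 'd) \<times> (real ^ 'd)) measure))"
      unfolding mtot using m0 n0 by (simp add: F_def card_cartesian_product card_grid card_vec_box c_def m_def)
    show "integrable cube_torus_measure \<Psi>" by (rule \<Psi>i)
  qed
  have c4: "c * (\<Sum>f\<in>F. er f) \<le> \<L> * (\<eta> + \<Lambda> * d / real N + 2 * S * B)"
  proof -
    define g1 where "g1 = \<L> * (\<eta> + \<Lambda> * d / real N)"
    define h1 where "h1 = \<L> * (2 * S)"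
    have g0: "g1 \<ge> 0" "h1 \<ge> 0" using L0 \<eta>0 \<Lambda>(1) d0 S(1) by (auto simp: g1_def h1_def)
    have "(\<Sum>f\<in>F. er f) = (\<Sum>y\<in>grid N. \<Sum>k\<in>vec_box (\<lambda>_::'d. {0..<int n}). (if ?R y then g1 else h1))"
      unfolding F_def er_def g1_def h1_def by (subst sum.cartesian_product) (simp add: case_prod_unfold)
    also have "\<dots> = real (n ^ CARD('d)) * (\<Sum>y\<in>grid N. (if ?R y then g1 else h1))"
      by (simp add: card_vec_box sum_distrib_left)
    finally have e1: "(\<Sum>f\<in>F. er f) = real (n ^ CARD('d)) * (\<Sum>y\<in>grid N. (if ?R y then g1 else h1))" .
    have "(\<Sum>y\<in>grid N. (if ?R y then g1 else h1)) \<le> (\<Sum>y\<in>grid N. (if \<not> ?R y then h1 else 0) + g1)"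
      using g0 by (intro sum_mono) auto
    also have "\<dots> = real (card {y \<in> grid N. \<not> ?R y}) * h1 + real m * g1"
      by (simp add: sum.distrib sum.inter_filter[OF finite_grid, symmetric] card_grid m_def)
    also have "\<dots> \<le> (real m * B) * h1 + real m * g1"
      using B g0 by (intro add_right_mono mult_right_mono) (auto simp: m_def)
    finally have e2: "(\<Sum>y\<in>grid N. (if ?R y then g1 else h1)) \<le> real m * (B * h1 + g1)" by (simp add: algebra_simps)
    have "c * (\<Sum>f\<in>F. er f) \<le> c * (real (n ^ CARD('d)) * (real m * (B * h1 + g1)))"
      unfolding e1 using nd0 e2 by (intro mult_left_mono) (auto simp: c_def)
    also have "\<dots> = (c * (real m * real (n ^ CARD('d)))) * (B * h1 + g1)" by (simp only: mult_ac)
    also have "c * (real m * real (n ^ CARD('d))) = 1" using m0 nd0 by (simp add: c_def)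
    finally show ?thesis by (simp add: g1_def h1_def algebra_simps)
  qed
  have id: "(LINT w|distr cube_torus_measure borel (\<lambda>(x, \<xi>). p x \<xi>). phi (cmod (w - z))) = integral\<^sup>L cube_torus_measure \<Psi>"
    using integral_distr[OF meas \<psi>m] unfolding \<Psi>_def \<psi>_def .
  have "\<bar>(\<Sum>i<m. phi (sv i)) / real m - integral\<^sup>L cube_torus_measure \<Psi>\<bar> \<le> \<L> * sqrt Q + \<L> * (\<eta> + \<Lambda> * d / real N + 2 * S * B)"
  proof -
    have "norm (integral\<^sup>L cube_torus_measure \<Psi> - (\<Sum>f\<in>F. c *\<^sub>R \<psi> (w f))) = \<bar>integral\<^sup>L cube_torus_measure \<Psi> - (\<Sum>f\<in>F. c * phi (cmod (w f - z)))\<bar>"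
      by (simp add: \<psi>_def)
    then show ?thesis using c2 c3 c4 by linarith
  qed
  also have "\<L> * sqrt Q + \<L> * (\<eta> + \<Lambda> * d / real N + 2 * S * B) = \<L> * (sqrt Q + \<eta> + \<Lambda> * d / real N + 2 * S * B)"
    by (simp only: distrib_left add.assoc)
  finally show ?thesis unfolding id Q_def E3_def K_def \<eta>_def m_def .
qed

text \<open>\<open>sv\<close> lists the singular values with multiplicity, in any order, certified
  by a left and a right orthonormal basis. The statistics are sums over this list, which the set
  \<open>singular_values\<close> could not express.\<close>

definition singular_system :: "nat \<Rightarrow> complex mat \<Rightarrow> (nat \<Rightarrow> real) \<Rightarrow> bool" where
  "singular_system n A sv \<longleftrightarrow> (\<exists>u v. orthonormal_sys n n u \<and> orthonormal_sys n n v \<and> (\<forall>i<n. sv i \<ge> 0) \<and>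
     (\<forall>i<n. \<forall>a<n. mat_app n A (v i) a = of_real (sv i) * u i a) \<and>
     (\<forall>i<n. \<forall>b<n. mat_app_adj n A (u i) b = of_real (sv i) * v i b))"

text \<open>
  Windows of side $N^{1 - 1/(4d)}$ make both the packet width $L/N$ and the boundary effect
  $N^{d-1}/L^d$ negative powers of $N$.
\<close>

lemma window_scale:
  fixes N dn :: nat
  assumes N: "N \<ge> 1" and dn: "dn \<ge> 1"
  defines "a \<equiv> 1 / (4 * real dn)" and "L \<equiv> nat \<lceil>real N powr (1 - 1 / (4 * real dn))\<rceil>"
  shows "0 < L" "L \<le> N" "real L / real N \<le> 2 * real N powr - a"
    "real (N ^ (dn - 1)) / real (L ^ dn) \<le> real N powr - (3 / 4)" "1 / (real L)\<^sup>2 \<le> real N powr - (3 / 4)"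
    "1 / real N \<le> real N powr - a"
proof -
  have a: "0 < a" "a \<le> 1 / 4" "a * real dn = 1 / 4"
    using dn by (auto simp: a_def field_simps)
  define x where "x = real N powr (1 - a)"
  have L: "L = nat \<lceil>x\<rceil>" by (simp add: L_def x_def a_def)
  have x1: "1 \<le> x" unfolding x_def using N a by (intro ge_one_powr_ge_zero) auto
  have xN: "x \<le> real N" unfolding x_def using N a powr_mono[of "1 - a" 1 "real N"] by simp
  show L0: "0 < L" using x1 by (simp add: L)
  have "\<lceil>x\<rceil> \<le> int N" using xN by (simp add: ceiling_le_iff)
  then show "L \<le> N" unfolding L by (subst nat_le_iff)
  have xL: "x \<le> real L" unfolding L using x1 by linarith
  have Lx: "real L \<le> 2 * x" unfolding L using x1 by linarith
  have xe: "x / real N = real N powr - a"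
    using N powr_add[of "real N" 1 "- a"] by (simp add: x_def)
  show "real L / real N \<le> 2 * real N powr - a"
    using Lx N by (simp flip: xe add: divide_right_mono)
  have "1 / real N = real N powr - 1" using N by (simp add: powr_minus_divide)
  also have "\<dots> \<le> real N powr - a" using N a by (intro powr_mono) auto
  finally show "1 / real N \<le> real N powr - a" .
  have "real (N ^ (dn - 1)) / real (L ^ dn) \<le> real N powr (real dn - 1) / real N powr (real dn - 1 / 4)"
  proof (rule frac_le)
    show "real (N ^ (dn - 1)) \<le> real N powr (real dn - 1)"
      using N dn powr_realpow[of "real N" "dn - 1"] by (simp add: of_nat_diff)
    have "real N powr (real dn - 1 / 4) = x powr real dn"
      unfolding x_def powr_powr by (simp only: left_diff_distrib a(3) mult_1)
    also have "\<dots> \<le> real L powr real dn" using xL x1 by (intro powr_mono2) auto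
    also have "\<dots> = real (L ^ dn)" using L0 by (simp add: powr_realpow)
    finally show "real N powr (real dn - 1 / 4) \<le> real (L ^ dn)" .
  qed (use N in auto)
  also have "\<dots> = real N powr - (3 / 4)" using N by (simp add: powr_diff[symmetric])
  finally show "real (N ^ (dn - 1)) / real (L ^ dn) \<le> real N powr - (3 / 4)" .
  have "1 / (real L)\<^sup>2 \<le> 1 / x\<^sup>2" using xL x1 by (intro divide_left_mono power_mono) auto
  also have "\<dots> = real N powr - (2 * (1 - a))"
  proof -
    have "x\<^sup>2 = x powr 2" using x1 by (intro powr_numeral[symmetric]) simp
    also have "\<dots> = real N powr ((1 - a) * 2)" unfolding x_def by (rule powr_powr)
    finally show ?thesis by (simp only: powr_minus_divide mult.commute)
  qed
  also have "\<dots> \<le> real N powr - (3 / 4)" using N a by (intro powr_mono) auto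
  finally show "1 / (real L)\<^sup>2 \<le> real N powr - (3 / 4)" .
qed

text \<open>The constants depend on the symbol alone; the point \<open>z\<close>, the test function
  and the perturbation are quantified after them. The square root is the price of passing from
  quadratic to linear transport cost.\<close>

lemma singular_value_statistics:
  fixes p :: "real ^ 'd \<Rightarrow> real ^ 'd \<Rightarrow> complex"
  assumes \<rho>: "0 < \<rho>" and p: "pw_symbol \<rho> s U p"
    and A1: "\<exists>\<kappa>\<^sub>1\<in>{0<..1}.
      (\<lambda>r. measure lebesgue ({x + y | x y. x \<in> singular_set s U \<and> y \<in> ball 0 r} \<inter> unit_cube))
        \<in> O[at_right 0](\<lambda>r. r powr \<kappa>\<^sub>1)"
  obtains C c N0 where "C > 0" "c > 0" "N0 \<ge> 1"
    "\<And>N X T z sv (phi :: real \<Rightarrow> real) \<L>. N \<ge> N0 \<Longrightarrow> X \<in> carrier_mat (N ^ CARD('d)) (N ^ CARD('d)) \<Longrightarrow> T \<ge> 0 \<Longrightarrow>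
      (\<Sum>a<N ^ CARD('d). \<Sum>b<N ^ CARD('d). (cmod (X $$ (a, b) - symbol_matrix N p $$ (a, b)))\<^sup>2) \<le> real (N ^ CARD('d)) * T \<Longrightarrow>
      singular_system (N ^ CARD('d)) (X - z \<cdot>\<^sub>m 1\<^sub>m (N ^ CARD('d))) sv \<Longrightarrow>
      (\<And>x y. \<bar>phi x - phi y\<bar> \<le> \<L> * \<bar>x - y\<bar>) \<Longrightarrow>
      \<bar>(\<Sum>i<N ^ CARD('d). phi (sv i)) / real (N ^ CARD('d)) - (LINT w|distr cube_torus_measure borel (\<lambda>(x, \<xi>). p x \<xi>). phi (cmod (w - z)))\<bar>
        \<le> \<L> * (C * sqrt (T + real N powr - c))"
proof -
  obtain \<kappa> C1 r0 where k: "\<kappa> > 0" "C1 > 0" "r0 > 0" "\<And>r. 0 < r \<Longrightarrow> r < r0 \<Longrightarrow>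
    measure lborel ((\<Union>x\<in>singular_set s U. ball x r) \<inter> unit_cube) \<le> C1 * r powr \<kappa>"
    by (rule singular_nbhd_bound[OF A1]) blast
  have meas: "(\<lambda>(x, \<xi>). p x \<xi>) \<in> borel_measurable cube_torus_measure"
    by (rule pw_symbol_measurable[OF \<rho> p singular_set_null[OF k]])
  obtain S H \<Lambda> where S: "S > 0" "\<And>x \<xi>. x \<in> unit_cube \<Longrightarrow> cmod (p x \<xi>) \<le> S"
    and H: "H \<ge> 0" "\<And>j x x' \<xi>. j < s \<Longrightarrow> x \<in> U j \<Longrightarrow> x' \<in> U j \<Longrightarrow> cmod (p x \<xi> - p x' \<xi>) \<le> H * dist x x' powr \<rho>"
    and \<Lambda>: "\<Lambda> \<ge> 0" "\<And>j x \<xi> \<xi>'. j < s \<Longrightarrow> x \<in> U j \<Longrightarrow> cmod (p x \<xi> - p x \<xi>') \<le> \<Lambda> * norm (\<xi> - \<xi>')"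
    by (rule pw_symbol_bounds[OF p]) blast
  define d where "d = real CARD('d)"
  have d1: "d \<ge> 1" by (simp add: d_def)
  define a where "a = 1 / (4 * d)"
  have a0: "a > 0" using d1 by (simp add: a_def)
  \<comment> \<open>One rate for each source: 3/4 for the variation of windows,
    \<open>a * \<kappa>\<close> for the irregular rows, \<open>a * \<rho>\<close> for the Hoelder
    modulus over a window.\<close>
  define c where "c = min (3 / 4) (min (a * \<kappa>) (a * \<rho>))"
  have c0: "c > 0" using a0 k(1) \<rho> by (simp add: c_def)
  \<comment> \<open>\<open>6 * d\<close> is \<open>4 * d\<close> for the radius \<open>r\<close>
    chosen below, by the bound on \<open>L / N\<close>, plus \<open>2 * d\<close> for the margin in
    \<open>singular_index_count\<close>.\<close>
  define K1 where "K1 = C1 * (6 * d) powr \<kappa>"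
  define K2 where "K2 = (2 * d) powr \<rho>"
  have K0: "K1 \<ge> 0" "K2 \<ge> 0" using k(2) by (auto simp: K1_def K2_def)
  define C2 where "C2 = 3 + 3 * (12 * S\<^sup>2 * K1 + 6 * (d * \<Lambda>\<^sup>2) + 2 * (H * K2)\<^sup>2)"
  define C3 where "C3 = H * K2 + \<Lambda> * d + 2 * S * K1"
  have C20: "C2 \<ge> 0" "C3 \<ge> 0" using K0 d1 H(1) \<Lambda>(1) S(1) by (auto simp: C2_def C3_def)
  have "((\<lambda>x. 6 * d * x powr - a) \<longlongrightarrow> 6 * d * 0) at_top"
    using a0 by (intro tendsto_intros tendsto_neg_powr filterlim_ident) auto
  then have "((\<lambda>N. 6 * d * real N powr - a) \<longlongrightarrow> 6 * d * 0) sequentially"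
    by (rule filterlim_compose[OF _ filterlim_real_sequentially])
  then have "\<forall>\<^sub>F N in sequentially. 6 * d * real N powr - a < r0"
    using k(3) by (intro order_tendstoD(2)) auto
  then obtain N1 where N1: "\<And>N. N \<ge> N1 \<Longrightarrow> 6 * d * real N powr - a < r0"
    unfolding eventually_sequentially by blast
  show thesis
  proof (rule that[of "sqrt (3 + C2) + C3 + 1" c "max 1 N1"])
    show "0 < sqrt (3 + C2) + C3 + 1" using C20 by (simp add: add_nonneg_pos)
    fix N X T z sv \<L> and phi :: "real \<Rightarrow> real"
    assume N: "max 1 N1 \<le> N" and X: "X \<in> carrier_mat (N ^ CARD('d)) (N ^ CARD('d))" and T0: "T \<ge> 0"
      and T: "(\<Sum>a<N ^ CARD('d). \<Sum>b<N ^ CARD('d). (cmod (X $$ (a, b) - symbol_matrix N p $$ (a, b)))\<^sup>2) \<le> real (N ^ CARD('d)) * T"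
      and ss: "singular_system (N ^ CARD('d)) (X - z \<cdot>\<^sub>m 1\<^sub>m (N ^ CARD('d))) sv"
      and lip: "\<And>x y. \<bar>phi x - phi y\<bar> \<le> \<L> * \<bar>x - y\<bar>"
    have N0: "N > 0" "N \<ge> 1" "N \<ge> N1" using N by auto
    have d1': "CARD('d) \<ge> 1" by simp
    define L where "L = nat \<lceil>real N powr (1 - 1 / (4 * real CARD('d)))\<rceil>"
    note ws = window_scale[OF N0(2) d1', folded L_def d_def, folded a_def]
    define q where "q = real N powr - c"
    have q0: "q > 0" using N0 by (simp add: q_def)
    have q1: "q \<le> 1" unfolding q_def using N0 c0 powr_mono[of "- c" 0 "real N"] by simp
    have qle: "real N powr - t \<le> q" if "c \<le> t" for t
      unfolding q_def using N0 that by (intro powr_mono) auto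
    \<comment> \<open>Twice the bound on the distance between a point and the corner of a window
      through it, which leaves room for the strict inequality.\<close>
    define r where "r = 2 * d * real L / real N"
    have dL: "d * real L / real N > 0" using d1 ws(1) N0 by simp
    have r: "d * real L / real N < r" using dL by (simp add: r_def)
    have R: "r + 2 * d / real N \<le> 6 * d * real N powr - a"
    proof -
      have "r = 2 * d * (real L / real N)" by (simp add: r_def)
      also have "\<dots> \<le> 2 * d * (2 * real N powr - a)" using ws(3) d1 by (intro mult_left_mono) auto
      finally have "r \<le> 4 * d * real N powr - a" by simp
      moreover have "2 * d * (1 / real N) \<le> 2 * d * real N powr - a" using ws(6) d1 by (intro mult_left_mono) auto
      ultimately show ?thesis by simp
    qed
    have R0: "0 < r + 2 * d / real N" using r dL d1 by (simp add: add_pos_nonneg)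
    have B: "real (card {m \<in> grid N. \<not> regular_index s U N r m}) \<le> real (N ^ CARD('d)) * (K1 * q)"
    proof (rule singular_index_count[OF N0(1)])
      show "r > 0" using r dL by linarith
      have "measure lborel ((\<Union>x\<in>singular_set s U. ball x (r + 2 * d / real N)) \<inter> unit_cube) \<le> C1 * (r + 2 * d / real N) powr \<kappa>"
        using R N1[OF N0(3)] R0 by (intro k(4)) auto
      also have "\<dots> \<le> C1 * (6 * d * real N powr - a) powr \<kappa>"
        using R R0 k by (intro mult_left_mono powr_mono2) auto
      also have "\<dots> = K1 * real N powr - (a * \<kappa>)"
        using d1 by (simp add: K1_def powr_mult powr_powr)
      also have "\<dots> \<le> K1 * q" using K0 by (intro mult_left_mono qle) (auto simp: c_def)
      finally show "measure lborel ((\<Union>x\<in>singular_set s U. ball x (r + 2 * real CARD('d) / real N)) \<inter> unit_cube) \<le> K1 * q"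
        by (simp add: d_def)
    qed
    obtain u v where uv: "orthonormal_sys (N ^ CARD('d)) (N ^ CARD('d)) u" "orthonormal_sys (N ^ CARD('d)) (N ^ CARD('d)) v"
      and sv: "\<And>i. i < N ^ CARD('d) \<Longrightarrow> sv i \<ge> 0"
      and Av: "\<And>i a. i < N ^ CARD('d) \<Longrightarrow> a < N ^ CARD('d) \<Longrightarrow>
         mat_app (N ^ CARD('d)) (X - z \<cdot>\<^sub>m 1\<^sub>m (N ^ CARD('d))) (v i) a = of_real (sv i) * u i a"
      and Au: "\<And>i b. i < N ^ CARD('d) \<Longrightarrow> b < N ^ CARD('d) \<Longrightarrow>
         mat_app_adj (N ^ CARD('d)) (X - z \<cdot>\<^sub>m 1\<^sub>m (N ^ CARD('d))) (u i) b = of_real (sv i) * v i b"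
      using ss unfolding singular_system_def by blast
    have L0: "\<L> \<ge> 0" using lip[of 0 1] by simp
    define G where "G = (d * real L / real N) powr \<rho>"
    have G: "0 \<le> G" "G \<le> K2 * q"
    proof -
      show "0 \<le> G" by (simp add: G_def)
      have "G \<le> (2 * d * real N powr - a) powr \<rho>"
        unfolding G_def
      proof (rule powr_mono2)
        have "d * (real L / real N) \<le> d * (2 * real N powr - a)" using ws(3) d1 by (intro mult_left_mono) auto
        then show "d * real L / real N \<le> 2 * d * real N powr - a" by simp
      qed (use \<rho> dL in auto)
      also have "\<dots> = K2 * real N powr - (a * \<rho>)" using d1 by (simp add: K2_def powr_mult powr_powr)
      also have "\<dots> \<le> K2 * q" using K0 by (intro mult_left_mono qle) (auto simp: c_def)
      finally show "G \<le> K2 * q" .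
    qed
    define W where "W = 2 * real (N ^ (CARD('d) - 1)) / real (L ^ CARD('d)) + 1 / (real L)\<^sup>2"
    have q34: "real N powr - (3 / 4) \<le> q" by (rule qle) (simp add: c_def)
    have W: "W \<le> 3 * q" using ws(4,5) q34 unfolding W_def by simp
    have NN: "1 / real N \<le> q"
      using N0 qle[of 1] by (simp add: powr_minus_divide c_def)
    have Nm: "1 / real (N ^ CARD('d)) \<le> q"
    proof -
      have "real N ^ 1 \<le> real N ^ CARD('d)" using N0 by (intro power_increasing) auto
      then have "1 / real (N ^ CARD('d)) \<le> 1 / real N" using N0 by (intro divide_left_mono) auto
      then show ?thesis using NN by linarith
    qed
    have main: "\<bar>(\<Sum>i<N ^ CARD('d). phi (sv i)) / real (N ^ CARD('d)) - (LINT w|distr cube_torus_measure borel (\<lambda>(x, \<xi>). p x \<xi>). phi (cmod (w - z)))\<bar>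
      \<le> \<L> * (sqrt (3 * T + 3 / real (N ^ CARD('d)) + 3 * (12 * S\<^sup>2 * (K1 * q) + 2 * W * (d * \<Lambda>\<^sup>2) + 2 * (H * G)\<^sup>2))
         + H * G + \<Lambda> * d / real N + 2 * S * (K1 * q))"
      unfolding W_def G_def d_def
      by (rule singular_value_statistics_discretized[OF N0(1) ws(1,2) p \<rho> S H \<Lambda> meas r[unfolded d_def] B X T uv sv Av Au lip])
    have HG: "H * G \<le> H * K2 * q" using mult_left_mono[OF G(2) H(1)] by (simp add: mult.assoc)
    have HG2: "(H * G)\<^sup>2 \<le> (H * K2)\<^sup>2 * q"
    proof -
      have "(H * G)\<^sup>2 \<le> (H * K2 * q)\<^sup>2" using HG G(1) H(1) by (intro power_mono) auto
      also have "\<dots> = (H * K2)\<^sup>2 * (q * q)" by (simp add: power2_eq_square)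
      also have "\<dots> \<le> (H * K2)\<^sup>2 * (q * 1)" using q0 q1 by (intro mult_left_mono) auto
      finally show ?thesis by simp
    qed
    have Wd: "W * (d * \<Lambda>\<^sup>2) \<le> 3 * q * (d * \<Lambda>\<^sup>2)" using W d1 by (intro mult_right_mono) auto
    have "3 * T + 3 / real (N ^ CARD('d)) + 3 * (12 * S\<^sup>2 * (K1 * q) + 2 * W * (d * \<Lambda>\<^sup>2) + 2 * (H * G)\<^sup>2) \<le> 3 * T + C2 * q"
      using Nm Wd HG2 unfolding C2_def by (simp add: algebra_simps)
    also have "\<dots> \<le> (3 + C2) * (T + q)"
      using mult_nonneg_nonneg[OF C20(1) T0] q0 by (simp add: algebra_simps)
    finally have s1: "sqrt (3 * T + 3 / real (N ^ CARD('d)) + 3 * (12 * S\<^sup>2 * (K1 * q) + 2 * W * (d * \<Lambda>\<^sup>2) + 2 * (H * G)\<^sup>2)) \<le> sqrt (3 + C2) * sqrt (T + q)"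
      by (simp add: real_sqrt_mult[symmetric])
    \<comment> \<open>As \<open>q \<le> 1\<close>, errors that are linear in \<open>q\<close> are
      absorbed into the root.\<close>
    have "q = sqrt (q * q)" using q0 by simp
    also have "\<dots> \<le> sqrt (T + q)" 
    proof (rule real_sqrt_le_mono)
      have "q * q \<le> q * 1" using q0 q1 by (intro mult_left_mono) auto
      then show "q * q \<le> T + q" using T0 by simp
    qed
    finally have qs: "q \<le> sqrt (T + q)" .
    have "H * G + \<Lambda> * d / real N + 2 * S * (K1 * q) \<le> C3 * q"
    proof -
      have "\<Lambda> * d * (1 / real N) \<le> \<Lambda> * d * q" using NN \<Lambda>(1) d1 by (intro mult_left_mono) auto
      then show ?thesis using HG by (simp add: C3_def algebra_simps)
    qed
    also have "\<dots> \<le> C3 * sqrt (T + q)" using qs C20 by (intro mult_left_mono)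
    finally have s2: "H * G + \<Lambda> * d / real N + 2 * S * (K1 * q) \<le> C3 * sqrt (T + q)" .
    have "0 \<le> sqrt (T + q)" using T0 q0 by simp
    moreover have "(sqrt (3 + C2) + C3 + 1) * sqrt (T + q) = sqrt (3 + C2) * sqrt (T + q) + C3 * sqrt (T + q) + sqrt (T + q)"
      by (simp only: distrib_right mult_1)
    ultimately have "sqrt (3 * T + 3 / real (N ^ CARD('d)) + 3 * (12 * S\<^sup>2 * (K1 * q) + 2 * W * (d * \<Lambda>\<^sup>2) + 2 * (H * G)\<^sup>2))
         + H * G + \<Lambda> * d / real N + 2 * S * (K1 * q) \<le> (sqrt (3 + C2) + C3 + 1) * sqrt (T + q)"
      using s1 s2 by linarith
    then have "\<L> * (sqrt (3 * T + 3 / real (N ^ CARD('d)) + 3 * (12 * S\<^sup>2 * (K1 * q) + 2 * W * (d * \<Lambda>\<^sup>2) + 2 * (H * G)\<^sup>2))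
         + H * G + \<Lambda> * d / real N + 2 * S * (K1 * q)) \<le> \<L> * ((sqrt (3 + C2) + C3 + 1) * sqrt (T + q))"
      using L0 by (rule mult_left_mono)
    with main show "\<bar>(\<Sum>i<N ^ CARD('d). phi (sv i)) / real (N ^ CARD('d)) - (LINT w|distr cube_torus_measure borel (\<lambda>(x, \<xi>). p x \<xi>). phi (cmod (w - z)))\<bar>
        \<le> \<L> * ((sqrt (3 + C2) + C3 + 1) * sqrt (T + real N powr - c))"
      unfolding q_def by linarith
  qed (use c0 in auto)
qed

section \<open>Discrete circle averages of the logarithm\<close>

definition unity_roots :: "nat \<Rightarrow> complex set" where
  "unity_roots M = {z. z ^ M = 1}"

lemma unity_roots_props:
  assumes "M > 0"
  shows "finite (unity_roots M)" "card (unity_roots M) = M" "\<And>z. z \<in> unity_roots M \<Longrightarrow> cmod z = 1"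
proof -
  show "finite (unity_roots M)" unfolding unity_roots_def using assms by (intro finite_roots_unity) auto
  show "card (unity_roots M) = M" unfolding unity_roots_def using assms by (rule card_roots_unity_eq)
  show "cmod z = 1" if "z \<in> unity_roots M" for z
  proof -
    have "cmod z ^ M = 1" using that by (simp add: unity_roots_def flip: norm_power)
    then show ?thesis using power_eq_iff_eq_base[OF assms, of "cmod z" 1] by simp
  qed
qed

text \<open>Both polynomials are monic of degree \<open>M\<close>, so their difference has smaller
  degree; it vanishes at \<open>M\<close> points.\<close>

lemma prod_unity_roots_poly:
  assumes M: "M > 0"
  shows "(\<Prod>z\<in>unity_roots M. [:- z, 1:]) = monom 1 M - 1"
proof (rule ccontr)
  let ?P = "\<Prod>z\<in>unity_roots M. [:- z, 1:]" and ?Q = "monom 1 M - 1 :: complex poly"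
  note U = unity_roots_props[OF M]
  assume "?P \<noteq> ?Q"
  then have nz: "?P - ?Q \<noteq> 0" by simp
  have dP: "degree ?P = M" using U(1,2) by (simp add: degree_prod_eq_sum_degree)
  have lP: "coeff ?P M = 1" using dP lead_coeff_prod[of "\<lambda>z. [:- z, 1:]" "unity_roots M"] by simp
  have dQ: "degree ?Q = M"
  proof -
    have "degree (monom 1 M + - 1 :: complex poly) = degree (monom 1 M :: complex poly)"
      using M by (intro degree_add_eq_left) (simp add: degree_monom_eq)
    then show ?thesis by (simp add: degree_monom_eq)
  qed
  have lQ: "coeff ?Q M = 1" using M by (simp add: coeff_1)
  have "degree (?P - ?Q) \<le> M" using degree_diff_le[of ?P M ?Q] dP dQ by simp
  moreover have "coeff (?P - ?Q) M = 0" using lP lQ by simp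
  ultimately have "degree (?P - ?Q) < M" using nz M by (metis le_neq_implies_less leading_coeff_0_iff)
  moreover have "unity_roots M \<subseteq> {x. poly (?P - ?Q) x = 0}"
  proof
    fix x assume x: "x \<in> unity_roots M"
    then have "poly ?P x = 0" using U(1) by (force simp: poly_prod prod_zero_iff)
    moreover have "poly ?Q x = 0" using x by (simp add: poly_monom unity_roots_def)
    ultimately show "x \<in> {x. poly (?P - ?Q) x = 0}" by simp
  qed
  then have "card (unity_roots M) \<le> card {x. poly (?P - ?Q) x = 0}"
    using poly_roots_finite[OF nz] by (rule card_mono[rotated])
  then have "M \<le> degree (?P - ?Q)" using U(2) card_poly_roots_bound[OF nz] by linarith
  ultimately show False by simp
qed

lemma prod_unity_roots:
  fixes u v :: complex
  assumes M: "M > 0"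
  shows "(\<Prod>z\<in>unity_roots M. u - v * z) = u ^ M - v ^ M"
proof (cases "v = 0")
  case True
  then show ?thesis using M unity_roots_props(2)[OF M] by (simp add: power_0_left)
next
  case False
  have "(\<Prod>z\<in>unity_roots M. u - v * z) = (\<Prod>z\<in>unity_roots M. v * (u / v - z))"
    using False by (intro prod.cong refl) (simp add: algebra_simps)
  also have "\<dots> = v ^ M * (\<Prod>z\<in>unity_roots M. u / v - z)"
    by (simp add: prod.distrib unity_roots_props(2)[OF M])
  also have "(\<Prod>z\<in>unity_roots M. u / v - z) = poly (\<Prod>z\<in>unity_roots M. [:- z, 1:]) (u / v)"
    by (simp add: poly_prod)
  also have "\<dots> = (u / v) ^ M - 1" unfolding prod_unity_roots_poly[OF M] by (simp add: poly_monom)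
  finally show ?thesis using False by (simp add: right_diff_distrib flip: power_mult_distrib)
qed

definition log_max :: "real \<Rightarrow> real \<Rightarrow> real" where
  "log_max \<epsilon> x = ln (max x \<epsilon>)"

lemma log_max_lipschitz:
  assumes e: "\<epsilon> > 0"
  shows "\<bar>log_max \<epsilon> x - log_max \<epsilon> y\<bar> \<le> (1 / \<epsilon>) * \<bar>x - y\<bar>"
proof -
  have *: "ln (max y \<epsilon>) - ln (max x \<epsilon>) \<le> (1 / \<epsilon>) * \<bar>x - y\<bar>" for x y
  proof -
    let ?a = "max x \<epsilon>" and ?b = "max y \<epsilon>"
    have "?a > 0" "?b > 0" using e by (simp_all add: less_max_iff_disj)
    then have "ln ?b - ln ?a = ln (?b / ?a)" by (simp add: ln_divide_pos)
    also have "\<dots> \<le> ?b / ?a - 1" using e by (intro ln_le_minus_one) auto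
    also have "\<dots> = (?b - ?a) / ?a" using e by (simp add: diff_divide_distrib)
    also have "\<dots> \<le> \<bar>x - y\<bar> / ?a" using e by (intro divide_right_mono) auto
    also have "\<dots> \<le> \<bar>x - y\<bar> / \<epsilon>" using e by (intro divide_left_mono) auto
    finally show ?thesis by simp
  qed
  show ?thesis using *[of x y] *[of y x] unfolding log_max_def abs_le_iff by (simp add: abs_minus_commute)
qed

text \<open>
  For $|z| = 1$ the regularized distance satisfies
  $|u - rz|^2 + \epsilon^2 = |a e' - b z|^2$ with $e' = u/|u|$, where $a \ge b$ are determined by
  $ab = |u| r$ and $a^2 + b^2 = |u|^2 + r^2 + \epsilon^2$. The product over the roots of unity is then
  $|(a e')^M - b^M|$.
\<close>

lemma circle_average_upper:
  fixes u :: complex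
  assumes M: "M > 0" and r: "r > 0" and e: "\<epsilon> > 0"
  shows "(\<Sum>z\<in>unity_roots M. log_max \<epsilon> (cmod (u - of_real r * z))) / real M \<le> log_max r (cmod u) + \<epsilon> / r + ln 2 / real M"
proof -
  note U = unity_roots_props[OF M]
  define s where "s = cmod u"
  define e' where "e' = (if s = 0 then 1 else u / of_real s)"
  have s0: "s \<ge> 0" by (simp add: s_def)
  have u: "u = of_real s * e'" by (auto simp: e'_def s_def)
  have ne: "cmod e' = 1" by (simp add: e'_def s_def norm_divide)
  \<comment> \<open>\<open>A\<close> and \<open>B\<close> are the largest and the smallest possible
    values of the regularized distance on the circle; \<open>a\<close> and \<open>b\<close> are half
    their sum and half their difference.\<close>
  define A where "A = sqrt ((s + r)\<^sup>2 + \<epsilon>\<^sup>2)"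
  define B where "B = sqrt ((s - r)\<^sup>2 + \<epsilon>\<^sup>2)"
  have A2: "A\<^sup>2 = (s + r)\<^sup>2 + \<epsilon>\<^sup>2" and B2: "B\<^sup>2 = (s - r)\<^sup>2 + \<epsilon>\<^sup>2" by (auto simp: A_def B_def)
  have B0: "B > 0" using e by (simp add: B_def add_nonneg_pos)
  have BA: "B \<le> A" unfolding A_def B_def using s0 r by (intro real_sqrt_le_mono) (simp add: power2_eq_square algebra_simps)
  define a where "a = (A + B) / 2"
  define b where "b = (A - B) / 2"
  have ab: "0 \<le> b" "b \<le> a" "0 < a" using B0 BA by (auto simp: a_def b_def)
  have ab1: "a * b = s * r"
  proof -
    have "a * b = (A\<^sup>2 - B\<^sup>2) / 4" by (simp add: a_def b_def power2_eq_square algebra_simps)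
    then show ?thesis unfolding A2 B2 by (simp add: power2_eq_square algebra_simps)
  qed
  have ab2: "a\<^sup>2 + b\<^sup>2 = s\<^sup>2 + r\<^sup>2 + \<epsilon>\<^sup>2"
  proof -
    have "a\<^sup>2 + b\<^sup>2 = (A\<^sup>2 + B\<^sup>2) / 2" by (simp add: a_def b_def power2_eq_square field_simps)
    then show ?thesis unfolding A2 B2 by (simp add: power2_eq_square algebra_simps)
  qed
  have sq: "sqrt (x\<^sup>2 + \<epsilon>\<^sup>2) \<le> \<bar>x\<bar> + \<epsilon>" for x
    using e by (intro real_le_lsqrt) (auto simp: power2_eq_square algebra_simps)
  \<comment> \<open>The half sum of s + r and |s - r| is max s r, and the regularization adds at
    most \<epsilon>.\<close>
  have am: "a \<le> max s r + \<epsilon>"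
  proof -
    have "A \<le> s + r + \<epsilon>" "B \<le> \<bar>s - r\<bar> + \<epsilon>" using sq[of "s + r"] sq[of "s - r"] s0 r by (auto simp: A_def B_def)
    then show ?thesis unfolding a_def by (auto simp: max_def abs_if split: if_splits)
  qed
  have gen: "(cmod (of_real x * e' - of_real y * z))\<^sup>2 = x\<^sup>2 + y\<^sup>2 - 2 * (x * y) * Re (e' * cnj z)" if "cmod z = 1" for x y z
  proof -
    have n1: "(Re e')\<^sup>2 + (Im e')\<^sup>2 = 1" "(Re z)\<^sup>2 + (Im z)\<^sup>2 = 1" using ne that by (auto simp: cmod_power2[symmetric])
    have "(cmod (of_real x * e' - of_real y * z))\<^sup>2 = x\<^sup>2 * ((Re e')\<^sup>2 + (Im e')\<^sup>2) + y\<^sup>2 * ((Re z)\<^sup>2 + (Im z)\<^sup>2) - 2 * (x * y) * Re (e' * cnj z)"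
      unfolding cmod_power2 by (simp add: power2_eq_square algebra_simps)
    then show ?thesis unfolding n1 by simp
  qed
  have le: "max (cmod (u - of_real r * z)) \<epsilon> \<le> cmod (of_real a * e' - of_real b * z)" if "z \<in> unity_roots M" for z
  proof -
    have "(cmod (of_real a * e' - of_real b * z))\<^sup>2 = (cmod (u - of_real r * z))\<^sup>2 + \<epsilon>\<^sup>2"
      unfolding u gen[OF U(3)[OF that]] ab1 ab2 by simp
    then have "(cmod (u - of_real r * z))\<^sup>2 \<le> (cmod (of_real a * e' - of_real b * z))\<^sup>2" "\<epsilon>\<^sup>2 \<le> (cmod (of_real a * e' - of_real b * z))\<^sup>2" by auto
    then show ?thesis using e by (auto intro: power2_le_imp_le)
  qed
  have "(\<Sum>z\<in>unity_roots M. log_max \<epsilon> (cmod (u - of_real r * z))) = ln (\<Prod>z\<in>unity_roots M. max (cmod (u - of_real r * z)) \<epsilon>)"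
    unfolding log_max_def using e by (subst ln_prod) (auto simp: U(1))
  also have "\<dots> \<le> ln (2 * (max s r + \<epsilon>) ^ M)"
  proof (rule ln_mono)
    show "0 < (\<Prod>z\<in>unity_roots M. max (cmod (u - of_real r * z)) \<epsilon>)" using e by (intro prod_pos) auto
    have "(\<Prod>z\<in>unity_roots M. max (cmod (u - of_real r * z)) \<epsilon>) \<le> (\<Prod>z\<in>unity_roots M. cmod (of_real a * e' - of_real b * z))"
      using e le by (intro prod_mono) auto
    also have "\<dots> = cmod ((of_real a * e') ^ M - of_real b ^ M)"
      unfolding prod_norm prod_unity_roots[OF M] ..
    also have "\<dots> \<le> cmod ((of_real a * e') ^ M) + cmod (of_real b ^ M)" by (rule norm_triangle_ineq4)
    also have "\<dots> = a ^ M + b ^ M" using ab ne by (simp add: norm_power norm_mult)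
    also have "\<dots> \<le> 2 * a ^ M" using ab power_mono[OF ab(2,1), of M] by simp
    also have "\<dots> \<le> 2 * (max s r + \<epsilon>) ^ M" using am ab by (simp add: power_mono)
    finally show "(\<Prod>z\<in>unity_roots M. max (cmod (u - of_real r * z)) \<epsilon>) \<le> 2 * (max s r + \<epsilon>) ^ M" .
  qed
  also have "\<dots> = ln 2 + real M * ln (max s r + \<epsilon>)"
  proof -
    have "0 < max s r + \<epsilon>" using r e by (simp add: less_max_iff_disj add_pos_pos)
    then show ?thesis by (simp add: ln_mult_pos ln_realpow)
  qed
  also have "ln (max s r + \<epsilon>) \<le> ln (max s r) + \<epsilon> / r"
  proof -
    have pos: "max s r > 0" using r by simp
    have "ln (max s r + \<epsilon>) = ln (max s r * (1 + \<epsilon> / max s r))" 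
    proof -
      have "max s r * (1 + \<epsilon> / max s r) = max s r + \<epsilon>" using pos by (simp add: distrib_left)
      then show ?thesis by simp
    qed
    also have "\<dots> = ln (max s r) + ln (1 + \<epsilon> / max s r)" using pos e by (intro ln_mult_pos) (simp_all add: add_pos_nonneg)
    also have "ln (1 + \<epsilon> / max s r) \<le> \<epsilon> / max s r" using pos e by (intro ln_add_one_self_le_self) auto
    also have "\<epsilon> / max s r \<le> \<epsilon> / r" using r e by (intro divide_left_mono) auto
    finally show ?thesis by simp
  qed
  finally have "(\<Sum>z\<in>unity_roots M. log_max \<epsilon> (cmod (u - of_real r * z))) \<le> ln 2 + real M * (ln (max s r) + \<epsilon> / r)"
    by (simp add: mult_left_mono)
  then have "(\<Sum>z\<in>unity_roots M. log_max \<epsilon> (cmod (u - of_real r * z))) / real M \<le> (ln 2 + real M * (ln (max s r) + \<epsilon> / r)) / real M"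
    by (rule divide_right_mono) simp
  also have "\<dots> = ln (max s r) + \<epsilon> / r + ln 2 / real M" using M by (simp add: add_divide_distrib)
  finally show ?thesis by (simp add: log_max_def s_def)
qed

lemma two_le_power_one_plus_inverse: "M > 0 \<Longrightarrow> 2 \<le> (1 + 1 / real M) ^ M"
proof -
  assume M: "M > 0"
  have "1 + real M * (1 / real M) \<le> (1 + 1 / real M) ^ M"
    by (rule Bernoulli_inequality) (rule order_trans[of _ 0], auto)
  then show ?thesis using M by simp
qed

text \<open>A ratio of moduli of at least 1 + 1/M makes the larger M-th power at least twice the
  smaller, by Bernoulli's inequality.\<close>

lemma norm_power_diff_ge:
  fixes u v :: complex
  assumes M: "M > 0" and uv: "cmod v * (1 + 1 / real M) \<le> cmod u"
  shows "cmod u ^ M / 2 \<le> cmod (u ^ M - v ^ M)"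
proof -
  have "2 * cmod v ^ M \<le> (1 + 1 / real M) ^ M * cmod v ^ M"
    using two_le_power_one_plus_inverse[OF M] by (intro mult_right_mono) auto
  also have "\<dots> = (cmod v * (1 + 1 / real M)) ^ M" by (simp add: power_mult_distrib mult.commute)
  also have "\<dots> \<le> cmod u ^ M" using uv by (intro power_mono) (auto simp: add_nonneg_nonneg)
  finally have "cmod u ^ M / 2 \<le> cmod u ^ M - cmod v ^ M" by simp
  also have "\<dots> \<le> cmod (u ^ M - v ^ M)" using norm_triangle_ineq2[of "u ^ M" "v ^ M"] by (simp add: norm_power)
  finally show ?thesis .
qed

text \<open>When the moduli are separated, the product over the nodes loses at most a factor 2
  against the larger M-th power. After averaging this is an error ln 2 / M, with no truncation of
  the logarithm.\<close>

lemma circle_average_lower_separated: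
  fixes u :: complex
  assumes M: "M > 0" and r: "r > 0" and sep: "r * (1 + 1 / real M) \<le> cmod u \<or> cmod u * (1 + 1 / real M) \<le> r"
  shows "u ^ M \<noteq> of_real r ^ M"
    and "log_max r (cmod u) - ln 2 / real M \<le> (\<Sum>z\<in>unity_roots M. ln (cmod (u - of_real r * z))) / real M"
proof -
  note U = unity_roots_props[OF M]
  define m where "m = max (cmod u) r"
  have m0: "m > 0" using r by (simp add: m_def)
  have "m ^ M / 2 \<le> cmod (u ^ M - of_real r ^ M)"
  proof -
    have M1: "1 \<le> 1 + 1 / real M" by simp
    show ?thesis using sep
    proof
      assume a: "r * (1 + 1 / real M) \<le> cmod u"
      then have "r \<le> cmod u" using M1 r by (smt (verit) mult_le_cancel_left1)
      then have "m = cmod u" by (simp add: m_def)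
      then show ?thesis using norm_power_diff_ge[OF M, of "of_real r" u] a r by simp
    next
      assume a: "cmod u * (1 + 1 / real M) \<le> r"
      have "cmod u * 1 \<le> cmod u * (1 + 1 / real M)" using M1 by (intro mult_left_mono) auto
      then have "m = r" using a by (simp add: m_def)
      then show ?thesis using norm_power_diff_ge[OF M, of u "of_real r"] a r by (simp add: norm_minus_commute)
    qed
  qed
  then have pos: "0 < m ^ M / 2" "m ^ M / 2 \<le> cmod (u ^ M - of_real r ^ M)" using m0 by auto
  then show ne: "u ^ M \<noteq> of_real r ^ M" by auto
  have pz: "(\<Prod>z\<in>unity_roots M. u - of_real r * z) \<noteq> 0" using ne by (simp add: prod_unity_roots[OF M])
  then have nz: "u - of_real r * z \<noteq> 0" if "z \<in> unity_roots M" for z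
    using that U(1) by (auto simp: prod_zero_iff)
  have "real M * ln m - ln 2 = ln (m ^ M / 2)" using m0 by (simp add: ln_divide_pos ln_realpow)
  also have "\<dots> \<le> ln (cmod (u ^ M - of_real r ^ M))" using pos by (intro ln_mono) auto
  also have "\<dots> = ln (\<Prod>z\<in>unity_roots M. cmod (u - of_real r * z))"
    by (simp only: prod_norm prod_unity_roots[OF M])
  also have "\<dots> = (\<Sum>z\<in>unity_roots M. ln (cmod (u - of_real r * z)))"
    using nz by (intro ln_prod) (auto simp: U(1))
  finally have "(real M * ln m - ln 2) / real M \<le> (\<Sum>z\<in>unity_roots M. ln (cmod (u - of_real r * z))) / real M"
    by (rule divide_right_mono) simp
  then show "log_max r (cmod u) - ln 2 / real M \<le> (\<Sum>z\<in>unity_roots M. ln (cmod (u - of_real r * z))) / real M"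
    using M by (simp add: diff_divide_distrib log_max_def m_def)
qed

text \<open>A point too close to the circle may be near a node. It is pushed radially out to the
  modulus \<open>r * (1 + 1 / real M)\<close>, where the separated case applies. The displacement is
  at most \<open>2 * r / real M\<close>, and the Lipschitz constant \<open>1 / \<epsilon>\<close> of
  the truncated logarithm converts it into the extra error.\<close>

lemma circle_average_lower:
  fixes u :: complex
  assumes M: "M > 0" and r: "r > 0" and e: "\<epsilon> > 0"
  shows "log_max r (cmod u) - ln 2 / real M - 2 * r / (real M * \<epsilon>) \<le> (\<Sum>z\<in>unity_roots M. log_max \<epsilon> (cmod (u - of_real r * z))) / real M"
proof -
  note U = unity_roots_props[OF M]
  have sep: "log_max r (cmod u) - ln 2 / real M \<le> (\<Sum>z\<in>unity_roots M. log_max \<epsilon> (cmod (u - of_real r * z))) / real M"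
    if s: "r * (1 + 1 / real M) \<le> cmod u \<or> cmod u * (1 + 1 / real M) \<le> r" for u :: complex
  proof -
    note c = circle_average_lower_separated[OF M r s]
    have pz: "(\<Prod>z\<in>unity_roots M. u - of_real r * z) \<noteq> 0" using c(1) by (simp add: prod_unity_roots[OF M])
    have "(\<Sum>z\<in>unity_roots M. ln (cmod (u - of_real r * z))) \<le> (\<Sum>z\<in>unity_roots M. log_max \<epsilon> (cmod (u - of_real r * z)))"
      unfolding log_max_def using pz U(1) by (intro sum_mono ln_mono) (auto simp: prod_zero_iff)
    then have "(\<Sum>z\<in>unity_roots M. ln (cmod (u - of_real r * z))) / real M \<le> (\<Sum>z\<in>unity_roots M. log_max \<epsilon> (cmod (u - of_real r * z))) / real M"
      by (rule divide_right_mono) simp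
    then show ?thesis using c(2) by linarith
  qed
  show ?thesis
  proof (cases "r * (1 + 1 / real M) \<le> cmod u \<or> cmod u * (1 + 1 / real M) \<le> r")
    case True
    have "0 \<le> 2 * r / (real M * \<epsilon>)" using r e by simp
    then show ?thesis using sep[OF True] by linarith
  next
    case False
    define s where "s = cmod u"
    have s: "s < r * (1 + 1 / real M)" "r < s * (1 + 1 / real M)" using False by (auto simp: s_def)
    have s0: "s > 0" using s r by (smt (verit) mult_nonneg_nonpos divide_nonneg_nonneg of_nat_0_le_iff s_def norm_ge_zero mult_not_zero)
    define t where "t = r * (1 + 1 / real M)"
    define u' where "u' = of_real (t / s) * u"
    have t0: "t \<ge> 0" using r by (simp add: t_def)
    have "cmod u' = \<bar>t / s\<bar> * s" by (simp only: u'_def norm_mult norm_of_real s_def)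
    then have nu': "cmod u' = t" using s0 t0 by simp
    have "cmod (u - u') = t - s"
    proof -
      have "u - u' = of_real (1 - t / s) * u" by (simp add: u'_def algebra_simps)
      then have "cmod (u - u') = \<bar>1 - t / s\<bar> * s" by (simp only: norm_mult norm_of_real s_def)
      also have "\<bar>1 - t / s\<bar> = t / s - 1" using s(1) s0 by (simp add: t_def)
      finally show ?thesis using s0 by (simp add: left_diff_distrib)
    qed
    also have "t - s \<le> 2 * r / real M"
    proof -
      have "r * (1 - 1 / real M) * (1 + 1 / real M) \<le> r" using r by (simp add: algebra_simps)
      then have "r * (1 - 1 / real M) * (1 + 1 / real M) < s * (1 + 1 / real M)" using s(2) by linarith
      then have "r * (1 - 1 / real M) < s" by (rule mult_right_less_imp_less) simp
      then have "r - r / real M < s" by (simp add: right_diff_distrib)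
      moreover have "t = r + r / real M" by (simp add: t_def distrib_left)
      moreover have "2 * r / real M = r / real M + r / real M" by (simp add: add_divide_distrib[symmetric])
      ultimately show ?thesis by linarith
    qed
    finally have du: "cmod (u - u') \<le> 2 * r / real M" .
    have "(\<Sum>z\<in>unity_roots M. log_max \<epsilon> (cmod (u' - of_real r * z)) - 2 * r / (real M * \<epsilon>)) \<le> (\<Sum>z\<in>unity_roots M. log_max \<epsilon> (cmod (u - of_real r * z)))"
    proof (intro sum_mono)
      fix z
      have "\<bar>cmod (u' - of_real r * z) - cmod (u - of_real r * z)\<bar> \<le> cmod (u - u')"
        using norm_triangle_ineq3[of "u' - of_real r * z" "u - of_real r * z"] by (simp add: norm_minus_commute)
      then have "(1 / \<epsilon>) * \<bar>cmod (u' - of_real r * z) - cmod (u - of_real r * z)\<bar> \<le> (1 / \<epsilon>) * (2 * r / real M)"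
        using du e by (intro mult_left_mono) auto
      then show "log_max \<epsilon> (cmod (u' - of_real r * z)) - 2 * r / (real M * \<epsilon>) \<le> log_max \<epsilon> (cmod (u - of_real r * z))"
        using log_max_lipschitz[OF e, of "cmod (u' - of_real r * z)" "cmod (u - of_real r * z)"] by (simp add: mult.commute)
    qed
    then have "((\<Sum>z\<in>unity_roots M. log_max \<epsilon> (cmod (u' - of_real r * z))) - real M * (2 * r / (real M * \<epsilon>))) / real M
      \<le> (\<Sum>z\<in>unity_roots M. log_max \<epsilon> (cmod (u - of_real r * z))) / real M"
      by (intro divide_right_mono) (simp_all add: sum_subtractf U(2))
    then have 1: "(\<Sum>z\<in>unity_roots M. log_max \<epsilon> (cmod (u' - of_real r * z))) / real M - 2 * r / (real M * \<epsilon>)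
      \<le> (\<Sum>z\<in>unity_roots M. log_max \<epsilon> (cmod (u - of_real r * z))) / real M"
      using M by (simp add: diff_divide_distrib mult.commute)
    have 2: "log_max r t - ln 2 / real M \<le> (\<Sum>z\<in>unity_roots M. log_max \<epsilon> (cmod (u' - of_real r * z))) / real M"
      using sep[of u'] nu' by (simp add: t_def)
    have "log_max r s \<le> log_max r t" unfolding log_max_def using r s(1) by (intro ln_mono) (auto simp: t_def)
    then show ?thesis using 1 2 by (simp add: s_def)
  qed
qed

text \<open>The untruncated counterpart, applied to eigenvalues in
  \<open>empirical_log_lower\<close>: the product over the nodes is exactly a difference of M-th
  powers, so the triangle inequality suffices.\<close>

lemma circle_average_log_upper:
  fixes u :: complex
  assumes M: "M > 0" and r: "r > 0" and nz: "\<And>z. z \<in> unity_roots M \<Longrightarrow> u \<noteq> of_real r * z"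
  shows "(\<Sum>z\<in>unity_roots M. ln (cmod (u - of_real r * z))) / real M \<le> log_max r (cmod u) + ln 2 / real M"
proof -
  note U = unity_roots_props[OF M]
  define m where "m = max (cmod u) r"
  have m0: "m > 0" using r by (simp add: m_def)
  have "(\<Sum>z\<in>unity_roots M. ln (cmod (u - of_real r * z))) = ln (\<Prod>z\<in>unity_roots M. cmod (u - of_real r * z))"
    using nz by (intro ln_prod[symmetric]) (auto simp: U(1))
  also have "\<dots> = ln (cmod (u ^ M - of_real r ^ M))" by (simp only: prod_norm prod_unity_roots[OF M])
  also have "\<dots> \<le> ln (2 * m ^ M)"
  proof (rule ln_mono)
    have "(\<Prod>z\<in>unity_roots M. u - of_real r * z) \<noteq> 0" using nz U(1) by (auto simp: prod_zero_iff)
    then show "0 < cmod (u ^ M - of_real r ^ M)" by (simp add: prod_unity_roots[OF M])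
    have "cmod (u ^ M - of_real r ^ M) \<le> cmod u ^ M + r ^ M"
      using norm_triangle_ineq4[of "u ^ M" "of_real r ^ M"] r by (simp add: norm_power)
    also have "\<dots> \<le> m ^ M + m ^ M" using r by (intro add_mono power_mono) (auto simp: m_def)
    finally show "cmod (u ^ M - of_real r ^ M) \<le> 2 * m ^ M" by simp
  qed
  also have "\<dots> = ln 2 + real M * ln m" using m0 by (simp add: ln_mult_pos ln_realpow)
  finally have "(\<Sum>z\<in>unity_roots M. ln (cmod (u - of_real r * z))) / real M \<le> (ln 2 + real M * ln m) / real M"
    by (rule divide_right_mono) simp
  also have "\<dots> = ln m + ln 2 / real M" using M by (simp add: add_divide_distrib)
  finally show ?thesis by (simp add: log_max_def m_def)
qed

section \<open>Truncated potentials determine the measure\<close>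

text \<open>Both truncations agree with ln outside the disc of radius \<open>R\<close>, so the
  difference has compact support. It is a nonnegative radial plateau of height ln 2.\<close>

definition log_bump :: "real \<Rightarrow> complex \<Rightarrow> real" where
  "log_bump R w = log_max R (cmod w) - log_max (R / 2) (cmod w)"

lemma log_bump_props:
  assumes R: "R > 0"
  shows "0 \<le> log_bump R w" "log_bump R w \<le> ln 2" "cmod w \<ge> R \<Longrightarrow> log_bump R w = 0" "cmod w \<le> R / 2 \<Longrightarrow> log_bump R w = ln 2"
    "\<bar>log_bump R w - log_bump R w'\<bar> \<le> (3 / R) * cmod (w - w')"
proof -
  show "0 \<le> log_bump R w" unfolding log_bump_def log_max_def using R by (simp add: ln_mono)
  have "ln (max (cmod w) R) \<le> ln (2 * max (cmod w) (R / 2))" using R by (intro ln_mono) auto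
  also have "\<dots> = ln 2 + ln (max (cmod w) (R / 2))" using R by (intro ln_mult_pos) (auto simp: less_max_iff_disj)
  finally show "log_bump R w \<le> ln 2" by (simp add: log_bump_def log_max_def)
  show "log_bump R w = 0" if "cmod w \<ge> R" using that R by (simp add: log_bump_def log_max_def max_absorb1)
  show "log_bump R w = ln 2" if "cmod w \<le> R / 2" using that R by (simp add: log_bump_def log_max_def max_absorb2 ln_divide_pos)
  have 1: "\<bar>log_max R (cmod w) - log_max R (cmod w')\<bar> \<le> (1 / R) * \<bar>cmod w - cmod w'\<bar>"
    using R by (rule log_max_lipschitz)
  have 2: "\<bar>log_max (R / 2) (cmod w) - log_max (R / 2) (cmod w')\<bar> \<le> (1 / (R / 2)) * \<bar>cmod w - cmod w'\<bar>"
    using R by (intro log_max_lipschitz) simp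
  have "(1 / R) * \<bar>cmod w - cmod w'\<bar> + (1 / (R / 2)) * \<bar>cmod w - cmod w'\<bar> = (3 / R) * \<bar>cmod w - cmod w'\<bar>"
    using R by (simp add: field_simps)
  also have "\<dots> \<le> (3 / R) * cmod (w - w')" using R by (intro mult_left_mono norm_triangle_ineq3) auto
  finally have 3: "(1 / R) * \<bar>cmod w - cmod w'\<bar> + (1 / (R / 2)) * \<bar>cmod w - cmod w'\<bar> \<le> (3 / R) * cmod (w - w')" .
  have "\<bar>log_bump R w - log_bump R w'\<bar> \<le> \<bar>log_max R (cmod w) - log_max R (cmod w')\<bar> + \<bar>log_max (R / 2) (cmod w) - log_max (R / 2) (cmod w')\<bar>"
    unfolding log_bump_def by linarith
  also note add_mono[OF 1 2]
  also note 3
  finally show "\<bar>log_bump R w - log_bump R w'\<bar> \<le> (3 / R) * cmod (w - w')" .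
qed

lemma log_bump_continuous: "R > 0 \<Longrightarrow> continuous_on A (log_bump R)"
  unfolding log_bump_def log_max_def by (intro continuous_intros) (auto simp: max_def)

lemma log_bump_measurable [measurable]:
  assumes "R > 0"
  shows "log_bump R \<in> borel_measurable borel"
  using log_bump_continuous[OF assms] by (rule borel_measurable_continuous_onI)

lemma log_bump_integral:
  assumes R: "R > 0"
  shows "integrable lborel (log_bump R)" "integral\<^sup>L lborel (log_bump R) > 0"
    "integral\<^sup>L lborel (\<lambda>z. log_bump R (w - z)) = integral\<^sup>L lborel (log_bump R)"
    "integrable lborel (\<lambda>z. log_bump R (w - z))"
proof -
  note P = log_bump_props[OF R]
  note m = log_bump_measurable[OF R]
  have fin: "emeasure lborel (cball (0::complex) t) < \<infinity>" for t
    using emeasure_compact_finite[OF compact_cball] by blast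
  show int: "integrable lborel (log_bump R)"
  proof (rule Bochner_Integration.integrable_bound)
    show "integrable lborel (\<lambda>w. indicator (cball (0::complex) R) w * ln 2 :: real)"
      using fin[of R] by (intro integrable_mult_left integrable_real_indicator) auto
    show "AE w in lborel. norm (log_bump R w) \<le> norm (indicator (cball (0::complex) R) w * ln 2 :: real)"
      using P by (intro AE_I2) (auto simp: indicator_def abs_of_nonneg)
  qed (use m in simp)
  have "0 < ln 2 * measure lborel (ball (0::complex) (R / 2))"
    using R by (simp add: content_ball_pos)
  also have "\<dots> = integral\<^sup>L lborel (\<lambda>w. ln 2 * indicator (ball (0::complex) (R / 2)) w)"
    by simp
  also have "\<dots> \<le> integral\<^sup>L lborel (log_bump R)"
  proof (rule integral_mono)
    have "emeasure lborel (ball (0::complex) (R / 2)) < \<infinity>"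
      using emeasure_mono[of "ball (0::complex) (R / 2)" "cball 0 (R / 2)" lborel] fin[of "R / 2"] by (simp add: le_less_trans)
    then show "integrable lborel (\<lambda>w. ln 2 * indicator (ball (0::complex) (R / 2)) w :: real)"
      by (intro integrable_mult_right integrable_real_indicator) auto
    show "ln 2 * indicator (ball (0::complex) (R / 2)) w \<le> log_bump R w" for w
      using P(1)[of w] P(4)[of w] by (auto simp: indicator_def)
  qed (rule int)
  finally show "integral\<^sup>L lborel (log_bump R) > 0" .
  \<comment> \<open>The bump is radial, so its argument may be reflected and translation invariance
    of Lebesgue measure applies.\<close>
  have e: "log_bump R (w - z) = log_bump R (- w + z)" for z
    using norm_minus_commute[of w z] by (simp add: log_bump_def)
  have d: "distr lborel borel ((+) (- w)) = (lborel :: complex measure)" by (rule lborel_distr_plus)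
  show "integral\<^sup>L lborel (\<lambda>z. log_bump R (w - z)) = integral\<^sup>L lborel (log_bump R)"
    unfolding e using integral_distr[of "(+) (- w)" lborel borel "log_bump R"] m by (simp add: d)
  show "integrable lborel (\<lambda>z. log_bump R (w - z))"
    unfolding e using integrable_distr_eq[of "(+) (- w)" lborel borel "log_bump R"] m int by (simp add: d)
qed

lemma convolution_approx:
  fixes h :: "complex \<Rightarrow> real"
  assumes R: "R > 0" and h: "continuous_on UNIV h" and hB: "\<And>z. B \<le> cmod z \<Longrightarrow> h z = 0" "\<And>z. \<bar>h z\<bar> \<le> C"
    and e: "\<And>z w. cmod (w - z) \<le> R \<Longrightarrow> \<bar>h z - h w\<bar> \<le> e"
  shows "\<bar>(LINT z|lborel. h z * log_bump R (w - z)) - integral\<^sup>L lborel (log_bump R) * h w\<bar> \<le> e * integral\<^sup>L lborel (log_bump R)"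
proof -
  note P = log_bump_props[OF R] and I = log_bump_integral[OF R]
  have hm: "h \<in> borel_measurable borel" using h by (rule borel_measurable_continuous_onI)
  have int: "integrable lborel (\<lambda>z. h z * log_bump R (w - z))"
  proof (rule Bochner_Integration.integrable_bound)
    show "integrable lborel (\<lambda>z. C * log_bump R (w - z))" using I(4) by (intro integrable_mult_right)
    have "\<bar>h z\<bar> * log_bump R (w - z) \<le> C * log_bump R (w - z)" for z using hB(2) P(1) by (intro mult_right_mono)
    moreover have "C \<ge> 0" using hB(2)[of 0] by linarith
    ultimately show "AE z in lborel. norm (h z * log_bump R (w - z)) \<le> norm (C * log_bump R (w - z))"
      using P(1) by (intro AE_I2) (auto simp: abs_mult abs_of_nonneg)
  qed (use hm log_bump_measurable[OF R] in measurable)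
  have "(LINT z|lborel. h z * log_bump R (w - z)) - integral\<^sup>L lborel (log_bump R) * h w
      = (LINT z|lborel. h z * log_bump R (w - z)) - (LINT z|lborel. h w * log_bump R (w - z))"
    using I(3)[of w] by simp
  also have "\<dots> = (LINT z|lborel. h z * log_bump R (w - z) - h w * log_bump R (w - z))"
    using int I(4)[of w] by (intro Bochner_Integration.integral_diff[symmetric]) auto
  also have "\<bar>\<dots>\<bar> \<le> (LINT z|lborel. \<bar>h z * log_bump R (w - z) - h w * log_bump R (w - z)\<bar>)"
    by (rule integral_abs_bound)
  also have "\<dots> \<le> (LINT z|lborel. e * log_bump R (w - z))"
  proof (rule integral_mono)
    show "integrable lborel (\<lambda>z. \<bar>h z * log_bump R (w - z) - h w * log_bump R (w - z)\<bar>)"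
      using int I(4)[of w] by (intro integrable_abs Bochner_Integration.integrable_diff) auto
    show "integrable lborel (\<lambda>z. e * log_bump R (w - z))" using I(4) by (intro integrable_mult_right)
    fix z
    show "\<bar>h z * log_bump R (w - z) - h w * log_bump R (w - z)\<bar> \<le> e * log_bump R (w - z)"
    proof (cases "cmod (w - z) \<le> R")
      case True
      have "\<bar>h z * log_bump R (w - z) - h w * log_bump R (w - z)\<bar> = \<bar>h z - h w\<bar> * log_bump R (w - z)"
        using P(1)[of "w - z"] by (simp add: left_diff_distrib[symmetric] abs_mult abs_of_nonneg)
      also have "\<dots> \<le> e * log_bump R (w - z)" using e[OF True] P(1) by (rule mult_right_mono)
      finally show ?thesis .
    next
      case False
      then show ?thesis using P(3)[of "w - z"] by simp
    qed
  qed
  also have "\<dots> = e * integral\<^sup>L lborel (log_bump R)" using I(3)[of w] by simp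
  finally show ?thesis .
qed

text \<open>Moves the convolution from the test function to the measure: the integral of a mollified
  \<open>h\<close> becomes an integral of differences of truncated potentials of \<nu> against
  \<open>h\<close>.\<close>

lemma convolution_fubini:
  fixes h :: "complex \<Rightarrow> real"
  assumes R: "R > 0" and h: "continuous_on UNIV h" and hB: "\<And>z. B \<le> cmod z \<Longrightarrow> h z = 0" "\<And>z. \<bar>h z\<bar> \<le> C"
    and \<nu>: "prob_space \<nu>" "sets \<nu> = sets borel"
  shows "(LINT w|\<nu>. LINT z|lborel. h z * log_bump R (w - z)) = (LINT z|lborel. h z * (LINT w|\<nu>. log_bump R (w - z)))"
    and "integrable \<nu> (\<lambda>w. LINT z|lborel. h z * log_bump R (w - z))"
    and "integrable lborel (\<lambda>z. h z * (LINT w|\<nu>. log_bump R (w - z)))"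
proof -
  interpret \<nu>: prob_space \<nu> by (rule \<nu>(1))
  interpret pair_sigma_finite lborel \<nu> ..
  note P = log_bump_props[OF R]
  have hm[measurable]: "h \<in> borel_measurable borel" using h by (rule borel_measurable_continuous_onI)
  have bm[measurable]: "log_bump R \<in> borel_measurable borel" by (rule log_bump_measurable[OF R])
  have sp: "space \<nu> = UNIV" using sets_eq_imp_space_eq[OF \<nu>(2)] by simp
  have idm[measurable]: "(\<lambda>w. w) \<in> measurable \<nu> borel" using measurable_ident_sets[OF \<nu>(2)] by simp
  have C: "C \<ge> 0" using hB(2)[of 0] by linarith
  have meas: "(\<lambda>(z, w). h z * log_bump R (w - z)) \<in> borel_measurable (lborel \<Otimes>\<^sub>M \<nu>)"
    by measurable
  have int: "integrable (lborel \<Otimes>\<^sub>M \<nu>) (\<lambda>(z, w). h z * log_bump R (w - z))"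
  proof (rule Bochner_Integration.integrable_bound[OF _ meas])
    have "emeasure (lborel \<Otimes>\<^sub>M \<nu>) (cball (0::complex) B \<times> space \<nu>) = emeasure lborel (cball (0::complex) B) * emeasure \<nu> (space \<nu>)"
      by (rule \<nu>.emeasure_pair_measure_Times) auto
    also have "\<dots> < \<infinity>" using emeasure_compact_finite[OF compact_cball, of "0::complex" B] by (simp add: \<nu>.emeasure_space_1)
    finally show "integrable (lborel \<Otimes>\<^sub>M \<nu>) (\<lambda>x. (C * ln 2) * indicator (cball (0::complex) B \<times> space \<nu>) x :: real)"
      by (intro integrable_mult_right integrable_real_indicator) auto
    show "AE x in lborel \<Otimes>\<^sub>M \<nu>. norm (case x of (z, w) \<Rightarrow> h z * log_bump R (w - z)) \<le> norm ((C * ln 2) * indicator (cball (0::complex) B \<times> space \<nu>) x :: real)"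
    proof (intro AE_I2, clarify)
      fix z w
      have "\<bar>h z\<bar> * log_bump R (w - z) \<le> C * ln 2" using hB(2) P(1,2) C by (intro mult_mono) auto
      then show "norm (h z * log_bump R (w - z)) \<le> norm ((C * ln 2) * indicator (cball (0::complex) B \<times> space \<nu>) (z, w) :: real)"
        using hB(1)[of z] P(1)[of "w - z"] C by (auto simp: abs_mult indicator_def sp not_le)
    qed
  qed
  show "(LINT w|\<nu>. LINT z|lborel. h z * log_bump R (w - z)) = (LINT z|lborel. h z * (LINT w|\<nu>. log_bump R (w - z)))"
    using Fubini_integral[OF int] by simp
  show "integrable \<nu> (\<lambda>w. LINT z|lborel. h z * log_bump R (w - z))"
    using integrable_snd[OF int] by simp
  show "integrable lborel (\<lambda>z. h z * (LINT w|\<nu>. log_bump R (w - z)))"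
    using integrable_fst[OF int] by simp
qed

text \<open>Mollification by the bump approximates \<open>h\<close> uniformly, up to the constant
  factor \<open>J\<close>, once \<open>R\<close> is below its modulus of continuity. The integral of
  the mollified function depends on \<nu> only through bump integrals centred in a compact disc.
  These are Lipschitz in the centre with a constant common to all probability measures, so a finite
  net of centres is enough.\<close>

lemma log_bump_determines_compact_support:
  fixes h :: "complex \<Rightarrow> real"
  assumes h: "continuous_on UNIV h" and hB0: "\<forall>z. B \<le> cmod z \<longrightarrow> h z = 0" and e: "e > 0"
    and \<mu>: "prob_space \<mu>" "sets \<mu> = sets borel"
  shows "\<exists>Z R \<eta>. finite Z \<and> R > 0 \<and> \<eta> > 0 \<and>
    (\<forall>\<nu>. prob_space \<nu> \<and> sets \<nu> = sets borel \<and>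
      (\<forall>z\<in>Z. \<bar>(LINT w|\<nu>. log_bump R (w - z)) - (LINT w|\<mu>. log_bump R (w - z))\<bar> \<le> \<eta>) \<longrightarrow>
      \<bar>(LINT w|\<nu>. h w) - (LINT w|\<mu>. h w)\<bar> \<le> e)"
proof -
  have hB: "h z = 0" if "B \<le> cmod z" for z using hB0 that by blast
  have "compact (h ` cball (0::complex) B)" using h by (intro compact_continuous_image continuous_on_subset[OF h]) auto
  then obtain C where C: "C > 0" "\<And>z. z \<in> cball (0::complex) B \<Longrightarrow> \<bar>h z\<bar> \<le> C"
    using compact_imp_bounded bounded_pos by (metis imageI real_norm_def)
  have hC: "\<bar>h z\<bar> \<le> C" for z using C(2)[of z] C(1) hB[of z] by (cases "cmod z \<le> B") auto
  obtain R where R: "R > 0" and unif: "\<And>z w. cmod (w - z) \<le> R \<Longrightarrow> \<bar>h z - h w\<bar> \<le> e / 3"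
  proof -
    \<comment> \<open>The margin 1 handles pairs that straddle the edge of the support: if one of
      two points at distance at most 1 leaves the larger ball, \<open>h\<close> vanishes at
      both.\<close>
    have "uniformly_continuous_on (cball 0 (B + 1)) h"
      by (intro compact_uniformly_continuous continuous_on_subset[OF h]) auto
    then obtain d where d: "d > 0" "\<And>x y. x \<in> cball 0 (B + 1) \<Longrightarrow> y \<in> cball 0 (B + 1) \<Longrightarrow> dist y x < d \<Longrightarrow> dist (h y) (h x) < e / 3"
      unfolding uniformly_continuous_on_def using e by (metis divide_pos_pos zero_less_numeral)
    show thesis
    proof (rule that[of "min (d / 2) 1"])
      show "min (d / 2) 1 > 0" using d(1) by simp
      fix z w :: complex assume zw: "cmod (w - z) \<le> min (d / 2) 1"
      have t: "cmod w \<le> cmod z + cmod (w - z)" "cmod z \<le> cmod w + cmod (w - z)"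
        using norm_triangle_sub[of w z] norm_triangle_sub[of z w] by (auto simp: norm_minus_commute)
      show "\<bar>h z - h w\<bar> \<le> e / 3"
      proof (cases "cmod z \<le> B + 1 \<and> cmod w \<le> B + 1")
        case True
        then show ?thesis using d(2)[of w z] zw d(1) by (simp add: dist_norm norm_minus_commute less_imp_le)
      next
        case False
        then have "B \<le> cmod z" "B \<le> cmod w" using t zw by auto
        then show ?thesis using hB e by simp
      qed
    qed
  qed
  define J where "J = integral\<^sup>L lborel (log_bump R)"
  have J: "J > 0" unfolding J_def by (rule log_bump_integral(2)[OF R])
  define I where "I = (LINT z|lborel. \<bar>h z\<bar>)"
  have hm[measurable]: "h \<in> borel_measurable borel" using h by (rule borel_measurable_continuous_onI)
  have hi: "integrable lborel h"
  proof (rule Bochner_Integration.integrable_bound)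
    show "integrable lborel (\<lambda>z. C * indicator (cball (0::complex) B) z :: real)"
      using emeasure_compact_finite[OF compact_cball, of "0::complex" B]
      by (intro integrable_mult_right integrable_real_indicator) (auto simp: less_top)
    show "AE z in lborel. norm (h z) \<le> norm (C * indicator (cball (0::complex) B) z :: real)"
      using hC hB C(1) by (intro AE_I2) (auto simp: indicator_def not_le)
  qed simp
  have I0: "I \<ge> 0" by (simp add: I_def)
  \<comment> \<open>Chosen so that \<open>2 * \<eta> * I\<close> is at most a third of
    \<open>J * e\<close>; the other two thirds are the mollification errors for \<nu> and for \<mu>.
    The added 1 avoids a division by 0.\<close>
  define \<eta> where "\<eta> = J * e / (3 * (2 * (I + 1)))"
  have \<eta>: "\<eta> > 0" using J e I0 by (simp add: \<eta>_def)
  \<comment> \<open>Moving the centre by \<delta> changes an integral of the bump, with Lipschitz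
    constant \<open>3 / R\<close>, by at most \<eta> / 2.\<close>
  define \<delta> where "\<delta> = \<eta> * R / 6"
  have \<delta>: "\<delta> > 0" using \<eta> R by (simp add: \<delta>_def)
  have "compact (cball (0::complex) B)" by simp
  then obtain Z where Z: "finite Z" "cball (0::complex) B \<subseteq> (\<Union>x\<in>Z. ball x \<delta>)"
    unfolding compact_eq_totally_bounded using \<delta> by blast
  show ?thesis
  proof (intro exI conjI allI impI, rule Z(1), rule R, rule \<eta>, elim conjE)
    fix \<nu> :: "complex measure"
    assume \<nu>: "prob_space \<nu>" "sets \<nu> = sets borel"
      and "\<forall>z\<in>Z. \<bar>(LINT w|\<nu>. log_bump R (w - z)) - (LINT w|\<mu>. log_bump R (w - z))\<bar> \<le> \<eta>"
    then have cl: "\<And>z. z \<in> Z \<Longrightarrow> \<bar>(LINT w|\<nu>. log_bump R (w - z)) - (LINT w|\<mu>. log_bump R (w - z))\<bar> \<le> \<eta>" by blast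
    define D where "D \<tau> z = (LINT w|\<tau>. log_bump R (w - z))" for \<tau> z
    have Dlip: "\<bar>D \<tau> z - D \<tau> z'\<bar> \<le> (3 / R) * cmod (z - z')" if \<tau>: "prob_space \<tau>" "sets \<tau> = sets borel" for \<tau> z z'
    proof -
      interpret \<tau>: prob_space \<tau> by (rule \<tau>(1))
      have idm: "(\<lambda>w. w) \<in> measurable \<tau> borel" using measurable_ident_sets[OF \<tau>(2)] by simp
      have int: "integrable \<tau> (\<lambda>w. log_bump R (w - z))" for z
        using log_bump_props[OF R] log_bump_measurable[OF R] idm
        by (intro \<tau>.integrable_const_bound[of _ "ln 2"]) (auto intro!: measurable_compose[OF _ log_bump_measurable[OF R]])
      have "\<bar>D \<tau> z - D \<tau> z'\<bar> = \<bar>LINT w|\<tau>. log_bump R (w - z) - log_bump R (w - z')\<bar>"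
        unfolding D_def using int by (simp add: Bochner_Integration.integral_diff)
      also have "\<dots> \<le> (LINT w|\<tau>. \<bar>log_bump R (w - z) - log_bump R (w - z')\<bar>)" by (rule integral_abs_bound)
      also have "\<dots> \<le> (LINT w|\<tau>. (3 / R) * cmod (z - z'))"
      proof (rule integral_mono)
        show "integrable \<tau> (\<lambda>w. \<bar>log_bump R (w - z) - log_bump R (w - z')\<bar>)" using int by (intro integrable_abs Bochner_Integration.integrable_diff)
        show "\<bar>log_bump R (w - z) - log_bump R (w - z')\<bar> \<le> (3 / R) * cmod (z - z')" for w
          using log_bump_props(5)[OF R, of "w - z" "w - z'"] by (simp add: norm_minus_commute)
      qed simp
      finally show ?thesis by (simp add: \<tau>.prob_space)
    qed
    have DD: "\<bar>D \<nu> z - D \<mu> z\<bar> \<le> 2 * \<eta>" if z: "cmod z \<le> B" for z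
    proof -
      obtain x where x: "x \<in> Z" "dist x z < \<delta>" using Z(2) z by (force simp: subset_iff)
      have "(3 / R) * cmod (z - x) \<le> (3 / R) * \<delta>" using x(2) R by (intro mult_left_mono) (auto simp: dist_norm norm_minus_commute)
      also have "\<dots> = \<eta> / 2" using R by (simp add: \<delta>_def)
      finally have "(3 / R) * cmod (z - x) \<le> \<eta> / 2" .
      then have "\<bar>D \<nu> z - D \<nu> x\<bar> \<le> \<eta> / 2" "\<bar>D \<mu> z - D \<mu> x\<bar> \<le> \<eta> / 2"
        using Dlip[OF \<nu>, of z x] Dlip[OF \<mu>, of z x] by linarith+
      moreover have "\<bar>D \<nu> x - D \<mu> x\<bar> \<le> \<eta>" using cl[OF x(1)] by (simp add: D_def)
      ultimately show ?thesis by linarith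
    qed
    define H where "H w = (LINT z|lborel. h z * log_bump R (w - z))" for w
    have HJ: "\<bar>H w - J * h w\<bar> \<le> e / 3 * J" for w
      unfolding H_def J_def by (rule convolution_approx[OF R h hB hC unif])
    have conv: "\<bar>(LINT w|\<tau>. H w) - J * (LINT w|\<tau>. h w)\<bar> \<le> e / 3 * J" if \<tau>: "prob_space \<tau>" "sets \<tau> = sets borel" for \<tau>
    proof -
      interpret \<tau>: prob_space \<tau> by (rule \<tau>(1))
      have Hi: "integrable \<tau> H" unfolding H_def by (rule convolution_fubini(2)[OF R h hB hC \<tau>])
      have "h \<in> borel_measurable \<tau>" using hm unfolding measurable_cong_sets[OF \<tau>(2) refl] .
      then have hi': "integrable \<tau> h" using hC by (intro \<tau>.integrable_const_bound[of _ C]) auto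
      have "\<bar>(LINT w|\<tau>. H w) - J * (LINT w|\<tau>. h w)\<bar> = \<bar>LINT w|\<tau>. H w - J * h w\<bar>"
        using Hi hi' by (simp add: Bochner_Integration.integral_diff)
      also have "\<dots> \<le> (LINT w|\<tau>. \<bar>H w - J * h w\<bar>)" by (rule integral_abs_bound)
      also have "\<dots> \<le> (LINT w|\<tau>. e / 3 * J)"
        using Hi hi' HJ by (intro integral_mono integrable_abs Bochner_Integration.integrable_diff integrable_mult_right) auto
      finally show ?thesis by (simp add: \<tau>.prob_space)
    qed
    have HD: "(LINT w|\<tau>. H w) = (LINT z|lborel. h z * D \<tau> z)" if \<tau>: "prob_space \<tau>" "sets \<tau> = sets borel" for \<tau>
      unfolding H_def D_def by (rule convolution_fubini(1)[OF R h hB hC \<tau>])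
    have Di: "integrable lborel (\<lambda>z. h z * D \<tau> z)" if \<tau>: "prob_space \<tau>" "sets \<tau> = sets borel" for \<tau>
      unfolding D_def by (rule convolution_fubini(3)[OF R h hB hC \<tau>])
    have "\<bar>(LINT w|\<nu>. H w) - (LINT w|\<mu>. H w)\<bar> = \<bar>LINT z|lborel. h z * D \<nu> z - h z * D \<mu> z\<bar>"
      unfolding HD[OF \<nu>] HD[OF \<mu>] using Di[OF \<nu>] Di[OF \<mu>] by (simp add: Bochner_Integration.integral_diff)
    also have "\<dots> \<le> (LINT z|lborel. \<bar>h z * D \<nu> z - h z * D \<mu> z\<bar>)" by (rule integral_abs_bound)
    also have "\<dots> \<le> (LINT z|lborel. 2 * \<eta> * \<bar>h z\<bar>)"
    proof (rule integral_mono)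
      show "integrable lborel (\<lambda>z. \<bar>h z * D \<nu> z - h z * D \<mu> z\<bar>)"
        using Di[OF \<nu>] Di[OF \<mu>] by (intro integrable_abs Bochner_Integration.integrable_diff)
      show "integrable lborel (\<lambda>z. 2 * \<eta> * \<bar>h z\<bar>)" using hi by (intro integrable_mult_right integrable_abs)
      fix z
      show "\<bar>h z * D \<nu> z - h z * D \<mu> z\<bar> \<le> 2 * \<eta> * \<bar>h z\<bar>"
      proof (cases "cmod z \<le> B")
        case True
        have "\<bar>h z\<bar> * \<bar>D \<nu> z - D \<mu> z\<bar> \<le> \<bar>h z\<bar> * (2 * \<eta>)" using DD[OF True] by (intro mult_left_mono) auto
        then show ?thesis by (simp add: right_diff_distrib[symmetric] abs_mult mult.commute)
      next
        case False
        then show ?thesis using hB[of z] by simp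
      qed
    qed
    also have "\<dots> = 2 * \<eta> * I" by (simp add: I_def)
    also have "\<dots> \<le> 2 * \<eta> * (I + 1)" using \<eta> by simp
    also have "\<dots> = J * e / 3" using I0 by (simp add: \<eta>_def field_simps)
    finally have "\<bar>(LINT w|\<nu>. H w) - (LINT w|\<mu>. H w)\<bar> \<le> J * e / 3" .
    then have "\<bar>J * (LINT w|\<nu>. h w) - J * (LINT w|\<mu>. h w)\<bar> \<le> J * e"
      using conv[OF \<nu>] conv[OF \<mu>] unfolding mult.commute[of "e / 3" J] times_divide_eq_right by linarith
    then have "J * \<bar>(LINT w|\<nu>. h w) - (LINT w|\<mu>. h w)\<bar> \<le> J * e"
      using J by (simp add: right_diff_distrib[symmetric] abs_mult)
    then show "\<bar>(LINT w|\<nu>. h w) - (LINT w|\<mu>. h w)\<bar> \<le> e" using J by simp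
  qed
qed

text \<open>Passing from compact support to bounded functions requires tightness, which is obtained
  by testing a cutoff \<open>\<psi>\<close> that equals 1 on the support of \<mu>: if its integral
  against \<nu> is close to 1, little mass of \<nu> lies outside. A second family of bumps is
  devoted to this cutoff.\<close>

lemma log_bump_determines:
  fixes f :: "complex \<Rightarrow> real"
  assumes f: "continuous_on UNIV f" "\<And>z. \<bar>f z\<bar> \<le> C" and e: "e > 0"
    and \<mu>: "prob_space \<mu>" "sets \<mu> = sets borel" "AE w in \<mu>. cmod w \<le> S"
  obtains Z \<eta> where "finite Z" "\<eta> > 0" "\<And>z R. (z, R) \<in> Z \<Longrightarrow> R > 0"
    "\<And>\<nu>. prob_space \<nu> \<Longrightarrow> sets \<nu> = sets borel \<Longrightarrow>
      (\<And>z R. (z, R) \<in> Z \<Longrightarrow> \<bar>(LINT w|\<nu>. log_bump R (w - z)) - (LINT w|\<mu>. log_bump R (w - z))\<bar> \<le> \<eta>) \<Longrightarrow>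
      \<bar>(LINT w|\<nu>. f w) - (LINT w|\<mu>. f w)\<bar> < e"
proof -
  define \<psi> where "\<psi> w = max 0 (min 1 (S + 1 - cmod w))" for w :: complex
  have \<psi>c: "continuous_on UNIV \<psi>" unfolding \<psi>_def by (intro continuous_intros)
  have \<psi>b: "0 \<le> \<psi> w" "\<psi> w \<le> 1" "S + 1 \<le> cmod w \<Longrightarrow> \<psi> w = 0" "cmod w \<le> S \<Longrightarrow> \<psi> w = 1" for w by (auto simp: \<psi>_def)
  have C: "C \<ge> 0" using f(2)[of 0] by linarith
  \<comment> \<open>The error is one \<open>e1\<close> for the truncated function and
    \<open>C\<close> times \<open>e1\<close> for the mass outside, which leaves half of
    \<open>e\<close>.\<close>
  define e1 where "e1 = e / (2 * (C + 1))"
  have e1: "e1 > 0" using e C by (simp add: e1_def)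
  have fc: "continuous_on UNIV (\<lambda>w. f w * \<psi> w)" using f(1) \<psi>c by (intro continuous_intros)
  have fz: "\<forall>w. S + 1 \<le> cmod w \<longrightarrow> f w * \<psi> w = 0" "\<forall>w. S + 1 \<le> cmod w \<longrightarrow> \<psi> w = 0" using \<psi>b(3) by simp_all
  obtain Z1 R1 \<eta>1 where 1: "finite Z1" "R1 > 0" "\<eta>1 > 0"
    "\<forall>\<nu>. prob_space \<nu> \<and> sets \<nu> = sets borel \<and>
      (\<forall>z\<in>Z1. \<bar>(LINT w|\<nu>. log_bump R1 (w - z)) - (LINT w|\<mu>. log_bump R1 (w - z))\<bar> \<le> \<eta>1) \<longrightarrow>
      \<bar>(LINT w|\<nu>. f w * \<psi> w) - (LINT w|\<mu>. f w * \<psi> w)\<bar> \<le> e1"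
    using log_bump_determines_compact_support[OF fc fz(1) e1 \<mu>(1,2)] by (elim exE conjE) (rule that)
  obtain Z2 R2 \<eta>2 where 2: "finite Z2" "R2 > 0" "\<eta>2 > 0"
    "\<forall>\<nu>. prob_space \<nu> \<and> sets \<nu> = sets borel \<and>
      (\<forall>z\<in>Z2. \<bar>(LINT w|\<nu>. log_bump R2 (w - z)) - (LINT w|\<mu>. log_bump R2 (w - z))\<bar> \<le> \<eta>2) \<longrightarrow>
      \<bar>(LINT w|\<nu>. \<psi> w) - (LINT w|\<mu>. \<psi> w)\<bar> \<le> e1"
    using log_bump_determines_compact_support[OF \<psi>c fz(2) e1 \<mu>(1,2)] by (elim exE conjE) (rule that)
  show thesis
  proof (rule that[of "Z1 \<times> {R1} \<union> Z2 \<times> {R2}" "min \<eta>1 \<eta>2"])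
    fix \<nu> :: "complex measure"
    assume \<nu>: "prob_space \<nu>" "sets \<nu> = sets borel"
      and cl: "\<And>z R. (z, R) \<in> Z1 \<times> {R1} \<union> Z2 \<times> {R2} \<Longrightarrow> \<bar>(LINT w|\<nu>. log_bump R (w - z)) - (LINT w|\<mu>. log_bump R (w - z))\<bar> \<le> min \<eta>1 \<eta>2"
    interpret \<nu>: prob_space \<nu> by (rule \<nu>(1))
    interpret \<mu>: prob_space \<mu> by (rule \<mu>(1))
    have a: "\<bar>(LINT w|\<nu>. f w * \<psi> w) - (LINT w|\<mu>. f w * \<psi> w)\<bar> \<le> e1" using \<nu> cl by (intro 1(4)[rule_format]) auto
    have b: "\<bar>(LINT w|\<nu>. \<psi> w) - (LINT w|\<mu>. \<psi> w)\<bar> \<le> e1" using \<nu> cl by (intro 2(4)[rule_format]) auto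
    have m[measurable]: "f \<in> borel_measurable borel" "\<psi> \<in> borel_measurable borel"
      using f(1) \<psi>c by (auto intro: borel_measurable_continuous_onI)
    have mm: "f \<in> borel_measurable \<nu>" "\<psi> \<in> borel_measurable \<nu>" unfolding measurable_cong_sets[OF \<nu>(2) refl] by (fact m)+
    have mu: "f \<in> borel_measurable \<mu>" "\<psi> \<in> borel_measurable \<mu>" unfolding measurable_cong_sets[OF \<mu>(2) refl] by (fact m)+
    have ae1: "AE w in \<mu>. \<psi> w = 1" using \<mu>(3) by eventually_elim (rule \<psi>b(4))
    have "(LINT w|\<mu>. \<psi> w) = (LINT w|\<mu>. 1)"
      using mu(2) ae1 by (intro integral_cong_AE) auto
    then have c1: "(LINT w|\<mu>. \<psi> w) = 1" by (simp add: \<mu>.prob_space)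
    have c2: "(LINT w|\<mu>. f w * \<psi> w) = (LINT w|\<mu>. f w)"
    proof (rule integral_cong_AE)
      show "AE w in \<mu>. f w * \<psi> w = f w" using ae1 by eventually_elim simp
    qed (use mu in auto)
    have fi: "integrable \<nu> f" using f(2) mm by (intro \<nu>.integrable_const_bound[of _ C]) auto
    have \<psi>i: "integrable \<nu> \<psi>" using \<psi>b mm by (intro \<nu>.integrable_const_bound[of _ 1]) auto
    have f\<psi>: "\<bar>f w * \<psi> w\<bar> \<le> C" for w
    proof -
      have "\<bar>f w\<bar> * \<psi> w \<le> C * 1" using f(2)[of w] \<psi>b(1,2)[of w] C by (intro mult_mono) auto
      then show ?thesis using \<psi>b(1)[of w] by (simp add: abs_mult)
    qed
    have f\<psi>i: "integrable \<nu> (\<lambda>w. f w * \<psi> w)" using f\<psi> mm by (intro \<nu>.integrable_const_bound[of _ C]) auto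
    have "\<bar>(LINT w|\<nu>. f w) - (LINT w|\<nu>. f w * \<psi> w)\<bar> = \<bar>LINT w|\<nu>. f w - f w * \<psi> w\<bar>"
      using fi f\<psi>i by (simp add: Bochner_Integration.integral_diff)
    also have "\<dots> \<le> (LINT w|\<nu>. \<bar>f w - f w * \<psi> w\<bar>)" by (rule integral_abs_bound)
    also have "\<dots> \<le> (LINT w|\<nu>. C * (1 - \<psi> w))"
    proof (rule integral_mono)
      show "integrable \<nu> (\<lambda>w. \<bar>f w - f w * \<psi> w\<bar>)" using fi f\<psi>i by (intro integrable_abs Bochner_Integration.integrable_diff)
      show "integrable \<nu> (\<lambda>w. C * (1 - \<psi> w))" using \<psi>i by (intro integrable_mult_right Bochner_Integration.integrable_diff) auto
      fix w
      have "\<bar>f w\<bar> * (1 - \<psi> w) \<le> C * (1 - \<psi> w)" using f(2)[of w] \<psi>b(2)[of w] by (intro mult_right_mono) auto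
      moreover have "f w - f w * \<psi> w = f w * (1 - \<psi> w)" by (simp add: algebra_simps)
      ultimately show "\<bar>f w - f w * \<psi> w\<bar> \<le> C * (1 - \<psi> w)" using \<psi>b(2)[of w] by (simp add: abs_mult)
    qed
    also have "\<dots> = C * (1 - (LINT w|\<nu>. \<psi> w))" using \<psi>i by (simp add: Bochner_Integration.integral_diff \<nu>.prob_space)
    also have "\<dots> \<le> C * e1" using b c1 C by (intro mult_left_mono) auto
    finally have "\<bar>(LINT w|\<nu>. f w) - (LINT w|\<mu>. f w)\<bar> \<le> (C + 1) * e1" using a c2 by (simp add: algebra_simps)
    also have "\<dots> = e / 2"
    proof -
      have "2 * (C + 1) \<noteq> 0" using C by simp
      moreover have "e / x * x = e" if "x \<noteq> 0" for x using that by simp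
      ultimately have "e1 * (2 * (C + 1)) = e" unfolding e1_def by blast
      then show ?thesis by (simp add: algebra_simps)
    qed
    finally show "\<bar>(LINT w|\<nu>. f w) - (LINT w|\<mu>. f w)\<bar> < e" using e by simp
  qed (use 1 2 in auto)
qed

section \<open>Empirical measures and logarithmic potentials\<close>

lemma proots_linear_product: "proots (\<Prod>a\<leftarrow>es. [:- a, 1:]) = mset (es :: complex list)"
proof (induction es)
  case (Cons a es)
  have "(\<Prod>a\<leftarrow>es. [:- a, 1:]) \<noteq> (0 :: complex poly)" by (auto simp: prod_list_zero_iff)
  then show ?case using Cons by (simp add: proots_mult del: mult_pCons_left)
qed simp

text \<open>The measure is identified with the law of an eigenvalue picked at a uniformly random
  index of the list \<open>es\<close>, which yields total mass 1 and the formula for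
  integrals.\<close>

lemma empirical_spectral_measure_eq:
  assumes A: "A \<in> carrier_mat m m" and m: "m > 0"
  obtains es where "length es = m" "\<And>z. cmod (det (A - z \<cdot>\<^sub>m 1\<^sub>m m)) = (\<Prod>i<m. cmod (es ! i - z))"
    "prob_space (empirical_spectral_measure A)" "sets (empirical_spectral_measure A) = sets borel"
    "\<And>f :: complex \<Rightarrow> real. f \<in> borel_measurable borel \<Longrightarrow> (LINT z|empirical_spectral_measure A. f z) = (\<Sum>i<m. f (es ! i)) / real m"
proof -
  obtain es where es: "char_poly A = (\<Prod>a\<leftarrow>es. [:- a, 1:])" "length es = m"
    using char_poly_factorized[OF A] by blast
  have det: "cmod (det (A - z \<cdot>\<^sub>m 1\<^sub>m m)) = (\<Prod>i<m. cmod (es ! i - z))" for z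
  proof -
    have "- (char_matrix A z) = (- 1) \<cdot>\<^sub>m (A - z \<cdot>\<^sub>m 1\<^sub>m m)"
      using A by (intro eq_matI) (auto simp: char_matrix_def)
    then have "cmod (poly (char_poly A) z) = cmod (det (A - z \<cdot>\<^sub>m 1\<^sub>m m))"
      unfolding char_poly_matrix[OF A] by (simp add: norm_mult norm_power)
    moreover have "poly (char_poly A) z = (\<Prod>i<m. z - es ! i)"
      unfolding es(1) poly_prod_list by (simp add: prod.list_conv_set_nth es(2) atLeast0LessThan o_def)
    ultimately show ?thesis by (simp add: prod_norm[symmetric] norm_minus_commute)
  qed
  define I where "I = measure_pmf (pmf_of_set {..<m})"
  have nem: "{..<m} \<noteq> {}" using m by auto
  have im: "(\<lambda>i. es ! i) \<in> measurable I borel" by (simp add: I_def)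
  define D where "D = distr I borel (\<lambda>i. es ! i)"
  have eq: "ennreal (1 / real (dim_row A)) * (\<Sum>z\<in>#proots (char_poly A). emeasure (return borel z) B) = emeasure D B"
    if B: "B \<in> sets borel" for B
  proof -
    have "(\<Sum>z\<in>#proots (char_poly A). emeasure (return borel z) B) = (\<Sum>z\<in>#mset es. indicator B z)"
      unfolding es(1) proots_linear_product using B by (simp add: emeasure_return)
    also have "\<dots> = (\<Sum>i<m. indicator B (es ! i))"
      by (simp only: sum_mset_sum_list mset_map[symmetric] sum_list_sum_nth length_map es(2)) (simp add: atLeast0LessThan es(2))
    also have "\<dots> = of_nat (card {i \<in> {..<m}. es ! i \<in> B})"
      by (simp add: indicator_def sum.inter_filter[symmetric] of_bool_def)
    finally have "(\<Sum>z\<in>#proots (char_poly A). emeasure (return borel z) B) = ennreal (real (card {i \<in> {..<m}. es ! i \<in> B}))"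
      by (simp add: ennreal_of_nat_eq_real_of_nat)
    moreover have "emeasure D B = ennreal (real (card {i \<in> {..<m}. es ! i \<in> B}) / real m)"
    proof -
      have "emeasure D B = emeasure I ((\<lambda>i. es ! i) -` B)"
        unfolding D_def using B im by (simp add: emeasure_distr I_def)
      also have "\<dots> = ennreal (real (card ({..<m} \<inter> (\<lambda>i. es ! i) -` B)) / real m)"
        unfolding I_def using nem by (simp add: emeasure_pmf_of_set)
      also have "{..<m} \<inter> (\<lambda>i. es ! i) -` B = {i \<in> {..<m}. es ! i \<in> B}" by auto
      finally show ?thesis .
    qed
    ultimately show ?thesis using A by (simp add: carrier_matD ennreal_mult[symmetric])
  qed
  have "empirical_spectral_measure A = measure_of UNIV (sets borel) (emeasure D)"
    unfolding empirical_spectral_measure_def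
    by (rule measure_of_eq) (use sets.sigma_sets_eq[of "borel :: complex measure"] eq in \<open>auto simp: space_borel\<close>)
  also have "\<dots> = D" using measure_of_of_measure[of D] by (simp add: D_def)
  finally have ED: "empirical_spectral_measure A = D" .
  have "prob_space D" unfolding D_def I_def by (intro prob_space.prob_space_distr measure_pmf.prob_space_axioms) simp
  moreover have "(LINT z|D. f z) = (\<Sum>i<m. f (es ! i)) / real m" if "f \<in> borel_measurable borel" for f :: "complex \<Rightarrow> real"
    unfolding D_def using im that by (subst integral_distr) (auto simp: I_def integral_pmf_of_set nem)
  ultimately show thesis using that[OF es(2) det] unfolding ED by (simp add: D_def)
qed

section \<open>Truncated logarithmic potentials\<close>

definition log_potential :: "complex measure \<Rightarrow> real \<Rightarrow> complex \<Rightarrow> real" where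
  "log_potential \<mu> \<epsilon> z = (LINT w|\<mu>. log_max \<epsilon> (cmod (w - z)))"

lemma log_max_measurable: "\<epsilon> > 0 \<Longrightarrow> (\<lambda>w. log_max \<epsilon> (cmod (w - z))) \<in> borel_measurable borel"
  unfolding log_max_def by measurable

locale compact_prob =
  fixes \<mu> :: "complex measure" and S :: real
  assumes prob: "prob_space \<mu>" and sets: "sets \<mu> = sets borel" and supp: "AE w in \<mu>. cmod w \<le> S"
begin

sublocale prob_space \<mu> by (rule prob)

lemma borel_meas: "f \<in> borel_measurable borel \<Longrightarrow> f \<in> borel_measurable \<mu>"
  using measurable_cong_sets[OF sets refl] by auto

lemma log_max_integrable:
  assumes e: "\<epsilon> > 0"
  shows "integrable \<mu> (\<lambda>w. log_max \<epsilon> (cmod (w - z)))"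
proof (rule integrable_const_bound)
  show "AE w in \<mu>. norm (log_max \<epsilon> (cmod (w - z))) \<le> \<bar>log_max \<epsilon> 0\<bar> + (1 / \<epsilon>) * (S + cmod z)"
    using supp
  proof eventually_elim
    case (elim w)
    have "(1 / \<epsilon>) * cmod (w - z) \<le> (1 / \<epsilon>) * (S + cmod z)"
      using e elim norm_triangle_ineq4[of w z] by (intro mult_left_mono) auto
    then show ?case using log_max_lipschitz[OF e, of "cmod (w - z)" 0] by simp
  qed
qed (rule borel_meas[OF log_max_measurable[OF e]])

text \<open>Allows the radius of a circle to be perturbed slightly in order to avoid
  eigenvalues.\<close>

lemma log_potential_radius_lipschitz:
  assumes r: "0 < r" "r \<le> r'"
  shows "log_potential \<mu> r' z \<le> log_potential \<mu> r z + (r' - r) / r"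
proof -
  have "log_potential \<mu> r' z \<le> (LINT w|\<mu>. log_max r (cmod (w - z)) + (r' - r) / r)"
    unfolding log_potential_def
  proof (rule integral_mono)
    show "integrable \<mu> (\<lambda>w. log_max r' (cmod (w - z)))" using r by (intro log_max_integrable) simp
    show "integrable \<mu> (\<lambda>w. log_max r (cmod (w - z)) + (r' - r) / r)" using r by (intro Bochner_Integration.integrable_add log_max_integrable) auto
    fix w
    let ?s = "cmod (w - z)"
    have "max ?s r' > 0" "max ?s r > 0" using r by (simp_all add: less_max_iff_disj)
    then have "ln (max ?s r') - ln (max ?s r) = ln (max ?s r' / max ?s r)" by (intro ln_divide_pos[symmetric])
    also have "\<dots> \<le> max ?s r' / max ?s r - 1" using r by (intro ln_le_minus_one) auto
    also have "\<dots> = (max ?s r' - max ?s r) / max ?s r" using r by (simp add: diff_divide_distrib)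
    also have "\<dots> \<le> (r' - r) / max ?s r" using r by (intro divide_right_mono) auto
    also have "\<dots> \<le> (r' - r) / r" using r by (intro divide_left_mono) auto
    finally show "log_max r' ?s \<le> log_max r ?s + (r' - r) / r" by (simp add: log_max_def)
  qed
  also have "\<dots> = log_potential \<mu> r z + (r' - r) / r"
    unfolding log_potential_def using r log_max_integrable[of r z] by (simp add: prob_space)
  finally show ?thesis .
qed

text \<open>The pointwise circle averages, integrated. The upper bound has a small error when
  \<epsilon> is small against \<open>r\<close>; the lower bound needs \<open>M\<close> large against
  \<open>r / \<epsilon>\<close>, so \<epsilon> must be fixed before \<open>M\<close>.\<close>

lemma log_potential_circle_average:
  assumes M: "M > 0" and r: "r > 0" and e: "\<epsilon> > 0"
  shows "(\<Sum>x\<in>unity_roots M. log_potential \<mu> \<epsilon> (z + of_real r * x)) / real M \<le> log_potential \<mu> r z + \<epsilon> / r + ln 2 / real M"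
    and "log_potential \<mu> r z - ln 2 / real M - 2 * r / (real M * \<epsilon>) \<le> (\<Sum>x\<in>unity_roots M. log_potential \<mu> \<epsilon> (z + of_real r * x)) / real M"
proof -
  have eq: "(\<Sum>x\<in>unity_roots M. log_potential \<mu> \<epsilon> (z + of_real r * x)) / real M
    = (LINT w|\<mu>. (\<Sum>x\<in>unity_roots M. log_max \<epsilon> (cmod ((w - z) - of_real r * x))) / real M)"
    unfolding log_potential_def using log_max_integrable[OF e]
    by (subst integral_divide_zero, subst Bochner_Integration.integral_sum) (auto simp: diff_diff_eq)
  have int: "integrable \<mu> (\<lambda>w. (\<Sum>x\<in>unity_roots M. log_max \<epsilon> (cmod ((w - z) - of_real r * x))) / real M)"
    using log_max_integrable[OF e] by (intro integrable_divide_zero Bochner_Integration.integrable_sum) (auto simp: diff_diff_eq)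
  have ir: "integrable \<mu> (\<lambda>w. log_max r (cmod (w - z)))" using r by (rule log_max_integrable)
  have "(LINT w|\<mu>. (\<Sum>x\<in>unity_roots M. log_max \<epsilon> (cmod ((w - z) - of_real r * x))) / real M)
      \<le> (LINT w|\<mu>. log_max r (cmod (w - z)) + (\<epsilon> / r + ln 2 / real M))"
  proof (rule integral_mono[OF int])
    show "integrable \<mu> (\<lambda>w. log_max r (cmod (w - z)) + (\<epsilon> / r + ln 2 / real M))" using ir by simp
    show "(\<Sum>x\<in>unity_roots M. log_max \<epsilon> (cmod ((w - z) - of_real r * x))) / real M \<le> log_max r (cmod (w - z)) + (\<epsilon> / r + ln 2 / real M)" for w
      using circle_average_upper[OF M r e, of "w - z"] by (simp add: add.assoc)
  qed
  also have "\<dots> = log_potential \<mu> r z + (\<epsilon> / r + ln 2 / real M)"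
    unfolding log_potential_def using ir by (simp add: prob_space)
  finally show "(\<Sum>x\<in>unity_roots M. log_potential \<mu> \<epsilon> (z + of_real r * x)) / real M \<le> log_potential \<mu> r z + \<epsilon> / r + ln 2 / real M"
    unfolding eq by (simp add: add.assoc)
  have "log_potential \<mu> r z - (ln 2 / real M + 2 * r / (real M * \<epsilon>)) = (LINT w|\<mu>. log_max r (cmod (w - z)) - (ln 2 / real M + 2 * r / (real M * \<epsilon>)))"
    unfolding log_potential_def using ir by (simp add: prob_space)
  also have "\<dots> \<le> (LINT w|\<mu>. (\<Sum>x\<in>unity_roots M. log_max \<epsilon> (cmod ((w - z) - of_real r * x))) / real M)"
  proof (rule integral_mono[OF _ int])
    show "integrable \<mu> (\<lambda>w. log_max r (cmod (w - z)) - (ln 2 / real M + 2 * r / (real M * \<epsilon>)))" using ir by simp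
    show "log_max r (cmod (w - z)) - (ln 2 / real M + 2 * r / (real M * \<epsilon>)) \<le> (\<Sum>x\<in>unity_roots M. log_max \<epsilon> (cmod ((w - z) - of_real r * x))) / real M" for w
      using circle_average_lower[OF M r e, of "w - z"] by linarith
  qed
  finally show "log_potential \<mu> r z - ln 2 / real M - 2 * r / (real M * \<epsilon>) \<le> (\<Sum>x\<in>unity_roots M. log_potential \<mu> \<epsilon> (z + of_real r * x)) / real M"
    unfolding eq by linarith
qed

lemma log_potential_halving:
  assumes e: "\<epsilon> > 0"
  shows "log_potential \<mu> \<epsilon> z \<le> log_potential \<mu> (\<epsilon> / 2) z + ln 2 * measure \<mu> {w. cmod (w - z) \<le> \<epsilon>}"
proof -
  have Bs: "{w. cmod (w - z) \<le> \<epsilon>} \<in> sets borel" by measurable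
  then have B: "{w. cmod (w - z) \<le> \<epsilon>} \<in> sets \<mu>" using sets by simp
  have ind: "integrable \<mu> (\<lambda>w. ln 2 * indicator {w. cmod (w - z) \<le> \<epsilon>} w :: real)"
    using B by (intro integrable_mult_right integrable_real_indicator) (auto simp: emeasure_eq_measure)
  have int: "integrable \<mu> (\<lambda>w. log_max (\<epsilon> / 2) (cmod (w - z)))" using e by (intro log_max_integrable) simp
  have "log_potential \<mu> \<epsilon> z \<le> (LINT w|\<mu>. log_max (\<epsilon> / 2) (cmod (w - z)) + ln 2 * indicator {w. cmod (w - z) \<le> \<epsilon>} w)"
    unfolding log_potential_def
  proof (rule integral_mono[OF log_max_integrable[OF e] Bochner_Integration.integrable_add[OF int ind]])
    fix w
    show "log_max \<epsilon> (cmod (w - z)) \<le> log_max (\<epsilon> / 2) (cmod (w - z)) + ln 2 * indicator {w. cmod (w - z) \<le> \<epsilon>} w"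
    proof (cases "cmod (w - z) \<le> \<epsilon>")
      case True
      have "ln \<epsilon> = ln (2 * (\<epsilon> / 2))" by simp
      also have "\<dots> = ln 2 + ln (\<epsilon> / 2)" using e by (intro ln_mult_pos) auto
      also have "ln (\<epsilon> / 2) \<le> ln (max (cmod (w - z)) (\<epsilon> / 2))" using e by (intro ln_mono) auto
      finally show ?thesis using True by (simp add: log_max_def max_absorb2)
    next
      case False
      then show ?thesis using e by (simp add: log_max_def max_absorb1)
    qed
  qed
  also have "\<dots> = log_potential \<mu> (\<epsilon> / 2) z + ln 2 * measure \<mu> {w. cmod (w - z) \<le> \<epsilon>}"
    unfolding log_potential_def using int ind B sets_eq_imp_space_eq[OF sets] by simp
  finally show ?thesis .
qed

lemma log_potential_mono:
  assumes "0 < e" "e \<le> \<epsilon>"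
  shows "log_potential \<mu> e z \<le> log_potential \<mu> \<epsilon> z"
  unfolding log_potential_def
  using assms by (intro integral_mono log_max_integrable) (auto simp: log_max_def intro!: ln_mono)

text \<open>Repeated halving. Each halving of the truncation radius costs ln 2 times the mass of a
  disc, and these masses decay geometrically with ratio \<open>2 powr - a\<close>. The sum is
  dominated by its first term and does not depend on the final radius \<open>e\<close>.\<close>

lemma log_potential_tail:
  assumes a: "a > 0" and K: "K \<ge> 0" and conc: "\<And>t. 0 \<le> t \<Longrightarrow> t \<le> t1 \<Longrightarrow> measure \<mu> {w. cmod (w - z) \<le> t} \<le> K * t powr a"
    and e: "0 < e" "e \<le> \<epsilon>" "\<epsilon> \<le> t1"
  shows "log_potential \<mu> \<epsilon> z \<le> log_potential \<mu> e z + (ln 2 * K / (1 - 2 powr - a)) * \<epsilon> powr a"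
proof -
  define q where "q = 2 powr - a"
  have q: "0 < q" "q < 1" unfolding q_def using a by (auto simp: powr_less_one)
  define G where "G = ln 2 * K / (1 - q)"
  have G: "G \<ge> 0" "G * (1 - q) = ln 2 * K" using q K by (auto simp: G_def)
  have it: "log_potential \<mu> \<epsilon> z \<le> log_potential \<mu> (\<epsilon> / 2 ^ j) z + G * (1 - q ^ j) * \<epsilon> powr a" for j
  proof (induction j)
    case (Suc j)
    have e2: "\<epsilon> / 2 ^ j > 0" using e by simp
    have "\<epsilon> / 2 ^ j \<le> \<epsilon> / 1" using e by (intro divide_left_mono) auto
    then have "\<epsilon> / 2 ^ j \<le> t1" using e by simp
    then have "measure \<mu> {w. cmod (w - z) \<le> \<epsilon> / 2 ^ j} \<le> K * (\<epsilon> / 2 ^ j) powr a" using e2 by (intro conc) auto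
    also have "(\<epsilon> / 2 ^ j) powr a = q ^ j * \<epsilon> powr a"
    proof -
      have "(2 ^ j) powr a = (2 powr a) ^ j" by (simp add: powr_powr mult.commute flip: powr_realpow)
      then show ?thesis using e by (simp add: powr_divide q_def powr_minus_divide power_divide)
    qed
    finally have "ln 2 * measure \<mu> {w. cmod (w - z) \<le> \<epsilon> / 2 ^ j} \<le> ln 2 * (K * (q ^ j * \<epsilon> powr a))" by (intro mult_left_mono) auto
    also have "\<dots> = G * (1 - q) * (q ^ j * \<epsilon> powr a)" unfolding G(2) by simp
    finally have "log_potential \<mu> (\<epsilon> / 2 ^ j) z \<le> log_potential \<mu> (\<epsilon> / 2 ^ j / 2) z + G * (1 - q) * (q ^ j * \<epsilon> powr a)"
      using log_potential_halving[OF e2, of z] by linarith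
    then have "log_potential \<mu> (\<epsilon> / 2 ^ j) z \<le> log_potential \<mu> (\<epsilon> / 2 ^ Suc j) z + G * (1 - q) * (q ^ j * \<epsilon> powr a)"
      by (simp add: mult.commute)
    moreover have "G * (1 - q ^ Suc j) * \<epsilon> powr a = G * (1 - q ^ j) * \<epsilon> powr a + G * (1 - q) * (q ^ j * \<epsilon> powr a)"
      by (simp add: algebra_simps)
    ultimately show ?case using Suc.IH by linarith
  qed simp
  obtain j where "\<epsilon> / e < 2 ^ j" using real_arch_pow[of 2 "\<epsilon> / e"] by auto
  then have "\<epsilon> / 2 ^ j \<le> e" using e by (simp add: field_simps less_imp_le)
  then have "log_potential \<mu> (\<epsilon> / 2 ^ j) z \<le> log_potential \<mu> e z" using e by (intro log_potential_mono) auto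
  moreover have "G * (1 - q ^ j) * \<epsilon> powr a \<le> G * 1 * \<epsilon> powr a" using G q by (intro mult_right_mono mult_left_mono) auto
  ultimately show ?thesis using it[of j] by (simp add: G_def q_def)
qed

end

section \<open>Singular systems and scaling of small singular values\<close>

lemma singular_system_exists:
  assumes "A \<in> carrier_mat n n" "det A \<noteq> 0"
  obtains sv where "singular_system n A sv" "\<And>i. i < n \<Longrightarrow> sv i > 0 \<and> sv i \<in> singular_values A" "cmod (det A) = (\<Prod>i<n. sv i)"
proof -
  obtain u v s where s: "orthonormal_sys n n u" "orthonormal_sys n n v"
    "\<And>i. i < n \<Longrightarrow> s i > 0 \<and> s i \<in> singular_values A"
    "\<And>i a. i < n \<Longrightarrow> a < n \<Longrightarrow> mat_app n A (v i) a = of_real (s i) * u i a"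
    "\<And>i b. i < n \<Longrightarrow> b < n \<Longrightarrow> mat_app_adj n A (u i) b = of_real (s i) * v i b"
    "cmod (det A) = (\<Prod>i<n. s i)"
    by (rule svd_exists[OF assms]) blast
  have "\<forall>i<n. s i \<ge> 0" using s(3) less_imp_le by blast
  then have "singular_system n A s" unfolding singular_system_def using s(1,2,4,5) by blast
  then show thesis using s(3,6) that by blast
qed

lemma det_nonzero_of_zero_not_singular_value:
  assumes A: "A \<in> carrier_mat n n" and z: "0 \<notin> singular_values A"
  shows "det A \<noteq> 0"
proof
  assume "det A = 0"
  then obtain v where v: "v \<in> carrier_vec n" "v \<noteq> 0\<^sub>v n" "A *\<^sub>v v = 0\<^sub>v n"
    using det_0_iff_vec_prod_zero_field[OF A] by blast
  have "mat_app n A (vec_index v) a = 0" if "a < n" for a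
    using index_mult_mat_vec_sum[OF A v(1) that] v(3) that by (simp add: mat_app_def)
  then have "mat_app_adj n A (mat_app n A (vec_index v)) b = 0" for b by (simp add: mat_app_adj_def)
  moreover have "\<exists>a<n. vec_index v a \<noteq> 0" using v(1,2) by (metis eq_vecI carrier_vecD index_zero_vec)
  ultimately have "0 \<in> singular_values A" unfolding singular_values_iff[OF A] by auto
  then show False using z by simp
qed

text \<open>(A3-ii) concerns \<open>A + Q\<close> with \<open>Q\<close> unscaled. The matrix of
  interest is \<delta> times such a sum, and this transfers the lower bound to it.\<close>

lemma singular_value_scale_ge:
  assumes B: "B \<in> carrier_mat n n" and n: "n > 0" and t: "\<delta> \<ge> 0" "0 \<le> t" "t \<le> smallest_sv B"
    and s: "\<sigma> \<in> singular_values (complex_of_real \<delta> \<cdot>\<^sub>m B)"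
  shows "\<delta> * t \<le> \<sigma>"
proof -
  let ?A = "complex_of_real \<delta> \<cdot>\<^sub>m B"
  have A: "?A \<in> carrier_mat n n" using B by simp
  obtain x where x: "\<exists>a<n. x a \<noteq> 0" "(\<Sum>a<n. (cmod (mat_app n ?A x a))\<^sup>2) = \<sigma>\<^sup>2 * (\<Sum>a<n. (cmod (x a))\<^sup>2)"
    by (rule singular_value_attained[OF A s]) blast
  have "mat_app n ?A x a = of_real \<delta> * mat_app n B x a" if "a < n" for a
    unfolding mat_app_def sum_distrib_left using B that by (intro sum.cong) auto
  then have "(\<Sum>a<n. (cmod (mat_app n ?A x a))\<^sup>2) = \<delta>\<^sup>2 * (\<Sum>a<n. (cmod (mat_app n B x a))\<^sup>2)"
    unfolding sum_distrib_left by (intro sum.cong) (auto simp: norm_mult power_mult_distrib)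
  moreover have "\<delta>\<^sup>2 * (t\<^sup>2 * (\<Sum>a<n. (cmod (x a))\<^sup>2)) \<le> \<delta>\<^sup>2 * (\<Sum>a<n. (cmod (mat_app n B x a))\<^sup>2)"
  proof (intro mult_left_mono order_trans[OF _ smallest_sv_le_mat_app[OF B n]] mult_right_mono power_mono)
  qed (use t in \<open>auto intro: sum_nonneg\<close>)
  ultimately have "(\<delta> * t)\<^sup>2 * (\<Sum>a<n. (cmod (x a))\<^sup>2) \<le> \<sigma>\<^sup>2 * (\<Sum>a<n. (cmod (x a))\<^sup>2)"
    unfolding x(2) by (simp add: power_mult_distrib mult.assoc)
  moreover have "(\<Sum>a<n. (cmod (x a))\<^sup>2) > 0" 
  proof -
    obtain a where "a < n" "x a \<noteq> 0" using x(1) by blast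
    then show ?thesis by (intro sum_pos2[of _ a]) auto
  qed
  ultimately have "(\<delta> * t)\<^sup>2 \<le> \<sigma>\<^sup>2" by (rule mult_right_le_imp_le)
  moreover have "\<sigma> \<ge> 0" using s by (simp add: singular_values_def)
  ultimately show ?thesis by (rule power2_le_imp_le)
qed

section \<open>From singular values to eigenvalues\<close>

text \<open>A deterministic property of one matrix that quantifies over \<open>z\<close>, the
  singular systems and the test functions. A single exceptional event, on which the perturbation is
  large, then serves all \<open>z\<close> at once.\<close>

definition close_statistics :: "complex measure \<Rightarrow> real \<Rightarrow> complex mat \<Rightarrow> bool" where
  "close_statistics \<mu> E X \<longleftrightarrow> (\<forall>z sv (phi :: real \<Rightarrow> real) \<L>.
     singular_system (dim_row X) (X - z \<cdot>\<^sub>m 1\<^sub>m (dim_row X)) sv \<longrightarrow> (\<forall>x y. \<bar>phi x - phi y\<bar> \<le> \<L> * \<bar>x - y\<bar>) \<longrightarrow>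
     \<bar>(\<Sum>i<dim_row X. phi (sv i)) / real (dim_row X) - (LINT w|\<mu>. phi (cmod (w - z)))\<bar> \<le> \<L> * E)"

lemma close_statisticsD:
  assumes "close_statistics \<mu> E X" "X \<in> carrier_mat m m" "singular_system m (X - z \<cdot>\<^sub>m 1\<^sub>m m) sv"
    "\<And>x y. \<bar>phi x - phi y\<bar> \<le> \<L> * \<bar>x - y\<bar>"
  shows "\<bar>(\<Sum>i<m. phi (sv i)) / real m - (LINT w|\<mu>. phi (cmod (w - z)))\<bar> \<le> \<L> * E"
  by (rule assms(1)[unfolded close_statistics_def carrier_matD(1)[OF assms(2)], THEN spec[of _ z], THEN spec[of _ sv], THEN spec[of _ phi],
      THEN spec[of _ \<L>], THEN mp, OF assms(3), THEN mp]) (intro allI assms(4))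

text \<open>Truncation only increases the logarithm, so small singular values do no harm and the
  bound holds wherever the determinant is nonzero.\<close>

lemma log_det_upper:
  assumes st: "close_statistics \<mu> E X" and X: "X \<in> carrier_mat m m" and e: "\<epsilon> > 0"
    and d: "det (X - z \<cdot>\<^sub>m 1\<^sub>m m) \<noteq> 0"
  shows "ln (cmod (det (X - z \<cdot>\<^sub>m 1\<^sub>m m))) / real m \<le> log_potential \<mu> \<epsilon> z + E / \<epsilon>"
proof -
  have A: "X - z \<cdot>\<^sub>m 1\<^sub>m m \<in> carrier_mat m m" by (intro minus_carrier_mat) simp
  obtain sv where sv: "singular_system m (X - z \<cdot>\<^sub>m 1\<^sub>m m) sv" "\<And>i. i < m \<Longrightarrow> sv i > 0 \<and> sv i \<in> singular_values (X - z \<cdot>\<^sub>m 1\<^sub>m m)"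
    "cmod (det (X - z \<cdot>\<^sub>m 1\<^sub>m m)) = (\<Prod>i<m. sv i)"
    by (rule singular_system_exists[OF A d]) blast
  have "ln (cmod (det (X - z \<cdot>\<^sub>m 1\<^sub>m m))) = (\<Sum>i<m. ln (sv i))"
    unfolding sv(3) using sv(2) by (intro ln_prod) force+
  also have "\<dots> \<le> (\<Sum>i<m. log_max \<epsilon> (sv i))"
    unfolding log_max_def using sv(2) by (intro sum_mono ln_mono) auto
  finally have "ln (cmod (det (X - z \<cdot>\<^sub>m 1\<^sub>m m))) / real m \<le> (\<Sum>i<m. log_max \<epsilon> (sv i)) / real m"
    by (rule divide_right_mono) simp
  moreover have "\<bar>(\<Sum>i<m. log_max \<epsilon> (sv i)) / real m - (LINT w|\<mu>. log_max \<epsilon> (cmod (w - z)))\<bar> \<le> (1 / \<epsilon>) * E"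
    by (rule close_statisticsD[OF st X sv(1) log_max_lipschitz[OF e]])
  ultimately show ?thesis by (simp add: log_potential_def abs_le_iff)
qed

context compact_prob
begin

text \<open>Below the cutoff \<open>e\<close> the truncated logarithm overshoots by at most
  \<open>ln (e / b)\<close>, as no singular value is below \<open>b\<close>. Correcting for this
  enlarges the Lipschitz constant, which multiplies the statistics error, and subtracts
  \<open>ln (e / b)\<close> on a disc of radius \<open>2 * e\<close>, where the cutoff function
  lives.\<close>

lemma log_det_lower:
  assumes st: "close_statistics \<mu> E X" and X: "X \<in> carrier_mat m m" and b: "0 < b" "b \<le> e"
    and sing: "\<And>s. s \<in> singular_values (X - z \<cdot>\<^sub>m 1\<^sub>m m) \<Longrightarrow> b \<le> s"
  shows "det (X - z \<cdot>\<^sub>m 1\<^sub>m m) \<noteq> 0"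
    and "log_potential \<mu> e z - (1 + ln (e / b)) / e * E - ln (e / b) * measure \<mu> {w. cmod (w - z) \<le> 2 * e}
      \<le> ln (cmod (det (X - z \<cdot>\<^sub>m 1\<^sub>m m))) / real m"
proof -
  have A: "X - z \<cdot>\<^sub>m 1\<^sub>m m \<in> carrier_mat m m" by (intro minus_carrier_mat) simp
  show d: "det (X - z \<cdot>\<^sub>m 1\<^sub>m m) \<noteq> 0" using sing[of 0] b by (intro det_nonzero_of_zero_not_singular_value[OF A]) auto
  obtain sv where sv: "singular_system m (X - z \<cdot>\<^sub>m 1\<^sub>m m) sv" "\<And>i. i < m \<Longrightarrow> sv i > 0 \<and> sv i \<in> singular_values (X - z \<cdot>\<^sub>m 1\<^sub>m m)"
    "cmod (det (X - z \<cdot>\<^sub>m 1\<^sub>m m)) = (\<Prod>i<m. sv i)"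
    by (rule singular_system_exists[OF A d]) blast
  have e: "e > 0" using b by simp
  define B where "B = ln (e / b)"
  have B: "B \<ge> 0" "ln e - B = ln b" using b e by (auto simp: B_def ln_divide_pos)
  \<comment> \<open>The correction by \<open>B\<close> makes \<open>phi\<close> a Lipschitz minorant of \<open>ln\<close> on \<open>{b..}\<close>.\<close>
  define \<psi> where "\<psi> s = max 0 (min 1 (2 - s / e))" for s
  define phi where "phi s = log_max e s - B * \<psi> s" for s
  have \<psi>: "0 \<le> \<psi> s" "\<psi> s \<le> 1" for s by (auto simp: \<psi>_def)
  have \<psi>lip: "\<bar>\<psi> x - \<psi> y\<bar> \<le> (1 / e) * \<bar>x - y\<bar>" for x y
  proof -
    have "\<bar>\<psi> x - \<psi> y\<bar> \<le> \<bar>x / e - y / e\<bar>" by (auto simp: \<psi>_def max_def min_def abs_if)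
    then show ?thesis using e by (simp add: diff_divide_distrib[symmetric])
  qed
  have lip: "\<bar>phi x - phi y\<bar> \<le> (1 + B) / e * \<bar>x - y\<bar>" for x y
  proof -
    have "\<bar>B * (\<psi> x - \<psi> y)\<bar> \<le> B * ((1 / e) * \<bar>x - y\<bar>)"
      unfolding abs_mult using \<psi>lip[of x y] B by (intro mult_mono) auto
    moreover have "phi x - phi y = log_max e x - log_max e y - B * (\<psi> x - \<psi> y)" by (simp add: phi_def algebra_simps)
    ultimately have "\<bar>phi x - phi y\<bar> \<le> (1 / e) * \<bar>x - y\<bar> + B * ((1 / e) * \<bar>x - y\<bar>)"
      using log_max_lipschitz[OF e, of x y] by linarith
    then show ?thesis by (simp add: add_divide_distrib distrib_right)
  qed
  have "phi (sv i) \<le> ln (sv i)" if i: "i < m" for i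
  proof (cases "sv i < e")
    case True
    then have "\<psi> (sv i) = 1" "log_max e (sv i) = ln e" using e by (auto simp: \<psi>_def log_max_def field_simps max_def min_def)
    then have "phi (sv i) = ln b" using B by (simp add: phi_def)
    then show ?thesis using sing[of "sv i"] sv(2)[OF i] b by (simp add: ln_mono)
  next
    case False
    then have "log_max e (sv i) = ln (sv i)" by (simp add: log_max_def max_absorb1)
    then show ?thesis using B(1) \<psi>(1) by (simp add: phi_def)
  qed
  then have "(\<Sum>i<m. phi (sv i)) \<le> (\<Sum>i<m. ln (sv i))" by (intro sum_mono) auto
  also have "\<dots> = ln (cmod (det (X - z \<cdot>\<^sub>m 1\<^sub>m m)))"
    unfolding sv(3) using sv(2) by (intro ln_prod[symmetric]) force+
  finally have 1: "(\<Sum>i<m. phi (sv i)) / real m \<le> ln (cmod (det (X - z \<cdot>\<^sub>m 1\<^sub>m m))) / real m"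
    by (rule divide_right_mono) simp
  have 2: "\<bar>(\<Sum>i<m. phi (sv i)) / real m - (LINT w|\<mu>. phi (cmod (w - z)))\<bar> \<le> (1 + B) / e * E"
    by (rule close_statisticsD[OF st X sv(1) lip])
  have Bs: "{w. cmod (w - z) \<le> 2 * e} \<in> sets borel" by measurable
  then have Bm: "{w. cmod (w - z) \<le> 2 * e} \<in> sets \<mu>" using sets by simp
  have ind: "integrable \<mu> (\<lambda>w. B * indicator {w. cmod (w - z) \<le> 2 * e} w)"
    using Bm by (intro integrable_mult_right integrable_real_indicator) (auto simp: emeasure_eq_measure)
  have \<psi>m: "(\<lambda>w. \<psi> (cmod (w - z))) \<in> borel_measurable \<mu>" unfolding \<psi>_def by (rule borel_meas) measurable
  have \<psi>i: "integrable \<mu> (\<lambda>w. \<psi> (cmod (w - z)))"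
    using \<psi> by (intro integrable_const_bound[of _ 1] AE_I2 \<psi>m) auto
  have "log_potential \<mu> e z - B * measure \<mu> {w. cmod (w - z) \<le> 2 * e}
    = (LINT w|\<mu>. log_max e (cmod (w - z)) - B * indicator {w. cmod (w - z) \<le> 2 * e} w)"
    unfolding log_potential_def using log_max_integrable[OF e] ind Bm sets_eq_imp_space_eq[OF sets] by simp
  also have "\<dots> \<le> (LINT w|\<mu>. phi (cmod (w - z)))"
  proof (rule integral_mono[OF Bochner_Integration.integrable_diff[OF log_max_integrable[OF e] ind]])
    show "integrable \<mu> (\<lambda>w. phi (cmod (w - z)))" unfolding phi_def
      using log_max_integrable[OF e] \<psi>i by (intro Bochner_Integration.integrable_diff integrable_mult_right)
    fix w
    have "\<psi> (cmod (w - z)) \<le> indicator {w. cmod (w - z) \<le> 2 * e} w"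
      using e \<psi>(2) by (auto simp: \<psi>_def indicator_def field_simps)
    then show "log_max e (cmod (w - z)) - B * indicator {w. cmod (w - z) \<le> 2 * e} w \<le> phi (cmod (w - z))"
      unfolding phi_def using B(1) by (simp add: mult_left_mono)
  qed
  finally show "log_potential \<mu> e z - (1 + ln (e / b)) / e * E - ln (e / b) * measure \<mu> {w. cmod (w - z) \<le> 2 * e}
      \<le> ln (cmod (det (X - z \<cdot>\<^sub>m 1\<^sub>m m))) / real m"
    using 1 2 unfolding B_def[symmetric] by linarith
qed

text \<open>
  The upper bound on the determinants holds for all \<open>z\<close> simultaneously, so the circle may be chosen
  depending on the eigenvalues: its radius avoids their distances to the centre, and the number of
  nodes is large in terms of the gaps.
\<close>

lemma empirical_log_upper:
  fixes es :: "complex list"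
  assumes m: "m > 0" and r: "r > 0" and e: "\<epsilon> > 0" and \<eta>: "\<eta> > 0"
    and U: "\<And>z. (\<Prod>i<m. cmod (es ! i - z)) \<noteq> 0 \<Longrightarrow> ln (\<Prod>i<m. cmod (es ! i - z)) / real m \<le> log_potential \<mu> \<epsilon> z + F"
  shows "(\<Sum>i<m. log_max r (cmod (es ! i - z))) / real m \<le> log_potential \<mu> r z + 2 * \<eta> + \<epsilon> / r + F"
proof -
  have "infinite {r<..<r * (1 + \<eta>)}" using r \<eta> by (simp add: infinite_Ioo distrib_left)
  moreover have "finite ((\<lambda>i. cmod (es ! i - z)) ` {..<m})" by simp
  ultimately have "infinite ({r<..<r * (1 + \<eta>)} - (\<lambda>i. cmod (es ! i - z)) ` {..<m})" by (rule Diff_infinite_finite[rotated])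
  then obtain r' where "r' \<in> {r<..<r * (1 + \<eta>)} - (\<lambda>i. cmod (es ! i - z)) ` {..<m}" using infinite_imp_nonempty by blast
  then have r': "r < r'" "r' < r * (1 + \<eta>)" and ne: "\<And>i. i < m \<Longrightarrow> cmod (es ! i - z) \<noteq> r'" by auto
  have r0: "r' > 0" using r r' by simp
  have lim: "((\<lambda>M. c * (1 + 1 / real M)) \<longlonglongrightarrow> c * (1 + 0))" for c :: real
    by (intro tendsto_mult tendsto_add tendsto_const lim_1_over_n)
  have sep: "\<forall>\<^sub>F M in sequentially. r' * (1 + 1 / real M) \<le> cmod (es ! i - z) \<or> cmod (es ! i - z) * (1 + 1 / real M) \<le> r'" if i: "i < m" for i
  proof (cases "r' < cmod (es ! i - z)")
    case True
    then have "\<forall>\<^sub>F M in sequentially. r' * (1 + 1 / real M) < cmod (es ! i - z)" using lim[of r'] by (intro order_tendstoD(2)) auto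
    then show ?thesis by (rule eventually_mono) simp
  next
    case False
    then have "cmod (es ! i - z) < r'" using ne[OF i] by simp
    then have "\<forall>\<^sub>F M in sequentially. cmod (es ! i - z) * (1 + 1 / real M) < r'" using lim[of "cmod (es ! i - z)"] by (intro order_tendstoD(2)) auto
    then show ?thesis by (rule eventually_mono) simp
  qed
  have "\<forall>\<^sub>F M in sequentially. \<forall>i\<in>{..<m}. r' * (1 + 1 / real M) \<le> cmod (es ! i - z) \<or> cmod (es ! i - z) * (1 + 1 / real M) \<le> r'"
    using sep by (intro eventually_ball_finite) auto
  moreover have "\<forall>\<^sub>F M in sequentially. 2 * ln 2 / real M < \<eta>"
    using \<eta> tendsto_mult[OF tendsto_const lim_1_over_n, of "2 * ln 2 :: real"] by (intro order_tendstoD(2)[of _ 0]) simp_all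
  moreover have "\<forall>\<^sub>F M in sequentially. M > (0::nat)" by (rule eventually_gt_at_top)
  ultimately have "\<forall>\<^sub>F M in sequentially. (\<forall>i\<in>{..<m}. r' * (1 + 1 / real M) \<le> cmod (es ! i - z) \<or> cmod (es ! i - z) * (1 + 1 / real M) \<le> r')
      \<and> 2 * ln 2 / real M < \<eta> \<and> M > 0"
    by eventually_elim simp
  then obtain M where M: "M > 0" "2 * ln 2 / real M < \<eta>"
    and sepM: "\<And>i. i < m \<Longrightarrow> r' * (1 + 1 / real M) \<le> cmod (es ! i - z) \<or> cmod (es ! i - z) * (1 + 1 / real M) \<le> r'"
    by (auto dest: eventually_happens'[OF sequentially_bot])
  note sp = circle_average_lower_separated[OF M(1) r0 sepM]
  note R = unity_roots_props[OF M(1)]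
  have nz: "es ! i - (z + of_real r' * x) \<noteq> 0" if "i < m" "x \<in> unity_roots M" for i x
  proof
    assume "es ! i - (z + of_real r' * x) = 0"
    then have "es ! i - z = of_real r' * x" by (simp add: algebra_simps)
    then have "(es ! i - z) ^ M = of_real r' ^ M" using that(2) by (simp add: power_mult_distrib unity_roots_def)
    then show False using sp(1)[OF that(1)] by simp
  qed
  have "(\<Sum>i<m. log_max r (cmod (es ! i - z))) \<le> (\<Sum>i<m. log_max r' (cmod (es ! i - z)))"
    unfolding log_max_def using r r' by (intro sum_mono ln_mono) (auto simp: less_max_iff_disj)
  also have "\<dots> \<le> (\<Sum>i<m. ln 2 / real M + (\<Sum>x\<in>unity_roots M. ln (cmod (es ! i - (z + of_real r' * x)))) / real M)"
    using sp(2) by (intro sum_mono) (force simp: diff_diff_eq algebra_simps)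
  also have "\<dots> = real m * (ln 2 / real M) + (\<Sum>x\<in>unity_roots M. \<Sum>i<m. ln (cmod (es ! i - (z + of_real r' * x)))) / real M"
    unfolding sum.distrib sum_divide_distrib[symmetric] by (subst sum.swap) simp
  finally have "(\<Sum>i<m. log_max r (cmod (es ! i - z))) / real m
      \<le> (real m * (ln 2 / real M) + (\<Sum>x\<in>unity_roots M. \<Sum>i<m. ln (cmod (es ! i - (z + of_real r' * x)))) / real M) / real m"
    by (rule divide_right_mono) simp
  also have "\<dots> = ln 2 / real M + (\<Sum>x\<in>unity_roots M. (\<Sum>i<m. ln (cmod (es ! i - (z + of_real r' * x)))) / real m) / real M"
    using m by (simp add: add_divide_distrib sum_divide_distrib[symmetric] mult.commute)
  also have "\<dots> \<le> ln 2 / real M + (\<Sum>x\<in>unity_roots M. log_potential \<mu> \<epsilon> (z + of_real r' * x) + F) / real M"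
  proof (intro add_left_mono divide_right_mono sum_mono)
    fix x assume x: "x \<in> unity_roots M"
    have "(\<Sum>i<m. ln (cmod (es ! i - (z + of_real r' * x)))) = ln (\<Prod>i<m. cmod (es ! i - (z + of_real r' * x)))"
      using nz[OF _ x] by (intro ln_prod[symmetric]) auto
    then show "(\<Sum>i<m. ln (cmod (es ! i - (z + of_real r' * x)))) / real m \<le> log_potential \<mu> \<epsilon> (z + of_real r' * x) + F"
      using U[of "z + of_real r' * x"] nz[OF _ x] by (auto simp: prod_zero_iff)
  qed simp
  also have "\<dots> = ln 2 / real M + (\<Sum>x\<in>unity_roots M. log_potential \<mu> \<epsilon> (z + of_real r' * x)) / real M + F"
    using M(1) R(2) by (simp add: sum.distrib add_divide_distrib)
  also have "\<dots> \<le> ln 2 / real M + (log_potential \<mu> r' z + \<epsilon> / r' + ln 2 / real M) + F"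
    using log_potential_circle_average(1)[OF M(1) r0 e, of z] by simp
  also have "\<dots> \<le> log_potential \<mu> r' z + \<epsilon> / r' + \<eta> + F" using M(2) by simp
  also have "\<epsilon> / r' \<le> \<epsilon> / r" using r r' e by (intro divide_left_mono) auto
  also have "log_potential \<mu> r' z \<le> log_potential \<mu> r z + \<eta>"
  proof -
    have "(r' - r) / r \<le> \<eta>" using r r' by (simp add: field_simps)
    then show ?thesis using log_potential_radius_lipschitz[OF r, of r' z] r' by simp
  qed
  finally show ?thesis by simp
qed

text \<open>In contrast to the upper estimate, the nodes are prescribed in advance, since lower
  bounds on determinants come with high probability at fixed points only. The delicate direction of
  the circle average now falls on the deterministic measure, whose potential is truncated; for the
  eigenvalues the easy direction suffices.\<close>

lemma empirical_log_lower:
  fixes es :: "complex list"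
  assumes m: "m > 0" and M: "M > 0" and r: "r > 0" and e: "\<epsilon> > 0"
    and L: "\<And>x. x \<in> unity_roots M \<Longrightarrow> (\<Prod>i<m. cmod (es ! i - (z + of_real r * x))) \<noteq> 0 \<and>
      log_potential \<mu> \<epsilon> (z + of_real r * x) - F \<le> ln (\<Prod>i<m. cmod (es ! i - (z + of_real r * x))) / real m"
  shows "log_potential \<mu> r z - 2 * ln 2 / real M - 2 * r / (real M * \<epsilon>) - F \<le> (\<Sum>i<m. log_max r (cmod (es ! i - z))) / real m"
proof -
  note R = unity_roots_props[OF M]
  have nz: "es ! i - (z + of_real r * x) \<noteq> 0" if "i < m" "x \<in> unity_roots M" for i x
    using L[OF that(2)] that(1) by (auto simp: prod_zero_iff)
  have "log_potential \<mu> r z - ln 2 / real M - 2 * r / (real M * \<epsilon>) - F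
      \<le> (\<Sum>x\<in>unity_roots M. log_potential \<mu> \<epsilon> (z + of_real r * x)) / real M - F"
    using log_potential_circle_average(2)[OF M r e, of z] by simp
  also have "\<dots> = (\<Sum>x\<in>unity_roots M. log_potential \<mu> \<epsilon> (z + of_real r * x) - F) / real M"
    using M R(2) by (simp add: sum_subtractf diff_divide_distrib)
  also have "\<dots> \<le> (\<Sum>x\<in>unity_roots M. (\<Sum>i<m. ln (cmod (es ! i - (z + of_real r * x)))) / real m) / real M"
  proof (intro divide_right_mono sum_mono)
    fix x assume x: "x \<in> unity_roots M"
    have "(\<Sum>i<m. ln (cmod (es ! i - (z + of_real r * x)))) = ln (\<Prod>i<m. cmod (es ! i - (z + of_real r * x)))"
      using nz[OF _ x] by (intro ln_prod[symmetric]) auto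
    then show "log_potential \<mu> \<epsilon> (z + of_real r * x) - F \<le> (\<Sum>i<m. ln (cmod (es ! i - (z + of_real r * x)))) / real m"
      using L[OF x] by simp
  qed simp
  also have "\<dots> = (\<Sum>i<m. (\<Sum>x\<in>unity_roots M. ln (cmod (es ! i - (z + of_real r * x)))) / real M) / real m"
    unfolding sum_divide_distrib[symmetric] by (subst sum.swap) simp
  also have "\<dots> \<le> (\<Sum>i<m. log_max r (cmod (es ! i - z)) + ln 2 / real M) / real m"
  proof (intro divide_right_mono sum_mono)
    fix i assume i: "i \<in> {..<m}"
    have "es ! i - z \<noteq> of_real r * x" if "x \<in> unity_roots M" for x using nz[OF _ that, of i] i by (auto simp: algebra_simps)
    then show "(\<Sum>x\<in>unity_roots M. ln (cmod (es ! i - (z + of_real r * x)))) / real M \<le> log_max r (cmod (es ! i - z)) + ln 2 / real M"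
      using circle_average_log_upper[OF M r, of "es ! i - z"] by (simp add: diff_diff_eq)
  qed simp
  also have "\<dots> = (\<Sum>i<m. log_max r (cmod (es ! i - z))) / real m + ln 2 / real M"
    using m by (simp add: sum.distrib add_divide_distrib)
  finally show ?thesis by simp
qed

end

section \<open>Convergence in probability\<close>

text \<open>
  The exceptional events \<open>B N\<close> are measurable, but \<open>\<Phi> N\<close> itself need not be.
\<close>

definition whp :: "(nat \<Rightarrow> 'w measure) \<Rightarrow> (nat \<Rightarrow> 'w \<Rightarrow> bool) \<Rightarrow> bool" where
  "whp P \<Phi> \<longleftrightarrow> (\<exists>B. (\<forall>N\<ge>1. B N \<in> sets (P N)) \<and> (\<lambda>N. measure (P N) (B N)) \<longlonglongrightarrow> 0 \<and>
     (\<forall>\<^sub>F N in sequentially. \<forall>\<omega>\<in>space (P N) - B N. \<Phi> N \<omega>))"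

lemma whp_mono:
  assumes "whp P \<Phi>" "\<forall>\<^sub>F N in sequentially. \<forall>\<omega>\<in>space (P N). \<Phi> N \<omega> \<longrightarrow> \<Psi> N \<omega>"
  shows "whp P \<Psi>"
proof -
  obtain B where B: "\<forall>N\<ge>1. B N \<in> sets (P N)" "(\<lambda>N. measure (P N) (B N)) \<longlonglongrightarrow> 0"
    "\<forall>\<^sub>F N in sequentially. \<forall>\<omega>\<in>space (P N) - B N. \<Phi> N \<omega>"
    using assms(1) unfolding whp_def by blast
  have "\<forall>\<^sub>F N in sequentially. \<forall>\<omega>\<in>space (P N) - B N. \<Psi> N \<omega>"
    using B(3) assms(2) by eventually_elim blast
  then show ?thesis unfolding whp_def using B(1,2) by blast
qed

lemma whp_conj:
  assumes "whp P \<Phi>" "whp P \<Psi>"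
  shows "whp P (\<lambda>N \<omega>. \<Phi> N \<omega> \<and> \<Psi> N \<omega>)"
proof -
  obtain B where B: "\<forall>N\<ge>1. B N \<in> sets (P N)" "(\<lambda>N. measure (P N) (B N)) \<longlonglongrightarrow> 0"
    "\<forall>\<^sub>F N in sequentially. \<forall>\<omega>\<in>space (P N) - B N. \<Phi> N \<omega>"
    using assms(1) unfolding whp_def by blast
  obtain D where D: "\<forall>N\<ge>1. D N \<in> sets (P N)" "(\<lambda>N. measure (P N) (D N)) \<longlonglongrightarrow> 0"
    "\<forall>\<^sub>F N in sequentially. \<forall>\<omega>\<in>space (P N) - D N. \<Psi> N \<omega>"
    using assms(2) unfolding whp_def by blast
  have "(\<lambda>N. measure (P N) (B N \<union> D N)) \<longlonglongrightarrow> 0"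
  proof (rule tendsto_sandwich[OF _ _ tendsto_const])
    show "\<forall>\<^sub>F N in sequentially. measure (P N) (B N \<union> D N) \<le> measure (P N) (B N) + measure (P N) (D N)"
      using eventually_ge_at_top[of 1] by eventually_elim (use B(1) D(1) in \<open>auto intro: measure_Un_le\<close>)
    show "(\<lambda>N. measure (P N) (B N) + measure (P N) (D N)) \<longlonglongrightarrow> 0" using tendsto_add[OF B(2) D(2)] by simp
  qed simp
  moreover have "\<forall>\<^sub>F N in sequentially. \<forall>\<omega>\<in>space (P N) - (B N \<union> D N). \<Phi> N \<omega> \<and> \<Psi> N \<omega>"
    using B(3) D(3) by eventually_elim blast
  moreover have "\<forall>N\<ge>1. B N \<union> D N \<in> sets (P N)" using B(1) D(1) by blast
  ultimately show ?thesis unfolding whp_def by (intro exI[of _ "\<lambda>N. B N \<union> D N"] conjI)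
qed

lemma whp_ball:
  assumes "finite Z" "\<And>z. z \<in> Z \<Longrightarrow> whp P (\<Phi> z)"
  shows "whp P (\<lambda>N \<omega>. \<forall>z\<in>Z. \<Phi> z N \<omega>)"
  using assms
proof (induction Z rule: finite_induct)
  case empty
  show ?case unfolding whp_def by (intro exI[of _ "\<lambda>_. {}"]) simp
next
  case (insert z Z)
  have "whp P (\<lambda>N \<omega>. \<Phi> z N \<omega> \<and> (\<forall>z\<in>Z. \<Phi> z N \<omega>))" using insert by (intro whp_conj) auto
  then show ?case by simp
qed

text \<open>The sets \<open>S N\<close> may fail to be measurable: monotonicity of the measure uses
  only that the larger set \<open>B N\<close> is.\<close>

lemma whp_measure_tendsto:
  assumes w: "whp P \<Phi>" and prob: "\<And>N. N \<ge> 1 \<Longrightarrow> prob_space (P N)"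
    and S: "\<forall>\<^sub>F N in sequentially. \<forall>\<omega>\<in>S N. \<omega> \<in> space (P N) \<and> \<not> \<Phi> N \<omega>"
  shows "(\<lambda>N. measure (P N) (S N)) \<longlonglongrightarrow> 0"
proof -
  obtain B where B: "\<forall>N\<ge>1. B N \<in> sets (P N)" "(\<lambda>N. measure (P N) (B N)) \<longlonglongrightarrow> 0"
    "\<forall>\<^sub>F N in sequentially. \<forall>\<omega>\<in>space (P N) - B N. \<Phi> N \<omega>"
    using w unfolding whp_def by blast
  show ?thesis
  proof (rule tendsto_sandwich[OF _ _ tendsto_const B(2)])
    show "\<forall>\<^sub>F N in sequentially. measure (P N) (S N) \<le> measure (P N) (B N)"
      using B(3) S eventually_ge_at_top[of 1]
    proof eventually_elim
      case (elim N)
      interpret prob_space "P N" using elim by (intro prob)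
      have "S N \<subseteq> B N" using elim by blast
      then show ?case using B(1) elim(3) by (intro finite_measure_mono) auto
    qed
  qed simp
qed

section \<open>Determinants and potentials with high probability\<close>

lemma powr_log_decay:
  assumes "c > 0"
  shows "(\<lambda>N. real N powr - c) \<longlonglongrightarrow> 0" "(\<lambda>N. ln (real N) * real N powr - c) \<longlonglongrightarrow> 0"
proof -
  have "((\<lambda>x::real. x powr - c) \<longlongrightarrow> 0) at_top" "((\<lambda>x::real. ln x * x powr - c) \<longlongrightarrow> 0) at_top"
    using assms by real_asymp+
  then show "(\<lambda>N. real N powr - c) \<longlonglongrightarrow> 0" "(\<lambda>N. ln (real N) * real N powr - c) \<longlonglongrightarrow> 0"
    by (auto intro: filterlim_compose[OF _ filterlim_real_sequentially])
qed

text \<open>The determinant is first compared with the potential truncated at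
  \<open>q = N powr - (c / 2)\<close>, a scale at which the statistics error divided by
  \<open>q\<close> is still of order \<open>q\<close>. The step from \<open>q\<close> up to the
  fixed radius \<epsilon> is deterministic and is \<open>log_potential_tail\<close>.\<close>

lemma log_det_lower_whp:
  assumes cp: "compact_prob \<mu> S" and a: "a > 0" and K: "K \<ge> 0"
    and conc: "\<And>t. 0 \<le> t \<Longrightarrow> t \<le> t1 \<Longrightarrow> measure \<mu> {w. cmod (w - z) \<le> t} \<le> K * t powr a"
    and X: "\<And>N \<omega>. N \<ge> 1 \<Longrightarrow> \<omega> \<in> space (P N) \<Longrightarrow> X N \<omega> \<in> carrier_mat (m N) (m N)"
    and c: "c > 0" and stat: "whp P (\<lambda>N \<omega>. close_statistics \<mu> (C * real N powr - c) (X N \<omega>))"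
    and sing: "whp P (\<lambda>N \<omega>. \<forall>s\<in>singular_values (X N \<omega> - z \<cdot>\<^sub>m 1\<^sub>m (m N)). real N powr - \<beta> \<le> s)"
    and e: "0 < \<epsilon>" "\<epsilon> \<le> t1" and \<eta>: "\<eta> > 0"
  shows "whp P (\<lambda>N \<omega>. det (X N \<omega> - z \<cdot>\<^sub>m 1\<^sub>m (m N)) \<noteq> 0 \<and>
    log_potential \<mu> \<epsilon> z - ((ln 2 * K / (1 - 2 powr - a)) * \<epsilon> powr a + \<eta>)
      \<le> ln (cmod (det (X N \<omega> - z \<cdot>\<^sub>m 1\<^sub>m (m N)))) / real (m N))"
proof (rule whp_mono[OF whp_conj[OF stat sing]])
  interpret compact_prob \<mu> S by (rule cp)
  \<comment> \<open>Enlarging \<beta> to at least \<open>c\<close> keeps the floor \<open>b\<close>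
    for the singular values below the cutoff \<open>q\<close> and makes \<open>k\<close>
    positive.\<close>
  define \<beta>' where "\<beta>' = max \<beta> c"
  define k where "k = \<beta>' - c / 2"
  have k: "k > 0" using c by (simp add: k_def \<beta>'_def)
  \<comment> \<open>\<open>k * ln N\<close> is \<open>ln (q / b)\<close>. The first two terms are
    the Lipschitz constant times the statistics error; the third is \<open>ln (q / b)\<close> times
    the mass of a disc of radius \<open>2 * q\<close>.\<close>
  define R where "R N = C * real N powr - (c / 2) + C * k * (ln (real N) * real N powr - (c / 2))
    + k * K * 2 powr a * (ln (real N) * real N powr - (c / 2 * a))" for N :: nat
  have "R \<longlonglongrightarrow> C * 0 + C * k * 0 + k * K * 2 powr a * 0"
    unfolding R_def using a c by (intro tendsto_intros powr_log_decay) auto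
  then have "\<forall>\<^sub>F N in sequentially. R N < \<eta>" using \<eta> by (intro order_tendstoD(2)) auto
  moreover have "\<forall>\<^sub>F N in sequentially. real N powr - (c / 2) < \<epsilon> / 2"
    using powr_log_decay(1)[of "c / 2"] c e by (intro order_tendstoD(2)) auto
  moreover have "\<forall>\<^sub>F N in sequentially. N \<ge> (1::nat)" by (rule eventually_ge_at_top)
  ultimately show "\<forall>\<^sub>F N in sequentially. \<forall>\<omega>\<in>space (P N). close_statistics \<mu> (C * real N powr - c) (X N \<omega>) \<and>
      (\<forall>s\<in>singular_values (X N \<omega> - z \<cdot>\<^sub>m 1\<^sub>m (m N)). real N powr - \<beta> \<le> s) \<longrightarrow>
      det (X N \<omega> - z \<cdot>\<^sub>m 1\<^sub>m (m N)) \<noteq> 0 \<and>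
      log_potential \<mu> \<epsilon> z - ((ln 2 * K / (1 - 2 powr - a)) * \<epsilon> powr a + \<eta>)
      \<le> ln (cmod (det (X N \<omega> - z \<cdot>\<^sub>m 1\<^sub>m (m N)))) / real (m N)"
  proof (eventually_elim, intro ballI impI, elim conjE)
    fix N \<omega>
    assume R: "R N < \<eta>" and eN: "real N powr - (c / 2) < \<epsilon> / 2" and N: "1 \<le> N" and w: "\<omega> \<in> space (P N)"
      and st: "close_statistics \<mu> (C * real N powr - c) (X N \<omega>)"
      and sg: "\<forall>s\<in>singular_values (X N \<omega> - z \<cdot>\<^sub>m 1\<^sub>m (m N)). real N powr - \<beta> \<le> s"
    define q where "q = real N powr - (c / 2)"
    define b where "b = real N powr - \<beta>'"
    have q0: "q > 0" and b0: "b > 0" using N by (auto simp: q_def b_def)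
    have bq: "b \<le> q" unfolding b_def q_def using N c by (intro powr_mono) (auto simp: \<beta>'_def)
    have bs: "b \<le> s" if "s \<in> singular_values (X N \<omega> - z \<cdot>\<^sub>m 1\<^sub>m (m N))" for s
    proof -
      have "b \<le> real N powr - \<beta>" unfolding b_def using N by (intro powr_mono) (auto simp: \<beta>'_def)
      then show ?thesis using sg that by fastforce
    qed
    have low: "det (X N \<omega> - z \<cdot>\<^sub>m 1\<^sub>m (m N)) \<noteq> 0"
      "log_potential \<mu> q z - (1 + ln (q / b)) / q * (C * real N powr - c) - ln (q / b) * measure \<mu> {w. cmod (w - z) \<le> 2 * q}
        \<le> ln (cmod (det (X N \<omega> - z \<cdot>\<^sub>m 1\<^sub>m (m N)))) / real (m N)"
      using bs by (intro log_det_lower[OF st X[OF N w] b0 bq]; blast)+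
    have lnqb: "ln (q / b) = k * ln (real N)"
      using q0 b0 N by (simp add: ln_divide_pos q_def b_def ln_powr k_def left_diff_distrib)
    have lnN: "ln (real N) \<ge> 0" using N by simp
    have qq: "C * real N powr - c / q = C * q" 
    proof -
      have "real N powr - c = q * q" by (simp add: q_def flip: powr_add)
      then show ?thesis using q0 by simp
    qed
    have "measure \<mu> {w. cmod (w - z) \<le> 2 * q} \<le> K * (2 * q) powr a"
      using q0 eN e by (intro conc) (auto simp: q_def)
    also have "(2 * q) powr a = 2 powr a * real N powr - (c / 2 * a)"
      using q0 by (simp add: powr_mult q_def powr_powr)
    finally have "k * ln (real N) * measure \<mu> {w. cmod (w - z) \<le> 2 * q} \<le> k * ln (real N) * (K * (2 powr a * real N powr - (c / 2 * a)))"
      using k lnN by (intro mult_left_mono) auto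
    moreover have "(1 + k * ln (real N)) / q * (C * real N powr - c) = C * q + C * k * (ln (real N) * q)"
    proof -
      have "(1 + k * ln (real N)) / q * (C * real N powr - c) = (1 + k * ln (real N)) * (C * real N powr - c / q)" by simp
      then show ?thesis unfolding qq by (simp add: algebra_simps)
    qed
    ultimately have "(1 + ln (q / b)) / q * (C * real N powr - c) + ln (q / b) * measure \<mu> {w. cmod (w - z) \<le> 2 * q} \<le> R N"
      unfolding lnqb R_def q_def[symmetric] by (simp add: algebra_simps)
    then have "log_potential \<mu> q z - \<eta> \<le> ln (cmod (det (X N \<omega> - z \<cdot>\<^sub>m 1\<^sub>m (m N)))) / real (m N)"
      using low(2) R by linarith
    moreover have "log_potential \<mu> \<epsilon> z \<le> log_potential \<mu> q z + (ln 2 * K / (1 - 2 powr - a)) * \<epsilon> powr a"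
      using eN q0 e by (intro log_potential_tail[where ?t1.0 = t1] a K conc) (auto simp: q_def)
    ultimately show "det (X N \<omega> - z \<cdot>\<^sub>m 1\<^sub>m (m N)) \<noteq> 0 \<and>
      log_potential \<mu> \<epsilon> z - ((ln 2 * K / (1 - 2 powr - a)) * \<epsilon> powr a + \<eta>)
      \<le> ln (cmod (det (X N \<omega> - z \<cdot>\<^sub>m 1\<^sub>m (m N)))) / real (m N)"
      using low(1) by simp
  qed
qed

text \<open>Quantifying over every list \<open>es\<close> that satisfies the determinant identity
  avoids a measurable choice of eigenvalues. The parameters are fixed in the order \<epsilon>,
  \<open>M\<close>, \<open>N\<close>; the upper estimate uses its own cutoff
  \<open>r * \<eta> / 4\<close>, unrelated to \<epsilon>.\<close>

lemma empirical_log_whp: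
  assumes cp: "compact_prob \<mu> S" and a: "a > 0" and K: "K \<ge> 0" and t1: "t1 > 0"
    and conc: "\<And>z t. 0 \<le> t \<Longrightarrow> t \<le> t1 \<Longrightarrow> measure \<mu> {w. cmod (w - z) \<le> t} \<le> K * t powr a"
    and m: "\<And>N. N \<ge> 1 \<Longrightarrow> m N > 0"
    and X: "\<And>N \<omega>. N \<ge> 1 \<Longrightarrow> \<omega> \<in> space (P N) \<Longrightarrow> X N \<omega> \<in> carrier_mat (m N) (m N)"
    and c: "c > 0" and stat: "whp P (\<lambda>N \<omega>. close_statistics \<mu> (C * real N powr - c) (X N \<omega>))"
    and sing: "\<And>z. \<exists>\<beta>. whp P (\<lambda>N \<omega>. \<forall>s\<in>singular_values (X N \<omega> - z \<cdot>\<^sub>m 1\<^sub>m (m N)). real N powr - \<beta> \<le> s)"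
    and r: "r > 0" and \<eta>: "\<eta> > 0"
  shows "whp P (\<lambda>N \<omega>. \<forall>es. (\<forall>z. cmod (det (X N \<omega> - z \<cdot>\<^sub>m 1\<^sub>m (m N))) = (\<Prod>i<m N. cmod (es ! i - z))) \<longrightarrow>
    \<bar>(\<Sum>i<m N. log_max r (cmod (es ! i - z0))) / real (m N) - log_potential \<mu> r z0\<bar> \<le> \<eta>)"
proof -
  interpret compact_prob \<mu> S by (rule cp)
  define G where "G = ln 2 * K / (1 - 2 powr - a)"
  have "((\<lambda>\<epsilon>. G * \<epsilon> powr a) \<longlongrightarrow> G * 0) (at_right 0)"
    using a by (intro tendsto_intros) real_asymp
  then have "\<forall>\<^sub>F \<epsilon> in at_right 0. G * \<epsilon> powr a < \<eta> / 4" using \<eta> by (intro order_tendstoD(2)) auto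
  moreover have "\<forall>\<^sub>F \<epsilon> in at_right 0. \<epsilon> \<in> {0<..<t1}" using t1 by (rule eventually_at_right_real)
  ultimately have "\<forall>\<^sub>F \<epsilon> in at_right 0. G * \<epsilon> powr a < \<eta> / 4 \<and> \<epsilon> \<in> {0<..<t1}" by (rule eventually_conj)
  \<comment> \<open>Small enough that the tail between the vanishing cutoff and \<epsilon> is
    negligible for all \<open>N\<close> simultaneously.\<close>
  then obtain \<epsilon> where e: "0 < \<epsilon>" "\<epsilon> < t1" "G * \<epsilon> powr a < \<eta> / 4"
    by (auto dest!: eventually_happens'[OF trivial_limit_at_right_real])
  have lim: "\<forall>\<^sub>F M in sequentially. t * (1 / real M) < \<eta> / 4" for t
    using \<eta> tendsto_mult[OF tendsto_const lim_1_over_n, of t] by (intro order_tendstoD(2)[of _ 0]) simp_all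
  have "\<forall>\<^sub>F M in sequentially. 2 * ln 2 * (1 / real M) < \<eta> / 4 \<and> 2 * r / \<epsilon> * (1 / real M) < \<eta> / 4 \<and> M > 0"
    by (intro eventually_conj lim eventually_gt_at_top)
  \<comment> \<open>Chosen after \<epsilon>, because one of the errors of the circle average is
    \<open>2 * r / (real M * \<epsilon>)\<close>.\<close>
  then obtain M where M: "2 * ln 2 * (1 / real M) < \<eta> / 4" "2 * r / \<epsilon> * (1 / real M) < \<eta> / 4" "M > 0"
    by (auto dest!: eventually_happens'[OF sequentially_bot])
  define L where "L x N \<omega> \<longleftrightarrow> det (X N \<omega> - (z0 + of_real r * x) \<cdot>\<^sub>m 1\<^sub>m (m N)) \<noteq> 0 \<and>
    log_potential \<mu> \<epsilon> (z0 + of_real r * x) - (G * \<epsilon> powr a + \<eta> / 4)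
      \<le> ln (cmod (det (X N \<omega> - (z0 + of_real r * x) \<cdot>\<^sub>m 1\<^sub>m (m N)))) / real (m N)" for x N \<omega>
  have "whp P (L x)" for x
  proof -
    obtain \<beta> where \<beta>: "whp P (\<lambda>N \<omega>. \<forall>s\<in>singular_values (X N \<omega> - (z0 + of_real r * x) \<cdot>\<^sub>m 1\<^sub>m (m N)). real N powr - \<beta> \<le> s)"
      using sing by blast
    show ?thesis unfolding L_def G_def
      using e \<eta> by (intro log_det_lower_whp[OF cp a K conc X c stat \<beta>, where ?t1.0 = t1]) auto
  qed
  then have "whp P (\<lambda>N \<omega>. \<forall>x\<in>unity_roots M. L x N \<omega>)" by (intro whp_ball unity_roots_props(1)[OF M(3)])
  from whp_conj[OF stat this] show ?thesis
  proof (rule whp_mono)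
    have re: "r * \<eta> / 4 > 0" using r \<eta> by simp
    have "(\<lambda>N. C * real N powr - c) \<longlonglongrightarrow> C * 0" by (intro tendsto_intros powr_log_decay c)
    then have "\<forall>\<^sub>F N in sequentially. C * real N powr - c < (r * \<eta> / 4) * (\<eta> / 4)"
      using re \<eta> by (intro order_tendstoD(2)) auto
    then show "\<forall>\<^sub>F N in sequentially. \<forall>\<omega>\<in>space (P N).
      close_statistics \<mu> (C * real N powr - c) (X N \<omega>) \<and> (\<forall>x\<in>unity_roots M. L x N \<omega>) \<longrightarrow>
      (\<forall>es. (\<forall>z. cmod (det (X N \<omega> - z \<cdot>\<^sub>m 1\<^sub>m (m N))) = (\<Prod>i<m N. cmod (es ! i - z))) \<longrightarrow>
        \<bar>(\<Sum>i<m N. log_max r (cmod (es ! i - z0))) / real (m N) - log_potential \<mu> r z0\<bar> \<le> \<eta>)"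
      using eventually_ge_at_top[of 1]
    proof (eventually_elim, intro ballI impI allI, elim conjE)
      fix N \<omega> es
      assume CN: "C * real N powr - c < (r * \<eta> / 4) * (\<eta> / 4)" and N: "1 \<le> N" and w: "\<omega> \<in> space (P N)"
        and st: "close_statistics \<mu> (C * real N powr - c) (X N \<omega>)" and L: "\<forall>x\<in>unity_roots M. L x N \<omega>"
        and es: "\<forall>z. cmod (det (X N \<omega> - z \<cdot>\<^sub>m 1\<^sub>m (m N))) = (\<Prod>i<m N. cmod (es ! i - z))"
      have up: "(\<Sum>i<m N. log_max r (cmod (es ! i - z0))) / real (m N)
          \<le> log_potential \<mu> r z0 + 2 * (\<eta> / 8) + (r * \<eta> / 4) / r + (C * real N powr - c) / (r * \<eta> / 4)"
      proof (rule empirical_log_upper[OF m[OF N] r re])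
        fix z assume "(\<Prod>i<m N. cmod (es ! i - z)) \<noteq> 0"
        then have "det (X N \<omega> - z \<cdot>\<^sub>m 1\<^sub>m (m N)) \<noteq> 0" using es[rule_format, of z] by auto
        then show "ln (\<Prod>i<m N. cmod (es ! i - z)) / real (m N) \<le> log_potential \<mu> (r * \<eta> / 4) z + (C * real N powr - c) / (r * \<eta> / 4)"
          unfolding es[rule_format, symmetric] by (rule log_det_upper[OF st X[OF N w] re])
      qed (use \<eta> in simp)
      have "(C * real N powr - c) / (r * \<eta> / 4) \<le> \<eta> / 4"
        using CN re by (simp add: pos_divide_le_eq mult.commute)
      moreover have "(r * \<eta> / 4) / r = \<eta> / 4" using r by simp
      ultimately have up': "(\<Sum>i<m N. log_max r (cmod (es ! i - z0))) / real (m N) \<le> log_potential \<mu> r z0 + \<eta>"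
        using up \<eta> by linarith
      have "log_potential \<mu> r z0 - 2 * ln 2 / real M - 2 * r / (real M * \<epsilon>) - (G * \<epsilon> powr a + \<eta> / 4)
          \<le> (\<Sum>i<m N. log_max r (cmod (es ! i - z0))) / real (m N)"
      proof (rule empirical_log_lower[OF m[OF N] M(3) r e(1)])
        fix x assume "x \<in> unity_roots M"
        then show "(\<Prod>i<m N. cmod (es ! i - (z0 + of_real r * x))) \<noteq> 0 \<and>
          log_potential \<mu> \<epsilon> (z0 + of_real r * x) - (G * \<epsilon> powr a + \<eta> / 4) \<le> ln (\<Prod>i<m N. cmod (es ! i - (z0 + of_real r * x))) / real (m N)"
          using L unfolding L_def es[rule_format, symmetric] by auto
      qed
      moreover have "2 * ln 2 / real M < \<eta> / 4" "2 * r / (real M * \<epsilon>) < \<eta> / 4" using M(1,2) by (auto simp: mult.commute)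
      ultimately have "log_potential \<mu> r z0 - \<eta> \<le> (\<Sum>i<m N. log_max r (cmod (es ! i - z0))) / real (m N)"
        using e(3) by linarith
      then show "\<bar>(\<Sum>i<m N. log_max r (cmod (es ! i - z0))) / real (m N) - log_potential \<mu> r z0\<bar> \<le> \<eta>"
        using up' by linarith
    qed
  qed
qed

lemma empirical_measure_converges:
  assumes cp: "compact_prob \<mu> S" and a: "a > 0" and K: "K \<ge> 0" and t1: "t1 > 0"
    and conc: "\<And>z t. 0 \<le> t \<Longrightarrow> t \<le> t1 \<Longrightarrow> measure \<mu> {w. cmod (w - z) \<le> t} \<le> K * t powr a"
    and prob: "\<And>N. N \<ge> 1 \<Longrightarrow> prob_space (P N)" and m: "\<And>N. N \<ge> 1 \<Longrightarrow> m N > 0"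
    and X: "\<And>N \<omega>. N \<ge> 1 \<Longrightarrow> \<omega> \<in> space (P N) \<Longrightarrow> X N \<omega> \<in> carrier_mat (m N) (m N)"
    and c: "c > 0" and stat: "whp P (\<lambda>N \<omega>. close_statistics \<mu> (C * real N powr - c) (X N \<omega>))"
    and sing: "\<And>z. \<exists>\<beta>. whp P (\<lambda>N \<omega>. \<forall>s\<in>singular_values (X N \<omega> - z \<cdot>\<^sub>m 1\<^sub>m (m N)). real N powr - \<beta> \<le> s)"
  shows "weakly_converges_in_prob P (\<lambda>N \<omega>. empirical_spectral_measure (X N \<omega>)) \<mu>"
  unfolding weakly_converges_in_prob_def
proof (intro allI impI, elim conjE)
  interpret compact_prob \<mu> S by (rule cp)
  fix f :: "complex \<Rightarrow> real" and \<epsilon> :: real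
  assume f: "continuous_on UNIV f" "bounded (range f)" and e: "\<epsilon> > 0"
  obtain Cf where Cf: "\<And>z. \<bar>f z\<bar> \<le> Cf" using f(2) by (auto simp: bounded_iff)
  obtain Z \<eta> where Z: "finite Z" "\<eta> > 0" "\<And>z R. (z, R) \<in> Z \<Longrightarrow> R > 0"
    and det: "\<And>\<nu>. prob_space \<nu> \<Longrightarrow> sets \<nu> = sets borel \<Longrightarrow>
      (\<And>z R. (z, R) \<in> Z \<Longrightarrow> \<bar>(LINT w|\<nu>. log_bump R (w - z)) - (LINT w|\<mu>. log_bump R (w - z))\<bar> \<le> \<eta>) \<Longrightarrow>
      \<bar>(LINT w|\<nu>. f w) - (LINT w|\<mu>. f w)\<bar> < \<epsilon>"
    by (rule log_bump_determines[OF f(1) Cf e prob sets supp]) blast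
  \<comment> \<open>Half of \<eta>, since each bump is a difference of two truncated
    logarithms.\<close>
  define \<Phi> where "\<Phi> r z0 N \<omega> \<longleftrightarrow> (\<forall>es. (\<forall>z. cmod (det (X N \<omega> - z \<cdot>\<^sub>m 1\<^sub>m (m N))) = (\<Prod>i<m N. cmod (es ! i - z))) \<longrightarrow>
    \<bar>(\<Sum>i<m N. log_max r (cmod (es ! i - z0))) / real (m N) - log_potential \<mu> r z0\<bar> \<le> \<eta> / 2)" for r z0 N \<omega>
  have \<Phi>: "whp P (\<Phi> r z0)" if "r > 0" for r z0
    unfolding \<Phi>_def using Z(2) by (intro empirical_log_whp[OF cp a K t1 conc m X c stat sing that]) auto
  have "whp P (\<lambda>N \<omega>. \<forall>x\<in>Z. \<Phi> (snd x) (fst x) N \<omega> \<and> \<Phi> (snd x / 2) (fst x) N \<omega>)"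
    using Z(3) by (intro whp_ball[OF Z(1)] whp_conj \<Phi>) auto
  then show "(\<lambda>N. measure (P N) {\<omega> \<in> space (P N). \<epsilon> \<le> \<bar>(LINT z|empirical_spectral_measure (X N \<omega>). f z) - (LINT z|\<mu>. f z)\<bar>}) \<longlonglongrightarrow> 0"
  proof (rule whp_measure_tendsto)
    have "\<bar>(LINT z|empirical_spectral_measure (X N \<omega>). f z) - (LINT z|\<mu>. f z)\<bar> < \<epsilon>"
      if N: "N \<ge> 1" and w: "\<omega> \<in> space (P N)" and good: "\<forall>x\<in>Z. \<Phi> (snd x) (fst x) N \<omega> \<and> \<Phi> (snd x / 2) (fst x) N \<omega>" for N \<omega>
    proof -
      let ?\<nu> = "empirical_spectral_measure (X N \<omega>)"
      obtain es where "length es = m N" and es: "\<And>z. cmod (det (X N \<omega> - z \<cdot>\<^sub>m 1\<^sub>m (m N))) = (\<Prod>i<m N. cmod (es ! i - z))"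
        and \<nu>: "prob_space ?\<nu>" "sets ?\<nu> = sets borel"
        and int: "\<And>f :: complex \<Rightarrow> real. f \<in> borel_measurable borel \<Longrightarrow> (LINT z|?\<nu>. f z) = (\<Sum>i<m N. f (es ! i)) / real (m N)"
        by (rule empirical_spectral_measure_eq[OF X[OF N w] m[OF N]]) blast
      show ?thesis
      proof (rule det[OF \<nu>])
        fix z R assume zR: "(z, R) \<in> Z"
        have R: "R > 0" "R / 2 > 0" using Z(3)[OF zR] by auto
        have "(LINT w|?\<nu>. log_bump R (w - z)) = (\<Sum>i<m N. log_bump R (es ! i - z)) / real (m N)"
          by (rule int) (intro measurable_compose[OF _ log_bump_measurable[OF R(1)]] borel_measurable_diff measurable_ident_sets refl borel_measurable_const)
        also have "\<dots> = (\<Sum>i<m N. log_max R (cmod (es ! i - z))) / real (m N) - (\<Sum>i<m N. log_max (R / 2) (cmod (es ! i - z))) / real (m N)"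
          by (simp add: log_bump_def sum_subtractf diff_divide_distrib)
        finally have 1: "(LINT w|?\<nu>. log_bump R (w - z)) = \<dots>" .
        have 2: "(LINT w|\<mu>. log_bump R (w - z)) = log_potential \<mu> R z - log_potential \<mu> (R / 2) z"
          unfolding log_bump_def log_potential_def using R by (intro Bochner_Integration.integral_diff log_max_integrable)
        have "\<bar>(\<Sum>i<m N. log_max R (cmod (es ! i - z))) / real (m N) - log_potential \<mu> R z\<bar> \<le> \<eta> / 2"
          "\<bar>(\<Sum>i<m N. log_max (R / 2) (cmod (es ! i - z))) / real (m N) - log_potential \<mu> (R / 2) z\<bar> \<le> \<eta> / 2"
          using good[rule_format, OF zR] es unfolding \<Phi>_def by simp_all
        then show "\<bar>(LINT w|?\<nu>. log_bump R (w - z)) - (LINT w|\<mu>. log_bump R (w - z))\<bar> \<le> \<eta>"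
          unfolding 1 2 by linarith
      qed
    qed
    then show "\<forall>\<^sub>F N in sequentially. \<forall>\<omega>\<in>{\<omega> \<in> space (P N). \<epsilon> \<le> \<bar>(LINT z|empirical_spectral_measure (X N \<omega>). f z) - (LINT z|\<mu>. f z)\<bar>}.
      \<omega> \<in> space (P N) \<and> \<not> (\<forall>x\<in>Z. \<Phi> (snd x) (fst x) N \<omega> \<and> \<Phi> (snd x / 2) (fst x) N \<omega>)"
      by (intro eventually_sequentiallyI[of 1]) fastforce
  qed (fact assms(6))
qed

lemma whpI:
  assumes "\<And>N. N \<ge> 1 \<Longrightarrow> {\<omega> \<in> space (P N). \<not> \<Phi> N \<omega>} \<in> sets (P N)"
    "(\<lambda>N. measure (P N) {\<omega> \<in> space (P N). \<not> \<Phi> N \<omega>}) \<longlonglongrightarrow> 0"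
  shows "whp P \<Phi>"
  unfolding whp_def using assms by (intro exI[of _ "\<lambda>N. {\<omega> \<in> space (P N). \<not> \<Phi> N \<omega>}"] conjI) auto

lemma markov_whp:
  fixes f :: "nat \<Rightarrow> 'w \<Rightarrow> real"
  assumes int: "\<And>N. N \<ge> 1 \<Longrightarrow> integrable (P N) (f N)" and pos: "\<And>N \<omega>. N \<ge> 1 \<Longrightarrow> \<omega> \<in> space (P N) \<Longrightarrow> f N \<omega> \<ge> 0"
    and O: "(\<lambda>N. LINT \<omega>|P N. f N \<omega>) \<in> O(\<lambda>N. real N powr \<kappa>)" and e: "e > 0"
  shows "whp P (\<lambda>N \<omega>. f N \<omega> < real N powr (\<kappa> + e))"
proof (rule whpI)
  show "{\<omega> \<in> space (P N). \<not> f N \<omega> < real N powr (\<kappa> + e)} \<in> sets (P N)" if "N \<ge> 1" for N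
  proof -
    have [measurable]: "f N \<in> borel_measurable (P N)" using int[OF that] by simp
    show ?thesis by measurable
  qed
  obtain c where c: "\<forall>\<^sub>F N in sequentially. norm (LINT \<omega>|P N. f N \<omega>) \<le> c * norm (real N powr \<kappa>)"
    using landau_o.bigE[OF O] by blast
  show "(\<lambda>N. measure (P N) {\<omega> \<in> space (P N). \<not> f N \<omega> < real N powr (\<kappa> + e)}) \<longlonglongrightarrow> 0"
  proof (rule tendsto_sandwich[OF _ _ tendsto_const])
    show "\<forall>\<^sub>F N in sequentially. measure (P N) {\<omega> \<in> space (P N). \<not> f N \<omega> < real N powr (\<kappa> + e)} \<le> c * real N powr - e"
      using c eventually_ge_at_top[of 1]
    proof eventually_elim
      case (elim N)
      have N: "real N > 0" using elim(2) by simp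
      have "measure (P N) {\<omega> \<in> space (P N). f N \<omega> \<ge> real N powr (\<kappa> + e)} \<le> (LINT \<omega>|P N. f N \<omega>) / real N powr (\<kappa> + e)"
        using pos[OF elim(2)] N by (intro integral_Markov_inequality_measure[OF int[OF elim(2)] sets.empty_sets] AE_I2) auto
      also have "\<dots> \<le> (c * real N powr \<kappa>) / real N powr (\<kappa> + e)" using elim(1) by (intro divide_right_mono) auto
      also have "\<dots> = c * real N powr - e" using N by (simp add: powr_add powr_minus_divide)
      finally show ?case by (simp add: not_less)
    qed
    show "(\<lambda>N. c * real N powr - e) \<longlonglongrightarrow> 0" using tendsto_mult[OF tendsto_const powr_log_decay(1)[OF e], of c] by simp
  qed simp
qed

section \<open>Perturbed symbol matrices\<close>

lemma norm_fourier_coeff_le: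
  fixes p :: "real ^ 'd \<Rightarrow> real ^ 'd \<Rightarrow> complex"
  assumes "\<And>\<xi>. cmod (p x \<xi>) \<le> S"
  shows "cmod (fourier_coeff p \<nu> x) \<le> S"
proof -
  let ?e = "\<lambda>\<xi>. exp (- 2 * \<i> * of_real pi * of_real (\<Sum>i\<in>UNIV. of_int (vec_nth \<nu> i) * vec_nth \<xi> i))"
  have n: "cmod (?e \<xi>) = 1" for \<xi> :: "real ^ 'd" by simp
  have S: "S \<ge> 0" using assms[of 0] norm_ge_zero order_trans by blast
  have "cmod (fourier_coeff p \<nu> x) \<le> (LINT \<xi>|lborel. norm (indicator unit_cube \<xi> *\<^sub>R (p x \<xi> * ?e \<xi>)))"
    unfolding fourier_coeff_def set_lebesgue_integral_def by (rule integral_norm_bound)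
  also have "\<dots> \<le> (LINT \<xi>|lborel. S * indicator (unit_cube :: (real ^ 'd) set) \<xi>)"
  proof (rule integral_mono')
    show "integrable lborel (\<lambda>\<xi>. S * indicator (unit_cube :: (real ^ 'd) set) \<xi>)"
      using emeasure_lborel_cbox_finite[of "0 :: real ^ 'd" 1] by (intro integrable_mult_right integrable_real_indicator) auto
    show "norm (indicator unit_cube \<xi> *\<^sub>R (p x \<xi> * ?e \<xi>)) \<le> S * indicator (unit_cube :: (real ^ 'd) set) \<xi>" for \<xi>
      unfolding norm_scaleR norm_mult n using assms[of \<xi>] by (auto simp: indicator_def)
    show "0 \<le> S * indicator (unit_cube :: (real ^ 'd) set) \<xi>" for \<xi> using S by simp
  qed
  also have "\<dots> = S" using measure_unit_cube[where 'd = 'd] by simp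
  finally show ?thesis .
qed

lemma symbol_matrix_carrier: "symbol_matrix N (p :: real ^ 'd \<Rightarrow> real ^ 'd \<Rightarrow> complex) \<in> carrier_mat (N ^ CARD('d)) (N ^ CARD('d))"
  by (simp add: symbol_matrix_def)

lemma norm_symbol_matrix_le:
  fixes p :: "real ^ 'd \<Rightarrow> real ^ 'd \<Rightarrow> complex"
  assumes S: "\<And>x \<xi>. x \<in> unit_cube \<Longrightarrow> cmod (p x \<xi>) \<le> S" and N: "N > 0"
    and a: "a < N ^ CARD('d)" and b: "b < N ^ CARD('d)"
  shows "cmod (symbol_matrix N p $$ (a, b)) \<le> S"
proof -
  let ?n = "from_nat_into (grid N :: (int ^ 'd) set) a"
  have "lattice_point N ?n \<in> unit_cube" by (rule grid_point_in_cube[OF from_nat_into_grid(1)[OF a] N])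
  then have "cmod (fourier_coeff p \<nu> (lattice_point N ?n)) \<le> S" for \<nu>
    by (intro norm_fourier_coeff_le S)
  then show ?thesis using a b by (simp add: symbol_matrix_def Let_def lattice_point_def)
qed

text \<open>Crude, but polynomial in \<open>n\<close>, and (A3-ii) accepts any polynomial growth of
  the deterministic matrices.\<close>

lemma greatest_sv_entries_le:
  assumes A: "A \<in> carrier_mat n n" and n: "n > 0" and R: "R \<ge> 0" "\<And>a b. a < n \<Longrightarrow> b < n \<Longrightarrow> cmod (A $$ (a, b)) \<le> R"
  shows "greatest_sv A \<le> real n * R"
proof -
  have "(greatest_sv A)\<^sup>2 \<le> (\<Sum>a<n. \<Sum>b<n. (cmod (A $$ (a, b)))\<^sup>2)" by (rule greatest_sv_le_sum_entries(2)[OF A n])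
  also have "\<dots> \<le> (\<Sum>a<n. \<Sum>b<n. R\<^sup>2)" using R by (intro sum_mono power_mono) auto
  also have "\<dots> = (real n * R)\<^sup>2" by (simp add: power2_eq_square)
  finally show ?thesis by (rule power2_le_imp_le) (use R in simp)
qed

section \<open>The law of the symbol\<close>

lemma emeasure_cube_torus: "emeasure lebesgue ((unit_cube :: (real ^ 'd) set) \<times> (unit_cube :: (real ^ 'd) set)) = 1"
  and cube_torus_sets: "(unit_cube :: (real ^ 'd) set) \<times> (unit_cube :: (real ^ 'd) set) \<in> sets lebesgue"
proof -
  let ?Q = "unit_cube :: (real ^ 'd) set"
  have "emeasure (lborel \<Otimes>\<^sub>M lborel) (?Q \<times> ?Q) = emeasure lborel ?Q * emeasure lborel ?Q"
    by (intro lborel.emeasure_pair_measure_Times) auto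
  moreover have "emeasure lborel ?Q = 1"
    using measure_unit_cube[where 'd = 'd] emeasure_eq_ennreal_measure[of lborel ?Q] emeasure_lborel_cbox_finite[of "0 :: real ^ 'd" 1] by simp
  ultimately have e: "emeasure lborel (?Q \<times> ?Q) = 1" by (simp add: lborel_prod)
  have "?Q \<times> ?Q \<in> sets lborel" by (simp, intro borel_closed closed_Times closed_cbox)
  then show "emeasure lebesgue (?Q \<times> ?Q) = 1" "?Q \<times> ?Q \<in> sets lebesgue" using e by auto
qed

lemma symbol_law_compact_prob:
  fixes p :: "real ^ 'd \<Rightarrow> real ^ 'd \<Rightarrow> complex"
  assumes meas: "(\<lambda>(x, \<xi>). p x \<xi>) \<in> borel_measurable cube_torus_measure"
    and S: "\<And>x \<xi>. x \<in> unit_cube \<Longrightarrow> cmod (p x \<xi>) \<le> S"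
  shows "compact_prob (distr cube_torus_measure borel (\<lambda>(x, \<xi>). p x \<xi>)) S"
  unfolding compact_prob_def
proof (intro conjI)
  let ?M = "cube_torus_measure :: ((real ^ 'd) \<times> (real ^ 'd)) measure"
  have "prob_space ?M"
    by (rule prob_spaceI) (simp add: emeasure_restrict_space emeasure_cube_torus cube_torus_sets)
  then show "prob_space (distr ?M borel (\<lambda>(x, \<xi>). p x \<xi>))" using meas by (rule prob_space.prob_space_distr)
  have "AE x in ?M. cmod (case x of (x, \<xi>) \<Rightarrow> p x \<xi>) \<le> S"
    using S by (intro AE_I2) (auto simp: cube_torus_sets)
  then show "AE w in distr ?M borel (\<lambda>(x, \<xi>). p x \<xi>). cmod w \<le> S"
    by (subst AE_distr_iff[OF meas]) auto
qed simp

lemma symbol_law_concentration: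
  fixes p :: "real ^ 'd \<Rightarrow> real ^ 'd \<Rightarrow> complex"
  assumes meas: "(\<lambda>(x, \<xi>). p x \<xi>) \<in> borel_measurable cube_torus_measure" and t: "t \<ge> 0"
  shows "measure (distr cube_torus_measure borel (\<lambda>(x, \<xi>). p x \<xi>)) {w. cmod (w - z) \<le> t}
    = measure lebesgue {(x, \<xi>) \<in> unit_cube \<times> unit_cube. (cmod (p x \<xi> - z))\<^sup>2 \<le> t\<^sup>2}"
proof -
  let ?M = "cube_torus_measure :: ((real ^ 'd) \<times> (real ^ 'd)) measure"
  have "{w. cmod (w - z) \<le> t} \<in> sets borel" by measurable
  then have "measure (distr ?M borel (\<lambda>(x, \<xi>). p x \<xi>)) {w. cmod (w - z) \<le> t}
      = measure ?M ((\<lambda>(x, \<xi>). p x \<xi>) -` {w. cmod (w - z) \<le> t} \<inter> space ?M)"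
    by (rule measure_distr[OF meas])
  also have "(\<lambda>(x, \<xi>). p x \<xi>) -` {w. cmod (w - z) \<le> t} \<inter> space ?M
      = {(x, \<xi>) \<in> unit_cube \<times> unit_cube. (cmod (p x \<xi> - z))\<^sup>2 \<le> t\<^sup>2}"
    using t by (auto simp: cube_torus_sets abs_le_square_iff[symmetric])
  also have "measure ?M \<dots> = measure lebesgue \<dots>"
    using cube_torus_sets by (intro measure_restrict_space) auto
  finally show ?thesis .
qed

text \<open>Multiplied by its coupling constant, the perturbation has norm at most
  \<open>N powr - (\<delta>\<^sub>0 / 2)\<close>, so its mean square contribution is
  \<open>N powr - \<delta>\<^sub>0\<close>. The resulting rate is half of the smaller of
  \<open>\<delta>\<^sub>0\<close> and \<open>c\<close>, because of the square root in
  \<open>singular_value_statistics\<close>.\<close>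

lemma close_statistics_perturbed:
  fixes p :: "real ^ 'd \<Rightarrow> real ^ 'd \<Rightarrow> complex"
  assumes \<rho>: "0 < \<rho>" and p: "pw_symbol \<rho> s U p"
    and A1: "\<exists>\<kappa>\<^sub>1\<in>{0<..1}.
      (\<lambda>r. measure lebesgue ({x + y | x y. x \<in> singular_set s U \<and> y \<in> ball 0 r} \<inter> unit_cube))
        \<in> O[at_right 0](\<lambda>r. r powr \<kappa>\<^sub>1)"
    and \<delta>: "\<delta>\<^sub>0 > 0"
  obtains C c N0 where "c > 0" "N0 \<ge> 1"
    "\<And>N A. N \<ge> N0 \<Longrightarrow> A \<in> carrier_mat (N ^ CARD('d)) (N ^ CARD('d)) \<Longrightarrow> greatest_sv A \<le> real N powr (\<kappa> + \<delta>\<^sub>0 / 2) \<Longrightarrow>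
      close_statistics (distr cube_torus_measure borel (\<lambda>(x, \<xi>). p x \<xi>)) (C * real N powr - c)
        (symbol_matrix N p + complex_of_real (real N powr - (\<kappa> + \<delta>\<^sub>0)) \<cdot>\<^sub>m A)"
proof (rule singular_value_statistics[OF \<rho> p A1])
  fix C c N0 assume C: "C > 0" "c > 0" "N0 \<ge> 1" and stat:
    "\<And>N X T z sv (phi :: real \<Rightarrow> real) \<L>. N \<ge> N0 \<Longrightarrow> X \<in> carrier_mat (N ^ CARD('d)) (N ^ CARD('d)) \<Longrightarrow> T \<ge> 0 \<Longrightarrow>
      (\<Sum>a<N ^ CARD('d). \<Sum>b<N ^ CARD('d). (cmod (X $$ (a, b) - symbol_matrix N p $$ (a, b)))\<^sup>2) \<le> real (N ^ CARD('d)) * T \<Longrightarrow>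
      singular_system (N ^ CARD('d)) (X - z \<cdot>\<^sub>m 1\<^sub>m (N ^ CARD('d))) sv \<Longrightarrow>
      (\<And>x y. \<bar>phi x - phi y\<bar> \<le> \<L> * \<bar>x - y\<bar>) \<Longrightarrow>
      \<bar>(\<Sum>i<N ^ CARD('d). phi (sv i)) / real (N ^ CARD('d)) - (LINT w|distr cube_torus_measure borel (\<lambda>(x, \<xi>). p x \<xi>). phi (cmod (w - z)))\<bar>
        \<le> \<L> * (C * sqrt (T + real N powr - c))"
  define c' where "c' = min \<delta>\<^sub>0 c"
  have c': "c' > 0" using C \<delta> by (simp add: c'_def)
  show thesis
  proof (rule that[of "c' / 2" N0 "C * sqrt 2"])
    fix N and A :: "complex mat"
    assume N: "N0 \<le> N" and A: "A \<in> carrier_mat (N ^ CARD('d)) (N ^ CARD('d))" and gA: "greatest_sv A \<le> real N powr (\<kappa> + \<delta>\<^sub>0 / 2)"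
    let ?\<mu> = "distr cube_torus_measure borel (\<lambda>(x, \<xi>). p x \<xi>)"
    define m where "m = N ^ CARD('d)"
    define \<delta> where "\<delta> = real N powr - (\<kappa> + \<delta>\<^sub>0)"
    define X where "X = symbol_matrix N p + complex_of_real \<delta> \<cdot>\<^sub>m A"
    have N1: "N \<ge> 1" using N C(3) by simp
    have m: "m > 0" using N1 by (simp add: m_def)
    have A': "A \<in> carrier_mat m m" using A by (simp add: m_def)
    have M: "symbol_matrix N p \<in> carrier_mat m m" unfolding m_def by (rule symbol_matrix_carrier)
    have X: "X \<in> carrier_mat m m" using A' M by (simp add: X_def)
    have "(\<Sum>a<m. \<Sum>b<m. (cmod (X $$ (a, b) - symbol_matrix N p $$ (a, b)))\<^sup>2) = \<delta>\<^sup>2 * (\<Sum>a<m. \<Sum>b<m. (cmod (A $$ (a, b)))\<^sup>2)"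
      unfolding sum_distrib_left using A' M by (intro sum.cong) (auto simp: X_def norm_mult power_mult_distrib)
    also have "\<dots> \<le> \<delta>\<^sup>2 * (real m * (greatest_sv A)\<^sup>2)"
      by (intro mult_left_mono sum_entries_le_greatest_sv[OF A' m]) simp
    also have "\<dots> \<le> \<delta>\<^sup>2 * (real m * (real N powr (\<kappa> + \<delta>\<^sub>0 / 2))\<^sup>2)"
      using gA greatest_sv_le_sum_entries(1)[OF A' m] by (intro mult_left_mono power_mono) auto
    also have "\<dots> = real m * (\<delta> * real N powr (\<kappa> + \<delta>\<^sub>0 / 2))\<^sup>2" by (simp add: power_mult_distrib)
    also have "\<delta> * real N powr (\<kappa> + \<delta>\<^sub>0 / 2) = real N powr - (\<delta>\<^sub>0 / 2)" unfolding \<delta>_def by (simp flip: powr_add)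
    also have "(real N powr - (\<delta>\<^sub>0 / 2))\<^sup>2 = real N powr - \<delta>\<^sub>0" by (simp add: power2_eq_square flip: powr_add)
    finally have T: "(\<Sum>a<m. \<Sum>b<m. (cmod (X $$ (a, b) - symbol_matrix N p $$ (a, b)))\<^sup>2) \<le> real m * real N powr - \<delta>\<^sub>0" .
    have "C * sqrt (real N powr - \<delta>\<^sub>0 + real N powr - c) \<le> C * (sqrt 2 * real N powr - (c' / 2))"
    proof (intro mult_left_mono)
      have "real N powr - \<delta>\<^sub>0 \<le> real N powr - c'" "real N powr - c \<le> real N powr - c'"
        using N1 by (auto intro!: powr_mono simp: c'_def)
      then have "sqrt (real N powr - \<delta>\<^sub>0 + real N powr - c) \<le> sqrt (2 * real N powr - c')" by (intro real_sqrt_le_mono) simp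
      also have "\<dots> = sqrt 2 * real N powr - (c' / 2)"
      proof -
        have "real N powr - c' = (real N powr - (c' / 2))\<^sup>2" by (simp add: power2_eq_square flip: powr_add)
        then show ?thesis by (simp add: real_sqrt_mult)
      qed
      finally show "sqrt (real N powr - \<delta>\<^sub>0 + real N powr - c) \<le> sqrt 2 * real N powr - (c' / 2)" .
    qed (use C in simp)
    then have E: "C * sqrt (real N powr - \<delta>\<^sub>0 + real N powr - c) \<le> C * sqrt 2 * real N powr - (c' / 2)" by simp
    have "\<bar>(\<Sum>i<m. phi (sv i)) / real m - (LINT w|?\<mu>. phi (cmod (w - z)))\<bar> \<le> \<L> * (C * sqrt 2 * real N powr - (c' / 2))"
      if ss: "singular_system m (X - z \<cdot>\<^sub>m 1\<^sub>m m) sv" and lip: "\<forall>x y. \<bar>phi x - phi y\<bar> \<le> \<L> * \<bar>x - y\<bar>"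
      for z sv and phi :: "real \<Rightarrow> real" and \<L>
    proof -
      have L: "\<L> \<ge> 0" using lip[rule_format, of 0 1] by simp
      have "\<bar>(\<Sum>i<m. phi (sv i)) / real m - (LINT w|?\<mu>. phi (cmod (w - z)))\<bar> \<le> \<L> * (C * sqrt (real N powr - \<delta>\<^sub>0 + real N powr - c))"
        unfolding m_def by (rule stat[OF N X[unfolded m_def] _ T[unfolded m_def] ss[unfolded m_def]]) (use lip in auto)
      also have "\<dots> \<le> \<L> * (C * sqrt 2 * real N powr - (c' / 2))" using E L by (rule mult_left_mono)
      finally show ?thesis .
    qed
    then have "close_statistics ?\<mu> (C * sqrt 2 * real N powr - (c' / 2)) X"
      unfolding close_statistics_def carrier_matD(1)[OF X] by blast
    then show "close_statistics ?\<mu> (C * sqrt 2 * real N powr - (c' / 2)) (symbol_matrix N p + complex_of_real (real N powr - (\<kappa> + \<delta>\<^sub>0)) \<cdot>\<^sub>m A)"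
      by (simp only: X_def \<delta>_def)
  qed (use c' C in auto)
qed

text \<open>The coupling constant is factored out: the shifted matrix is
  \<open>N powr - \<alpha>\<close> times \<open>A N + Q N \<omega>\<close>, where \<open>A N\<close>
  is deterministic and of polynomial norm. (A3-ii) applies to this sequence, and scaling back only
  lowers the exponent.\<close>

lemma singular_values_perturbed_whp:
  fixes p :: "real ^ 'd \<Rightarrow> real ^ 'd \<Rightarrow> complex" and Q :: "nat \<Rightarrow> 'w \<Rightarrow> complex mat"
  assumes S: "\<And>x \<xi>. x \<in> unit_cube \<Longrightarrow> cmod (p x \<xi>) \<le> S"
    and rand: "\<And>N. N \<ge> 1 \<Longrightarrow> random_matrix (P N) (N ^ CARD('d)) (Q N)"
    and \<alpha>: "\<alpha> > 0"
    and A3ii: "\<And>\<theta>. \<theta> > 0 \<Longrightarrow> \<exists>\<beta>>0. \<forall>A :: nat \<Rightarrow> complex mat.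
      (\<forall>N\<ge>1. A N \<in> carrier_mat (N ^ CARD('d)) (N ^ CARD('d))) \<and>
      (\<lambda>N. greatest_sv (A N)) \<in> O(\<lambda>N. real N powr \<theta>) \<longrightarrow>
      (\<lambda>N. measure (P N) {\<omega> \<in> space (P N). smallest_sv (A N + Q N \<omega>) \<le> real N powr - \<beta>})
        \<longlonglongrightarrow> 0"
  shows "\<exists>\<beta>. whp P (\<lambda>N \<omega>. \<forall>\<sigma>\<in>singular_values (symbol_matrix N p + complex_of_real (real N powr - \<alpha>) \<cdot>\<^sub>m Q N \<omega>
    - z \<cdot>\<^sub>m 1\<^sub>m (N ^ CARD('d))). real N powr - \<beta> \<le> \<sigma>)"
proof -
  define d where "d = real CARD('d)"
  \<comment> \<open>The exponent is \<alpha> for undoing the coupling constant plus \<open>d\<close>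
    for the crude bound of the norm by the matrix size \<open>N ^ CARD('d)\<close> times the largest
    entry.\<close>
  have th: "\<alpha> + d > 0" using \<alpha> by (simp add: d_def)
  obtain \<beta> where \<beta>: "\<forall>A :: nat \<Rightarrow> complex mat.
      (\<forall>N\<ge>1. A N \<in> carrier_mat (N ^ CARD('d)) (N ^ CARD('d))) \<and>
      (\<lambda>N. greatest_sv (A N)) \<in> O(\<lambda>N. real N powr (\<alpha> + d)) \<longrightarrow>
      (\<lambda>N. measure (P N) {\<omega> \<in> space (P N). smallest_sv (A N + Q N \<omega>) \<le> real N powr - \<beta>}) \<longlonglongrightarrow> 0"
    using A3ii[OF th] by blast
  define A where "A N = complex_of_real (real N powr \<alpha>) \<cdot>\<^sub>m (symbol_matrix N p - z \<cdot>\<^sub>m 1\<^sub>m (N ^ CARD('d)))" for N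
  have D: "symbol_matrix N p - z \<cdot>\<^sub>m 1\<^sub>m (N ^ CARD('d)) \<in> carrier_mat (N ^ CARD('d)) (N ^ CARD('d))" for N
    by (intro minus_carrier_mat) simp
  have A: "A N \<in> carrier_mat (N ^ CARD('d)) (N ^ CARD('d))" for N using D by (simp add: A_def)
  have "(0 :: real ^ 'd) \<in> unit_cube" by (simp add: mem_box_cart)
  from S[OF this, of 0] have S0: "S \<ge> 0" using norm_ge_zero[of "p 0 0"] by linarith
  have gA: "0 \<le> greatest_sv (A N) \<and> greatest_sv (A N) \<le> (S + cmod z) * real N powr (\<alpha> + d)" if N: "N \<ge> 1" for N
  proof -
    have m: "N ^ CARD('d) > 0" using N by simp
    have "greatest_sv (A N) \<le> real (N ^ CARD('d)) * (real N powr \<alpha> * (S + cmod z))"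
    proof (rule greatest_sv_entries_le[OF A m])
      fix a b assume ab: "a < N ^ CARD('d)" "b < N ^ CARD('d)"
      have "A N $$ (a, b) = of_real (real N powr \<alpha>) * (symbol_matrix N p $$ (a, b) - z * (if a = b then 1 else 0))"
        using ab symbol_matrix_carrier[of N p] by (simp add: A_def)
      moreover have "cmod (symbol_matrix N p $$ (a, b) - z * (if a = b then 1 else 0)) \<le> S + cmod z"
      proof -
        have "cmod (z * (if a = b then 1 else 0)) \<le> cmod z" by simp
        moreover have "cmod (symbol_matrix N p $$ (a, b)) \<le> S" using N by (intro norm_symbol_matrix_le S ab) auto
        ultimately show ?thesis
          using norm_triangle_ineq4[of "symbol_matrix N p $$ (a, b)" "z * (if a = b then 1 else 0)"] by linarith
      qed
      ultimately show "cmod (A N $$ (a, b)) \<le> real N powr \<alpha> * (S + cmod z)"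
        by (simp add: norm_mult mult_left_mono)
    qed (use S0 in simp)
    also have "\<dots> = (S + cmod z) * real N powr (\<alpha> + d)"
      using N by (simp add: powr_add d_def powr_realpow)
    finally show ?thesis using greatest_sv_le_sum_entries(1)[OF A m] by simp
  qed
  have O: "(\<lambda>N. greatest_sv (A N)) \<in> O(\<lambda>N. real N powr (\<alpha> + d))"
  proof (rule bigoI[of _ "S + cmod z"])
    show "\<forall>\<^sub>F N in sequentially. norm (greatest_sv (A N)) \<le> (S + cmod z) * norm (real N powr (\<alpha> + d))"
      using eventually_ge_at_top[of 1] by eventually_elim (use gA in auto)
  qed
  have lim: "(\<lambda>N. measure (P N) {\<omega> \<in> space (P N). smallest_sv (A N + Q N \<omega>) \<le> real N powr - \<beta>}) \<longlonglongrightarrow> 0"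
    by (rule \<beta>[THEN spec[of _ A], THEN mp]) (intro conjI allI impI A O)
  have "whp P (\<lambda>N \<omega>. real N powr - \<beta> < smallest_sv (A N + Q N \<omega>))"
  proof (rule whpI)
    show "{\<omega> \<in> space (P N). \<not> real N powr - \<beta> < smallest_sv (A N + Q N \<omega>)} \<in> sets (P N)" if N: "N \<ge> 1" for N
    proof -
      have "{\<omega> \<in> space (P N). smallest_sv (A N + Q N \<omega>) \<le> real N powr - \<beta>} \<in> sets (P N)"
        by (rule smallest_sv_sets[OF rand[OF N] A]) (use N in simp_all)
      then show ?thesis by (simp only: not_less)
    qed
    show "(\<lambda>N. measure (P N) {\<omega> \<in> space (P N). \<not> real N powr - \<beta> < smallest_sv (A N + Q N \<omega>)}) \<longlonglongrightarrow> 0"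
      using lim by (simp only: not_less)
  qed
  then have "whp P (\<lambda>N \<omega>. \<forall>\<sigma>\<in>singular_values (symbol_matrix N p + complex_of_real (real N powr - \<alpha>) \<cdot>\<^sub>m Q N \<omega>
    - z \<cdot>\<^sub>m 1\<^sub>m (N ^ CARD('d))). real N powr - (\<alpha> + \<beta>) \<le> \<sigma>)"
  proof (rule whp_mono, intro eventually_sequentiallyI[of 1] ballI impI)
    fix N \<omega> \<sigma>
    assume N: "1 \<le> N" and w: "\<omega> \<in> space (P N)" and sm: "real N powr - \<beta> < smallest_sv (A N + Q N \<omega>)"
      and \<sigma>: "\<sigma> \<in> singular_values (symbol_matrix N p + complex_of_real (real N powr - \<alpha>) \<cdot>\<^sub>m Q N \<omega> - z \<cdot>\<^sub>m 1\<^sub>m (N ^ CARD('d)))"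
    have Qc: "Q N \<omega> \<in> carrier_mat (N ^ CARD('d)) (N ^ CARD('d))" using rand[OF N] w by (simp add: random_matrix_def)
    have one: "complex_of_real (real N powr - \<alpha>) * complex_of_real (real N powr \<alpha>) = 1"
      using N by (simp flip: of_real_mult powr_add)
    have eq: "symbol_matrix N p + complex_of_real (real N powr - \<alpha>) \<cdot>\<^sub>m Q N \<omega> - z \<cdot>\<^sub>m 1\<^sub>m (N ^ CARD('d))
      = complex_of_real (real N powr - \<alpha>) \<cdot>\<^sub>m (A N + Q N \<omega>)"
    proof (rule eq_matI)
      fix i j assume "i < dim_row (complex_of_real (real N powr - \<alpha>) \<cdot>\<^sub>m (A N + Q N \<omega>))"
        "j < dim_col (complex_of_real (real N powr - \<alpha>) \<cdot>\<^sub>m (A N + Q N \<omega>))"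
      then have ij: "i < N ^ CARD('d)" "j < N ^ CARD('d)" using Qc by auto
      have "A N $$ (i, j) = of_real (real N powr \<alpha>) * (symbol_matrix N p $$ (i, j) - z * 1\<^sub>m (N ^ CARD('d)) $$ (i, j))"
        using ij symbol_matrix_carrier[of N p] by (simp add: A_def)
      then have "complex_of_real (real N powr - \<alpha>) * A N $$ (i, j) = symbol_matrix N p $$ (i, j) - z * 1\<^sub>m (N ^ CARD('d)) $$ (i, j)"
        using one by (simp add: mult.assoc[symmetric])
      then show "(symbol_matrix N p + complex_of_real (real N powr - \<alpha>) \<cdot>\<^sub>m Q N \<omega> - z \<cdot>\<^sub>m 1\<^sub>m (N ^ CARD('d))) $$ (i, j)
        = (complex_of_real (real N powr - \<alpha>) \<cdot>\<^sub>m (A N + Q N \<omega>)) $$ (i, j)"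
        using ij Qc A[of N] symbol_matrix_carrier[of N p] by (simp add: distrib_left)
    qed (use Qc A[of N] symbol_matrix_carrier[of N p] in auto)
    have Bc: "A N + Q N \<omega> \<in> carrier_mat (N ^ CARD('d)) (N ^ CARD('d))" using Qc by (rule add_carrier_mat)
    have "real N powr - \<alpha> * real N powr - \<beta> \<le> \<sigma>"
      by (rule singular_value_scale_ge[OF Bc _ _ _ _ \<sigma>[unfolded eq]]) (use N less_imp_le[OF sm] in simp_all)
    then show "real N powr - (\<alpha> + \<beta>) \<le> \<sigma>" by (simp flip: powr_add)
  qed
  then show ?thesis by (rule exI)
qed

theorem theorem1p2:
  fixes p :: "real ^ 'd \<Rightarrow> real ^ 'd \<Rightarrow> complex"
    and \<rho> \<kappa>\<^sub>3 :: real
    and s :: nat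
    and U :: "nat \<Rightarrow> (real ^ 'd) set"
    and P :: "nat \<Rightarrow> 'w measure"
    and Q :: "nat \<Rightarrow> 'w \<Rightarrow> complex mat"
  assumes "0 < \<rho>" "\<rho> \<le> 1"
    and symbol: "pw_symbol \<rho> s U p"
    and A1: "\<exists>\<kappa>\<^sub>1\<in>{0<..1}.
      (\<lambda>r. measure lebesgue ({x + y | x y. x \<in> singular_set s U \<and> y \<in> ball 0 r} \<inter> unit_cube))
        \<in> O[at_right 0](\<lambda>r. r powr \<kappa>\<^sub>1)"
    and A2: "\<exists>\<kappa>\<^sub>2\<in>{0<..1}. \<exists>C. \<exists>t\<^sub>0>0. \<forall>z. \<forall>t\<in>{0..t\<^sub>0}.
      measure lebesgue {(x, \<xi>) \<in> unit_cube \<times> unit_cube. (cmod (p x \<xi> - z))\<^sup>2 \<le> t}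
        \<le> C * t powr \<kappa>\<^sub>2"
    and prob: "\<And>N. N \<ge> 1 \<Longrightarrow> prob_space (P N)"
    and rand: "\<And>N. N \<ge> 1 \<Longrightarrow> random_matrix (P N) (N ^ CARD('d)) (Q N)"
    and "\<kappa>\<^sub>3 > 0"
    and A3i_integrable: "\<And>N. N \<ge> 1 \<Longrightarrow> integrable (P N) (\<lambda>\<omega>. greatest_sv (Q N \<omega>))"
    and A3i: "(\<lambda>N. LINT \<omega>|P N. greatest_sv (Q N \<omega>)) \<in> O(\<lambda>N. real N powr \<kappa>\<^sub>3)"
    and A3ii: "\<And>\<theta>. \<theta> > 0 \<Longrightarrow> \<exists>\<beta>>0. \<forall>A :: nat \<Rightarrow> complex mat.
      (\<forall>N\<ge>1. A N \<in> carrier_mat (N ^ CARD('d)) (N ^ CARD('d))) \<and>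
      (\<lambda>N. greatest_sv (A N)) \<in> O(\<lambda>N. real N powr \<theta>) \<longrightarrow>
      (\<lambda>N. measure (P N) {\<omega> \<in> space (P N). smallest_sv (A N + Q N \<omega>) \<le> real N powr - \<beta>})
        \<longlonglongrightarrow> 0"
  shows "\<forall>\<delta>\<^sub>0>0. weakly_converges_in_prob P
    (\<lambda>N \<omega>. empirical_spectral_measure
       (symbol_matrix N p + complex_of_real (real N powr - (\<kappa>\<^sub>3 + \<delta>\<^sub>0)) \<cdot>\<^sub>m Q N \<omega>))
    (distr cube_torus_measure borel (\<lambda>(x, \<xi>). p x \<xi>))"
proof (intro allI impI)
  fix \<delta>\<^sub>0 :: real assume \<delta>: "\<delta>\<^sub>0 > 0"
  let ?\<mu> = "distr cube_torus_measure borel (\<lambda>(x, \<xi>). p x \<xi>)"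
  obtain \<kappa> C1 r0 where k: "\<kappa> > 0" "C1 > 0" "r0 > 0" "\<And>r. 0 < r \<Longrightarrow> r < r0 \<Longrightarrow>
    measure lborel ((\<Union>x\<in>singular_set s U. ball x r) \<inter> unit_cube) \<le> C1 * r powr \<kappa>"
    by (rule singular_nbhd_bound[OF A1]) blast
  have meas: "(\<lambda>(x, \<xi>). p x \<xi>) \<in> borel_measurable cube_torus_measure"
    by (rule pw_symbol_measurable[OF assms(1) symbol singular_set_null[OF k]])
  obtain S where S: "\<And>x \<xi>. x \<in> unit_cube \<Longrightarrow> cmod (p x \<xi>) \<le> S"
    by (rule pw_symbol_bounds[OF symbol]) blast
  obtain \<kappa>\<^sub>2 where k2': "\<kappa>\<^sub>2 \<in> {0<..1}" and ex: "\<exists>C. \<exists>t\<^sub>0>0. \<forall>z. \<forall>t\<in>{0..t\<^sub>0}.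
      measure lebesgue {(x, \<xi>) \<in> unit_cube \<times> unit_cube. (cmod (p x \<xi> - z))\<^sup>2 \<le> t} \<le> C * t powr \<kappa>\<^sub>2"
    using A2 by (rule bexE)
  have k2: "\<kappa>\<^sub>2 > 0" using k2' by simp
  obtain C2 t\<^sub>0 where t0: "t\<^sub>0 > 0" and C2: "\<forall>z. \<forall>t\<in>{0..t\<^sub>0}.
      measure lebesgue {(x, \<xi>) \<in> unit_cube \<times> unit_cube. (cmod (p x \<xi> - z))\<^sup>2 \<le> t} \<le> C2 * t powr \<kappa>\<^sub>2"
    using ex by (elim exE conjE) (rule that)
  obtain C c N0 where c: "c > 0" and N0: "N0 \<ge> 1" and stat:
    "\<And>N A. N \<ge> N0 \<Longrightarrow> A \<in> carrier_mat (N ^ CARD('d)) (N ^ CARD('d)) \<Longrightarrow> greatest_sv A \<le> real N powr (\<kappa>\<^sub>3 + \<delta>\<^sub>0 / 2) \<Longrightarrow>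
      close_statistics ?\<mu> (C * real N powr - c) (symbol_matrix N p + complex_of_real (real N powr - (\<kappa>\<^sub>3 + \<delta>\<^sub>0)) \<cdot>\<^sub>m A)"
    by (rule close_statistics_perturbed[OF assms(1) symbol A1 \<delta>, where \<kappa> = \<kappa>\<^sub>3]) blast
  have Qc: "Q N \<omega> \<in> carrier_mat (N ^ CARD('d)) (N ^ CARD('d))" if "N \<ge> 1" "\<omega> \<in> space (P N)" for N \<omega>
    using rand[OF that(1)] that(2) by (simp add: random_matrix_def)
  show "weakly_converges_in_prob P (\<lambda>N \<omega>. empirical_spectral_measure
       (symbol_matrix N p + complex_of_real (real N powr - (\<kappa>\<^sub>3 + \<delta>\<^sub>0)) \<cdot>\<^sub>m Q N \<omega>)) ?\<mu>"
  \<comment> \<open>(A2) bounds the measure where a squared distance is small, so the exponent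
    doubles and the threshold becomes a square root. The absolute value of \<open>C2\<close>
    provides a nonnegative constant.\<close>
  proof (rule empirical_measure_converges[OF symbol_law_compact_prob[OF meas S], where ?t1.0 = "sqrt t\<^sub>0" and a = "2 * \<kappa>\<^sub>2" and K = "\<bar>C2\<bar>" and c = c and C = C and m = "\<lambda>N. N ^ CARD('d)"])
    fix z :: complex and t :: real assume t: "0 \<le> t" "t \<le> sqrt t\<^sub>0"
    have "t\<^sup>2 \<le> (sqrt t\<^sub>0)\<^sup>2" using t by (intro power_mono) auto
    then have "t\<^sup>2 \<le> t\<^sub>0" using t0 by simp
    then have "measure ?\<mu> {w. cmod (w - z) \<le> t} \<le> C2 * (t\<^sup>2) powr \<kappa>\<^sub>2"
      unfolding symbol_law_concentration[OF meas t(1)] by (intro C2[THEN spec, THEN bspec]) auto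
    also have "\<dots> \<le> \<bar>C2\<bar> * (t\<^sup>2) powr \<kappa>\<^sub>2" by (intro mult_right_mono) auto
    also have "(t\<^sup>2) powr \<kappa>\<^sub>2 = t powr (2 * \<kappa>\<^sub>2)"
      using t(1) by (cases "t = 0") (auto simp: powr_powr simp flip: powr_numeral)
    finally show "measure ?\<mu> {w. cmod (w - z) \<le> t} \<le> \<bar>C2\<bar> * t powr (2 * \<kappa>\<^sub>2)" .
  next
    fix N \<omega> assume N: "(1::nat) \<le> N" and w: "\<omega> \<in> space (P N)"
    show "symbol_matrix N p + complex_of_real (real N powr - (\<kappa>\<^sub>3 + \<delta>\<^sub>0)) \<cdot>\<^sub>m Q N \<omega> \<in> carrier_mat (N ^ CARD('d)) (N ^ CARD('d))"
      using Qc[OF N w] by simp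
  next
    \<comment> \<open>Markov's inequality spends half of \<open>\<delta>\<^sub>0\<close> on the
      growth of the norm; the other half remains to make the perturbation small.\<close>
    have "whp P (\<lambda>N \<omega>. greatest_sv (Q N \<omega>) < real N powr (\<kappa>\<^sub>3 + \<delta>\<^sub>0 / 2))"
      by (rule markov_whp, erule A3i_integrable, rule greatest_sv_le_sum_entries(1)[OF Qc], assumption, assumption, simp, rule A3i, use \<delta> in simp)
    then show "whp P (\<lambda>N \<omega>. close_statistics ?\<mu> (C * real N powr - c)
        (symbol_matrix N p + complex_of_real (real N powr - (\<kappa>\<^sub>3 + \<delta>\<^sub>0)) \<cdot>\<^sub>m Q N \<omega>))"
    proof (rule whp_mono, intro eventually_sequentiallyI[of N0] ballI impI)
      fix N \<omega> assume "N0 \<le> N" "\<omega> \<in> space (P N)" "greatest_sv (Q N \<omega>) < real N powr (\<kappa>\<^sub>3 + \<delta>\<^sub>0 / 2)"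
      then show "close_statistics ?\<mu> (C * real N powr - c) (symbol_matrix N p + complex_of_real (real N powr - (\<kappa>\<^sub>3 + \<delta>\<^sub>0)) \<cdot>\<^sub>m Q N \<omega>)"
        using N0 by (intro stat Qc) auto
    qed
  next
    fix z
    show "\<exists>\<beta>. whp P (\<lambda>N \<omega>. \<forall>\<sigma>\<in>singular_values (symbol_matrix N p + complex_of_real (real N powr - (\<kappa>\<^sub>3 + \<delta>\<^sub>0)) \<cdot>\<^sub>m Q N \<omega>
        - z \<cdot>\<^sub>m 1\<^sub>m (N ^ CARD('d))). real N powr - \<beta> \<le> \<sigma>)"
      by (rule singular_values_perturbed_whp, erule S, erule rand, use \<open>\<kappa>\<^sub>3 > 0\<close> \<delta> in simp, erule A3ii)
  qed (use k2 t0 c prob in simp_all)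
qed

end
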